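(* Fix $\lambda\in(0,1)$ and let $\alpha,\epsilon$ be the constants of the Lyapunov theorem (see context). There is a constant $c=c(\lambda)>0$ such that for every lattice polygon, every boundary condition $\xi$, every $g\in\mathbb{G}^\xi$, every initial $\sigma\in\Omega^\xi$, every $t\ge1$ and every $\ell\ge0$, with $\sigma^t$ the state at time $t$ of $\mathcal{M}^\lambda(\Omega^\xi)$ started at $\sigma$, $$\mathbb{P}_\sigma\Big(\exists y\in\Lambda:\ \sigma^t_y\cap g\ne\emptyset,\ |\sigma^t_y|\ge|g|+\ell\Big)\le\max\Big\{\Psi^\xi_g(\sigma)\Big(1-\frac{\epsilon}{|\Lambda|}\Big)^t,\ c\Big\}\alpha^{-\ell}.$$ In particular, if $x$ is the midpoint of $g$ and $\sigma\sim\pi^\xi$, then $\pi^\xi(|\sigma_x|\ge|g|+\ell)\le c\,\alpha^{-\ell}$ for all $\ell\ge0$.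
   Context: Let $P$ be a lattice polygon (a simple polygon whose vertices lie in $\mathbb{Z}^2$ and whose sides contain no points of $\mathbb{Z}^2$ other than their endpoints) and let $\Lambda^0$ be the set of points of $\mathbb{Z}^2$ in $P$ (including its boundary). Edges are open straight line segments with endpoints in $\Lambda^0$; $|e|$ denotes the $\ell_1$ length of an edge $e$. A triangulation of $\Lambda^0$ is a maximal collection of pairwise disjoint edges none of which contains a point of $\Lambda^0$; all its triangles have area $1/2$, and the set $\Lambda$ of midpoints of its edges does not depend on the triangulation, so a triangulation $\sigma$ is written $\sigma=\{\sigma_x\}_{x\in\Lambda}$ with $\sigma_x$ the edge of midpoint $x$. A boundary condition $\xi$ is a set of pairwise disjoint edges containing no point of $\Lambda^0$ and containing all sides of $P$; $\Omega^\xi$ is the set of triangulations containing every edge of $\xi$. An edge $\sigma_x$ of $\sigma\in\Omega^\xi$ is flippable if $\sigma_x\notin\xi$ and the two triangles of $\sigma$ containing it form a strictly convex quadrilateral; flipping it replaces $\sigma_x$ by the other diagonal, giving $\sigma^x\in\Omega^\xi$. For $x\in\Lambda$, $E_x^\xi=\{\sigma_x:\sigma\in\Omega^\xi\}$; the ground state edges of $x$ are the elements of $E^\xi_x$ of minimal length; $\mathbb{G}^\xi$ is the set of all ground state edges of all midpoints. For each non-ground-state $f\in E_x^\xi$ there is a unique $e\in E_x^\xi$ (its parent) with $|e|<|f|$ obtainable from $f$ by a single flip in some triangulation of $\Omega^\xi$; $\prec$ is the transitive closure of "is the parent of", and $e\preceq f$ means $e=f$ or $e\prec f$. Glauber dynamics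 $\mathcal{M}^\lambda(\Omega^\xi)$: from the current $\sigma$, pick $x\in\Lambda$ uniformly; if $\sigma_x$ is not flippable do nothing; otherwise move to $\sigma^x$ with probability $\lambda^{|\sigma^x_x|}/(\lambda^{|\sigma^x_x|}+\lambda^{|\sigma_x|})$. Its stationary distribution is $\pi^\xi(\sigma)\propto\lambda^{\sum_{x\in\Lambda}|\sigma_x|}$. $\mathbb{P}_\sigma$ refers to the chain started at $\sigma$. Height function: $E_x^\xi(\sigma,g)=\{e\in E_x^\xi: e\cap g\ne\emptyset,\ e\preceq\sigma_x\}$, $\Psi_g^\xi(\sigma)=\sum_{x\in\Lambda}\sum_{e\in E_x^\xi(\sigma,g)}\alpha^{|e|-|g|}$. Lyapunov theorem: for each $\lambda\in(0,1)$ there are $\alpha\in(1,\lambda^{-1/2})$, $\psi_0>1$, $\epsilon>0$ depending only on $\lambda$ such that for every lattice polygon, boundary condition $\xi$, $\sigma\in\Omega^\xi$ and $g\in\mathbb{G}^\xi$ with $\Psi_g^\xi(\sigma)\ge\psi_0$, one step $\sigma'$ of $\mathcal{M}^\lambda(\Omega^\xi)$ from $\sigma$ satisfies $\mathbb{E}_\sigma\Psi_g^\xi(\sigma')\le(1-\epsilon/|\Lambda|)\Psi_g^\xi(\sigma)$. These $\alpha,\psi_0,\epsilon$ are fixed throughout. *)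

theory Defs
  imports "HOL-Analysis.Analysis" "HOL-Probability.Probability"
begin

type_synonym lpt = "int \<times> int"
type_synonym edge = "lpt set"

definition rp :: "lpt \<Rightarrow> real \<times> real" where
  "rp p = (real_of_int (fst p), real_of_int (snd p))"

text \<open>Polygon given by its cyclic list of vertices.\<close>
definition nverts :: "lpt list \<Rightarrow> nat" where "nverts vs = length vs"

definition side :: "lpt list \<Rightarrow> nat \<Rightarrow> edge" where
  "side vs i = {vs ! i, vs ! (Suc i mod length vs)}"

definition side_seg :: "lpt list \<Rightarrow> nat \<Rightarrow> (real \<times> real) set" where
  "side_seg vs i = closed_segment (rp (vs ! i)) (rp (vs ! (Suc i mod length vs)))"

definition poly_boundary :: "lpt list \<Rightarrow> (real \<times> real) set" where
  "poly_boundary vs = (\<Union>i<length vs. side_seg vs i)"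

definition lattice_polygon :: "lpt list \<Rightarrow> bool" where
  "lattice_polygon vs \<longleftrightarrow>
     length vs \<ge> 3 \<and> distinct vs \<and>
     (\<forall>i<length vs. \<forall>j<length vs. i \<noteq> j \<longrightarrow>
        (if Suc i mod length vs = j then side_seg vs i \<inter> side_seg vs j = {rp (vs ! j)}
         else if Suc j mod length vs = i then side_seg vs i \<inter> side_seg vs j = {rp (vs ! i)}
         else side_seg vs i \<inter> side_seg vs j = {})) \<and>
     (\<forall>i<length vs. \<forall>p. rp p \<in> side_seg vs i \<longrightarrow> p \<in> side vs i)"

definition region :: "lpt list \<Rightarrow> (real \<times> real) set" where
  "region vs = poly_boundary vs \<union> inside (poly_boundary vs)"

definition Lam0 :: "lpt list \<Rightarrow> lpt set" where
  "Lam0 vs = {p. rp p \<in> region vs}"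

definition l1 :: "lpt \<Rightarrow> lpt \<Rightarrow> nat" where
  "l1 p q = nat \<bar>fst p - fst q\<bar> + nat \<bar>snd p - snd q\<bar>"

definition len :: "edge \<Rightarrow> nat" where
  "len e = Max ((\<lambda>(p, q). l1 p q) ` (e \<times> e))"

definition seg :: "edge \<Rightarrow> (real \<times> real) set" where
  "seg e = {z. \<exists>a b. e = {a, b} \<and> a \<noteq> b \<and> z \<in> open_segment (rp a) (rp b)}"

definition mid :: "edge \<Rightarrow> real \<times> real" where
  "mid e = (1/2) *\<^sub>R (\<Sum>p\<in>e. rp p)"

definition is_edge :: "lpt list \<Rightarrow> edge \<Rightarrow> bool" where
  "is_edge vs e \<longleftrightarrow> (\<exists>a b. a \<noteq> b \<and> e = {a, b} \<and> a \<in> Lam0 vs \<and> b \<in> Lam0 vs)"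

definition empty_edge :: "lpt list \<Rightarrow> edge \<Rightarrow> bool" where
  "empty_edge vs e \<longleftrightarrow> is_edge vs e \<and> seg e \<inter> rp ` Lam0 vs = {}"

definition admissible :: "lpt list \<Rightarrow> edge \<Rightarrow> bool" where
  "admissible vs e \<longleftrightarrow> empty_edge vs e \<and> seg e \<subseteq> region vs"

definition pairwise_disjoint :: "edge set \<Rightarrow> bool" where
  "pairwise_disjoint T \<longleftrightarrow> (\<forall>e\<in>T. \<forall>f\<in>T. e \<noteq> f \<longrightarrow> seg e \<inter> seg f = {})"

definition triangulation :: "lpt list \<Rightarrow> edge set \<Rightarrow> bool" where
  "triangulation vs T \<longleftrightarrow>
     (\<forall>e\<in>T. admissible vs e) \<and> pairwise_disjoint T \<and>
     (\<forall>e. admissible vs e \<and> e \<notin> T \<longrightarrow> (\<exists>f\<in>T. seg e \<inter> seg f \<noteq> {}))"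

text \<open>The set \<open>\<Lambda>\<close> of midpoints (independent of the triangulation).\<close>
definition Lam :: "lpt list \<Rightarrow> (real \<times> real) set" where
  "Lam vs = (\<Union>T\<in>{T. triangulation vs T}. mid ` T)"

definition edge_at :: "edge set \<Rightarrow> real \<times> real \<Rightarrow> edge" where
  "edge_at \<sigma> x = (THE e. e \<in> \<sigma> \<and> mid e = x)"

definition boundary_condition :: "lpt list \<Rightarrow> edge set \<Rightarrow> bool" where
  "boundary_condition vs \<xi> \<longleftrightarrow>
     (\<forall>e\<in>\<xi>. empty_edge vs e) \<and> pairwise_disjoint \<xi> \<and>
     (\<forall>i<length vs. side vs i \<in> \<xi>)"

definition Omega :: "lpt list \<Rightarrow> edge set \<Rightarrow> edge set set" where
  "Omega vs \<xi> = {T. triangulation vs T \<and> \<xi> \<subseteq> T}"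

definition apex :: "lpt list \<Rightarrow> edge set \<Rightarrow> edge \<Rightarrow> lpt \<Rightarrow> bool" where
  "apex vs \<sigma> e c \<longleftrightarrow> (\<exists>a b. e = {a, b} \<and> a \<noteq> b \<and> c \<notin> e \<and> {a, c} \<in> \<sigma> \<and> {b, c} \<in> \<sigma> \<and>
      \<not> collinear {rp a, rp b, rp c} \<and>
      (\<forall>p\<in>Lam0 vs. rp p \<in> convex hull {rp a, rp b, rp c} \<longrightarrow> p \<in> {a, b, c}))"

definition strictly_convex_quad :: "lpt set \<Rightarrow> bool" where
  "strictly_convex_quad Q \<longleftrightarrow> card Q = 4 \<and> (\<forall>p\<in>Q. rp p \<notin> convex hull (rp ` (Q - {p})))"

definition flippable :: "lpt list \<Rightarrow> edge set \<Rightarrow> edge set \<Rightarrow> real \<times> real \<Rightarrow> bool" where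
  "flippable vs \<xi> \<sigma> x \<longleftrightarrow> edge_at \<sigma> x \<notin> \<xi> \<and>
     (\<exists>c d. c \<noteq> d \<and> apex vs \<sigma> (edge_at \<sigma> x) c \<and> apex vs \<sigma> (edge_at \<sigma> x) d \<and>
        strictly_convex_quad (edge_at \<sigma> x \<union> {c, d}))"

definition flip :: "lpt list \<Rightarrow> edge set \<Rightarrow> real \<times> real \<Rightarrow> edge set" where
  "flip vs \<sigma> x = (let e = edge_at \<sigma> x;
      cd = (SOME cd. fst cd \<noteq> snd cd \<and> apex vs \<sigma> e (fst cd) \<and> apex vs \<sigma> e (snd cd))
    in (\<sigma> - {e}) \<union> {{fst cd, snd cd}})"

definition step :: "real \<Rightarrow> lpt list \<Rightarrow> edge set \<Rightarrow> edge set \<Rightarrow> edge set pmf" where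
  "step lam vs \<xi> \<sigma> = pmf_of_set (Lam vs) \<bind> (\<lambda>x.
     if flippable vs \<xi> \<sigma> x then
       map_pmf (\<lambda>b. if b then flip vs \<sigma> x else \<sigma>)
         (bernoulli_pmf (lam ^ len (edge_at (flip vs \<sigma> x) x) /
            (lam ^ len (edge_at (flip vs \<sigma> x) x) + lam ^ len (edge_at \<sigma> x))))
     else return_pmf \<sigma>)"

fun chain :: "real \<Rightarrow> lpt list \<Rightarrow> edge set \<Rightarrow> edge set \<Rightarrow> nat \<Rightarrow> edge set pmf" where
  "chain lam vs \<xi> \<sigma> 0 = return_pmf \<sigma>"
| "chain lam vs \<xi> \<sigma> (Suc t) = chain lam vs \<xi> \<sigma> t \<bind> step lam vs \<xi>"

definition weight :: "real \<Rightarrow> lpt list \<Rightarrow> edge set \<Rightarrow> real" where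
  "weight lam vs \<sigma> = lam ^ (\<Sum>x\<in>Lam vs. len (edge_at \<sigma> x))"

definition pi :: "real \<Rightarrow> lpt list \<Rightarrow> edge set \<Rightarrow> edge set \<Rightarrow> real" where
  "pi lam vs \<xi> \<sigma> = (if \<sigma> \<in> Omega vs \<xi>
      then weight lam vs \<sigma> / (\<Sum>\<tau>\<in>Omega vs \<xi>. weight lam vs \<tau>) else 0)"

definition pi_prob :: "real \<Rightarrow> lpt list \<Rightarrow> edge set \<Rightarrow> (edge set \<Rightarrow> bool) \<Rightarrow> real" where
  "pi_prob lam vs \<xi> P = (\<Sum>\<sigma>\<in>{\<sigma>\<in>Omega vs \<xi>. P \<sigma>}. pi lam vs \<xi> \<sigma>)"

definition Ex :: "lpt list \<Rightarrow> edge set \<Rightarrow> real \<times> real \<Rightarrow> edge set" where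
  "Ex vs \<xi> x = {edge_at \<sigma> x | \<sigma>. \<sigma> \<in> Omega vs \<xi>}"

definition ground :: "lpt list \<Rightarrow> edge set \<Rightarrow> real \<times> real \<Rightarrow> edge set" where
  "ground vs \<xi> x = {e \<in> Ex vs \<xi> x. \<forall>f\<in>Ex vs \<xi> x. len e \<le> len f}"

definition G :: "lpt list \<Rightarrow> edge set \<Rightarrow> edge set" where
  "G vs \<xi> = (\<Union>x\<in>Lam vs. ground vs \<xi> x)"

definition parent :: "lpt list \<Rightarrow> edge set \<Rightarrow> edge \<Rightarrow> edge \<Rightarrow> bool" where
  "parent vs \<xi> e f \<longleftrightarrow> (\<exists>x\<in>Lam vs. f \<in> Ex vs \<xi> x \<and> f \<notin> ground vs \<xi> x \<and> e \<in> Ex vs \<xi> x \<and>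
      len e < len f \<and>
      (\<exists>\<sigma>\<in>Omega vs \<xi>. edge_at \<sigma> x = f \<and> flippable vs \<xi> \<sigma> x \<and> edge_at (flip vs \<sigma> x) x = e))"

definition prec :: "lpt list \<Rightarrow> edge set \<Rightarrow> edge \<Rightarrow> edge \<Rightarrow> bool" where
  "prec vs \<xi> = (parent vs \<xi>)\<^sup>+\<^sup>+"

definition preceq :: "lpt list \<Rightarrow> edge set \<Rightarrow> edge \<Rightarrow> edge \<Rightarrow> bool" where
  "preceq vs \<xi> e f \<longleftrightarrow> e = f \<or> prec vs \<xi> e f"

definition Exsg :: "lpt list \<Rightarrow> edge set \<Rightarrow> real \<times> real \<Rightarrow> edge set \<Rightarrow> edge \<Rightarrow> edge set" where
  "Exsg vs \<xi> x \<sigma> g = {e \<in> Ex vs \<xi> x. seg e \<inter> seg g \<noteq> {} \<and> preceq vs \<xi> e (edge_at \<sigma> x)}"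

definition Psi :: "lpt list \<Rightarrow> edge set \<Rightarrow> real \<Rightarrow> edge \<Rightarrow> edge set \<Rightarrow> real" where
  "Psi vs \<xi> \<alpha> g \<sigma> = (\<Sum>x\<in>Lam vs. \<Sum>e\<in>Exsg vs \<xi> x \<sigma> g. \<alpha> powr (real (len e) - real (len g)))"

definition lyapunov_constants :: "real \<Rightarrow> real \<Rightarrow> real \<Rightarrow> real \<Rightarrow> bool" where
  "lyapunov_constants lam \<alpha> \<psi>0 \<epsilon> \<longleftrightarrow>
     1 < \<alpha> \<and> \<alpha> < lam powr (-1/2) \<and> \<psi>0 > 1 \<and> \<epsilon> > 0 \<and>
     (\<forall>vs \<xi> \<sigma> g. lattice_polygon vs \<longrightarrow> boundary_condition vs \<xi> \<longrightarrow>
        \<sigma> \<in> Omega vs \<xi> \<longrightarrow> g \<in> G vs \<xi> \<longrightarrow> Psi vs \<xi> \<alpha> g \<sigma> \<ge> \<psi>0 \<longrightarrow>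
        measure_pmf.expectation (step lam vs \<xi> \<sigma>) (Psi vs \<xi> \<alpha> g)
          \<le> (1 - \<epsilon> / real (card (Lam vs))) * Psi vs \<xi> \<alpha> g \<sigma>)"

end

theory Submission
  imports Defs
begin

text \<open>Write \<open>\<Psi>\<close> for the height function, \<open>N = |\<Lambda>|\<close> and \<open>L = \<alpha> powr l\<close>. A long edge meeting \<open>g\<close> alone contributes
  at least \<open>L\<close> to \<open>\<Psi>\<close>, so Markov's inequality and the iterated drift bound the tail probability by
  \<open>(q\<^sup>t \<Psi> + O(1)) / L\<close> with \<open>q = 1 - \<epsilon> / N\<close>. The maximum in the conclusion leaves no room for the
  additive constant. But Markov is wasteful unless the final state has a long edge and \<open>\<Psi>\<close> barely
  above \<open>L\<close>, that is, unless a single edge carries almost all of \<open>\<Psi>\<close>. In such a state the drift condition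
  can only hold if that edge is flippable, and it then flips at rate almost 1; in particular
  \<open>\<epsilon> < 1\<close>, and the drift there is strictly better than \<open>\<epsilon>\<close>. So a fixed proportion of \<open>q\<^sup>t \<Psi>\<close> is
  gained back, which beats the constant as soon as \<open>q\<^sup>t \<Psi>\<close> is large.

  The estimates on a single step rest on the geometry of unimodular triangulations: every triangle
  has area 1/2, a flip exchanges the diagonals of a lattice parallelogram, and parents are unique.
  The stationary bound follows by integrating the drift against the reversible measure.\<close>

section \<open>Affine functionals and barycentric coordinates\<close>

text \<open>A triangulation is given only as a maximal disjoint family of edges. That its triangles
  have area 1/2, that every midpoint carries an edge and that flips stay in \<open>Omega\<close>
  must all be derived. The lever is integrality: \<open>ori (rp a) (rp b)\<close> is integral at
  lattice points, so the row at height 1/2 over an edge contains none of them, and an edge reaching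
  that row must cross it. In the drift the obstacle is an upward flip that creates a new crossing of
  \<open>g\<close>. As \<open>lam\<close> is at most \<alpha> to the power -2, its rate times its
  weight is charged to an edge that already crosses \<open>g\<close>, with a factor \<alpha> to the
  power -3 m, where m is the length of a side of the flipped parallelogram. Each edge receives at
  most 4 such charges, and at most 8 bounded ones come from the ends of \<open>g\<close>. The same
  decay makes the charges to a dominating edge negligible. In the tail estimate the invariant is a
  convex combination of \<open>q^t * Psi\<close> and a constant, whose coefficient grows linearly in
  t / N. A convex combination stays below the maximum, and once the coefficient of the constant is
  bounded below it absorbs the total later loss D / \<epsilon>.\<close>

definition affn :: "(real \<times> real \<Rightarrow> real) \<Rightarrow> bool" where
  "affn D \<longleftrightarrow> (\<exists>c0 c1 c2. \<forall>z. D z = c0 + c1 * fst z + c2 * snd z)"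

lemma affn_convex_comb:
  assumes "affn D" shows "D ((1 - t) *\<^sub>R x + t *\<^sub>R y) = (1 - t) * D x + t * D y"
proof -
  obtain c0 c1 c2 where "\<And>z. D z = c0 + c1 * fst z + c2 * snd z"
    using assms unfolding affn_def by blast
  then show ?thesis by (simp add: algebra_simps)
qed

lemma affn_intro: "(\<And>z. D z = c0 + c1 * fst z + c2 * snd z) \<Longrightarrow> affn D"
  unfolding affn_def by blast

lemma affn_cmult: assumes "affn D" shows "affn (\<lambda>z. c * D z)"
proof -
  obtain c0 c1 c2 where "\<And>z. D z = c0 + c1 * fst z + c2 * snd z"
    using assms unfolding affn_def by blast
  then show ?thesis by (intro affn_intro[of _ "c*c0" "c*c1" "c*c2"]) (simp add: algebra_simps)
qed

lemma affn_add: assumes "affn D" "affn E" shows "affn (\<lambda>z. D z + E z)"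
proof -
  obtain c0 c1 c2 where 1: "\<And>z. D z = c0 + c1 * fst z + c2 * snd z"
    using assms unfolding affn_def by blast
  obtain d0 d1 d2 where 2: "\<And>z. E z = d0 + d1 * fst z + d2 * snd z"
    using assms unfolding affn_def by blast
  show ?thesis by (intro affn_intro[of _ "c0+d0" "c1+d1" "c2+d2"]) (simp add: 1 2 algebra_simps)
qed

lemma affn_const: "affn (\<lambda>z. c)"
  by (intro affn_intro[of _ c 0 0]) simp

lemma affn_continuous: assumes "affn D" shows "continuous_on S D"
proof -
  obtain c0 c1 c2 where "\<And>z. D z = c0 + c1 * fst z + c2 * snd z"
    using assms unfolding affn_def by blast
  then have "D = (\<lambda>z. c0 + c1 * fst z + c2 * snd z)" by blast
  then show ?thesis by (auto intro!: continuous_intros)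
qed

lemma affn_open_segment_pos:
  assumes "affn D" "D x \<ge> 0" "D y \<ge> 0" "D x > 0 \<or> D y > 0" "z \<in> open_segment x y"
  shows "D z > 0"
proof -
  obtain t where t: "0 < t" "t < 1" "z = (1 - t) *\<^sub>R x + t *\<^sub>R y"
    using assms(5) by (auto simp: in_segment)
  have "D z = (1 - t) * D x + t * D y" using t affn_convex_comb[OF assms(1)] by simp
  moreover have "(1-t) * D x \<ge> 0" "t * D y \<ge> 0" using t assms by auto
  moreover have "(1-t) * D x > 0 \<or> t * D y > 0" using t assms by auto
  ultimately show ?thesis by linarith
qed

lemma affn_segment_nonneg:
  assumes "affn D" "D x \<ge> 0" "D y \<ge> 0" "z \<in> closed_segment x y"
  shows "D z \<ge> 0"
proof -
  obtain t where t: "0 \<le> t" "t \<le> 1" "z = (1 - t) *\<^sub>R x + t *\<^sub>R y"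
    using assms(4) by (auto simp: in_segment)
  have "D z = (1 - t) * D x + t * D y" using t affn_convex_comb[OF assms(1)] by simp
  then show ?thesis using t assms by simp
qed

lemma affn_segment_zero:
  assumes "affn D" "D x = 0" "D y = 0" "z \<in> closed_segment x y"
  shows "D z = 0"
proof -
  obtain t where t: "0 \<le> t" "t \<le> 1" "z = (1 - t) *\<^sub>R x + t *\<^sub>R y"
    using assms(4) by (auto simp: in_segment)
  have "D z = (1 - t) * D x + t * D y" using t affn_convex_comb[OF assms(1)] by simp
  then show ?thesis using assms by simp
qed

lemma affn_segment_le:
  assumes "affn D" "D y \<le> D x" "z \<in> closed_segment x y"
  shows "D z \<le> D x" "D y \<le> D z"
proof -
  obtain t where t: "0 \<le> t" "t \<le> 1" "z = (1 - t) *\<^sub>R x + t *\<^sub>R y"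
    using assms(3) by (auto simp: in_segment)
  have *: "D z = (1 - t) * D x + t * D y" using t affn_convex_comb[OF assms(1)] by simp
  have "D z = D x - t * (D x - D y)" using * by (simp add: algebra_simps)
  moreover have "D z = D y + (1-t) * (D x - D y)" using * by (simp add: algebra_simps)
  moreover have "t * (D x - D y) \<ge> 0" "(1-t) * (D x - D y) \<ge> 0" using t assms by auto
  ultimately show "D z \<le> D x" "D y \<le> D z" by linarith+
qed

text \<open>Intermediate value theorem for the minimum of the three functionals along the segment
  from \<open>x\<close> to \<open>r\<close>. The zero found lies in the closed cell and on one of
  its walls. Cells with fewer walls are obtained by repeating a functional.\<close>

lemma exit_cell:
  assumes f: "affn f" and g: "affn g" and h: "affn h"
    and x: "f x > 0" "g x > 0" "h x > 0" and r: "\<not> (f r > 0 \<and> g r > 0 \<and> h r > 0)"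
  obtains y where "y \<in> open_segment x r \<or> y = r" "f y \<ge> 0" "g y \<ge> 0" "h y \<ge> 0"
    "f y = 0 \<or> g y = 0 \<or> h y = 0"
proof -
  define p where "p t = (1 - t) *\<^sub>R x + t *\<^sub>R r" for t
  define m where "m t = min (min (f (p t)) (g (p t))) (h (p t))" for t
  have cp: "continuous_on {0..1} p" unfolding p_def by (intro continuous_intros)
  have c: "continuous_on {0..1} m" unfolding m_def
    using affn_continuous[OF f] affn_continuous[OF g] affn_continuous[OF h]
    by (intro continuous_intros continuous_on_compose2[OF _ cp, of UNIV]) auto
  have "m 1 \<le> 0" "0 \<le> m 0" using x r by (auto simp: m_def p_def min_def)
  from IVT2'[OF this _ c] obtain t where t: "0 \<le> t" "t \<le> 1" "m t = 0" by auto
  have "p 0 = x" by (simp add: p_def)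
  then have "m 0 > 0" using x by (simp add: m_def)
  then have "t \<noteq> 0" using t(3) by auto
  have "x \<noteq> r" using x r by auto
  have 1: "p t \<in> open_segment x r \<or> p t = r"
  proof (cases "t = 1")
    case False
    then have "\<exists>u>0. u < 1 \<and> p t = (1 - u) *\<^sub>R x + u *\<^sub>R r"
      using t \<open>t \<noteq> 0\<close> by (intro exI[of _ t]) (auto simp: p_def)
    then show ?thesis using \<open>x \<noteq> r\<close> by (simp add: in_segment)
  qed (simp add: p_def)
  have "f (p t) \<ge> 0" "g (p t) \<ge> 0" "h (p t) \<ge> 0" "f (p t) = 0 \<or> g (p t) = 0 \<or> h (p t) = 0"
    using t(3) unfolding m_def min_def by (simp_all split: if_splits)
  with 1 that show ?thesis by blast
qed

text \<open>Twice the signed area of the triangle \<open>p\<close>, \<open>q\<close>,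
  \<open>z\<close>. For fixed \<open>p\<close> and \<open>q\<close> it serves as a height of
  \<open>z\<close> over the line through them; \<open>iori\<close> is its integer version on the
  lattice.\<close>

definition ori :: "real \<times> real \<Rightarrow> real \<times> real \<Rightarrow> real \<times> real \<Rightarrow> real" where
  "ori p q z = (fst q - fst p) * (snd z - snd p) - (snd q - snd p) * (fst z - fst p)"

definition iori :: "lpt \<Rightarrow> lpt \<Rightarrow> lpt \<Rightarrow> int" where
  "iori p q z = (fst q - fst p) * (snd z - snd p) - (snd q - snd p) * (fst z - fst p)"

lemma ori_rp: "ori (rp a) (rp b) (rp c) = of_int (iori a b c)"
  by (simp add: ori_def iori_def rp_def)

lemma affn_ori: "affn (ori p q)"
  by (intro affn_intro[of _ "- (fst q - fst p) * snd p + (snd q - snd p) * fst p" "- (snd q - snd p)" "fst q - fst p"])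
     (simp add: ori_def algebra_simps)

lemma ori_cyc: "ori b c a = ori a b c" by (simp add: ori_def algebra_simps)
lemma ori_swap: "ori b a c = - ori a b c" by (simp add: ori_def algebra_simps)
lemma ori_swap2: "ori a c b = - ori a b c" by (simp add: ori_def algebra_simps)
lemma ori_self [simp]: "ori a b a = 0" "ori a b b = 0" "ori a a z = 0" by (simp_all add: ori_def)
lemma ori_sum: "ori b c z + ori c a z + ori a b z = ori a b c" by (simp add: ori_def algebra_simps)

text \<open>The barycentric coordinate belonging to the first vertex; cyclic rotation of the
  arguments gives the other two. For a degenerate triangle division by zero makes it 0, so
  \<open>tri\<close> is then empty.\<close>

definition bar :: "real \<times> real \<Rightarrow> real \<times> real \<Rightarrow> real \<times> real \<Rightarrow> real \<times> real \<Rightarrow> real" where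
  "bar a b c z = ori b c z / ori a b c"

lemma bar_comm: "bar a c b = bar a b c"
proof
  fix z have "ori c b z = - ori b c z" "ori a c b = - ori a b c" by (rule ori_swap ori_swap2)+
  then show "bar a c b z = bar a b c z" by (simp add: bar_def)
qed

lemma affn_bar: "affn (bar a b c)"
  using affn_cmult[OF affn_ori, of "1 / ori a b c" b c] unfolding bar_def by simp

lemma bar_sum: assumes "ori a b c \<noteq> 0" shows "bar a b c z + bar b c a z + bar c a b z = 1"
proof -
  have "bar a b c z + bar b c a z + bar c a b z = (ori b c z + ori c a z + ori a b z) / ori a b c"
    unfolding bar_def using ori_cyc[of b c a] ori_cyc[of a b c] by (simp add: add_divide_distrib)
  then show ?thesis using assms ori_sum by simp
qed

lemma bar_eq: "bar a b c z = ori b c z / ori a b c" "bar b c a z = ori c a z / ori a b c"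
    "bar c a b z = ori a b z / ori a b c"
  unfolding bar_def using ori_cyc[of b c a] ori_cyc[of a b c] by simp_all

lemma bar_vertex:
  assumes "ori a b c \<noteq> 0"
  shows "bar a b c a = 1" "bar a b c b = 0" "bar a b c c = 0"
  using assms by (auto simp: bar_def ori_cyc[of b c a])

lemma bar_decomp:
  assumes "ori a b c \<noteq> 0"
  shows "z = bar a b c z *\<^sub>R a + bar b c a z *\<^sub>R b + bar c a b z *\<^sub>R c"
proof -
  define D where "D = ori a b c"
  have D: "D \<noteq> 0" using assms by (simp add: D_def)
  have "D * fst z = ori b c z * fst a + ori c a z * fst b + ori a b z * fst c"
       "D * snd z = ori b c z * snd a + ori c a z * snd b + ori a b z * snd c"
    by (simp_all add: D_def ori_def algebra_simps)
  then have "fst z = (ori b c z * fst a + ori c a z * fst b + ori a b z * fst c) / D"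
       "snd z = (ori b c z * snd a + ori c a z * snd b + ori a b z * snd c) / D"
    using D by (simp_all add: eq_divide_eq mult.commute[of D])
  then show ?thesis unfolding bar_eq[where a=a and b=b and c=c] D_def[symmetric] prod_eq_iff
    by (simp add: add_divide_distrib)
qed

definition tri :: "real \<times> real \<Rightarrow> real \<times> real \<Rightarrow> real \<times> real \<Rightarrow> (real \<times> real) set" where
  "tri a b c = {z. 0 < bar a b c z \<and> 0 < bar b c a z \<and> 0 < bar c a b z}"

lemma tri_comm: "tri a c b = tri a b c" "tri b a c = tri a b c" "tri b c a = tri a b c"
  by (auto simp: tri_def bar_comm)

lemma side_of_bar:
  assumes "ori a b c \<noteq> 0" "bar c a b z = 0" "bar a b c z > 0" "bar b c a z > 0"
  shows "z \<in> open_segment a b"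
proof -
  have s: "bar a b c z = 1 - bar b c a z" using bar_sum[OF assms(1), of z] assms(2) by simp
  have "z = (1 - bar b c a z) *\<^sub>R a + bar b c a z *\<^sub>R b"
    using bar_decomp[OF assms(1), of z] assms(2) s by simp
  moreover have "a \<noteq> b" using assms(1) by auto
  ultimately show ?thesis using assms s unfolding in_segment
    by (intro conjI exI[of _ "bar b c a z"]) auto
qed

lemma vertex_of_bar:
  assumes "ori a b c \<noteq> 0" "bar c a b z = 0" "bar b c a z = 0" shows "z = a"
  using bar_decomp[OF assms(1), of z] bar_sum[OF assms(1), of z] assms by simp

lemma bar_side:
  assumes "ori a b c \<noteq> 0" "z \<in> closed_segment a b" shows "bar c a b z = 0"
proof -
  have "bar c a b a = 0" "bar c a b b = 0" by (simp_all add: bar_def)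
  then show ?thesis using affn_segment_zero[OF affn_bar _ _ assms(2)] by blast
qed

lemma open_tri: "open (tri a b c)"
proof -
  have "tri a b c = {z. 0 < bar a b c z} \<inter> {z. 0 < bar b c a z} \<inter> {z. 0 < bar c a b z}"
    by (auto simp: tri_def)
  then show ?thesis
    by (simp only:) (intro open_Int open_Collect_less continuous_on_const affn_continuous affn_bar)
qed

text \<open>The closed triangle, but only for \<open>ori a b c \<noteq> 0\<close>: in the degenerate
  case all three coordinates are 0 and the set is the whole plane.\<close>

definition ctri :: "real \<times> real \<Rightarrow> real \<times> real \<Rightarrow> real \<times> real \<Rightarrow> (real \<times> real) set" where
  "ctri a b c = {z. 0 \<le> bar a b c z \<and> 0 \<le> bar b c a z \<and> 0 \<le> bar c a b z}"

lemma closed_ctri: "closed (ctri a b c)"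
proof -
  have "ctri a b c = {z. 0 \<le> bar a b c z} \<inter> {z. 0 \<le> bar b c a z} \<inter> {z. 0 \<le> bar c a b z}"
    by (auto simp: ctri_def)
  then show ?thesis
    by (simp only:) (intro closed_Int closed_Collect_le continuous_on_const affn_continuous affn_bar)
qed

lemma tri_subset_ctri: "tri a b c \<subseteq> ctri a b c"
  by (auto simp: tri_def ctri_def)

lemma ctri_hull:
  assumes "ori a b c \<noteq> 0" shows "ctri a b c = convex hull {a, b, c}"
proof
  show "ctri a b c \<subseteq> convex hull {a, b, c}"
  proof
    fix z assume "z \<in> ctri a b c"
    then show "z \<in> convex hull {a, b, c}" unfolding convex_hull_3 ctri_def
      using bar_sum[OF assms, of z] bar_decomp[OF assms, of z] by blast
  qed
  show "convex hull {a, b, c} \<subseteq> ctri a b c"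
  proof (rule hull_minimal)
    have o: "ori b c a \<noteq> 0" "ori c a b \<noteq> 0" using assms ori_cyc[of b c a] ori_cyc[of a b c] by auto
    show "{a, b, c} \<subseteq> ctri a b c"
      using bar_vertex[OF assms] bar_vertex[OF o(1)] bar_vertex[OF o(2)] by (auto simp: ctri_def)
    show "convex (ctri a b c)"
    proof (rule convexI)
      fix x y u v assume *: "x \<in> ctri a b c" "y \<in> ctri a b c" "(0::real) \<le> u" "0 \<le> v" "u + v = 1"
      have u: "u = 1 - v" using * by simp
      show "u *\<^sub>R x + v *\<^sub>R y \<in> ctri a b c"
        using * by (simp add: ctri_def u affn_convex_comb[OF affn_bar])
    qed
  qed
qed

lemma ctri_side:
  assumes "ori a b c \<noteq> 0" "bar c a b z = 0" "bar a b c z \<ge> 0" "bar b c a z \<ge> 0"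
  shows "z \<in> open_segment a b \<or> z = a \<or> z = b"
proof -
  have o: "ori b a c \<noteq> 0" using assms ori_swap[of b a c] by simp
  have "z = b" if "bar a b c z = 0"
    using vertex_of_bar[OF o, of z] assms(2) that by (simp add: bar_comm[of c b a] bar_comm[of a c b])
  then show ?thesis
    using side_of_bar[OF assms(1,2)] vertex_of_bar[OF assms(1,2)] assms(3,4)
    by (cases "bar a b c z = 0"; cases "bar b c a z = 0") auto
qed

lemma ctri_cases:
  assumes "ori a b c \<noteq> 0" "z \<in> ctri a b c" "z \<notin> tri a b c"
  shows "z \<in> open_segment a b \<or> z \<in> open_segment b c \<or> z \<in> open_segment a c \<or> z \<in> {a, b, c}"
proof -
  have o: "ori b c a \<noteq> 0" "ori c a b \<noteq> 0" using assms ori_cyc[of b c a] ori_cyc[of a b c] by auto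
  have nn: "bar a b c z \<ge> 0" "bar b c a z \<ge> 0" "bar c a b z \<ge> 0" using assms by (auto simp: ctri_def)
  have "bar c a b z = 0 \<or> bar a b c z = 0 \<or> bar b c a z = 0"
    using assms(3) nn unfolding tri_def mem_Collect_eq by linarith
  then show ?thesis
    using ctri_side[OF assms(1) _ nn(1,2)] ctri_side[OF o(1) _ nn(2,3)] ctri_side[OF o(2) _ nn(3,1)]
      open_segment_commute[of c a] by blast
qed

lemma tri_ori: "z \<in> tri a b c \<Longrightarrow> ori a b c \<noteq> 0"
  by (auto simp: tri_def bar_def)

lemma exit_tri:
  assumes "x \<in> tri a b c" "r \<notin> tri a b c"
  obtains y where "y \<in> open_segment x r \<or> y = r"
    "y \<in> open_segment a b \<or> y \<in> open_segment b c \<or> y \<in> open_segment a c \<or> y \<in> {a, b, c}"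
proof -
  have x: "bar a b c x > 0" "bar b c a x > 0" "bar c a b x > 0"
    and r: "\<not> (bar a b c r > 0 \<and> bar b c a r > 0 \<and> bar c a b r > 0)"
    using assms by (auto simp: tri_def)
  obtain y where y: "y \<in> open_segment x r \<or> y = r" "bar a b c y \<ge> 0" "bar b c a y \<ge> 0" "bar c a b y \<ge> 0"
    "bar a b c y = 0 \<or> bar b c a y = 0 \<or> bar c a b y = 0"
    by (rule exit_cell[OF affn_bar affn_bar affn_bar x r]) blast
  then have "y \<in> ctri a b c" "y \<notin> tri a b c" by (auto simp: tri_def ctri_def)
  with ctri_cases[OF tri_ori[OF assms(1)]] y(1) that show ?thesis by blast
qed

lemma open_segment_vertex_tri:
  assumes "ori a b c \<noteq> 0" "y \<in> open_segment b c" "z \<in> open_segment a y"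
  shows "z \<in> tri a b c"
proof -
  have o: "ori b c a \<noteq> 0" "ori c a b \<noteq> 0" using assms ori_cyc[of b c a] ori_cyc[of a b c] by auto
  have b: "bar b c a y > 0" "bar c a b y > 0"
    using affn_open_segment_pos[OF affn_bar _ _ _ assms(2), of b c a]
      affn_open_segment_pos[OF affn_bar _ _ _ assms(2), of c a b] bar_vertex[OF o(1)] bar_vertex[OF o(2)] by auto
  have a: "bar a b c y = 0" using bar_side[OF o(1)] assms(2) segment_open_subset_closed by blast
  have "bar a b c z > 0" "bar b c a z > 0" "bar c a b z > 0"
    using affn_open_segment_pos[OF affn_bar _ _ _ assms(3), of a b c]
      affn_open_segment_pos[OF affn_bar _ _ _ assms(3), of b c a]
      affn_open_segment_pos[OF affn_bar _ _ _ assms(3), of c a b]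
      a b bar_vertex[OF o(1)] bar_vertex[OF o(2)] bar_vertex[OF assms(1)] by auto
  then show ?thesis by (simp add: tri_def)
qed

lemma bounded_tri: assumes "ori a b c \<noteq> 0" shows "bounded (tri a b c)"
  by (rule bounded_subset[OF _ tri_subset_ctri]) (simp add: ctri_hull[OF assms] bounded_convex_hull finite_imp_bounded)

section \<open>Lattice triangles\<close>

lemma rp_inj: "rp p = rp q \<longleftrightarrow> p = q"
  by (auto simp: rp_def prod_eq_iff)

text \<open>Reduce a lattice point modulo the lattice spanned by the two sides; it lands in the triangle or,
  after a point reflection, in the triangle again.\<close>

lemma empty_triangle_unimodular:
  assumes D: "iori a b c \<noteq> 0"
    and empty: "\<And>p. rp p \<in> ctri (rp a) (rp b) (rp c) \<Longrightarrow> p \<in> {a, b, c}"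
  shows "\<bar>iori a b c\<bar> = 1"
proof -
  have o: "ori (rp a) (rp b) (rp c) \<noteq> 0" using D by (simp add: ori_rp)
  define u1 u2 v1 v2 where "u1 = fst b - fst a" and "u2 = snd b - snd a"
    and "v1 = fst c - fst a" and "v2 = snd c - snd a"
  define d where "d = iori a b c"
  have d: "d = u1 * v2 - u2 * v1" by (simp add: d_def iori_def u1_def u2_def v1_def v2_def)
  have d0: "d \<noteq> 0" using D by (simp add: d_def)
  have coords: "bar (rp b) (rp c) (rp a) (rp p) = of_int ((fst p - fst a) * v2 - (snd p - snd a) * v1) / of_int d"
       "bar (rp c) (rp a) (rp b) (rp p) = of_int (u1 * (snd p - snd a) - u2 * (fst p - fst a)) / of_int d" for p
  proof -
    have "iori c a p = (fst p - fst a) * v2 - (snd p - snd a) * v1"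
      by (simp add: iori_def v1_def v2_def algebra_simps)
    then show "bar (rp b) (rp c) (rp a) (rp p) = of_int ((fst p - fst a) * v2 - (snd p - snd a) * v1) / of_int d"
      unfolding bar_eq(2)[where a="rp a" and b="rp b" and c="rp c"] ori_rp d_def by simp
    show "bar (rp c) (rp a) (rp b) (rp p) = of_int (u1 * (snd p - snd a) - u2 * (fst p - fst a)) / of_int d"
      unfolding bar_eq(3)[where a="rp a" and b="rp b" and c="rp c"] ori_rp d_def by (simp add: iori_def u1_def u2_def)
  qed
  \<comment> \<open>The two expressions are the numerators in Cramer's rule for the vector (x, y) in
    the basis formed by the two sides at \<open>a\<close>. Their divisibility by \<open>d\<close>
    says that the sides span the whole lattice.\<close>
  have key: "d dvd x * v2 - y * v1 \<and> d dvd u1 * y - u2 * x" for x y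
  proof -
    define A where "A = x * v2 - y * v1"
    define B where "B = u1 * y - u2 * x"
    define m where "m = \<lfloor>real_of_int A / d\<rfloor>"
    define n where "n = \<lfloor>real_of_int B / d\<rfloor>"
    define s where "s = real_of_int A / d - m"
    define t where "t = real_of_int B / d - n"
    have s: "0 \<le> s" "s < 1" and t: "0 \<le> t" "t < 1"
      unfolding s_def t_def m_def n_def by linarith+
    define p where "p = (fst a + x - m * u1 - n * v1, snd a + y - m * u2 - n * v2)"
    have bp: "bar (rp b) (rp c) (rp a) (rp p) = s" "bar (rp c) (rp a) (rp b) (rp p) = t"
    proof -
      have "(fst p - fst a) * v2 - (snd p - snd a) * v1 = A - m * d"
        by (simp add: p_def A_def d algebra_simps)
      then show "bar (rp b) (rp c) (rp a) (rp p) = s"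
        unfolding coords s_def using d0 by (simp add: diff_divide_distrib)
      have "u1 * (snd p - snd a) - u2 * (fst p - fst a) = B - n * d"
        by (simp add: p_def B_def d algebra_simps)
      then show "bar (rp c) (rp a) (rp b) (rp p) = t"
        unfolding coords t_def using d0 by (simp add: diff_divide_distrib)
    qed
    have sum: "bar (rp a) (rp b) (rp c) (rp p) = 1 - s - t"
      using bar_sum[OF o, of "rp p"] bp by simp
    have o': "ori (rp b) (rp c) (rp a) \<noteq> 0" "ori (rp c) (rp a) (rp b) \<noteq> 0"
      using o ori_cyc by metis+
    have vb: "bar (rp b) (rp c) (rp a) (rp a) = 0" "bar (rp b) (rp c) (rp a) (rp b) = 1" "bar (rp b) (rp c) (rp a) (rp c) = 0"
       "bar (rp c) (rp a) (rp b) (rp a) = 0" "bar (rp c) (rp a) (rp b) (rp b) = 0" "bar (rp c) (rp a) (rp b) (rp c) = 1"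
      using bar_vertex[OF o'(1)] bar_vertex[OF o'(2)] by auto
    have "s = 0 \<and> t = 0"
    proof (cases "s + t \<le> 1")
      case True
      then have "p \<in> {a, b, c}" using empty[of p] bp sum s t by (simp add: ctri_def)
      then show ?thesis using bp vb s t by auto
    next
      case False
      \<comment> \<open>Reflection in the midpoint of the side from \<open>b\<close> to
        \<open>c\<close> turns the coordinates s, t into 1 - s, 1 - t, and the third one becomes s +
        t - 1. All three are positive here, so the reflected point is no vertex and the case is
        contradictory.\<close>
      define p' where "p' = (fst b + fst c - fst p, snd b + snd c - snd p)"
      have bp': "bar (rp b) (rp c) (rp a) (rp p') = 1 - s" "bar (rp c) (rp a) (rp b) (rp p') = 1 - t"
      proof -
        have "(fst p' - fst a) * v2 - (snd p' - snd a) * v1 = d - ((fst p - fst a) * v2 - (snd p - snd a) * v1)"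
          by (simp add: p'_def d u1_def u2_def v1_def v2_def algebra_simps)
        then show "bar (rp b) (rp c) (rp a) (rp p') = 1 - s"
          using bp(1) d0 unfolding coords by (simp add: diff_divide_distrib)
        have "u1 * (snd p' - snd a) - u2 * (fst p' - fst a) = d - (u1 * (snd p - snd a) - u2 * (fst p - fst a))"
          by (simp add: p'_def d u1_def u2_def v1_def v2_def algebra_simps)
        then show "bar (rp c) (rp a) (rp b) (rp p') = 1 - t"
          using bp(2) d0 unfolding coords by (simp add: diff_divide_distrib)
      qed
      have sum': "bar (rp a) (rp b) (rp c) (rp p') = s + t - 1"
        using bar_sum[OF o, of "rp p'"] bp' by simp
      have "p' \<in> {a, b, c}" using empty[of p'] bp' sum' s t False by (simp add: ctri_def)
      then show ?thesis using bp' vb s t False by auto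
    qed
    then have "real_of_int A = m * d" "real_of_int B = n * d"
      using d0 unfolding s_def t_def by (auto simp: field_simps)
    then have "A = m * d" "B = n * d" by (metis of_int_eq_iff of_int_mult)+
    then show ?thesis unfolding A_def B_def by simp
  qed
  \<comment> \<open>For the two unit vectors the divisibility reaches all four matrix entries, so
    the square of \<open>d\<close> divides the determinant \<open>d\<close>.\<close>
  have "d dvd v2" "d dvd u2" using key[of 1 0] by auto
  moreover have "d dvd v1" "d dvd u1" using key[of 0 1] by auto
  ultimately have "d * d dvd u1 * v2 - u2 * v1"
    by (intro dvd_diff mult_dvd_mono)
  then have "d * d dvd d * 1" by (simp only: d[symmetric] mult_1_right)
  then have "d dvd 1" using d0 dvd_times_left_cancel_iff by blast
  then show ?thesis unfolding d_def by simp
qed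

text \<open>Numerators are integers and the common denominator is 1 or -1. Every later use of
  unimodularity goes through this integrality.\<close>

lemma bar_int:
  assumes "\<bar>iori a b c\<bar> = 1"
  shows "bar (rp a) (rp b) (rp c) (rp p) \<in> \<int>" "bar (rp b) (rp c) (rp a) (rp p) \<in> \<int>" "bar (rp c) (rp a) (rp b) (rp p) \<in> \<int>"
proof -
  have "real_of_int x / of_int (iori a b c) \<in> \<int>" for x
    using assms by (cases "iori a b c = 1") (auto simp: abs_if split: if_splits)
  then show "bar (rp a) (rp b) (rp c) (rp p) \<in> \<int>" "bar (rp b) (rp c) (rp a) (rp p) \<in> \<int>" "bar (rp c) (rp a) (rp b) (rp p) \<in> \<int>"
    unfolding bar_eq[where a="rp a" and b="rp b" and c="rp c"] ori_rp by auto
qed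

lemma Ints_pos_ge1: "(x::real) \<in> \<int> \<Longrightarrow> x > 0 \<Longrightarrow> x \<ge> 1"
  by (auto elim!: Ints_cases)

lemma lattice_notin_unimodular_tri:
  assumes "\<bar>iori a b c\<bar> = 1" shows "rp p \<notin> tri (rp a) (rp b) (rp c)"
proof
  assume t: "rp p \<in> tri (rp a) (rp b) (rp c)"
  have "ori (rp a) (rp b) (rp c) \<noteq> 0" using assms by (auto simp: ori_rp)
  from bar_sum[OF this, of "rp p"] show False
    using t Ints_pos_ge1[OF bar_int(1)[OF assms, of p]] Ints_pos_ge1[OF bar_int(2)[OF assms, of p]]
      Ints_pos_ge1[OF bar_int(3)[OF assms, of p]] unfolding tri_def mem_Collect_eq by linarith
qed

text \<open>Three nonnegative integers with sum 1: two of them vanish, which leaves only a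
  vertex.\<close>

lemma unimodular_ctri_lattice:
  assumes "\<bar>iori a b c\<bar> = 1" "rp p \<in> ctri (rp a) (rp b) (rp c)" shows "p \<in> {a, b, c}"
proof -
  have o: "ori (rp a) (rp b) (rp c) \<noteq> 0" using assms by (auto simp: ori_rp)
  then have o': "ori (rp b) (rp c) (rp a) \<noteq> 0" "ori (rp c) (rp a) (rp b) \<noteq> 0"
    using ori_cyc by metis+
  have nn: "bar (rp a) (rp b) (rp c) (rp p) \<ge> 0" "bar (rp b) (rp c) (rp a) (rp p) \<ge> 0" "bar (rp c) (rp a) (rp b) (rp p) \<ge> 0"
    using assms by (auto simp: ctri_def)
  have s: "bar (rp a) (rp b) (rp c) (rp p) + bar (rp b) (rp c) (rp a) (rp p) + bar (rp c) (rp a) (rp b) (rp p) = 1"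
    by (rule bar_sum[OF o])
  note i = bar_int[OF assms(1), of p]
  have z: "x = 0 \<or> x \<ge> 1" if "x \<in> \<int>" "x \<ge> 0" for x :: real
    using that Ints_pos_ge1[of x] by linarith
  have "(bar (rp a) (rp b) (rp c) (rp p) = 0 \<and> bar (rp b) (rp c) (rp a) (rp p) = 0) \<or>
    (bar (rp a) (rp b) (rp c) (rp p) = 0 \<and> bar (rp c) (rp a) (rp b) (rp p) = 0) \<or>
    (bar (rp b) (rp c) (rp a) (rp p) = 0 \<and> bar (rp c) (rp a) (rp b) (rp p) = 0)"
    using z[OF i(1) nn(1)] z[OF i(2) nn(2)] z[OF i(3) nn(3)] s nn by linarith
  then show ?thesis
    using vertex_of_bar[OF o] vertex_of_bar[OF o'(1)] vertex_of_bar[OF o'(2)] rp_inj by blast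
qed

text \<open>A point of half the lattice has half-integral barycentric coordinates, so three positive ones sum to at least 3/2.\<close>

lemma half_lattice_notin_unimodular_tri:
  assumes "\<bar>iori a b c\<bar> = 1" shows "(1/2) *\<^sub>R (rp p + rp q) \<notin> tri (rp a) (rp b) (rp c)"
proof
  assume t: "(1/2) *\<^sub>R (rp p + rp q) \<in> tri (rp a) (rp b) (rp c)"
  have o: "ori (rp a) (rp b) (rp c) \<noteq> 0" using assms by (auto simp: ori_rp)
  have e: "(1/2) *\<^sub>R (rp p + rp q) = (1 - 1/2) *\<^sub>R rp p + (1/2) *\<^sub>R rp q"
    by (simp add: algebra_simps)
  have h: "D ((1/2) *\<^sub>R (rp p + rp q)) \<ge> 1/2"
    if "affn D" "D (rp p) \<in> \<int>" "D (rp q) \<in> \<int>" "D ((1/2) *\<^sub>R (rp p + rp q)) > 0" for D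
  proof -
    have "2 * D ((1/2) *\<^sub>R (rp p + rp q)) = D (rp p) + D (rp q)"
      unfolding e affn_convex_comb[OF that(1)] by (simp add: field_simps)
    then show ?thesis using that Ints_pos_ge1[of "D (rp p) + D (rp q)"] by auto
  qed
  from bar_sum[OF o, of "(1/2) *\<^sub>R (rp p + rp q)"] show False
    using t h[OF affn_bar bar_int(1)[OF assms] bar_int(1)[OF assms]] h[OF affn_bar bar_int(2)[OF assms] bar_int(2)[OF assms]]
     h[OF affn_bar bar_int(3)[OF assms] bar_int(3)[OF assms]] unfolding tri_def mem_Collect_eq by linarith
qed

section \<open>Edges, region and triangulations\<close>

lemma seg_pair: "a \<noteq> b \<Longrightarrow> seg {a, b} = open_segment (rp a) (rp b)"
proof -
  assume "a \<noteq> b"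
  have "z \<in> open_segment (rp a) (rp b)" if z: "z \<in> seg {a, b}" for z
  proof -
    obtain c d where "{a, b} = {c, d}" "z \<in> open_segment (rp c) (rp d)"
      using z unfolding seg_def by blast
    moreover from this have "(a = c \<and> b = d) \<or> (a = d \<and> b = c)" by (simp add: doubleton_eq_iff)
    ultimately show ?thesis by (elim disjE conjE) (simp_all add: open_segment_commute)
  qed
  moreover have "open_segment (rp a) (rp b) \<subseteq> seg {a, b}"
    unfolding seg_def using \<open>a \<noteq> b\<close> by blast
  ultimately show ?thesis by blast
qed

lemma seg_closed: "a \<noteq> b \<Longrightarrow> z \<in> seg {a, b} \<Longrightarrow> z \<in> closed_segment (rp a) (rp b)"
  using seg_pair segment_open_subset_closed by blast

lemma mid_pair: "a \<noteq> b \<Longrightarrow> mid {a, b} = (1/2) *\<^sub>R (rp a + rp b)"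
  by (simp add: mid_def)

lemma mid_in_seg: assumes "a \<noteq> b" shows "mid {a, b} \<in> seg {a, b}"
proof -
  have "mid {a, b} = (1 - 1/2) *\<^sub>R rp a + (1/2) *\<^sub>R rp b"
    unfolding mid_pair[OF assms] by (simp add: algebra_simps)
  moreover have "rp a \<noteq> rp b" using assms rp_inj by blast
  ultimately show ?thesis unfolding seg_pair[OF assms] in_segment
    by (intro conjI exI[of _ "1/2"]) auto
qed

lemma l1_commute: "l1 p q = l1 q p"
  unfolding l1_def by (simp add: abs_minus_commute)

lemma len_pair: "len {a, b} = l1 a b"
proof -
  have "(\<lambda>(p, q). l1 p q) ` ({a, b} \<times> {a, b}) = {0, l1 a b}"
    by (auto simp: l1_commute[of b a]) (auto simp: l1_def)
  then show ?thesis unfolding len_def by simp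
qed

lemma admissibleE:
  assumes "admissible vs e"
  obtains a b where "a \<noteq> b" "e = {a, b}" "a \<in> Lam0 vs" "b \<in> Lam0 vs"
  using assms unfolding admissible_def empty_edge_def is_edge_def by blast

lemma admissible_lattice_free: "admissible vs e \<Longrightarrow> rp p \<notin> seg e"
  unfolding admissible_def empty_edge_def Lam0_def by auto

lemma compact_boundary: "compact (poly_boundary vs)"
  unfolding poly_boundary_def side_seg_def by (intro compact_UN) auto

lemma bounded_region: "bounded (region vs)"
  unfolding region_def
  using compact_imp_bounded[OF compact_boundary] bounded_inside[OF compact_imp_bounded[OF compact_boundary]] by simp

lemma finite_Lam0: "finite (Lam0 vs)"
proof -
  obtain B where B: "\<And>z. z \<in> region vs \<Longrightarrow> norm z \<le> B"
    using bounded_region unfolding bounded_iff by blast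
  define n where "n = \<lceil>B\<rceil>"
  have "Lam0 vs \<subseteq> {-n..n} \<times> {-n..n}"
  proof
    fix p assume "p \<in> Lam0 vs"
    then have n: "norm (rp p) \<le> B" using B by (simp add: Lam0_def)
    have "\<bar>real_of_int (fst p)\<bar> \<le> norm (rp p)" "\<bar>real_of_int (snd p)\<bar> \<le> norm (rp p)"
      using norm_fst_le[of "real_of_int (fst p)" "real_of_int (snd p)"]
        norm_snd_le[of "real_of_int (snd p)" "real_of_int (fst p)"] unfolding rp_def by simp_all
    with n have "\<bar>real_of_int (fst p)\<bar> \<le> B" "\<bar>real_of_int (snd p)\<bar> \<le> B" by linarith+
    then have "\<bar>fst p\<bar> \<le> n" "\<bar>snd p\<bar> \<le> n" unfolding n_def by linarith+
    then show "p \<in> {-n..n} \<times> {-n..n}" by (cases p) auto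
  qed
  then show ?thesis by (rule finite_subset) simp
qed

text \<open>A connected set off the boundary stays in one component of its complement, and one point
  of the region makes that component a bounded one.\<close>

lemma connected_region:
  assumes "connected C" "C \<inter> poly_boundary vs = {}" "x \<in> C" "x \<in> region vs"
  shows "C \<subseteq> region vs" "bounded C"
proof -
  have x: "x \<in> inside (poly_boundary vs)" using assms by (auto simp: region_def)
  have sub: "C \<subseteq> connected_component_set (- poly_boundary vs) x"
    using assms by (intro connected_component_maximal) auto
  also have "\<dots> \<subseteq> inside (poly_boundary vs)"
    using inside_same_component[OF _ x] by blast
  finally show "C \<subseteq> region vs" by (auto simp: region_def)
  then show "bounded C" using bounded_region bounded_subset by blast
qed

text \<open>A component of the complement of the polygon is unbounded, so it would have to leave the triangle through a side.\<close>

lemma tri_region: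
  assumes o: "ori a b c \<noteq> 0"
    and s: "closed_segment a b \<subseteq> region vs" "closed_segment b c \<subseteq> region vs" "closed_segment a c \<subseteq> region vs"
  shows "tri a b c \<subseteq> region vs"
proof
  fix z assume z: "z \<in> tri a b c"
  show "z \<in> region vs"
  proof (rule ccontr)
    assume nz: "z \<notin> region vs"
    define C where "C = connected_component_set (- poly_boundary vs) z"
    have "z \<notin> poly_boundary vs" using nz by (simp add: region_def)
    then have zC: "z \<in> C" unfolding C_def by simp
    have unb: "\<not> bounded C" using nz by (auto simp: region_def inside_def C_def)
    have con: "connected C" unfolding C_def by simp
    have dj: "C \<inter> poly_boundary vs = {}" unfolding C_def using connected_component_subset by fastforce
    then have "C \<inter> region vs = {}" using connected_region(2)[OF con dj] unb by blast
    moreover have "w \<in> region vs" if "w \<in> ctri a b c - tri a b c" for w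
    proof -
      have "a \<in> region vs" "b \<in> region vs" "c \<in> region vs"
        using s ends_in_segment by blast+
      moreover have "open_segment a b \<subseteq> region vs" "open_segment b c \<subseteq> region vs" "open_segment a c \<subseteq> region vs"
        using s segment_open_subset_closed by blast+
      moreover have "w \<in> open_segment a b \<or> w \<in> open_segment b c \<or> w \<in> open_segment a c \<or> w \<in> {a, b, c}"
        using ctri_cases[OF o] that by blast
      ultimately show ?thesis by blast
    qed
    ultimately have "C \<inter> (ctri a b c - tri a b c) = {}" by blast
    then have "C \<subseteq> tri a b c \<union> (- ctri a b c)" using tri_subset_ctri by blast
    moreover have "tri a b c \<inter> (- ctri a b c) \<inter> C = {}" using tri_subset_ctri by blast
    ultimately have "tri a b c \<inter> C = {} \<or> (- ctri a b c) \<inter> C = {}"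
      using connectedD[OF con open_tri, of "- ctri a b c"] closed_ctri by (simp add: open_Compl)
    then have "C \<subseteq> tri a b c" using z zC \<open>C \<subseteq> tri a b c \<union> (- ctri a b c)\<close> by blast
    then show False using unb bounded_tri[OF o] bounded_subset by blast
  qed
qed

text \<open>Any height function that separates \<open>p\<close> from \<open>q\<close> can be used as
  parameter on the line through them; here it is the height over another pair \<open>a\<close>,
  \<open>b\<close>.\<close>

lemma on_line:
  assumes "ori p q w = 0" "ori a b p \<noteq> ori a b q"
  shows "w = (1 - (ori a b w - ori a b p) / (ori a b q - ori a b p)) *\<^sub>R p + ((ori a b w - ori a b p) / (ori a b q - ori a b p)) *\<^sub>R q"
proof -
  define d where "d = ori a b q - ori a b p"
  define n where "n = ori a b w - ori a b p"
  have d: "d \<noteq> 0" using assms by (simp add: d_def)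
  have "d * fst w = (d - n) * fst p + n * fst q - ori p q w * (fst b - fst a)"
       "d * snd w = (d - n) * snd p + n * snd q - ori p q w * (snd b - snd a)"
    unfolding d_def n_def ori_def by algebra+
  then have "d * fst w = (d - n) * fst p + n * fst q" "d * snd w = (d - n) * snd p + n * snd q"
    using assms(1) by simp_all
  then have "fst w = (1 - n / d) * fst p + n / d * fst q" "snd w = (1 - n / d) * snd p + n / d * snd q"
    using d by (simp_all add: field_simps)
  then show ?thesis unfolding d_def[symmetric] n_def[symmetric] by (simp add: prod_eq_iff)
qed

lemma on_line_open:
  assumes "ori p q w = 0" "ori a b p < ori a b w" "ori a b w < ori a b q"
  shows "w \<in> open_segment p q"
proof -
  let ?t = "(ori a b w - ori a b p) / (ori a b q - ori a b p)"
  have "w = (1 - ?t) *\<^sub>R p + ?t *\<^sub>R q" using assms by (intro on_line) auto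
  moreover have "0 < ?t" "?t < 1" using assms by (auto simp: field_simps)
  moreover have "p \<noteq> q" using assms by auto
  ultimately show ?thesis unfolding in_segment by blast
qed

lemma ori_on_segment: "z \<in> closed_segment a b \<Longrightarrow> ori a b z = 0"
  using affn_segment_zero[OF affn_ori ori_self(1) ori_self(2)] .

lemma collinear_param:
  assumes "ori a b x = 0" "a \<noteq> b" obtains t where "x = (1 - t) *\<^sub>R a + t *\<^sub>R b"
proof -
  define n where "n = (fst b - fst a)^2 + (snd b - snd a)^2"
  define m where "m = (fst x - fst a) * (fst b - fst a) + (snd x - snd a) * (snd b - snd a)"
  have n: "n \<noteq> 0" using assms(2) unfolding n_def sum_power2_eq_zero_iff by (auto simp: prod_eq_iff)
  have "n * (fst x - fst a) = m * (fst b - fst a) - ori a b x * (snd b - snd a)"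
       "n * (snd x - snd a) = m * (snd b - snd a) + ori a b x * (fst b - fst a)"
    unfolding n_def m_def ori_def by algebra+
  then have "fst x - fst a = m / n * (fst b - fst a)" "snd x - snd a = m / n * (snd b - snd a)"
    using n assms(1) by (simp_all add: field_simps)
  then have "x = (1 - m/n) *\<^sub>R a + (m/n) *\<^sub>R b" by (simp add: prod_eq_iff algebra_simps)
  then show ?thesis by (rule that)
qed

lemma affn_bar_decomp:
  assumes "affn D" "ori a b c \<noteq> 0"
  shows "D z = bar a b c z * D a + bar b c a z * D b + bar c a b z * D c"
proof -
  obtain c0 c1 c2 where D: "\<And>z. D z = c0 + c1 * fst z + c2 * snd z"
    using assms unfolding affn_def by blast
  have s: "c0 = c0 * (bar a b c z + bar b c a z + bar c a b z)" using bar_sum[OF assms(2)] by simp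
  have "fst z = bar a b c z * fst a + bar b c a z * fst b + bar c a b z * fst c"
     "snd z = bar a b c z * snd a + bar b c a z * snd b + bar c a b z * snd c"
    by (subst bar_decomp[OF assms(2), of z], simp)+
  then have "D z = c0 * (bar a b c z + bar b c a z + bar c a b z) + c1 * (bar a b c z * fst a + bar b c a z * fst b + bar c a b z * fst c)
     + c2 * (bar a b c z * snd a + bar b c a z * snd b + bar c a b z * snd c)"
    unfolding D using s by simp
  then show ?thesis unfolding D by (simp add: algebra_simps)
qed

section \<open>The one-skeleton of a triangulation and the edges that bound a free segment\<close>

locale triangulated =
  fixes vs :: "lpt list" and \<sigma> :: "edge set"
  assumes poly: "lattice_polygon vs" and trg: "triangulation vs \<sigma>"
    and sides: "\<And>i. i < length vs \<Longrightarrow> side vs i \<in> \<sigma>"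
begin

lemma adm: "e \<in> \<sigma> \<Longrightarrow> admissible vs e"
  using trg by (simp add: triangulation_def)

lemma edge_lattice_free: "e \<in> \<sigma> \<Longrightarrow> rp p \<notin> seg e"
  using adm admissible_lattice_free by blast

lemma edges_disjoint: "e \<in> \<sigma> \<Longrightarrow> f \<in> \<sigma> \<Longrightarrow> z \<in> seg e \<Longrightarrow> z \<in> seg f \<Longrightarrow> e = f"
  using trg unfolding triangulation_def pairwise_disjoint_def by blast

lemma edge_in_region: "e \<in> \<sigma> \<Longrightarrow> seg e \<subseteq> region vs"
  using adm unfolding admissible_def by blast

lemma edgeE:
  assumes "e \<in> \<sigma>" obtains a b where "a \<noteq> b" "e = {a, b}" "a \<in> Lam0 vs" "b \<in> Lam0 vs"
  using adm[OF assms] by (rule admissibleE)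

lemma edge_ends: "{a, b} \<in> \<sigma> \<Longrightarrow> a \<in> Lam0 vs \<and> b \<in> Lam0 vs \<and> a \<noteq> b"
  by (elim edgeE) (auto simp: doubleton_eq_iff)

lemma maximal_edge:
  assumes "a \<noteq> b" "a \<in> Lam0 vs" "b \<in> Lam0 vs" "open_segment (rp a) (rp b) \<subseteq> region vs"
    "open_segment (rp a) (rp b) \<inter> rp ` Lam0 vs = {}"
    "\<And>f. f \<in> \<sigma> \<Longrightarrow> f \<noteq> {a, b} \<Longrightarrow> open_segment (rp a) (rp b) \<inter> seg f = {}"
  shows "{a, b} \<in> \<sigma>"
proof (rule ccontr)
  assume n: "{a, b} \<notin> \<sigma>"
  have "admissible vs {a, b}"
    unfolding admissible_def empty_edge_def is_edge_def seg_pair[OF assms(1)] using assms by blast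
  then obtain f where "f \<in> \<sigma>" "seg {a, b} \<inter> seg f \<noteq> {}"
    using n trg unfolding triangulation_def by blast
  then show False using assms(6)[of f] n unfolding seg_pair[OF assms(1)] by blast
qed

text \<open>All lattice points of the region are included with the open edges, which makes the set
  closed. It contains the boundary of the polygon because the sides are edges, so a connected set
  avoiding it cannot leave the region.\<close>

definition skel :: "(real \<times> real) set" where
  "skel = (\<Union>e\<in>\<sigma>. seg e) \<union> rp ` Lam0 vs"

lemma finite_edges: "finite \<sigma>"
proof -
  have "\<sigma> \<subseteq> Pow (Lam0 vs)" by (auto elim!: edgeE)
  then show ?thesis by (rule finite_subset) (simp add: finite_Lam0)
qed

lemma closed_skel: "closed skel"
proof -
  have "skel = (\<Union>e\<in>\<sigma>. seg e \<union> rp ` e) \<union> rp ` Lam0 vs"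
  proof -
    have "rp ` e \<subseteq> rp ` Lam0 vs" if "e \<in> \<sigma>" for e using edgeE[OF that] by blast
    then show ?thesis unfolding skel_def by blast
  qed
  moreover have "closed (seg e \<union> rp ` e)" if e: "e \<in> \<sigma>" for e
  proof -
    obtain a b where ab: "a \<noteq> b" "e = {a, b}" by (rule edgeE[OF e]) blast
    have "seg e \<union> rp ` e = closed_segment (rp a) (rp b)"
      unfolding ab(2) seg_pair[OF ab(1)] closed_segment_eq_open by simp
    then show ?thesis by simp
  qed
  moreover have "closed (rp ` Lam0 vs)" using finite_Lam0 by (simp add: finite_imp_closed)
  ultimately show ?thesis using finite_edges by (simp only:) (intro closed_Un closed_UN, auto)
qed

lemma boundary_skel: "poly_boundary vs \<subseteq> skel"
proof
  fix z assume "z \<in> poly_boundary vs"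
  then obtain i where i: "i < length vs" "z \<in> side_seg vs i" unfolding poly_boundary_def by blast
  define a b where "a = vs ! i" and "b = vs ! (Suc i mod length vs)"
  have s: "{a, b} \<in> \<sigma>" using sides[OF i(1)] unfolding side_def a_def b_def .
  have "a \<noteq> b" "a \<in> Lam0 vs" "b \<in> Lam0 vs" using edge_ends[OF s] by auto
  moreover have "z \<in> open_segment (rp a) (rp b) \<union> {rp a, rp b}"
    using i(2) unfolding side_seg_def closed_segment_eq_open a_def b_def .
  ultimately show "z \<in> skel" unfolding skel_def using s seg_pair by blast
qed

lemma free_region:
  assumes "connected C" "C \<inter> skel = {}" "x \<in> C" "x \<in> region vs"
  shows "C \<subseteq> region vs" "bounded C"
proof -
  have dj: "C \<inter> poly_boundary vs = {}" using boundary_skel assms(2) by blast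
  show "C \<subseteq> region vs" "bounded C" using connected_region[OF assms(1) dj assms(3,4)] by blast+
qed

text \<open>A ray that never met the skeleton would stay in the bounded region, so the set of
  hitting times is nonempty. It is closed as well, and its infimum is the first hit.\<close>

lemma first_hit:
  assumes "w \<in> region vs" "w \<notin> skel" "v \<noteq> 0"
  obtains s where "s > 0" "w + s *\<^sub>R v \<in> skel" "\<And>s'. 0 \<le> s' \<Longrightarrow> s' < s \<Longrightarrow> w + s' *\<^sub>R v \<notin> skel"
proof -
  define S where "S = {s. 0 \<le> s \<and> w + s *\<^sub>R v \<in> skel}"
  have ne: "S \<noteq> {}"
  proof
    assume e: "S = {}"
    define R where "R = (\<lambda>s. w + s *\<^sub>R v) ` {0..}"
    have "connected R" unfolding R_def
      by (intro connected_continuous_image continuous_intros) (simp add: convex_connected)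
    moreover have "R \<inter> skel = {}" using e unfolding R_def S_def by auto
    moreover have "w \<in> R" unfolding R_def by (force intro: image_eqI[of _ _ 0])
    ultimately have "bounded R" using free_region(2) assms(1) by blast
    then obtain B where B: "\<And>s. s \<ge> 0 \<Longrightarrow> norm (w + s *\<^sub>R v) \<le> B"
      unfolding R_def bounded_iff by auto
    define s where "s = (\<bar>B\<bar> + norm w + 1) / norm v"
    have "s \<ge> 0" unfolding s_def by simp
    have "norm (s *\<^sub>R v) = \<bar>B\<bar> + norm w + 1" using assms(3) by (simp add: s_def)
    moreover have "norm (s *\<^sub>R v) \<le> norm (w + s *\<^sub>R v) + norm w"
      using norm_triangle_ineq4[of "w + s *\<^sub>R v" w] by simp
    ultimately show False using B[OF \<open>s \<ge> 0\<close>] by simp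
  qed
  have "S = {0..} \<inter> (\<lambda>s. w + s *\<^sub>R v) -` skel" by (auto simp: S_def)
  moreover have "closed ({0..} \<inter> (\<lambda>s. w + s *\<^sub>R v) -` skel)"
    by (intro closed_Int closed_vimage closed_skel continuous_intros)
  ultimately have cl: "closed S" by simp
  have bb: "bdd_below S" by (rule bdd_belowI[of _ 0]) (simp add: S_def)
  have i: "Inf S \<in> S" by (rule closed_contains_Inf[OF ne bb cl])
  show ?thesis
  proof (rule that)
    show "Inf S > 0" using i assms(2) unfolding S_def by (cases "Inf S = 0") (auto simp: S_def)
    show "w + Inf S *\<^sub>R v \<in> skel" using i by (simp add: S_def)
    fix s' assume "0 \<le> s'" "s' < Inf S"
    then show "w + s' *\<^sub>R v \<notin> skel" using cInf_lower[OF _ bb, of s'] unfolding S_def by fastforce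
  qed
qed

text \<open>Heights of lattice points over \<open>{a, b}\<close> are integers, so an edge
  \<open>k\<close> through the row at height 1/2 runs from height at most 0 to height at least 1.
  The free segment from \<open>w\<close> down to \<open>z\<close> then keeps the whole edge
  \<open>{a, b}\<close> on one closed side of the line of \<open>k\<close>. The factor
  \<open>c\<close> lets the caller choose the sign of \<open>D\<close> that is positive at
  \<open>w\<close>, which differs for the left and the right bounding edge.\<close>

lemma bounding_edge:
  assumes ab: "{a, b} \<in> \<sigma>" and z: "z \<in> seg {a, b}"
    and w: "ori (rp a) (rp b) w = 1/2" and free: "open_segment w z \<inter> skel = {}"
    and k: "k \<in> \<sigma>" "P \<in> seg k" "ori (rp a) (rp b) P = 1/2"
  obtains lo hi where "k = {lo, hi}" "lo \<noteq> hi" "ori (rp a) (rp b) (rp lo) \<le> 0" "ori (rp a) (rp b) (rp hi) \<ge> 1"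
    "\<And>c D v. D = (\<lambda>z. c * ori (rp lo) (rp hi) z) \<Longrightarrow> D w > 0 \<Longrightarrow> D v = 0 \<Longrightarrow> 0 \<le> ori (rp a) (rp b) v \<Longrightarrow>
        ori (rp a) (rp b) v \<le> ori (rp a) (rp b) (rp hi) \<Longrightarrow> v \<in> seg k \<or> v = rp lo \<or> v = rp hi"
    "\<And>c D v. D = (\<lambda>z. c * ori (rp lo) (rp hi) z) \<Longrightarrow> D w > 0 \<Longrightarrow> v \<in> seg {a, b} \<Longrightarrow> D v > 0"
    "\<And>c D. D = (\<lambda>z. c * ori (rp lo) (rp hi) z) \<Longrightarrow> D w > 0 \<Longrightarrow> D (rp a) \<ge> 0 \<and> D (rp b) \<ge> 0"
proof -
  let ?y = "ori (rp a) (rp b)"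
  have anb: "a \<noteq> b" using edge_ends[OF ab] by simp
  obtain p q where pq: "p \<noteq> q" "k = {p, q}" "p \<in> Lam0 vs" "q \<in> Lam0 vs" by (rule edgeE[OF k(1)])
  have Pseg: "P \<in> open_segment (rp p) (rp q)" using k(2) pq seg_pair by simp
  have int: "?y (rp c) \<le> 0 \<or> ?y (rp c) \<ge> 1" for c
    unfolding ori_rp by (cases "iori a b c \<le> 0") auto
  have half: "\<not> (?y (rp p) \<le> 0 \<and> ?y (rp q) \<le> 0)" "\<not> (?y (rp p) \<ge> 1 \<and> ?y (rp q) \<ge> 1)"
  proof -
    have A: "affn (\<lambda>z. - ?y z)" "affn (\<lambda>z. ?y z - 1)"
      using affn_cmult[OF affn_ori[of "rp a" "rp b"], of "-1"]
        affn_add[OF affn_ori[of "rp a" "rp b"] affn_const[of "-1"]] by simp_all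
    have P: "P \<in> closed_segment (rp p) (rp q)" using Pseg segment_open_subset_closed by blast
    show "\<not> (?y (rp p) \<le> 0 \<and> ?y (rp q) \<le> 0)"
      using affn_segment_nonneg[OF A(1) _ _ P] k(3) by linarith
    show "\<not> (?y (rp p) \<ge> 1 \<and> ?y (rp q) \<ge> 1)"
      using affn_segment_nonneg[OF A(2) _ _ P] k(3) by linarith
  qed
  obtain lo hi where lh: "k = {lo, hi}" "lo \<noteq> hi" "?y (rp lo) \<le> 0" "?y (rp hi) \<ge> 1"
  proof (cases "?y (rp p) \<le> 0")
    case True
    then have "?y (rp q) \<ge> 1" using half(1) int[of q] by blast
    then show ?thesis using that[OF pq(2) pq(1) True] by blast
  next
    case False
    then have 1: "?y (rp p) \<ge> 1" using int[of p] by blast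
    then have 2: "?y (rp q) \<le> 0" using half(2) int[of q] by blast
    have "k = {q, p}" "q \<noteq> p" using pq by auto
    then show ?thesis using that[OF _ _ 2 1] by blast
  qed
  have kne: "k \<noteq> {a, b}"
  proof
    assume "k = {a, b}"
    then have "P \<in> closed_segment (rp a) (rp b)" using k(2) seg_closed[OF anb] by blast
    then have "?y P = 0" by (rule ori_on_segment)
    then show False using k(3) by simp
  qed
  have zero: "v \<in> seg k \<or> v = rp lo \<or> v = rp hi"
    if D: "D = (\<lambda>z. c * ori (rp lo) (rp hi) z)" "D w > 0" "D v = 0" "0 \<le> ?y v" "?y v \<le> ?y (rp hi)" for c D v
  proof -
    have c: "c \<noteq> 0" using D by auto
    then have o: "ori (rp lo) (rp hi) v = 0" using D by simp
    let ?t = "(?y v - ?y (rp lo)) / (?y (rp hi) - ?y (rp lo))"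
    have v: "v = (1 - ?t) *\<^sub>R rp lo + ?t *\<^sub>R rp hi" using lh by (intro on_line[OF o]) simp
    consider "?y v = ?y (rp lo)" | "?y v = ?y (rp hi)" | "?y (rp lo) < ?y v" "?y v < ?y (rp hi)"
      using D lh by linarith
    then show ?thesis
    proof cases
      case 1 then show ?thesis using v by simp
    next
      case 2 then show ?thesis using v lh by simp
    next
      case 3 then show ?thesis using on_line_open[OF o 3] lh seg_pair by simp
    qed
  qed
  have notin: "D v \<noteq> 0" if "D = (\<lambda>z. c * ori (rp lo) (rp hi) z)" "D w > 0" "v \<in> seg {a, b}" for c D v
  proof
    assume "D v = 0"
    have "v \<in> closed_segment (rp a) (rp b)" using that(3) seg_closed[OF anb] by blast
    then have "?y v = 0" by (rule ori_on_segment)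
    then have "0 \<le> ?y v" "?y v \<le> ?y (rp hi)" using lh(4) by linarith+
    from zero[OF that(1,2) \<open>D v = 0\<close> this] have "v \<in> seg k \<or> v = rp lo \<or> v = rp hi" .
    moreover have "v \<notin> seg k" using edges_disjoint[OF k(1) ab _ that(3)] kne by blast
    moreover have "v \<noteq> rp lo" "v \<noteq> rp hi" using edge_lattice_free[OF ab] that(3) by blast+
    ultimately show False by blast
  qed
  \<comment> \<open>Otherwise the way from \<open>w\<close> to \<open>z\<close> meets the line of
    \<open>k\<close> at a height between 0 and 1/2. There that line belongs to the closed edge
    \<open>k\<close>, so the free segment would hit the skeleton.\<close>
  have Dz: "D z > 0" if D: "D = (\<lambda>z. c * ori (rp lo) (rp hi) z)" "D w > 0" for c D
  proof (rule ccontr)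
    assume n: "\<not> D z > 0"
    have A: "affn D" unfolding D(1) by (rule affn_cmult[OF affn_ori])
    obtain v where v: "v \<in> open_segment w z \<or> v = z" "D v = 0"
      using exit_cell[OF A A A D(2) D(2) D(2), of z] n by auto
    have "v \<noteq> z" using notin[OF D z] v by auto
    then have vo: "v \<in> open_segment w z" using v by simp
    have "z \<in> closed_segment (rp a) (rp b)" using z seg_closed[OF anb] by blast
    then have yz: "?y z = 0" by (rule ori_on_segment)
    have vc: "v \<in> closed_segment w z" using vo segment_open_subset_closed by blast
    have le: "?y z \<le> ?y w" using yz w by simp
    have "?y v \<le> ?y w" "0 \<le> ?y v"
      using affn_segment_le[OF affn_ori le vc] yz by auto
    then have "v \<in> seg k \<or> v = rp lo \<or> v = rp hi" using zero[OF D v(2)] w lh(4) by linarith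
    then have "v \<in> skel" using lh k(1) edge_ends[of lo hi] unfolding skel_def by auto
    then show False using free vo by blast
  qed
  have Dz': "D v \<ge> 0 \<and> (v \<in> seg {a, b} \<longrightarrow> D v > 0)" if D: "D = (\<lambda>z. c * ori (rp lo) (rp hi) z)" "D w > 0"
     "v \<in> closed_segment (rp a) (rp b)" for c D v
  proof -
    have A: "affn D" unfolding D(1) by (rule affn_cmult[OF affn_ori])
    note dz = Dz[OF D(1,2)]
    have "D v \<ge> 0"
    proof (rule ccontr)
      assume n: "\<not> D v \<ge> 0"
      obtain v' where v': "v' \<in> open_segment z v \<or> v' = v" "D v' = 0"
        using exit_cell[OF A A A dz dz dz, of v] n by auto
      then have "v' \<in> open_segment z v" using n by auto
      moreover have "open_segment z v \<subseteq> open_segment (rp a) (rp b)"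
        using z D(3) segment_open_subset_closed unfolding seg_pair[OF anb] subset_open_segment by blast
      ultimately show False using notin[OF D(1,2), of v'] v' seg_pair[OF anb] by auto
    qed
    then show ?thesis using notin[OF D(1,2), of v] by fastforce
  qed
  show ?thesis
  proof (rule that[OF lh zero])
    fix c D v assume D: "D = (\<lambda>z. c * ori (rp lo) (rp hi) z)" "D w > 0"
    show "D v > 0" if "v \<in> seg {a, b}"
      using Dz'[OF D, of v] that seg_closed[OF anb] by blast
    show "D (rp a) \<ge> 0 \<and> D (rp b) \<ge> 0"
      using Dz'[OF D, of "rp a"] Dz'[OF D, of "rp b"] by simp
  qed
qed

end

section \<open>The triangle next to an edge, and an edge at every midpoint\<close>

lemma ori_shift: "ori p q (w + s *\<^sub>R v) = ori p q w + s * (fst q - fst p) * snd v - s * (snd q - snd p) * fst v"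
  by (simp add: ori_def algebra_simps)

text \<open>On the line, \<open>x\<close> has a parameter at most 0 or at least 1, so the way from
  the interior point \<open>z\<close> passes through one of the ends.\<close>

lemma line_exit:
  assumes z: "z \<in> open_segment a b" and o: "ori a b x = 0" and x: "x \<notin> open_segment a b"
  shows "a \<in> open_segment z x \<or> a = x \<or> b \<in> open_segment z x \<or> b = x"
proof -
  have ab: "a \<noteq> b" and zx: "z \<noteq> x" using z x by auto
  obtain t where t: "x = (1 - t) *\<^sub>R a + t *\<^sub>R b" by (rule collinear_param[OF o ab])
  obtain m where m: "0 < m" "m < 1" "z = (1 - m) *\<^sub>R a + m *\<^sub>R b"
    using z unfolding in_segment by blast
  have tt: "\<not> (0 < t \<and> t < 1)" using x ab t unfolding in_segment by blast
  have comb: "(1 - n) *\<^sub>R z + n *\<^sub>R x = ((1 - n) * (1 - m) + n * (1 - t)) *\<^sub>R a + ((1 - n) * m + n * t) *\<^sub>R b" for n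
    unfolding m(3) t by (simp add: algebra_simps)
  have mem: "v \<in> open_segment z x \<or> v = x" if "0 < n" "n \<le> 1" "v = (1 - n) *\<^sub>R z + n *\<^sub>R x" for n v
    using that zx unfolding in_segment by (cases "n = 1") auto
  show ?thesis
  proof (cases "t \<le> 0")
    case True
    \<comment> \<open>The parameter at which the way from \<open>z\<close> to \<open>x\<close>
      passes \<open>a\<close>, obtained by solving (1 - n) m + n t = 0.\<close>
    define n where "n = m / (m - t)"
    have n: "0 < n" "n \<le> 1" using m True by (auto simp: n_def field_simps)
    have "(m - t) * n = m" using m True by (simp add: n_def)
    then have c: "(1 - n) * (1 - m) + n * (1 - t) = 1" "(1 - n) * m + n * t = 0" by (simp_all add: algebra_simps)
    have "a = (1 - n) *\<^sub>R z + n *\<^sub>R x" unfolding comb c by simp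
    from mem[OF n this] show ?thesis by blast
  next
    case False
    then have tg: "t \<ge> 1" using tt by simp
    define n where "n = (1 - m) / (t - m)"
    have n: "0 < n" "n \<le> 1" using m tg by (auto simp: n_def field_simps)
    have "(t - m) * n = 1 - m" using m tg by (simp add: n_def)
    then have c: "(1 - n) * (1 - m) + n * (1 - t) = 0" "(1 - n) * m + n * t = 1" by (simp_all add: algebra_simps)
    have "b = (1 - n) *\<^sub>R z + n *\<^sub>R x" unfolding comb c by simp
    from mem[OF n this] show ?thesis by blast
  qed
qed

context triangulated
begin

text \<open>From \<open>w\<close>, the row at height 1/2 is followed both ways to the first edges
  \<open>kL\<close> and \<open>kR\<close>. The apex is a lattice point of least height above
  \<open>{a, b}\<close> and between the lines of these two edges. The minimal choice keeps the cell
  below it free of the skeleton, and then maximality of the triangulation supplies the two missing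
  sides.\<close>

lemma edge_triangle_aux:
  assumes ab: "{a, b} \<in> \<sigma>" and z: "z \<in> seg {a, b}"
    and w: "ori (rp a) (rp b) w = 1/2" and wr: "w \<in> region vs" "w \<notin> skel"
    and free: "open_segment w z \<inter> skel = {}"
  obtains r where "r \<in> Lam0 vs" "{a, r} \<in> \<sigma>" "{b, r} \<in> \<sigma>" "ori (rp a) (rp b) (rp r) > 0"
    "tri (rp a) (rp b) (rp r) \<subseteq> region vs" "tri (rp a) (rp b) (rp r) \<inter> skel = {}"
proof -
  let ?y = "ori (rp a) (rp b)"
  have anb: "a \<noteq> b" using edge_ends[OF ab] by simp
  define u where "u = rp b - rp a"
  have u: "u \<noteq> 0" using anb rp_inj by (auto simp: u_def)
  have yu: "?y (v + s *\<^sub>R u) = ?y v" for v s by (simp add: ori_def u_def algebra_simps)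
  obtain sR where sR: "sR > 0" "w + sR *\<^sub>R u \<in> skel" "\<And>s. 0 \<le> s \<Longrightarrow> s < sR \<Longrightarrow> w + s *\<^sub>R u \<notin> skel"
    by (rule first_hit[OF wr u], rule that)
  have nu: "- u \<noteq> 0" using u by simp
  obtain sL where sL: "sL > 0" "w + sL *\<^sub>R - u \<in> skel" "\<And>s. 0 \<le> s \<Longrightarrow> s < sL \<Longrightarrow> w + s *\<^sub>R - u \<notin> skel"
    by (rule first_hit[OF wr nu], rule that)
  define PR where "PR = w + sR *\<^sub>R u"
  define PL where "PL = w + (- sL) *\<^sub>R u"
  have PLR: "PL \<in> skel" "PR \<in> skel" using sL(2) sR(2) by (auto simp: PL_def PR_def)
  have yP: "?y PL = 1/2" "?y PR = 1/2" unfolding PL_def PR_def yu w by simp_all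
  have nl: "?y (rp c) \<noteq> 1/2" for c
  proof
    assume "?y (rp c) = 1/2"
    then have "real_of_int (2 * iori a b c) = of_int 1" by (simp add: ori_rp)
    then have "2 * iori a b c = 1" by (simp only: of_int_eq_iff)
    then show False by presburger
  qed
  obtain kL where kL: "kL \<in> \<sigma>" "PL \<in> seg kL" using PLR(1) yP nl unfolding skel_def by auto
  obtain kR where kR: "kR \<in> \<sigma>" "PR \<in> seg kR" using PLR(2) yP nl unfolding skel_def by auto
  obtain loL hiL where L: "kL = {loL, hiL}" "loL \<noteq> hiL" "?y (rp loL) \<le> 0" "?y (rp hiL) \<ge> 1"
    and L1: "\<And>c D v. D = (\<lambda>z. c * ori (rp loL) (rp hiL) z) \<Longrightarrow> D w > 0 \<Longrightarrow> D v = 0 \<Longrightarrow> 0 \<le> ?y v \<Longrightarrow>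
        ?y v \<le> ?y (rp hiL) \<Longrightarrow> v \<in> seg kL \<or> v = rp loL \<or> v = rp hiL"
    and L2: "\<And>c D v. D = (\<lambda>z. c * ori (rp loL) (rp hiL) z) \<Longrightarrow> D w > 0 \<Longrightarrow> v \<in> seg {a, b} \<Longrightarrow> D v > 0"
    and L3: "\<And>c D. D = (\<lambda>z. c * ori (rp loL) (rp hiL) z) \<Longrightarrow> D w > 0 \<Longrightarrow> D (rp a) \<ge> 0 \<and> D (rp b) \<ge> 0"
    by (rule bounding_edge[OF ab z w free kL yP(1)], rule that)
  obtain loR hiR where R: "kR = {loR, hiR}" "loR \<noteq> hiR" "?y (rp loR) \<le> 0" "?y (rp hiR) \<ge> 1"
    and R1: "\<And>c D v. D = (\<lambda>z. c * ori (rp loR) (rp hiR) z) \<Longrightarrow> D w > 0 \<Longrightarrow> D v = 0 \<Longrightarrow> 0 \<le> ?y v \<Longrightarrow>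
        ?y v \<le> ?y (rp hiR) \<Longrightarrow> v \<in> seg kR \<or> v = rp loR \<or> v = rp hiR"
    and R2: "\<And>c D v. D = (\<lambda>z. c * ori (rp loR) (rp hiR) z) \<Longrightarrow> D w > 0 \<Longrightarrow> v \<in> seg {a, b} \<Longrightarrow> D v > 0"
    and R3: "\<And>c D. D = (\<lambda>z. c * ori (rp loR) (rp hiR) z) \<Longrightarrow> D w > 0 \<Longrightarrow> D (rp a) \<ge> 0 \<and> D (rp b) \<ge> 0"
    by (rule bounding_edge[OF ab z w free kR yP(2)], rule that)
  \<comment> \<open>The signs -1 and 1 make both functionals positive at \<open>w\<close>: along the
    direction \<open>u\<close> the first increases and the second decreases.\<close>
  define DL where "DL = (\<lambda>z. (-1) * ori (rp loL) (rp hiL) z)"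
  define DR where "DR = (\<lambda>z. 1 * ori (rp loR) (rp hiR) z)"
  have AL: "affn DL" unfolding DL_def by (rule affn_cmult[OF affn_ori])
  have AR: "affn DR" unfolding DR_def by (rule affn_cmult[OF affn_ori])
  define cL where "cL = ?y (rp hiL) - ?y (rp loL)"
  define cR where "cR = ?y (rp hiR) - ?y (rp loR)"
  have c: "cL > 0" "cR > 0" using L R by (auto simp: cL_def cR_def)
  have shL: "DL (v + s *\<^sub>R u) = DL v + s * cL" for v s
    unfolding DL_def ori_shift cL_def u_def by (simp add: ori_def algebra_simps)
  have shR: "DR (v + s *\<^sub>R u) = DR v - s * cR" for v s
    unfolding DR_def ori_shift cR_def u_def by (simp add: ori_def algebra_simps)
  have "PL \<in> closed_segment (rp loL) (rp hiL)" "PR \<in> closed_segment (rp loR) (rp hiR)"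
    using kL(2) kR(2) seg_closed[OF L(2)] seg_closed[OF R(2)] unfolding L(1) R(1) by blast+
  then have "DL PL = 0" "DR PR = 0" unfolding DL_def DR_def by (simp_all add: ori_on_segment)
  then have wv: "DL w = sL * cL" "DR w = sR * cR"
    using shL[of w "-sL"] shR[of w sR] unfolding PL_def PR_def by simp_all
  then have wpos: "DL w > 0" "DR w > 0" using c sL(1) sR(1) by simp_all
  have DRPL: "DR PL > 0" and DLPR: "DL PR > 0"
    using wv c sL(1) sR(1) shR[of w "-sL"] shL[of w sR] unfolding PL_def PR_def
    by (simp_all add: add_pos_pos)
  note zL = L1[OF DL_def wpos(1)] and zR = R1[OF DR_def wpos(2)]
  have onL: "DL v = 0" if "v \<in> seg kL" for v
    using that seg_closed[OF L(2)] ori_on_segment unfolding L(1) DL_def by fastforce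
  have onR: "DR v = 0" if "v \<in> seg kR" for v
    using that seg_closed[OF R(2)] ori_on_segment unfolding R(1) DR_def by fastforce
  \<comment> \<open>Points of the row strictly between the two lines are translates of
    \<open>w\<close> by less than the first hitting distances.\<close>
  have row: "v \<notin> skel" if v: "?y v = 1/2" "DL v > 0" "DR v > 0" for v
  proof -
    have d: "u = rp b - rp a" by (simp add: u_def)
    have "ori (rp a) (rp b) (v - w + rp a) = 0" using v(1) w by (simp add: ori_def algebra_simps)
    then obtain t where "v - w + rp a = (1 - t) *\<^sub>R rp a + t *\<^sub>R rp b"
      using anb rp_inj by (metis collinear_param)
    then have vw: "v = w + t *\<^sub>R u" unfolding d by (simp add: algebra_simps)
    have "0 < sL * cL + t * cL" "0 < sR * cR - t * cR" using v(2,3) wv unfolding vw shL shR by auto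
    then have "0 < (sL + t) * cL" "0 < (sR - t) * cR" by (simp_all add: algebra_simps)
    then have t: "- sL < t" "t < sR" using c by (simp_all add: zero_less_mult_iff)
    show ?thesis
    proof (cases "t \<ge> 0")
      case True then show ?thesis using sR(3)[of t] t vw by simp
    next
      case False then show ?thesis using sL(3)[of "-t"] t vw by simp
    qed
  qed
  define Cand where "Cand = {r \<in> Lam0 vs. ?y (rp r) > 0 \<and> DL (rp r) \<ge> 0 \<and> DR (rp r) \<ge> 0}"
  have ends: "loL \<in> Lam0 vs" "hiL \<in> Lam0 vs" "loR \<in> Lam0 vs" "hiR \<in> Lam0 vs"
    using edge_ends kL(1) kR(1) unfolding L(1) R(1) by auto
  have kLR: "kL \<noteq> kR" using onL[of PR] kR(2) DLPR by auto
  \<comment> \<open>The lower one of the two upper ends is a candidate: if it lay beyond the other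
    line, \<open>kL\<close> and \<open>kR\<close> would cross on the way up to it. Hence candidates
    exist, and the lowest is no higher than either upper end.\<close>
  have cand: "hiL \<in> Cand \<and> ?y (rp hiL) \<le> ?y (rp hiR) \<or> hiR \<in> Cand \<and> ?y (rp hiR) \<le> ?y (rp hiL)"
  proof (cases "?y (rp hiL) \<le> ?y (rp hiR)")
    case True
    have "DR (rp hiL) \<ge> 0"
    proof (rule ccontr)
      assume n: "\<not> DR (rp hiL) \<ge> 0"
      obtain v where v: "v \<in> open_segment PL (rp hiL) \<or> v = rp hiL" "DR v = 0"
        using exit_cell[OF AR AR AR DRPL DRPL DRPL, of "rp hiL"] n by auto
      then have vo: "v \<in> open_segment PL (rp hiL)" using n by auto
      have le: "?y PL \<le> ?y (rp hiL)" using yP L by simp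
      have vc: "v \<in> closed_segment (rp hiL) PL"
        using vo segment_open_subset_closed by (auto simp: closed_segment_commute)
      have "1/2 \<le> ?y v" "?y v \<le> ?y (rp hiL)" using affn_segment_le[OF affn_ori le vc] yP by auto
      then have vv: "v \<in> seg kR \<or> v = rp loR \<or> v = rp hiR" using zR[of v] v(2) True by linarith
      have "PL \<in> closed_segment (rp loL) (rp hiL)" using kL(2) seg_closed[OF L(2)] unfolding L(1) by blast
      then have "open_segment PL (rp hiL) \<subseteq> open_segment (rp loL) (rp hiL)"
        unfolding subset_open_segment by simp
      then have vk: "v \<in> seg kL" using vo seg_pair[OF L(2)] unfolding L(1) by blast
      then show False using vv edges_disjoint[OF kL(1) kR(1) vk] kLR edge_lattice_free[OF kL(1)] by blast
    qed
    moreover have "DL (rp hiL) = 0" by (simp add: DL_def)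
    ultimately show ?thesis using True ends L unfolding Cand_def by auto
  next
    case False
    have "DL (rp hiR) \<ge> 0"
    proof (rule ccontr)
      assume n: "\<not> DL (rp hiR) \<ge> 0"
      obtain v where v: "v \<in> open_segment PR (rp hiR) \<or> v = rp hiR" "DL v = 0"
        using exit_cell[OF AL AL AL DLPR DLPR DLPR, of "rp hiR"] n by auto
      then have vo: "v \<in> open_segment PR (rp hiR)" using n by auto
      have le: "?y PR \<le> ?y (rp hiR)" using yP R by simp
      have vc: "v \<in> closed_segment (rp hiR) PR"
        using vo segment_open_subset_closed by (auto simp: closed_segment_commute)
      have "1/2 \<le> ?y v" "?y v \<le> ?y (rp hiR)" using affn_segment_le[OF affn_ori le vc] yP by auto
      then have vv: "v \<in> seg kL \<or> v = rp loL \<or> v = rp hiL" using zL[of v] v(2) False by linarith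
      have "PR \<in> closed_segment (rp loR) (rp hiR)" using kR(2) seg_closed[OF R(2)] unfolding R(1) by blast
      then have "open_segment PR (rp hiR) \<subseteq> open_segment (rp loR) (rp hiR)"
        unfolding subset_open_segment by simp
      then have vk: "v \<in> seg kR" using vo seg_pair[OF R(2)] unfolding R(1) by blast
      then show False using vv edges_disjoint[OF kR(1) kL(1) vk] kLR edge_lattice_free[OF kR(1)] by blast
    qed
    moreover have "DR (rp hiR) = 0" by (simp add: DR_def)
    ultimately show ?thesis using False ends R unfolding Cand_def by auto
  qed
  have finC: "finite Cand" unfolding Cand_def using finite_Lam0 by simp
  have neC: "Cand \<noteq> {}" using cand by blast
  define r where "r = arg_min_on (\<lambda>r. ?y (rp r)) Cand"
  have rC: "r \<in> Cand" unfolding r_def by (rule arg_min_if_finite(1)[OF finC neC])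
  have rmin: "?y (rp r) \<le> ?y (rp p)" if "p \<in> Cand" for p
    unfolding r_def by (rule arg_min_least[OF finC neC that])
  have r0: "r \<in> Lam0 vs" "?y (rp r) > 0" "DL (rp r) \<ge> 0" "DR (rp r) \<ge> 0" using rC by (auto simp: Cand_def)
  have rhi: "?y (rp r) \<le> ?y (rp hiL)" "?y (rp r) \<le> ?y (rp hiR)" using cand rmin[of hiL] rmin[of hiR] by auto
  have int1: "?y (rp c) \<ge> 1" if "?y (rp c) > 0" for c using that unfolding ori_rp by simp
  \<comment> \<open>The open cell between the two lines, above \<open>{a, b}\<close> and below the
    chosen apex. The claim is that it misses the skeleton.\<close>
  define G where "G = {v. 0 < ?y v \<and> ?y v < ?y (rp r) \<and> DL v > 0 \<and> DR v > 0}"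
  have noK: "v \<notin> skel" if v: "v \<in> G" for v
  proof
    assume vs': "v \<in> skel"
    have "v \<noteq> rp p" if "p \<in> Lam0 vs" for p
      using rmin[of p] v that unfolding G_def Cand_def by auto
    then obtain k where k: "k \<in> \<sigma>" "v \<in> seg k" using vs' unfolding skel_def by blast
    obtain p q where pq: "p \<noteq> q" "k = {p, q}" "p \<in> Lam0 vs" "q \<in> Lam0 vs" by (rule edgeE[OF k(1)])
    have vpq: "v \<in> closed_segment (rp p) (rp q)" using k(2) seg_closed[OF pq(1)] unfolding pq(2) by blast
    have vo: "v \<in> open_segment (rp p) (rp q)" using k(2) seg_pair[OF pq(1)] unfolding pq(2) by blast
    have g: "0 < ?y v" "?y v < ?y (rp r)" "DL v > 0" "DR v > 0" using v by (auto simp: G_def)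
    have kn: "k \<noteq> kL" "k \<noteq> kR" using onL[of v] onR[of v] k(2) g by auto
    have sub: "open_segment v (rp p) \<subseteq> seg k" "open_segment v (rp q) \<subseteq> seg k"
      unfolding pq(2) seg_pair[OF pq(1)] subset_open_segment using vpq by auto
    \<comment> \<open>At heights strictly between 0 and that of \<open>r\<close>, the lines of
      \<open>kL\<close> and \<open>kR\<close> carry only interior points of these edges. Another
      edge therefore cannot touch them, and the row between them is already known to be
      free.\<close>
    have bad: False if x: "x \<in> seg k \<or> x = rp e" "e \<in> Lam0 vs" "0 < ?y x" "?y x < ?y (rp r)" "DL x \<ge> 0" "DR x \<ge> 0"
        "DL x = 0 \<or> DR x = 0 \<or> ?y x = 1/2" for x e
    proof -
      have 1: "DL x > 0"
      proof (rule ccontr)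
        assume "\<not> DL x > 0"
        then have "DL x = 0" using x by simp
        then have "x \<in> seg kL \<or> x = rp loL \<or> x = rp hiL" using zL[of x] x rhi by linarith
        moreover have "x \<noteq> rp loL" "x \<noteq> rp hiL" using x L rhi by auto
        ultimately have xk: "x \<in> seg kL" by blast
        show False using x(1) edges_disjoint[OF k(1) kL(1) _ xk] kn edge_lattice_free[OF kL(1)] xk by blast
      qed
      have 2: "DR x > 0"
      proof (rule ccontr)
        assume "\<not> DR x > 0"
        then have "DR x = 0" using x by simp
        then have "x \<in> seg kR \<or> x = rp loR \<or> x = rp hiR" using zR[of x] x rhi by linarith
        moreover have "x \<noteq> rp loR" "x \<noteq> rp hiR" using x R rhi by auto
        ultimately have xk: "x \<in> seg kR" by blast
        show False using x(1) edges_disjoint[OF k(1) kR(1) _ xk] kn edge_lattice_free[OF kR(1)] xk by blast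
      qed
      have "?y x = 1/2" using x 1 2 by simp
      then have "x \<notin> skel" using row 1 2 by blast
      then show False using x(1,2) k(1) unfolding skel_def by blast
    qed
    consider "?y v = 1/2" | "?y v > 1/2" | "?y v < 1/2" by linarith
    then show False
    proof cases
      case 1 then show False using row[of v] g vs' by blast
    next
      case 2
      have Ay: "affn (\<lambda>x. ?y x + (- 1/2))" by (rule affn_add[OF affn_ori affn_const])
      \<comment> \<open>Above the row, the edge is followed to an end that is not higher. By
        minimality of \<open>r\<close> this end is not inside the cell, so the edge must leave
        through a line or through the row.\<close>
      have "\<exists>e\<in>{p, q}. ?y (rp e) \<le> ?y v"
      proof (cases "?y (rp p) \<le> ?y (rp q)")
        case True
        then show ?thesis using affn_segment_le(2)[OF affn_ori True, of v] vpq by (auto simp: closed_segment_commute)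
      next
        case False
        then have le: "?y (rp q) \<le> ?y (rp p)" by simp
        then show ?thesis using affn_segment_le(2)[OF affn_ori le vpq] by auto
      qed
      then obtain e where e: "e \<in> {p, q}" "?y (rp e) \<le> ?y v" by blast
      have eL: "e \<in> Lam0 vs" using e pq by blast
      have "\<not> (DL (rp e) > 0 \<and> DR (rp e) > 0 \<and> ?y (rp e) + (- 1/2) > 0)"
      proof
        assume "DL (rp e) > 0 \<and> DR (rp e) > 0 \<and> ?y (rp e) + (- 1/2) > 0"
        then have "e \<in> Cand" using eL by (auto simp: Cand_def)
        then show False using rmin[of e] e g by simp
      qed
      moreover have "?y v + (- 1/2) > 0" using 2 by simp
      ultimately obtain x where x: "x \<in> open_segment v (rp e) \<or> x = rp e" "DL x \<ge> 0" "DR x \<ge> 0" "?y x + (- 1/2) \<ge> 0"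
        "DL x = 0 \<or> DR x = 0 \<or> ?y x + (- 1/2) = 0"
        using exit_cell[OF AL AR Ay g(3,4)] by blast
      have "x \<in> closed_segment v (rp e)" using x(1) segment_open_subset_closed by auto
      then have "?y x \<le> ?y v" using affn_segment_le(1)[OF affn_ori e(2)] by blast
      moreover have "x \<in> seg k \<or> x = rp e" using x(1) e(1) sub by blast
      ultimately show False using bad[of x e] eL x g by auto
    next
      case 3
      have Ay: "affn (\<lambda>x. (-1) * ?y x + 1/2)" by (rule affn_add[OF affn_cmult[OF affn_ori] affn_const])
      have "\<exists>e\<in>{p, q}. ?y v \<le> ?y (rp e)"
      proof (cases "?y (rp p) \<le> ?y (rp q)")
        case True
        then show ?thesis using affn_segment_le(1)[OF affn_ori True, of v] vpq by (auto simp: closed_segment_commute)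
      next
        case False
        then have le: "?y (rp q) \<le> ?y (rp p)" by simp
        then show ?thesis using affn_segment_le(1)[OF affn_ori le vpq] by auto
      qed
      then obtain e where e: "e \<in> {p, q}" "?y v \<le> ?y (rp e)" by blast
      have eL: "e \<in> Lam0 vs" using e pq by blast
      \<comment> \<open>Below the row, the edge is followed upwards: the end has positive, hence
        integral height at least 1, so the row or one of the lines is met before.\<close>
      have "?y (rp e) \<ge> 1" using int1[of e] e g by simp
      then have "\<not> (DL (rp e) > 0 \<and> DR (rp e) > 0 \<and> (-1) * ?y (rp e) + 1/2 > 0)" by simp
      moreover have "(-1) * ?y v + 1/2 > 0" using 3 by simp
      ultimately obtain x where x: "x \<in> open_segment v (rp e) \<or> x = rp e" "DL x \<ge> 0" "DR x \<ge> 0" "(-1) * ?y x + 1/2 \<ge> 0"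
        "DL x = 0 \<or> DR x = 0 \<or> (-1) * ?y x + 1/2 = 0"
        using exit_cell[OF AL AR Ay g(3,4)] by blast
      have "x \<in> closed_segment (rp e) v" using x(1) segment_open_subset_closed by (auto simp: closed_segment_commute open_segment_commute)
      then have "?y v \<le> ?y x" using affn_segment_le(2)[OF affn_ori e(2)] by blast
      moreover have "x \<in> seg k \<or> x = rp e" using x(1) e(1) sub by blast
      moreover have "?y x < ?y (rp r)" using x(4) int1[OF r0(2)] by simp
      ultimately show False using bad[of x e] eL x g by auto
    qed
  qed
  have convG: "convex G"
  proof (rule convexI)
    fix x y s t assume *: "x \<in> G" "y \<in> G" "(0::real) \<le> s" "0 \<le> t" "s + t = 1"
    have s: "s = 1 - t" using * by simp
    have pos: "D (s *\<^sub>R x + t *\<^sub>R y) > 0" if "affn D" "D x > 0" "D y > 0" for D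
    proof (cases "t = 0 \<or> t = 1")
      case True then show ?thesis using s that by auto
    next
      case False
      then have "(1-t) * D x > 0" "t * D y > 0" using that * s by auto
      then show ?thesis unfolding s affn_convex_comb[OF that(1)] by linarith
    qed
    have "affn (\<lambda>x. (-1) * ?y x + ?y (rp r))" by (rule affn_add[OF affn_cmult[OF affn_ori] affn_const])
    from pos[OF this] pos[OF AL] pos[OF AR] pos[OF affn_ori, of "rp a" "rp b"] *(1,2)
    show "s *\<^sub>R x + t *\<^sub>R y \<in> G" unfolding G_def by auto
  qed
  have wG: "w \<in> G" unfolding G_def using w wpos int1[OF r0(2)] by auto
  have GK: "G \<inter> skel = {}" using noK by blast
  have Greg: "G \<subseteq> region vs" using free_region(1)[OF convex_connected[OF convG] GK wG wr(1)] .
  have abL: "DL (rp a) \<ge> 0" "DL (rp b) \<ge> 0" using L3[OF DL_def wpos(1)] by auto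
  have abR: "DR (rp a) \<ge> 0" "DR (rp b) \<ge> 0" using R3[OF DR_def wpos(2)] by auto
  have side: "{e, r} \<in> \<sigma>" if e: "e \<in> {a, b}" for e
  proof -
    have ye: "?y (rp e) = 0" using e by auto
    have eL: "e \<in> Lam0 vs" using e edge_ends[OF ab] by blast
    have enr: "e \<noteq> r" using ye r0 by auto
    have De: "DL (rp e) \<ge> 0" "DR (rp e) \<ge> 0" using e abL abR by auto
    \<comment> \<open>If \<open>e\<close> and \<open>r\<close> lie on the line of \<open>kL\<close>
      or of \<open>kR\<close>, the wanted side is that edge itself. Otherwise the open segment runs
      inside \<open>G\<close>, and maximality makes it an edge.\<close>
    consider "DL (rp e) = 0" "DL (rp r) = 0" | "DR (rp e) = 0" "DR (rp r) = 0" |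
      "DL (rp e) > 0 \<or> DL (rp r) > 0" "DR (rp e) > 0 \<or> DR (rp r) > 0" using De r0 by linarith
    then show ?thesis
    proof cases
      case 1
      have "rp e \<in> seg kL \<or> rp e = rp loL \<or> rp e = rp hiL" using zL[of "rp e"] 1 ye L by linarith
      then have "e = loL" using edge_lattice_free[OF kL(1)] rp_inj ye L by auto
      moreover have "rp r \<in> seg kL \<or> rp r = rp loL \<or> rp r = rp hiL" using zL[of "rp r"] 1 r0 rhi by linarith
      then have "r = hiL" using edge_lattice_free[OF kL(1)] rp_inj r0 L by auto
      ultimately show ?thesis using kL(1) L by simp
    next
      case 2
      have "rp e \<in> seg kR \<or> rp e = rp loR \<or> rp e = rp hiR" using zR[of "rp e"] 2 ye R by linarith
      then have "e = loR" using edge_lattice_free[OF kR(1)] rp_inj ye R by auto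
      moreover have "rp r \<in> seg kR \<or> rp r = rp loR \<or> rp r = rp hiR" using zR[of "rp r"] 2 r0 rhi by linarith
      then have "r = hiR" using edge_lattice_free[OF kR(1)] rp_inj r0 R by auto
      ultimately show ?thesis using kR(1) R by simp
    next
      case 3
      have Ay: "affn (\<lambda>x. (-1) * ?y x + ?y (rp r))" by (rule affn_add[OF affn_cmult[OF affn_ori] affn_const])
      have sub: "open_segment (rp e) (rp r) \<subseteq> G"
      proof
        fix x assume x: "x \<in> open_segment (rp e) (rp r)"
        have "DL x > 0" by (rule affn_open_segment_pos[OF AL De(1) r0(3) 3(1) x])
        moreover have "DR x > 0" by (rule affn_open_segment_pos[OF AR De(2) r0(4) 3(2) x])
        moreover have "?y x > 0" by (rule affn_open_segment_pos[OF affn_ori _ _ _ x]) (use ye r0 in auto)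
        moreover have "(-1) * ?y x + ?y (rp r) > 0" by (rule affn_open_segment_pos[OF Ay _ _ _ x]) (use ye r0 in auto)
        ultimately show "x \<in> G" unfolding G_def by auto
      qed
      show ?thesis
      proof (rule maximal_edge[OF enr eL r0(1)])
        show "open_segment (rp e) (rp r) \<subseteq> region vs" using sub Greg by blast
        show "open_segment (rp e) (rp r) \<inter> rp ` Lam0 vs = {}" using sub GK unfolding skel_def by blast
        show "open_segment (rp e) (rp r) \<inter> seg f = {}" if "f \<in> \<sigma>" for f
          using sub GK that unfolding skel_def by blast
      qed
    qed
  qed
  have o: "?y (rp r) \<noteq> 0" using r0 by simp
  have triG: "tri (rp a) (rp b) (rp r) \<subseteq> G"
  proof
    fix x assume x: "x \<in> tri (rp a) (rp b) (rp r)"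
    have b: "bar (rp a) (rp b) (rp r) x > 0" "bar (rp b) (rp r) (rp a) x > 0" "bar (rp r) (rp a) (rp b) x > 0"
      using x by (auto simp: tri_def)
    have m: "mid {a, b} \<in> seg {a, b}" by (rule mid_in_seg[OF anb])
    have e: "mid {a, b} = (1 - 1/2) *\<^sub>R rp a + (1/2) *\<^sub>R rp b"
      unfolding mid_pair[OF anb] by (simp add: algebra_simps)
    \<comment> \<open>Positivity at the midpoint of \<open>{a, b}\<close> ensures that the
      functional does not vanish at both ends; nonnegativity at the vertices then gives positivity
      throughout the open triangle.\<close>
    have pos: "D x > 0" if D: "affn D" "D (rp a) \<ge> 0" "D (rp b) \<ge> 0" "D (rp r) \<ge> 0" "D (mid {a, b}) > 0" for D
    proof -
      have "D (rp a) > 0 \<or> D (rp b) > 0" using D(5) unfolding e affn_convex_comb[OF D(1)] by auto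
      then have "bar (rp a) (rp b) (rp r) x * D (rp a) > 0 \<or> bar (rp b) (rp r) (rp a) x * D (rp b) > 0" using b by auto
      moreover have "bar (rp a) (rp b) (rp r) x * D (rp a) \<ge> 0" "bar (rp b) (rp r) (rp a) x * D (rp b) \<ge> 0"
        "bar (rp r) (rp a) (rp b) x * D (rp r) \<ge> 0" using D b by auto
      ultimately show ?thesis using affn_bar_decomp[OF D(1) o, of x] by linarith
    qed
    have "DL x > 0" using pos[OF AL abL r0(3)] L2[OF DL_def wpos(1) m] by simp
    moreover have "DR x > 0" using pos[OF AR abR r0(4)] R2[OF DR_def wpos(2) m] by simp
    moreover have yx: "?y x = bar (rp r) (rp a) (rp b) x * ?y (rp r)"
      using affn_bar_decomp[OF affn_ori o, of "rp a" "rp b" x] by simp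
    moreover have "bar (rp r) (rp a) (rp b) x < 1" using bar_sum[OF o, of x] b by linarith
    ultimately show "x \<in> G" unfolding G_def using b r0(2) by simp
  qed
  show ?thesis
    by (rule that[OF r0(1) side side r0(2)]) (use triG Greg GK in auto)
qed

text \<open>The point at height exactly 1/2 on the way from \<open>z\<close> to \<open>x\<close>
  reduces this to the previous lemma. The triangle found contains \<open>x\<close> because the free
  way cannot pass its sides, which are edges. The bound 1/2 is the least positive height of a
  half-lattice point.\<close>

lemma edge_triangle:
  assumes ab: "{a, b} \<in> \<sigma>" and z: "z \<in> seg {a, b}"
    and x: "x \<in> region vs" "x \<notin> skel" and free: "open_segment z x \<inter> skel = {}"
    and yx: "ori (rp a) (rp b) x \<ge> 1/2"
  obtains r where "r \<in> Lam0 vs" "{a, r} \<in> \<sigma>" "{b, r} \<in> \<sigma>" "ori (rp a) (rp b) (rp r) > 0"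
    "tri (rp a) (rp b) (rp r) \<subseteq> region vs" "tri (rp a) (rp b) (rp r) \<inter> skel = {}"
    "x \<in> tri (rp a) (rp b) (rp r)"
proof -
  let ?y = "ori (rp a) (rp b)"
  have anb: "a \<noteq> b" using edge_ends[OF ab] by simp
  have zc: "z \<in> closed_segment (rp a) (rp b)" using z seg_closed[OF anb] by blast
  have zo: "z \<in> open_segment (rp a) (rp b)" using z seg_pair[OF anb] by blast
  have yz: "?y z = 0" using zc by (rule ori_on_segment)
  have zx: "z \<noteq> x" using yz yx by auto
  define t where "t = 1 / (2 * ?y x)"
  have t: "0 < t" "t \<le> 1" using yx by (auto simp: t_def field_simps)
  define w where "w = (1 - t) *\<^sub>R z + t *\<^sub>R x"
  have "?y w = t * ?y x" unfolding w_def affn_convex_comb[OF affn_ori] using yz by simp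
  then have yw: "?y w = 1/2" using yx by (simp add: t_def)
  have wc: "w \<in> closed_segment z x" unfolding w_def in_segment using t by (intro exI[of _ t]) auto
  have wz: "w \<noteq> z" using yw yz by auto
  then have wo: "w \<in> open_segment z x \<or> w = x" using wc unfolding open_segment_def by blast
  have wK: "w \<notin> skel" using wo free x by blast
  have sub: "open_segment w z \<subseteq> open_segment z x"
    unfolding subset_open_segment using wc by simp
  have fr: "open_segment w z \<inter> skel = {}" using sub free by blast
  define C where "C = insert x (open_segment z x)"
  have sC: "connected C"
  proof (rule connected_intermediate_closure)
    show "connected (open_segment z x)" by (simp add: convex_connected)
    show "open_segment z x \<subseteq> C" unfolding C_def by blast
    show "C \<subseteq> closure (open_segment z x)" unfolding C_def using zx segment_open_subset_closed[of z x] by auto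
  qed
  have "C \<subseteq> region vs"
  proof (rule free_region(1)[OF sC])
    show "C \<inter> skel = {}" using free x unfolding C_def by blast
  qed (use x in \<open>auto simp: C_def\<close>)
  then have wr: "w \<in> region vs" using wo unfolding C_def by blast
  obtain r where r: "r \<in> Lam0 vs" "{a, r} \<in> \<sigma>" "{b, r} \<in> \<sigma>" "?y (rp r) > 0"
    "tri (rp a) (rp b) (rp r) \<subseteq> region vs" "tri (rp a) (rp b) (rp r) \<inter> skel = {}"
    by (rule edge_triangle_aux[OF ab z yw wr wK fr])
  have o: "ori (rp a) (rp b) (rp r) \<noteq> 0" using r(4) by simp
  have o2: "ori (rp b) (rp r) (rp a) \<noteq> 0" using o ori_cyc[where a="rp a" and b="rp b" and c="rp r"] by simp
  have bv: "bar (rp a) (rp b) (rp r) (rp a) = 1" "bar (rp a) (rp b) (rp r) (rp b) = 0"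
     "bar (rp b) (rp r) (rp a) (rp a) = 0" "bar (rp b) (rp r) (rp a) (rp b) = 1"
    using bar_vertex[OF o] bar_vertex[OF o2] by auto
  have zb: "bar (rp a) (rp b) (rp r) z > 0" "bar (rp b) (rp r) (rp a) z > 0"
    using affn_open_segment_pos[OF affn_bar _ _ _ zo, of "rp a" "rp b" "rp r"]
      affn_open_segment_pos[OF affn_bar _ _ _ zo, of "rp b" "rp r" "rp a"] bv by auto
  have xt: "x \<in> tri (rp a) (rp b) (rp r)"
  proof (rule ccontr)
    assume n: "x \<notin> tri (rp a) (rp b) (rp r)"
    have br: "bar (rp r) (rp a) (rp b) v = ?y v / ?y (rp r)" for v
      using bar_eq(3)[where a="rp a" and b="rp b" and c="rp r"] .
    have bx: "bar (rp r) (rp a) (rp b) x > 0" unfolding br using yx r(4) by simp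
    \<comment> \<open>The third coordinate is positive at \<open>x\<close>, so a failure must come
      from one of the other two; exiting the cell cut out by those two would put a point of the free
      way on a side of the triangle.\<close>
    then have "\<not> (bar (rp a) (rp b) (rp r) x > 0 \<and> bar (rp b) (rp r) (rp a) x > 0 \<and> bar (rp b) (rp r) (rp a) x > 0)"
      using n by (auto simp: tri_def)
    from exit_cell[OF affn_bar affn_bar affn_bar zb(1) zb(2) zb(2) this]
    obtain v where v: "v \<in> open_segment z x \<or> v = x" "bar (rp a) (rp b) (rp r) v \<ge> 0" "bar (rp b) (rp r) (rp a) v \<ge> 0"
      "bar (rp a) (rp b) (rp r) v = 0 \<or> bar (rp b) (rp r) (rp a) v = 0" by blast
    have yv: "?y v > 0"
    proof (cases "v = x")
      case False
      then have "v \<in> open_segment z x" using v by blast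
      then show ?thesis using affn_open_segment_pos[OF affn_ori, of "rp a" "rp b" z x v] yz yx by auto
    qed (use yx in simp)
    then have "bar (rp r) (rp a) (rp b) v > 0" unfolding br using r(4) by simp
    then have "v \<in> ctri (rp a) (rp b) (rp r)" "v \<notin> tri (rp a) (rp b) (rp r)"
      using v by (auto simp: ctri_def tri_def)
    from ctri_cases[OF o this] consider "v \<in> open_segment (rp a) (rp b)" | "v \<in> open_segment (rp b) (rp r)" |
      "v \<in> open_segment (rp a) (rp r)" | "v \<in> {rp a, rp b, rp r}" by blast
    then have "v \<in> skel"
    proof cases
      case 1
      then show ?thesis using ab seg_pair[OF anb] unfolding skel_def by blast
    next
      case 2
      then show ?thesis using r(3) edge_ends[OF r(3)] seg_pair unfolding skel_def by blast
    next
      case 3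
      then show ?thesis using r(2) edge_ends[OF r(2)] seg_pair unfolding skel_def by blast
    next
      case 4
      then show ?thesis using edge_ends[OF r(2)] edge_ends[OF r(3)] unfolding skel_def by blast
    qed
    then show False using v(1) free x by blast
  qed
  show ?thesis by (rule that[OF r xt])
qed

text \<open>The emptiness hypothesis speaks of lattice points of the region only. Since the sides
  lie in the region, so does the triangle, and emptiness extends to all lattice points.\<close>

lemma edges_empty_triangle:
  assumes o: "ori (rp a) (rp b) (rp r) \<noteq> 0"
    and s: "{a, b} \<in> \<sigma>" "{b, r} \<in> \<sigma>" "{a, r} \<in> \<sigma>"
    and e: "\<And>p. p \<in> Lam0 vs \<Longrightarrow> rp p \<notin> tri (rp a) (rp b) (rp r)"
  shows "\<bar>iori a b r\<bar> = 1" "tri (rp a) (rp b) (rp r) \<subseteq> region vs"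
proof -
  have ne: "a \<noteq> b" "b \<noteq> r" "a \<noteq> r" using s edge_ends by auto
  have cl: "closed_segment (rp c) (rp d) \<subseteq> region vs" if "{c, d} \<in> \<sigma>" for c d
  proof -
    have "c \<noteq> d" "c \<in> Lam0 vs" "d \<in> Lam0 vs" using edge_ends[OF that] by auto
    then show ?thesis using edge_in_region[OF that] seg_pair[of c d] unfolding closed_segment_eq_open Lam0_def by auto
  qed
  show tr: "tri (rp a) (rp b) (rp r) \<subseteq> region vs"
    by (rule tri_region[OF o cl[OF s(1)] cl[OF s(2)] cl[OF s(3)]])
  show "\<bar>iori a b r\<bar> = 1"
  proof (rule empty_triangle_unimodular)
    show "iori a b r \<noteq> 0" using o by (simp add: ori_rp)
    fix p assume p: "rp p \<in> ctri (rp a) (rp b) (rp r)"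
    have "rp p \<notin> tri (rp a) (rp b) (rp r)"
      using e[of p] tr unfolding Lam0_def by blast
    moreover have "rp p \<notin> open_segment (rp a) (rp b)" "rp p \<notin> open_segment (rp b) (rp r)" "rp p \<notin> open_segment (rp a) (rp r)"
      using edge_lattice_free s seg_pair ne by blast+
    ultimately have "rp p \<in> {rp a, rp b, rp r}" using ctri_cases[OF o p] by blast
    then show "p \<in> {a, b, r}" using rp_inj by blast
  qed
qed

text \<open>Reflecting the nearer end of the edge in an off-centre half-lattice point would produce
  a lattice point inside the open edge, at parameter 2 t or 2 t - 1.\<close>

lemma half_lattice_midpoint:
  assumes e: "e \<in> \<sigma>" and x: "(1/2) *\<^sub>R (rp p + rp q) \<in> seg e"
  shows "mid e = (1/2) *\<^sub>R (rp p + rp q)"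
proof -
  obtain a b where ab: "a \<noteq> b" "e = {a, b}" "a \<in> Lam0 vs" "b \<in> Lam0 vs" by (rule edgeE[OF e])
  have nab: "rp a \<noteq> rp b" using ab rp_inj by blast
  obtain t where t: "0 < t" "t < 1" "(1/2) *\<^sub>R (rp p + rp q) = (1 - t) *\<^sub>R rp a + t *\<^sub>R rp b"
    using x unfolding ab(2) seg_pair[OF ab(1)] in_segment by blast
  have pq: "rp p + rp q = (2 * (1 - t)) *\<^sub>R rp a + (2 * t) *\<^sub>R rp b"
  proof -
    have "rp p + rp q = 2 *\<^sub>R ((1/2) *\<^sub>R (rp p + rp q))" by simp
    also have "\<dots> = (2 * (1 - t)) *\<^sub>R rp a + (2 * t) *\<^sub>R rp b" unfolding t(3) by (simp add: scaleR_add_right)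
    finally show ?thesis .
  qed
  have lat: "rp (p + q - c) = rp p + rp q - rp c" for c by (simp add: rp_def)
  have no: "rp c \<notin> open_segment (rp a) (rp b)" for c
    using edge_lattice_free[OF e] unfolding ab(2) seg_pair[OF ab(1)] by blast
  have "t = 1/2"
  proof (rule ccontr)
    assume n: "t \<noteq> 1/2"
    show False
    proof (cases "t < 1/2")
      case True
      have "rp (p + q - a) = (1 - 2 * t) *\<^sub>R rp a + (2 * t) *\<^sub>R rp b"
        unfolding lat pq by (simp add: algebra_simps scaleR_2)
      then have "rp (p + q - a) \<in> open_segment (rp a) (rp b)"
        unfolding in_segment using True t nab by (intro conjI exI[of _ "2 * t"]) auto
      then show False using no by blast
    next
      case False
      have "rp (p + q - b) = (1 - (2 * t - 1)) *\<^sub>R rp a + (2 * t - 1) *\<^sub>R rp b"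
        unfolding lat pq by (simp add: algebra_simps scaleR_2)
      then have "rp (p + q - b) \<in> open_segment (rp a) (rp b)"
        unfolding in_segment using False n t nab by (intro conjI exI[of _ "2 * t - 1"]) auto
      then show False using no by blast
    qed
  qed
  then have th: "t = 1/2" .
  show ?thesis unfolding t(3) ab(2) mid_pair[OF ab(1)] th by (simp add: scaleR_add_right)
qed

text \<open>If no edge of the triangulation had the given midpoint, the first edge met on the way along the
  admissible edge would bound an empty triangle containing a half-lattice point in its interior.\<close>

lemma edge_exists:
  assumes h: "admissible vs h" shows "\<exists>e\<in>\<sigma>. mid e = mid h"
proof (rule ccontr)
  assume no: "\<not> (\<exists>e\<in>\<sigma>. mid e = mid h)"
  obtain p q where pq: "p \<noteq> q" "h = {p, q}" "p \<in> Lam0 vs" "q \<in> Lam0 vs" by (rule admissibleE[OF h])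
  define x where "x = mid h"
  have xe: "x = (1/2) *\<^sub>R (rp p + rp q)" unfolding x_def pq(2) by (rule mid_pair[OF pq(1)])
  have xs: "x \<in> seg h" unfolding x_def pq(2) by (rule mid_in_seg[OF pq(1)])
  have hs: "seg h = open_segment (rp p) (rp q)" using seg_pair[OF pq(1)] pq(2) by simp
  have xr: "x \<in> region vs" using xs h unfolding admissible_def by blast
  have xK: "x \<notin> skel"
  proof
    assume "x \<in> skel"
    then obtain e where "e \<in> \<sigma>" "x \<in> seg e"
      using admissible_lattice_free[OF h] xs unfolding skel_def by blast
    then have "mid e = mid h" using half_lattice_midpoint[of e p q] xe x_def by metis
    then show False using no \<open>e \<in> \<sigma>\<close> by blast
  qed
  have "\<exists>v. v \<in> seg h \<and> v \<in> skel"
  proof (rule ccontr)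
    assume n: "\<not> ?thesis"
    have "{p, q} \<in> \<sigma>"
    proof (rule maximal_edge[OF pq(1,3,4)])
      show "open_segment (rp p) (rp q) \<subseteq> region vs" using h hs unfolding admissible_def by blast
      show "open_segment (rp p) (rp q) \<inter> rp ` Lam0 vs = {}" using n hs unfolding skel_def by blast
      show "open_segment (rp p) (rp q) \<inter> seg f = {}" if "f \<in> \<sigma>" for f using n hs that unfolding skel_def by blast
    qed
    then show False using no pq(2) by blast
  qed
  then obtain v where v: "v \<in> seg h" "v \<in> skel" by blast
  define dd where "dd = v - x"
  have d0: "dd \<noteq> 0" using v xK unfolding dd_def by auto
  obtain s where s: "s > 0" "x + s *\<^sub>R dd \<in> skel" "\<And>s'. 0 \<le> s' \<Longrightarrow> s' < s \<Longrightarrow> x + s' *\<^sub>R dd \<notin> skel"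
    by (rule first_hit[OF xr xK d0], rule that)
  have s1: "s \<le> 1" using s(3)[of 1] v(2) unfolding dd_def by force
  define z where "z = x + s *\<^sub>R dd"
  have "z = (1 - s) *\<^sub>R x + s *\<^sub>R v" unfolding z_def dd_def by (simp add: algebra_simps)
  then have "z \<in> closed_segment x v" unfolding in_segment using s s1 by (intro exI[of _ s]) auto
  moreover have "closed_segment x v \<subseteq> seg h" using xs v(1) unfolding hs by (intro closed_segment_subset) auto
  ultimately have zh: "z \<in> seg h" by blast
  have fr: "open_segment z x \<inter> skel = {}"
  proof -
    have "c \<notin> skel" if c: "c \<in> open_segment x z" for c
    proof -
      obtain t where t: "0 < t" "t < 1" "c = (1 - t) *\<^sub>R x + t *\<^sub>R z" using c unfolding in_segment by blast
      have "c = x + (t * s) *\<^sub>R dd" unfolding t(3) z_def by (simp add: algebra_simps)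
      moreover have "t * s < s" "0 \<le> t * s" using t s(1) by auto
      ultimately show ?thesis using s(3) by blast
    qed
    then show ?thesis by (auto simp: open_segment_commute)
  qed
  obtain e where e: "e \<in> \<sigma>" "z \<in> seg e"
    using s(2) zh admissible_lattice_free[OF h] unfolding skel_def z_def[symmetric] by blast
  obtain a0 b0 where ab0: "a0 \<noteq> b0" "e = {a0, b0}" "a0 \<in> Lam0 vs" "b0 \<in> Lam0 vs" by (rule edgeE[OF e(1)])
  \<comment> \<open>Were \<open>x\<close> on the line of \<open>e\<close>, the way from
    \<open>z\<close> to \<open>x\<close> would pass through an end of \<open>e\<close>, which is a
    point of the skeleton.\<close>
  have y0: "ori (rp a0) (rp b0) x \<noteq> 0"
  proof
    assume o: "ori (rp a0) (rp b0) x = 0"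
    have zo: "z \<in> open_segment (rp a0) (rp b0)" using e(2) unfolding ab0(2) seg_pair[OF ab0(1)] .
    have K: "rp a0 \<in> skel" "rp b0 \<in> skel" using ab0 unfolding skel_def by auto
    have "x \<notin> open_segment (rp a0) (rp b0)"
      using xK e(1) seg_pair[OF ab0(1)] ab0(2) unfolding skel_def by blast
    from line_exit[OF zo o this] show False using K fr xK by auto
  qed
  have "\<exists>a b. e = {a, b} \<and> a \<noteq> b \<and> ori (rp a) (rp b) x > 0"
  proof (cases "ori (rp a0) (rp b0) x > 0")
    case True then show ?thesis using ab0 by blast
  next
    case False
    then have "ori (rp b0) (rp a0) x > 0" using y0 ori_swap[of "rp b0" "rp a0" x] by simp
    then show ?thesis using ab0 by blast
  qed
  then obtain a b where ab: "e = {a, b}" "a \<noteq> b" "ori (rp a) (rp b) x > 0" by blast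
  \<comment> \<open>Twice the height of a half-lattice point is an integer, so a positive height is
    at least 1/2, as \<open>edge_triangle\<close> requires.\<close>
  have "2 * ori (rp a) (rp b) x = ori (rp a) (rp b) (rp p) + ori (rp a) (rp b) (rp q)"
    unfolding xe by (simp add: ori_def field_simps)
  then have i: "2 * ori (rp a) (rp b) x = of_int (iori a b p + iori a b q)" by (simp add: ori_rp)
  then have "iori a b p + iori a b q \<ge> 1" using ab(3) by linarith
  then have yx: "ori (rp a) (rp b) x \<ge> 1/2" using i by linarith
  have abs: "{a, b} \<in> \<sigma>" and zab: "z \<in> seg {a, b}" using e ab by auto
  obtain r where r: "r \<in> Lam0 vs" "{a, r} \<in> \<sigma>" "{b, r} \<in> \<sigma>" "ori (rp a) (rp b) (rp r) > 0"
    "tri (rp a) (rp b) (rp r) \<subseteq> region vs" "tri (rp a) (rp b) (rp r) \<inter> skel = {}"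
    "x \<in> tri (rp a) (rp b) (rp r)"
    by (rule edge_triangle[OF abs zab xr xK fr yx])
  have o: "ori (rp a) (rp b) (rp r) \<noteq> 0" using r(4) by simp
  have "\<bar>iori a b r\<bar> = 1"
    by (rule edges_empty_triangle(1)[OF o abs r(3) r(2)]) (use r(6) in \<open>auto simp: skel_def\<close>)
  then show False using half_lattice_notin_unimodular_tri[of a b r p q] r(7) xe by blast
qed

end

section \<open>Flips\<close>

lemma collinear_ori: "collinear {a, b, c} \<longleftrightarrow> ori a b c = 0"
proof
  assume "collinear {a, b, c}"
  then obtain u where u: "\<And>x y. x \<in> {a, b, c} \<Longrightarrow> y \<in> {a, b, c} \<Longrightarrow> \<exists>k. x - y = k *\<^sub>R u"
    unfolding collinear_def by blast
  obtain k l where "b - a = k *\<^sub>R u" "c - a = l *\<^sub>R u" using u[of b a] u[of c a] by auto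
  then have "b = a + k *\<^sub>R u" "c = a + l *\<^sub>R u" by (metis add.commute diff_add_cancel)+
  then show "ori a b c = 0" by (simp add: ori_def algebra_simps)
next
  assume o: "ori a b c = 0"
  show "collinear {a, b, c}"
  proof (cases "a = b")
    case True then show ?thesis by (simp add: collinear_2)
  next
    case False
    obtain t where t: "c = (1 - t) *\<^sub>R a + t *\<^sub>R b" by (rule collinear_param[OF o False])
    have "\<exists>k. a - b = k *\<^sub>R (b - a)" "\<exists>k. b - a = k *\<^sub>R (b - a)"
      "\<exists>k. a - c = k *\<^sub>R (b - a)" "\<exists>k. c - a = k *\<^sub>R (b - a)"
      "\<exists>k. b - c = k *\<^sub>R (b - a)" "\<exists>k. c - b = k *\<^sub>R (b - a)" "\<And>x. \<exists>k. x - x = k *\<^sub>R (b - a)"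
    proof -
      show "\<exists>k. a - b = k *\<^sub>R (b - a)" by (rule exI[of _ "-1"]) simp
      show "\<exists>k. b - a = k *\<^sub>R (b - a)" by (rule exI[of _ 1]) simp
      show "\<exists>k. a - c = k *\<^sub>R (b - a)" by (rule exI[of _ "-t"]) (simp add: t algebra_simps)
      show "\<exists>k. c - a = k *\<^sub>R (b - a)" by (rule exI[of _ t]) (simp add: t algebra_simps)
      show "\<exists>k. b - c = k *\<^sub>R (b - a)" by (rule exI[of _ "1-t"]) (simp add: t algebra_simps)
      show "\<exists>k. c - b = k *\<^sub>R (b - a)" by (rule exI[of _ "t-1"]) (simp add: t algebra_simps)
      show "\<exists>k. x - x = k *\<^sub>R (b - a)" for x by (rule exI[of _ 0]) simp
    qed
    then show ?thesis unfolding collinear_def by (intro exI[of _ "b - a"]) auto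
  qed
qed

lemma affn_hull_le:
  assumes "affn D" "\<And>p. p \<in> S \<Longrightarrow> D p \<le> 0" "z \<in> convex hull S" shows "D z \<le> 0"
proof -
  have "convex {z. D z \<le> 0}"
  proof (rule convexI)
    fix x y u v assume *: "x \<in> {z. D z \<le> 0}" "y \<in> {z. D z \<le> 0}" "(0::real) \<le> u" "0 \<le> v" "u + v = 1"
    have u: "u = 1 - v" using * by simp
    have "(1 - v) * D x \<le> 0" "v * D y \<le> 0" using * u by (auto simp: mult_nonneg_nonpos)
    then show "u *\<^sub>R x + v *\<^sub>R y \<in> {z. D z \<le> 0}" unfolding u mem_Collect_eq affn_convex_comb[OF assms(1)] by linarith
  qed
  then have "convex hull S \<subseteq> {z. D z \<le> 0}" using assms(2) by (intro hull_minimal) auto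
  then show ?thesis using assms(3) by blast
qed

lemma tri_not_side:
  assumes "z \<in> tri a b c"
  shows "z \<notin> closed_segment a b" "z \<notin> closed_segment b c" "z \<notin> closed_segment a c"
proof -
  have o: "ori a b c \<noteq> 0" "ori b c a \<noteq> 0" "ori c a b \<noteq> 0"
    using tri_ori[OF assms] ori_cyc[of b c a] ori_cyc[of a b c] by auto
  have b: "bar a b c z > 0" "bar b c a z > 0" "bar c a b z > 0" using assms by (auto simp: tri_def)
  show "z \<notin> closed_segment a b" using bar_side[OF o(1), of z] b by auto
  show "z \<notin> closed_segment b c" using bar_side[OF o(2), of z] b by auto
  show "z \<notin> closed_segment a c" using bar_side[OF o(3), of z] b by (auto simp: closed_segment_commute)
qed

lemma iori_swap: "iori b a c = - iori a b c" by (simp add: iori_def algebra_simps)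

lemma apexI:
  assumes "a \<noteq> b" "{a, c} \<in> \<sigma>" "{b, c} \<in> \<sigma>" "\<bar>iori a b c\<bar> = 1"
  shows "apex vs \<sigma> {a, b} c"
proof -
  have o: "ori (rp a) (rp b) (rp c) \<noteq> 0" using assms(4) by (auto simp: ori_rp)
  have "c \<noteq> a" "c \<noteq> b" using assms(4) by (auto simp: iori_def)
  moreover have "\<forall>p\<in>Lam0 vs. rp p \<in> convex hull {rp a, rp b, rp c} \<longrightarrow> p \<in> {a, b, c}"
    unfolding ctri_hull[OF o, symmetric] using unimodular_ctri_lattice[OF assms(4)] by blast
  ultimately show ?thesis unfolding apex_def collinear_ori using assms o by blast
qed

text \<open>The lattice parallelogram with diagonals \<open>{a, b}\<close> and
  \<open>{c, d}\<close>, expressed by equality of the diagonal sums. Only one half is required to be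
  unimodular; \<open>iori_opposite\<close> gives the other.\<close>

definition quad :: "edge set \<Rightarrow> lpt \<Rightarrow> lpt \<Rightarrow> lpt \<Rightarrow> lpt \<Rightarrow> bool" where
  "quad \<sigma> a b c d \<longleftrightarrow> a \<noteq> b \<and> c \<noteq> d \<and> c + d = a + b \<and> \<bar>iori a b c\<bar> = 1 \<and> {a, b} \<in> \<sigma> \<and>
     {a, c} \<in> \<sigma> \<and> {b, c} \<in> \<sigma> \<and> {a, d} \<in> \<sigma> \<and> {b, d} \<in> \<sigma>"

lemma iori_opposite: "c + d = a + b \<Longrightarrow> iori a b d = - iori a b c"
proof -
  assume "c + d = a + b"
  then have d: "d = a + b - c" by (simp add: algebra_simps)
  show ?thesis unfolding d by (simp add: iori_def algebra_simps)
qed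

lemma quad_sym: assumes "quad \<sigma> a b c d" shows "quad \<sigma> b a c d" "quad \<sigma> a b d c"
  using assms iori_opposite[of c d a b] iori_swap[of b a c]
  unfolding quad_def by (auto simp: insert_commute add.commute)

lemma iori_diag: "c + d = a + b \<Longrightarrow> iori c d a = iori a b d"
proof -
  assume "c + d = a + b"
  then have d: "d = a + b - c" by (simp add: algebra_simps)
  show ?thesis unfolding d by (simp add: iori_def algebra_simps)
qed

lemma rp_add: "rp (a + b) = rp a + rp b" by (simp add: rp_def)

lemma quad_bars:
  assumes "c + d = a + b" "\<bar>iori a b c\<bar> = 1"
  shows "bar (rp a) (rp b) (rp c) (rp d) = 1" "bar (rp b) (rp c) (rp a) (rp d) = 1" "bar (rp c) (rp a) (rp b) (rp d) = -1"
proof -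
  have d: "d = a + b - c" using assms by (simp add: algebra_simps)
  have i: "iori a b c \<noteq> 0" using assms by auto
  have "iori b c d = iori a b c" "iori c a d = iori a b c" "iori a b d = - iori a b c"
    unfolding d by (simp_all add: iori_def algebra_simps)
  then show "bar (rp a) (rp b) (rp c) (rp d) = 1" "bar (rp b) (rp c) (rp a) (rp d) = 1" "bar (rp c) (rp a) (rp b) (rp d) = -1"
    unfolding bar_eq[where a="rp a" and b="rp b" and c="rp c"] ori_rp using i by simp_all
qed

lemma quad_vertex_bars:
  assumes "\<bar>iori a b c\<bar> = 1"
  shows "bar (rp a) (rp b) (rp c) (rp a) = 1" "bar (rp b) (rp c) (rp a) (rp a) = 0" "bar (rp c) (rp a) (rp b) (rp a) = 0"
    "bar (rp a) (rp b) (rp c) (rp b) = 0" "bar (rp b) (rp c) (rp a) (rp b) = 1" "bar (rp c) (rp a) (rp b) (rp b) = 0"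
    "bar (rp a) (rp b) (rp c) (rp c) = 0" "bar (rp b) (rp c) (rp a) (rp c) = 0" "bar (rp c) (rp a) (rp b) (rp c) = 1"
proof -
  have o: "ori (rp a) (rp b) (rp c) \<noteq> 0" using assms by (auto simp: ori_rp)
  have o2: "ori (rp b) (rp c) (rp a) \<noteq> 0" "ori (rp c) (rp a) (rp b) \<noteq> 0" using o ori_cyc by metis+
  show "bar (rp a) (rp b) (rp c) (rp a) = 1" "bar (rp b) (rp c) (rp a) (rp a) = 0" "bar (rp c) (rp a) (rp b) (rp a) = 0"
    "bar (rp a) (rp b) (rp c) (rp b) = 0" "bar (rp b) (rp c) (rp a) (rp b) = 1" "bar (rp c) (rp a) (rp b) (rp b) = 0"
    "bar (rp a) (rp b) (rp c) (rp c) = 0" "bar (rp b) (rp c) (rp a) (rp c) = 0" "bar (rp c) (rp a) (rp b) (rp c) = 1"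
    using bar_vertex[OF o] bar_vertex[OF o2(1)] bar_vertex[OF o2(2)] by auto
qed

lemma mid_parallelogram: "c \<noteq> d \<Longrightarrow> a \<noteq> b \<Longrightarrow> c + d = a + b \<Longrightarrow> mid {c, d} = mid {a, b}"
  by (simp add: mid_pair rp_add[symmetric])

text \<open>A point of the second diagonal with parameter t has coordinates t, t, 1 - 2 t in the
  first half triangle; the case t = 1/2 is the common midpoint.\<close>

lemma diagonal_cases:
  assumes cd: "c + d = a + b" and u: "\<bar>iori a b c\<bar> = 1" and n: "a \<noteq> b" and v: "v \<in> open_segment (rp c) (rp d)"
  shows "v \<in> tri (rp a) (rp b) (rp c) \<or> v = mid {a, b} \<or> v \<in> tri (rp a) (rp b) (rp d)"
proof -
  obtain t where t: "0 < t" "t < 1" "v = (1 - t) *\<^sub>R rp c + t *\<^sub>R rp d"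
    using v unfolding in_segment by blast
  have b: "bar (rp a) (rp b) (rp c) v = t" "bar (rp b) (rp c) (rp a) v = t" "bar (rp c) (rp a) (rp b) v = 1 - 2 * t"
    unfolding t(3) affn_convex_comb[OF affn_bar] quad_bars[OF cd u] quad_vertex_bars[OF u] by simp_all
  have cd': "d + c = a + b" using cd by (simp add: add.commute)
  have u': "\<bar>iori a b d\<bar> = 1" using u iori_opposite[OF cd] by simp
  have b': "bar (rp a) (rp b) (rp d) v = 1 - t" "bar (rp b) (rp d) (rp a) v = 1 - t" "bar (rp d) (rp a) (rp b) v = 2 * t - 1"
    unfolding t(3) affn_convex_comb[OF affn_bar] quad_bars[OF cd' u'] quad_vertex_bars[OF u'] by simp_all
  consider "t < 1/2" | "t = 1/2" | "t > 1/2" by linarith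
  then show ?thesis
  proof cases
    case 1 then show ?thesis using b t by (simp add: tri_def)
  next
    case 2
    have "v = (1/2) *\<^sub>R (rp c + rp d)" unfolding t(3) 2 by (simp add: scaleR_add_right)
    then show ?thesis unfolding mid_pair[OF n] using cd by (simp add: rp_add[symmetric])
  next
    case 3 then show ?thesis using b' t by (simp add: tri_def)
  qed
qed

text \<open>Equal heights make the difference parallel to \<open>b - a\<close>, and a determinant of
  1 or -1 keeps the multiplier integral.\<close>

lemma same_side_shift:
  assumes i: "iori a b c = iori a b c'" and u: "\<bar>iori a b c\<bar> = 1"
  obtains k where "fst c' = fst c + k * (fst b - fst a)" "snd c' = snd c + k * (snd b - snd a)"
proof -
  define u1 u2 w1 w2 v1 v2 where "u1 = fst b - fst a" and "u2 = snd b - snd a" and "w1 = fst c - fst a"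
    and "w2 = snd c - snd a" and "v1 = fst c' - fst c" and "v2 = snd c' - snd c"
  define k where "k = iori a b c * (v1 * w2 - v2 * w1)"
  have D: "iori a b c = u1 * w2 - u2 * w1" by (simp add: iori_def u1_def u2_def w1_def w2_def)
  have z: "u1 * v2 - u2 * v1 = 0" using i by (simp add: iori_def u1_def u2_def v1_def v2_def algebra_simps)
  have sq: "iori a b c * iori a b c = 1" using u by (metis abs_mult_self_eq mult_1)
  have "(u1 * w2 - u2 * w1) * v1 = (v1 * w2 - v2 * w1) * u1 + (u1 * v2 - u2 * v1) * w1"
    "(u1 * w2 - u2 * w1) * v2 = (v1 * w2 - v2 * w1) * u2 + (u1 * v2 - u2 * v1) * w2" by algebra+
  then have e: "iori a b c * v1 = (v1 * w2 - v2 * w1) * u1" "iori a b c * v2 = (v1 * w2 - v2 * w1) * u2"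
    unfolding D z by simp_all
  have "v1 = iori a b c * (iori a b c * v1)" "v2 = iori a b c * (iori a b c * v2)"
    by (simp_all add: mult.assoc[symmetric] sq)
  then have v: "v1 = k * u1" "v2 = k * u2" unfolding e k_def by simp_all
  show ?thesis
  proof (rule that)
    show "fst c' = fst c + k * (fst b - fst a)" "snd c' = snd c + k * (snd b - snd a)"
      using v by (auto simp: v1_def v2_def u1_def u2_def)
  qed
qed

section \<open>Apexes, triangles free of edges, and the edge at a midpoint\<close>

context triangulated
begin

lemma apexD:
  assumes "apex vs \<sigma> {a, b} c" "{a, b} \<in> \<sigma>"
  shows "{a, c} \<in> \<sigma>" "{b, c} \<in> \<sigma>" "\<bar>iori a b c\<bar> = 1"
proof -
  have *: "{p, c} \<in> \<sigma> \<and> {q, c} \<in> \<sigma> \<and> \<bar>iori p q c\<bar> = 1"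
    if p: "{a, b} = {p, q}" "p \<noteq> q" "c \<notin> {a, b}" "{p, c} \<in> \<sigma>" "{q, c} \<in> \<sigma>" "\<not> collinear {rp p, rp q, rp c}"
    "\<forall>r\<in>Lam0 vs. rp r \<in> convex hull {rp p, rp q, rp c} \<longrightarrow> r \<in> {p, q, c}" for p q
  proof -
    have o: "ori (rp p) (rp q) (rp c) \<noteq> 0" using p(6) by (simp add: collinear_ori)
    have "rp r \<notin> tri (rp p) (rp q) (rp c)" if r: "r \<in> Lam0 vs" for r
    proof
      assume t: "rp r \<in> tri (rp p) (rp q) (rp c)"
      then have "rp r \<in> convex hull {rp p, rp q, rp c}" using tri_subset_ctri ctri_hull[OF o] by blast
      then have "rp r \<in> {rp p, rp q, rp c}" using p(7) r by blast
      then show False using tri_not_side[OF t] by auto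
    qed
    moreover have "{p, q} \<in> \<sigma>" using assms(2) p(1) by simp
    ultimately show ?thesis using edges_empty_triangle(1)[OF o] p(4,5) by blast
  qed
  obtain p q where p: "{a, b} = {p, q}" "p \<noteq> q" "c \<notin> {a, b}" "{p, c} \<in> \<sigma>" "{q, c} \<in> \<sigma>" "\<not> collinear {rp p, rp q, rp c}"
    "\<forall>r\<in>Lam0 vs. rp r \<in> convex hull {rp p, rp q, rp c} \<longrightarrow> r \<in> {p, q, c}"
    using assms(1) unfolding apex_def by blast
  have k: "{p, c} \<in> \<sigma> \<and> {q, c} \<in> \<sigma> \<and> \<bar>iori p q c\<bar> = 1" by (rule *[OF p])
  have "p = a \<and> q = b \<or> p = b \<and> q = a" using p(1) by (auto simp: doubleton_eq_iff)
  then show "{a, c} \<in> \<sigma>" "{b, c} \<in> \<sigma>" "\<bar>iori a b c\<bar> = 1"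
    using k iori_swap[of a b c] by auto
qed

text \<open>With \<open>c'\<close> shifted from \<open>c\<close> by k times \<open>b - a\<close>,
  the edges \<open>{a, c'}\<close> and \<open>{b, c}\<close> are the diagonals of a trapezoid and
  cross at parameter 1 / (k + 1).\<close>

lemma apex_same_side_aux:
  assumes e: "{a, c'} \<in> \<sigma>" "{b, c} \<in> \<sigma>" and ab: "a \<noteq> b" and i: "iori a b c \<noteq> 0"
    and c': "fst c' = fst c + k * (fst b - fst a)" "snd c' = snd c + k * (snd b - snd a)" and k: "k \<ge> 1"
  shows False
proof -
  define s where "s = 1 / (real_of_int k + 1)"
  have s: "0 < s" "s < 1" "s * k = 1 - s" using k by (auto simp: s_def field_simps)
  define v where "v = (1 - s) *\<^sub>R rp a + s *\<^sub>R rp c'"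
  have sk: "s * (real_of_int k * y) = (1 - s) * y" for y by (simp only: mult.assoc[symmetric] s(3))
  have comp: "(1 - s) * x + s * (z + real_of_int k * (y - x)) = (1 - s) * y + s * z" for x y z
    unfolding distrib_left[of s z] sk by (simp add: algebra_simps)
  have v: "v = (1 - s) *\<^sub>R rp b + s *\<^sub>R rp c"
    unfolding v_def using comp[of "fst a" "fst c" "fst b"] comp[of "snd a" "snd c" "snd b"] by (simp add: rp_def c' prod_eq_iff)
  have ne: "a \<noteq> c'" "b \<noteq> c" using edge_ends e by auto
  then have "rp a \<noteq> rp c'" "rp b \<noteq> rp c" using rp_inj by auto
  then have "v \<in> seg {a, c'}" "v \<in> seg {b, c}"
    unfolding seg_pair[OF ne(1)] seg_pair[OF ne(2)] in_segment using s v v_def by blast+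
  then have "{a, c'} = {b, c}" using edges_disjoint e by blast
  then have "a = c" using ab by (auto simp: doubleton_eq_iff)
  then show False using i by (simp add: iori_def)
qed

lemma apex_unique:
  assumes e: "{a, b} \<in> \<sigma>" and c: "apex vs \<sigma> {a, b} c" "apex vs \<sigma> {a, b} c'" and i: "iori a b c = iori a b c'"
  shows "c = c'"
proof -
  have ab: "a \<noteq> b" using edge_ends[OF e] by simp
  note d = apexD[OF c(1) e] and d' = apexD[OF c(2) e]
  obtain k where f: "fst c' = fst c + k * (fst b - fst a)" "snd c' = snd c + k * (snd b - snd a)"
    by (rule same_side_shift[OF i d(3)])
  then have f': "fst c = fst c' + (- k) * (fst b - fst a)" "snd c = snd c' + (- k) * (snd b - snd a)" by simp_all
  have i0: "iori a b c \<noteq> 0" "iori a b c' \<noteq> 0" using d(3) d'(3) by auto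
  consider "k = 0" | "k \<ge> 1" | "- k \<ge> 1" by linarith
  then show ?thesis
  proof cases
    case 1 then show ?thesis using f by (simp add: prod_eq_iff)
  next
    case 2 then show ?thesis using apex_same_side_aux[OF d'(1) d(2) ab i0(1) f] by blast
  next
    case 3 then show ?thesis using apex_same_side_aux[OF d(1) d'(2) ab i0(2) f'] by blast
  qed
qed

text \<open>An edge entering the triangle can be followed to both its ends. Disjointness of edges
  forces each exit to be at a vertex, so the edge would be one of the sides, and these miss the open
  triangle.\<close>

lemma triangle_free:
  assumes s: "{a, b} \<in> \<sigma>" "{a, c} \<in> \<sigma>" "{b, c} \<in> \<sigma>" and u: "\<bar>iori a b c\<bar> = 1" and f: "f \<in> \<sigma>"
  shows "seg f \<inter> tri (rp a) (rp b) (rp c) = {}"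
proof (rule ccontr)
  assume "\<not> ?thesis"
  then obtain v where v: "v \<in> seg f" "v \<in> tri (rp a) (rp b) (rp c)" by blast
  have ne: "a \<noteq> b" "a \<noteq> c" "b \<noteq> c" using s edge_ends by auto
  obtain p q where pq: "p \<noteq> q" "f = {p, q}" "p \<in> Lam0 vs" "q \<in> Lam0 vs" by (rule edgeE[OF f])
  have vc: "v \<in> closed_segment (rp p) (rp q)" using v(1) seg_closed[OF pq(1)] pq(2) by blast
  have fn: "f \<noteq> {a, b}" "f \<noteq> {a, c}" "f \<noteq> {b, c}"
    using v(1) tri_not_side[OF v(2)] seg_closed[OF ne(1), of v] seg_closed[OF ne(2), of v] seg_closed[OF ne(3), of v] by blast+
  have end_vertex: "r \<in> {a, b, c}" if r: "open_segment v (rp r) \<subseteq> seg f" for r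
  proof -
    have "rp r \<notin> tri (rp a) (rp b) (rp c)" by (rule lattice_notin_unimodular_tri[OF u])
    then obtain y where y: "y \<in> open_segment v (rp r) \<or> y = rp r"
      "y \<in> open_segment (rp a) (rp b) \<or> y \<in> open_segment (rp b) (rp c) \<or> y \<in> open_segment (rp a) (rp c) \<or> y \<in> {rp a, rp b, rp c}"
      by (rule exit_tri[OF v(2)])
    have y1: "y \<in> seg f \<or> y = rp r" using y(1) r by blast
    have "y \<notin> seg g" if g: "g \<in> \<sigma>" "f \<noteq> g" for g
      using y1 edges_disjoint[OF f g(1)] g(2) edge_lattice_free[OF g(1)] by blast
    then have "y \<in> {rp a, rp b, rp c}"
      using y(2) s fn unfolding seg_pair[OF ne(1), symmetric] seg_pair[OF ne(2), symmetric] seg_pair[OF ne(3), symmetric] by blast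
    then obtain g where g: "y = rp g" "g \<in> {a, b, c}" by blast
    then have "y = rp r" using y1 edge_lattice_free[OF f] by auto
    then show ?thesis using g rp_inj by auto
  qed
  have "open_segment v (rp p) \<subseteq> seg f" "open_segment v (rp q) \<subseteq> seg f"
    unfolding pq(2) seg_pair[OF pq(1)] subset_open_segment using vc by auto
  then have "p \<in> {a, b, c}" "q \<in> {a, b, c}" using end_vertex by blast+
  then have "f = {a, b} \<or> f = {a, c} \<or> f = {b, c}" using pq(1) unfolding pq(2) by auto
  then show False using fn by blast
qed

lemma triangle_region:
  assumes s: "{a, b} \<in> \<sigma>" "{a, c} \<in> \<sigma>" "{b, c} \<in> \<sigma>" and u: "\<bar>iori a b c\<bar> = 1"
  shows "tri (rp a) (rp b) (rp c) \<subseteq> region vs"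
proof -
  have o: "ori (rp a) (rp b) (rp c) \<noteq> 0" using u by (auto simp: ori_rp)
  show ?thesis by (rule edges_empty_triangle(2)[OF o s(1,3,2)]) (use lattice_notin_unimodular_tri[OF u] in blast)
qed

lemma edge_at_eq: assumes "e \<in> \<sigma>" shows "edge_at \<sigma> (mid e) = e" "mid e \<in> Lam vs"
proof -
  have m: "mid f \<in> seg f" if f: "f \<in> \<sigma>" for f
    by (rule edgeE[OF f]) (use mid_in_seg in simp)
  show "edge_at \<sigma> (mid e) = e" unfolding edge_at_def
  proof (rule the_equality)
    fix f assume f: "f \<in> \<sigma> \<and> mid f = mid e"
    then have "mid e \<in> seg f" using m[of f] by simp
    then show "f = e" using edges_disjoint[OF _ assms _ m[OF assms]] f by blast
  qed (use assms in simp)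
  show "mid e \<in> Lam vs" unfolding Lam_def using trg assms by blast
qed

text \<open>A midpoint in \<open>Lam vs\<close> may come from another triangulation;
  \<open>edge_exists\<close> transfers it to this one. It also makes the set of midpoints
  independent of the triangulation.\<close>

lemma edge_at: assumes "x \<in> Lam vs" shows "edge_at \<sigma> x \<in> \<sigma>" "mid (edge_at \<sigma> x) = x"
proof -
  obtain T h where "triangulation vs T" "h \<in> T" "x = mid h" using assms unfolding Lam_def by blast
  then obtain e where "e \<in> \<sigma>" "mid e = x" using edge_exists[of h] unfolding triangulation_def by blast
  then show "edge_at \<sigma> x \<in> \<sigma>" "mid (edge_at \<sigma> x) = x" using edge_at_eq[of e] by auto
qed

lemma Lam_eq: "Lam vs = mid ` \<sigma>"
  using edge_at edge_at_eq(2) by force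

lemma finite_Lam: "finite (Lam vs)"
  unfolding Lam_eq using finite_edges by simp

end

section \<open>A flip turns a triangulation into a triangulation\<close>

lemma in_hull3:
  assumes "0 \<le> u" "0 \<le> v" "0 \<le> w" "u + v + w = 1"
  shows "u *\<^sub>R x + v *\<^sub>R y + w *\<^sub>R z \<in> convex hull {x, y, z}"
  unfolding convex_hull_3 using assms by blast

context triangulated
begin

text \<open>The cell is the triangle with corners \<open>a\<close>, \<open>c\<close> and the
  midpoint of \<open>{a, b}\<close>. Its outer walls are the edge \<open>{a, c}\<close> and half of
  the new diagonal. A lattice point on that side has third coordinate at least 1, so it lies outside
  the cell, and the only way out that avoids both walls ends at \<open>c\<close>.\<close>

lemma flip_maximal_half:
  assumes q: "quad \<sigma> a b c d" and z: "z \<in> seg {a, b}"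
    and za: "bar (rp a) (rp b) (rp c) z > bar (rp b) (rp c) (rp a) z"
    and p: "bar (rp c) (rp a) (rp b) (rp p) > 0"
    and av: "\<And>v. v \<in> open_segment z (rp p) \<Longrightarrow> v \<notin> seg {a, c} \<and> v \<notin> seg {c, d} \<and> v \<noteq> rp c"
  shows "p = c"
proof -
  let ?A = "bar (rp a) (rp b) (rp c)" and ?B = "bar (rp b) (rp c) (rp a)" and ?C = "bar (rp c) (rp a) (rp b)"
  have u: "\<bar>iori a b c\<bar> = 1" and cd: "c + d = a + b" and ne: "a \<noteq> b" "c \<noteq> d" and ac: "{a, c} \<in> \<sigma>"
    using q by (auto simp: quad_def)
  have anc: "a \<noteq> c" using edge_ends[OF ac] by simp
  have o: "ori (rp a) (rp b) (rp c) \<noteq> 0" using u by (auto simp: ori_rp)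
  have o2: "ori (rp c) (rp a) (rp b) \<noteq> 0" using o ori_cyc by metis
  note vb = quad_vertex_bars[OF u]
  have zo: "z \<in> open_segment (rp a) (rp b)" using z seg_pair[OF ne(1)] by blast
  have zc: "z \<in> closed_segment (rp a) (rp b)" using z seg_closed[OF ne(1)] by blast
  have Cz: "?C z = 0" by (rule bar_side[OF o zc])
  have Bz: "?B z > 0" using affn_open_segment_pos[OF affn_bar _ _ _ zo, of "rp b" "rp c" "rp a"] vb by simp
  have A2: "affn (\<lambda>v. ?A v + (-1) * ?B v)" by (rule affn_add[OF affn_bar affn_cmult[OF affn_bar]])
  have sum: "?A v + ?B v + ?C v = 1" for v by (rule bar_sum[OF o])
  have Cp: "?C (rp p) \<ge> 1" using Ints_pos_ge1[OF bar_int(3)[OF u] p] .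
  have np: "\<not> (?B (rp p) > 0 \<and> ?A (rp p) + (-1) * ?B (rp p) > 0 \<and> ?A (rp p) + (-1) * ?B (rp p) > 0)"
    using sum[of "rp p"] Cp by linarith
  have zA: "?A z + (-1) * ?B z > 0" using za by simp
  obtain v where v: "v \<in> open_segment z (rp p) \<or> v = rp p" "?B v \<ge> 0" "?A v + (-1) * ?B v \<ge> 0"
    "?B v = 0 \<or> ?A v + (-1) * ?B v = 0"
    using exit_cell[OF affn_bar A2 A2 Bz zA zA np] by blast
  have Cv: "?C v > 0"
  proof (cases "v = rp p")
    case False
    then have "v \<in> open_segment z (rp p)" using v by blast
    then show ?thesis using affn_open_segment_pos[OF affn_bar, of "rp c" "rp a" "rp b" z "rp p" v] Cz p by auto
  qed (use p in simp)
  show ?thesis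
  proof (cases "?B v = 0")
    case True
    show ?thesis
    proof (cases "?A v = 0")
      case A0: True
      have "v = rp c" using vertex_of_bar[OF o2 True A0] .
      then have "v = rp p" using v(1) av by blast
      then show ?thesis using \<open>v = rp c\<close> rp_inj by auto
    next
      case False
      then have "?A v > 0" using v(3) True by simp
      then have "v \<in> open_segment (rp c) (rp a)" using side_of_bar[OF o2 True Cv] by blast
      then have "v \<in> seg {a, c}" unfolding seg_pair[OF anc] by (simp add: open_segment_commute)
      then show ?thesis using v(1) av edge_lattice_free[OF ac] by blast
    qed
  next
    case False
    then have t: "?A v = ?B v" "?B v > 0" using v by auto
    then have C: "?C v = 1 - 2 * ?B v" using sum[of v] by linarith
    have "v \<noteq> rp p" using C t(2) Cp by auto
    then have vo: "v \<in> open_segment z (rp p)" using v(1) by blast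
    have rd: "rp d = rp a + rp b - rp c"
    proof -
      have "rp c + rp d = rp a + rp b" using cd rp_add by metis
      then show ?thesis by (simp add: algebra_simps)
    qed
    have "v = ?A v *\<^sub>R rp a + ?B v *\<^sub>R rp b + ?C v *\<^sub>R rp c" by (rule bar_decomp[OF o])
    also have "\<dots> = (1 - ?B v) *\<^sub>R rp c + ?B v *\<^sub>R rp d"
      unfolding rd t(1) C by (simp add: algebra_simps scaleR_2[symmetric])
    finally have "v = (1 - ?B v) *\<^sub>R rp c + ?B v *\<^sub>R rp d" .
    moreover have "?B v < 1" using C Cv by linarith
    moreover have "rp c \<noteq> rp d" using ne rp_inj by blast
    ultimately have "v \<in> seg {c, d}" unfolding seg_pair[OF ne(2)] in_segment using t(2) by blast
    then show ?thesis using av vo by blast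
  qed
qed

lemma flip_maximal_end:
  assumes q: "quad \<sigma> a b c d" and z: "z \<in> seg {a, b}" "z \<noteq> mid {a, b}"
    and p: "bar (rp c) (rp a) (rp b) (rp p) > 0"
    and av: "\<And>v. v \<in> open_segment z (rp p) \<Longrightarrow> v \<notin> seg {a, c} \<and> v \<notin> seg {b, c} \<and> v \<notin> seg {c, d} \<and> v \<noteq> rp c"
  shows "p = c"
proof -
  let ?A = "bar (rp a) (rp b) (rp c)" and ?B = "bar (rp b) (rp c) (rp a)" and ?C = "bar (rp c) (rp a) (rp b)"
  have u: "\<bar>iori a b c\<bar> = 1" and ne: "a \<noteq> b" using q by (auto simp: quad_def)
  have o: "ori (rp a) (rp b) (rp c) \<noteq> 0" using u by (auto simp: ori_rp)
  have zc: "z \<in> closed_segment (rp a) (rp b)" using z seg_closed[OF ne(1)] by blast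
  have Cz: "?C z = 0" by (rule bar_side[OF o zc])
  have sum: "?A z + ?B z = 1" using bar_sum[OF o, of z] Cz by simp
  consider "?A z > ?B z" | "?B z > ?A z" | "?A z = ?B z" by linarith
  then show ?thesis
  proof cases
    case 1 then show ?thesis using flip_maximal_half[OF q z(1) 1 p] av by blast
  next
    case 2
    have q': "quad \<sigma> b a c d" by (rule quad_sym(1)[OF q])
    have z': "z \<in> seg {b, a}" using z by (simp add: insert_commute)
    have za': "bar (rp b) (rp a) (rp c) z > bar (rp a) (rp c) (rp b) z"
      using 2 by (simp add: bar_comm)
    have p': "bar (rp c) (rp b) (rp a) (rp p) > 0" using p by (simp add: bar_comm[of "rp c" "rp a" "rp b"])
    show ?thesis using flip_maximal_half[OF q' z' za' p'] av by blast
  next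
    case 3
    then have AB: "?A z = 1/2" "?B z = 1/2" using sum by auto
    have "z = ?A z *\<^sub>R rp a + ?B z *\<^sub>R rp b + ?C z *\<^sub>R rp c" by (rule bar_decomp[OF o])
    then have "z = mid {a, b}" unfolding AB Cz mid_pair[OF ne] by (simp add: scaleR_add_right)
    then show ?thesis using z(2) by blast
  qed
qed

lemma diagonal_region:
  assumes q: "quad \<sigma> a b c d"
  shows "admissible vs {c, d}"
proof -
  have u: "\<bar>iori a b c\<bar> = 1" and cd: "c + d = a + b" and ne: "a \<noteq> b" "c \<noteq> d"
    and e: "{a, b} \<in> \<sigma>" "{a, c} \<in> \<sigma>" "{b, c} \<in> \<sigma>" "{a, d} \<in> \<sigma>" "{b, d} \<in> \<sigma>"
    using q by (auto simp: quad_def)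
  have u': "\<bar>iori a b d\<bar> = 1" using u iori_opposite[OF cd] by simp
  have "v \<in> region vs \<and> v \<notin> rp ` Lam0 vs" if v: "v \<in> seg {c, d}" for v
  proof -
    have "v \<in> tri (rp a) (rp b) (rp c) \<or> v = mid {a, b} \<or> v \<in> tri (rp a) (rp b) (rp d)"
      using diagonal_cases[OF cd u ne(1)] v seg_pair[OF ne(2)] by blast
    moreover have "mid {a, b} \<in> region vs" using edge_in_region[OF e(1)] mid_in_seg[OF ne(1)] by blast
    moreover have "mid {a, b} \<notin> rp ` Lam0 vs" using edge_lattice_free[OF e(1)] mid_in_seg[OF ne(1)] by force
    ultimately show ?thesis
      using triangle_region[OF e(1,2,3) u] triangle_region[OF e(1,4,5) u']
        lattice_notin_unimodular_tri[OF u] lattice_notin_unimodular_tri[OF u'] by (elim disjE) auto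
  qed
  moreover have "c \<in> Lam0 vs" "d \<in> Lam0 vs" using edge_ends e by auto
  ultimately show ?thesis unfolding admissible_def empty_edge_def is_edge_def using ne(2) by blast
qed

lemma diagonal_disjoint:
  assumes q: "quad \<sigma> a b c d" and f: "f \<in> \<sigma>" "f \<noteq> {a, b}"
  shows "seg f \<inter> seg {c, d} = {}"
proof (rule ccontr)
  have u: "\<bar>iori a b c\<bar> = 1" and cd: "c + d = a + b" and ne: "a \<noteq> b" "c \<noteq> d"
    and e: "{a, b} \<in> \<sigma>" "{a, c} \<in> \<sigma>" "{b, c} \<in> \<sigma>" "{a, d} \<in> \<sigma>" "{b, d} \<in> \<sigma>"
    using q by (auto simp: quad_def)
  have u': "\<bar>iori a b d\<bar> = 1" using u iori_opposite[OF cd] by simp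
  assume "\<not> ?thesis"
  then obtain v where v: "v \<in> seg f" "v \<in> seg {c, d}" by blast
  have "v \<in> tri (rp a) (rp b) (rp c) \<or> v = mid {a, b} \<or> v \<in> tri (rp a) (rp b) (rp d)"
    using diagonal_cases[OF cd u ne(1)] v(2) seg_pair[OF ne(2)] by blast
  moreover have "v \<noteq> mid {a, b}" using edges_disjoint[OF f(1) e(1) v(1)] mid_in_seg[OF ne(1)] f(2) by blast
  ultimately show False
    using triangle_free[OF e(1,2,3) u f(1)] triangle_free[OF e(1,4,5) u' f(1)] v(1) by blast
qed

text \<open>Only maximality is delicate. A further edge \<open>h\<close> disjoint from the new
  family would have to cross the removed edge away from its midpoint. Each end of \<open>h\<close>
  is then forced to be \<open>c\<close> or \<open>d\<close>, or, along the line of the removed edge,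
  \<open>a\<close> or \<open>b\<close>, so \<open>h\<close> would be one of the two
  diagonals.\<close>

lemma quad_triangulation:
  assumes q: "quad \<sigma> a b c d"
  shows "triangulation vs (insert {c, d} (\<sigma> - {{a, b}}))"
proof -
  define T where "T = insert {c, d} (\<sigma> - {{a, b}})"
  have u: "\<bar>iori a b c\<bar> = 1" and cd: "c + d = a + b" and ne: "a \<noteq> b" "c \<noteq> d"
    and e: "{a, b} \<in> \<sigma>" "{a, c} \<in> \<sigma>" "{b, c} \<in> \<sigma>" "{a, d} \<in> \<sigma>" "{b, d} \<in> \<sigma>"
    using q by (auto simp: quad_def)
  have u': "\<bar>iori a b d\<bar> = 1" using u iori_opposite[OF cd] by simp
  have nc: "c \<noteq> a" "c \<noteq> b" "d \<noteq> a" "d \<noteq> b" using e edge_ends by blast+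
  have eT: "{a, c} \<in> T" "{b, c} \<in> T" "{a, d} \<in> T" "{b, d} \<in> T" "{c, d} \<in> T"
    unfolding T_def using e nc by (auto simp: doubleton_eq_iff)
  have m: "mid {c, d} = mid {a, b}" by (rule mid_parallelogram[OF ne(2,1) cd])
  have adm': "\<forall>f\<in>T. admissible vs f" unfolding T_def using adm diagonal_region[OF q] by blast
  have dj: "pairwise_disjoint T"
    unfolding pairwise_disjoint_def T_def using diagonal_disjoint[OF q] edges_disjoint by blast
  have mx: "\<exists>f\<in>T. seg h \<inter> seg f \<noteq> {}" if h: "admissible vs h" "h \<notin> T" for h
  proof (rule ccontr)
    assume no: "\<not> ?thesis"
    have hab: "h \<noteq> {a, b}"
    proof
      assume "h = {a, b}"
      then have "mid {c, d} \<in> seg h" using m mid_in_seg[OF ne(1)] by simp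
      then show False using no eT(5) mid_in_seg[OF ne(2)] by blast
    qed
    then have "h \<notin> \<sigma>" using h(2) unfolding T_def by blast
    then obtain f where f: "f \<in> \<sigma>" "seg h \<inter> seg f \<noteq> {}" using trg h(1) unfolding triangulation_def by blast
    have "f = {a, b}" using f no unfolding T_def by blast
    then obtain z where z: "z \<in> seg h" "z \<in> seg {a, b}" using f by blast
    have zm: "z \<noteq> mid {a, b}" using no eT(5) mid_in_seg[OF ne(2)] z(1) m by force
    obtain p q' where pq: "p \<noteq> q'" "h = {p, q'}" "p \<in> Lam0 vs" "q' \<in> Lam0 vs" by (rule admissibleE[OF h(1)])
    have zc: "z \<in> closed_segment (rp p) (rp q')" using z(1) seg_closed[OF pq(1)] pq(2) by blast
    have sub: "open_segment z (rp p) \<subseteq> seg h" "open_segment z (rp q') \<subseteq> seg h"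
      unfolding pq(2) seg_pair[OF pq(1)] subset_open_segment using zc by auto
    have lf: "rp r \<notin> seg h" for r by (rule admissible_lattice_free[OF h(1)])
    have avc: "v \<notin> seg {a, c} \<and> v \<notin> seg {b, c} \<and> v \<notin> seg {c, d} \<and> v \<noteq> rp c"
      and avd: "v \<notin> seg {a, d} \<and> v \<notin> seg {b, d} \<and> v \<notin> seg {d, c} \<and> v \<noteq> rp d" if v: "v \<in> seg h" for v
    proof -
      have nT: "v \<notin> seg g" if "g \<in> T" for g using no v that by blast
      have lc: "v \<noteq> rp c" "v \<noteq> rp d" using lf v by blast+
      have dc: "{d, c} = {c, d}" by (rule insert_commute)
      show "v \<notin> seg {a, c} \<and> v \<notin> seg {b, c} \<and> v \<notin> seg {c, d} \<and> v \<noteq> rp c"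
        by (intro conjI nT eT lc)
      show "v \<notin> seg {a, d} \<and> v \<notin> seg {b, d} \<and> v \<notin> seg {d, c} \<and> v \<noteq> rp d"
        unfolding dc by (intro conjI nT eT lc)
    qed
    have toc: "r = c" if "open_segment z (rp r) \<subseteq> seg h" "bar (rp c) (rp a) (rp b) (rp r) > 0" for r
      by (rule flip_maximal_end[OF q z(2) zm that(2)]) (use avc that(1) in blast)
    have tod: "r = d" if "open_segment z (rp r) \<subseteq> seg h" "bar (rp d) (rp a) (rp b) (rp r) > 0" for r
      by (rule flip_maximal_end[OF quad_sym(2)[OF q] z(2) zm that(2)]) (use avd that(1) in blast)
    have opp: "bar (rp d) (rp a) (rp b) v = - bar (rp c) (rp a) (rp b) v" for v
      using bar_eq(3)[where a="rp a" and b="rp b" and c="rp c" and z=v]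
        bar_eq(3)[where a="rp a" and b="rp b" and c="rp d" and z=v] iori_opposite[OF cd]
      by (simp add: ori_rp)
    have o: "ori (rp a) (rp b) (rp c) \<noteq> 0" using u by (auto simp: ori_rp)
    have zab: "z \<in> closed_segment (rp a) (rp b)" using z(2) seg_closed[OF ne(1)] by blast
    have zo: "z \<in> open_segment (rp a) (rp b)" using z(2) seg_pair[OF ne(1)] by blast
    have Cz: "bar (rp c) (rp a) (rp b) z = 0" by (rule bar_side[OF o zab])
    let ?C = "bar (rp c) (rp a) (rp b)"
    obtain t where t: "0 < t" "t < 1" "z = (1 - t) *\<^sub>R rp p + t *\<^sub>R rp q'"
      using z(1) unfolding pq(2) seg_pair[OF pq(1)] in_segment by blast
    \<comment> \<open>The third coordinate vanishes at \<open>z\<close>, so the two ends of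
      \<open>h\<close> lie strictly on opposite sides of the removed edge or both on its
      line.\<close>
    have bal: "(1 - t) * ?C (rp p) + t * ?C (rp q') = 0" using Cz unfolding t(3) affn_convex_comb[OF affn_bar] .
    consider "?C (rp p) > 0" | "?C (rp p) < 0" | "?C (rp p) = 0" by linarith
    then show False
    proof cases
      case 1
      then have "(1 - t) * ?C (rp p) > 0" using t by simp
      then have "t * ?C (rp q') < 0" using bal by linarith
      then have "?C (rp q') < 0" using t by (simp add: mult_less_0_iff)
      then have "q' = d" using tod[OF sub(2)] opp by simp
      moreover have "p = c" using toc[OF sub(1) 1] .
      ultimately show False using h(2) eT(5) pq(2) by simp
    next
      case 2
      then have "(1 - t) * ?C (rp p) < 0" using t by (simp add: mult_less_0_iff)
      then have "t * ?C (rp q') > 0" using bal by linarith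
      then have "?C (rp q') > 0" using t by (simp add: zero_less_mult_iff)
      then have "q' = c" using toc[OF sub(2)] by blast
      moreover have "p = d" using tod[OF sub(1)] opp 2 by simp
      ultimately have "h = {c, d}" unfolding pq(2) by (simp add: doubleton_eq_iff)
      then show False using h(2) eT(5) by simp
    next
      case 3
      then have q0: "?C (rp q') = 0" using bal t by simp
      have line: "ori (rp a) (rp b) v = 0" if "?C v = 0" for v
        using that unfolding bar_eq(3)[where a="rp a" and b="rp b" and c="rp c" and z=v] using o by simp
      have ends: "r = a \<or> r = b" if r: "open_segment z (rp r) \<subseteq> seg h" "?C (rp r) = 0" for r
      proof -
        have "rp r \<notin> open_segment (rp a) (rp b)" using edge_lattice_free[OF e(1)] seg_pair[OF ne(1)] by blast
        from line_exit[OF zo line[OF r(2)] this]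
        have "rp a = rp r \<or> rp b = rp r" using r(1) lf[of a] lf[of b] by blast
        then show ?thesis unfolding rp_inj by blast
      qed
      have "p = a \<or> p = b" "q' = a \<or> q' = b" using ends[OF sub(1) 3] ends[OF sub(2) q0] by auto
      then have "h = {a, b}" using pq(1) unfolding pq(2) by (elim disjE) (simp_all add: doubleton_eq_iff)
      then show False using hab by blast
    qed
  qed
  show ?thesis unfolding triangulation_def T_def[symmetric] using adm' dj mx by blast
qed

text \<open>Opposite unit heights give c + d = 2 a + k (b - a) with an integer k. For k at most 0,
  \<open>a\<close> is a convex combination of the other three vertices; for k at least 2,
  \<open>b\<close> is. Only k = 1 is left.\<close>

lemma strictly_convex_parallelogram:
  assumes "strictly_convex_quad ({a, b} \<union> {c, d})" and m: "iori a b c + iori a b d = 0" "\<bar>iori a b c\<bar> = 1"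
    and ne: "a \<noteq> b" "c \<noteq> d" and nc: "c \<noteq> a" "c \<noteq> b" "d \<noteq> a" "d \<noteq> b"
  shows "c + d = a + b"
proof -
  define u1 u2 v1 v2 w1 w2 where "u1 = fst b - fst a" and "u2 = snd b - snd a"
    and "v1 = fst c + fst d - 2 * fst a" and "v2 = snd c + snd d - 2 * snd a"
    and "w1 = fst c - fst a" and "w2 = snd c - snd a"
  define k where "k = iori a b c * (v1 * w2 - v2 * w1)"
  have D: "iori a b c = u1 * w2 - u2 * w1" by (simp add: iori_def u1_def u2_def w1_def w2_def)
  have z: "u1 * v2 - u2 * v1 = 0" using m(1) by (simp add: iori_def u1_def u2_def v1_def v2_def algebra_simps)
  have sq: "iori a b c * iori a b c = 1" using m(2) by (metis abs_mult_self_eq mult_1)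
  have "(u1 * w2 - u2 * w1) * v1 = (v1 * w2 - v2 * w1) * u1 + (u1 * v2 - u2 * v1) * w1"
    "(u1 * w2 - u2 * w1) * v2 = (v1 * w2 - v2 * w1) * u2 + (u1 * v2 - u2 * v1) * w2" by algebra+
  then have e: "iori a b c * v1 = (v1 * w2 - v2 * w1) * u1" "iori a b c * v2 = (v1 * w2 - v2 * w1) * u2"
    unfolding D z by simp_all
  have "v1 = iori a b c * (iori a b c * v1)" "v2 = iori a b c * (iori a b c * v2)"
    by (simp_all add: mult.assoc[symmetric] sq)
  then have v: "v1 = k * u1" "v2 = k * u2" unfolding e k_def by simp_all
  have f: "fst c + fst d = 2 * fst a + k * (fst b - fst a)" "snd c + snd d = 2 * snd a + k * (snd b - snd a)"
    using v unfolding u1_def u2_def v1_def v2_def by simp_all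
  have fr: "rp c + rp d = 2 *\<^sub>R rp a + real_of_int k *\<^sub>R (rp b - rp a)"
    using arg_cong[OF f(1), of real_of_int] arg_cong[OF f(2), of real_of_int] by (simp add: rp_def)
  have sc: "rp p \<notin> convex hull (rp ` ({a, b, c, d} - {p}))" if "p \<in> {a, b, c, d}" for p
    using assms(1) that unfolding strictly_convex_quad_def by (metis insert_is_Un Un_insert_left)
  have hulls: "convex hull (rp ` ({a, b, c, d} - {a})) = convex hull {rp b, rp c, rp d}"
     "convex hull (rp ` ({a, b, c, d} - {b})) = convex hull {rp a, rp c, rp d}"
  proof -
    have "{a, b, c, d} - {a} = {b, c, d}" "{a, b, c, d} - {b} = {a, c, d}" using ne nc by auto
    then show "convex hull (rp ` ({a, b, c, d} - {a})) = convex hull {rp b, rp c, rp d}"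
     "convex hull (rp ` ({a, b, c, d} - {b})) = convex hull {rp a, rp c, rp d}" by simp_all
  qed
  have "k = 1"
  proof (rule ccontr)
    assume "k \<noteq> 1"
    then consider "k \<le> 0" | "k \<ge> 2" by linarith
    then show False
    proof cases
      case 1
      define r where "r = 1 / (2 - real_of_int k)"
      have r: "r > 0" "r * (2 - real_of_int k) = 1" using 1 by (auto simp: r_def)
      have "(2 - real_of_int k) *\<^sub>R rp a = (- real_of_int k) *\<^sub>R rp b + rp c + rp d"
        using fr by (simp add: algebra_simps)
      then have "r *\<^sub>R ((2 - real_of_int k) *\<^sub>R rp a) = r *\<^sub>R ((- real_of_int k) *\<^sub>R rp b + rp c + rp d)" by simp
      then have "rp a = (r * (- real_of_int k)) *\<^sub>R rp b + r *\<^sub>R rp c + r *\<^sub>R rp d"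
        unfolding scaleR_scaleR r(2) by (simp add: algebra_simps)
      moreover have "r * (- real_of_int k) \<ge> 0" using r 1 by (intro mult_nonneg_nonneg) auto
      moreover have "r * (- real_of_int k) + r + r = 1" using r(2) by (simp add: algebra_simps)
      ultimately have "rp a \<in> convex hull {rp b, rp c, rp d}"
        using in_hull3[of "r * (- real_of_int k)" r r "rp b" "rp c" "rp d"] r(1) by simp
      then show False using sc[of a] hulls by simp
    next
      case 2
      define r where "r = 1 / real_of_int k"
      have r: "r > 0" "r * real_of_int k = 1" using 2 by (auto simp: r_def)
      have "real_of_int k *\<^sub>R rp b = (real_of_int k - 2) *\<^sub>R rp a + rp c + rp d"
        using fr by (simp add: algebra_simps)
      then have "r *\<^sub>R (real_of_int k *\<^sub>R rp b) = r *\<^sub>R ((real_of_int k - 2) *\<^sub>R rp a + rp c + rp d)" by simp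
      then have "rp b = (r * (real_of_int k - 2)) *\<^sub>R rp a + r *\<^sub>R rp c + r *\<^sub>R rp d"
        unfolding scaleR_scaleR r(2) by (simp add: algebra_simps)
      moreover have "r * (real_of_int k - 2) \<ge> 0" using r 2 by (intro mult_nonneg_nonneg) auto
      moreover have "r * (real_of_int k - 2) + r + r = 1" using r(2) by (simp add: algebra_simps)
      ultimately have "rp b \<in> convex hull {rp a, rp c, rp d}"
        using in_hull3[of "r * (real_of_int k - 2)" r r "rp a" "rp c" "rp d"] r(1) by simp
      then show False using sc[of b] hulls by simp
    qed
  qed
  then show ?thesis using f by (simp add: prod_eq_iff)
qed

end

text \<open>Each vertex is cut off from the other three by an affine functional: the differences of
  the first two coordinates for \<open>a\<close> and \<open>b\<close>, the third coordinate and its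
  negative for \<open>c\<close> and \<open>d\<close>.\<close>

lemma parallelogram_strictly_convex:
  assumes cd: "c + d = a + b" and u: "\<bar>iori a b c\<bar> = 1" and ne: "a \<noteq> b" "c \<noteq> d"
  shows "strictly_convex_quad ({a, b} \<union> {c, d})"
proof -
  let ?A = "bar (rp a) (rp b) (rp c)" and ?B = "bar (rp b) (rp c) (rp a)" and ?C = "bar (rp c) (rp a) (rp b)"
  note vb = quad_vertex_bars[OF u] quad_bars[OF cd u]
  have nc: "c \<noteq> a" "c \<noteq> b" using u by (auto simp: iori_def)
  have nd: "d \<noteq> a" "d \<noteq> b" using cd nc by (auto simp: add.commute)
  have card: "card ({a, b} \<union> {c, d}) = 4" using ne nc nd by auto
  have A1: "affn (\<lambda>v. ?A v + (-1) * ?B v)" by (rule affn_add[OF affn_bar affn_cmult[OF affn_bar]])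
  have A2: "affn (\<lambda>v. ?B v + (-1) * ?A v)" by (rule affn_add[OF affn_bar affn_cmult[OF affn_bar]])
  have A3: "affn ?C" by (rule affn_bar)
  have A4: "affn (\<lambda>v. (-1) * ?C v)" by (rule affn_cmult[OF affn_bar])
  have "rp p \<notin> convex hull (rp ` ({a, b} \<union> {c, d} - {p}))" if p: "p \<in> {a, b} \<union> {c, d}" for p
  proof
    assume h: "rp p \<in> convex hull (rp ` ({a, b} \<union> {c, d} - {p}))"
    consider "p = a" | "p = b" | "p = c" | "p = d" using p by blast
    then show False
    proof cases
      case 1
      have "?A (rp p) + (-1) * ?B (rp p) \<le> 0" by (rule affn_hull_le[OF A1 _ h]) (use 1 vb in auto)
      then show False using 1 vb by simp
    next
      case 2
      have "?B (rp p) + (-1) * ?A (rp p) \<le> 0" by (rule affn_hull_le[OF A2 _ h]) (use 2 vb in auto)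
      then show False using 2 vb by simp
    next
      case 3
      have "?C (rp p) \<le> 0" by (rule affn_hull_le[OF A3 _ h]) (use 3 vb in auto)
      then show False using 3 vb by simp
    next
      case 4
      have "(-1) * ?C (rp p) \<le> 0" by (rule affn_hull_le[OF A4 _ h]) (use 4 vb in auto)
      then show False using 4 vb by simp
    qed
  qed
  then show ?thesis unfolding strictly_convex_quad_def using card by blast
qed

section \<open>Flips within the triangulations that respect the boundary condition\<close>

lemma Omega_triangulated:
  assumes "lattice_polygon vs" "boundary_condition vs \<xi>" "\<sigma> \<in> Omega vs \<xi>"
  shows "triangulated vs \<sigma>"
  using assms unfolding triangulated_def Omega_def boundary_condition_def by blast

locale glauber =
  fixes vs :: "lpt list" and \<xi> :: "edge set"
  assumes poly: "lattice_polygon vs" and bc: "boundary_condition vs \<xi>"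
begin

abbreviation "\<Omega> \<equiv> Omega vs \<xi>"
abbreviation "\<Lambda> \<equiv> Lam vs"

lemma Omega_trg: "\<sigma> \<in> \<Omega> \<Longrightarrow> triangulated vs \<sigma>"
  using Omega_triangulated poly bc by blast

lemma quad_Omega:
  assumes s: "\<sigma> \<in> \<Omega>" and q: "quad \<sigma> a b c d" and n: "{a, b} \<notin> \<xi>"
  shows "insert {c, d} (\<sigma> - {{a, b}}) \<in> \<Omega>"
  using triangulated.quad_triangulation[OF Omega_trg[OF s] q] s n unfolding Omega_def by blast

lemma diagonal_notin:
  assumes s: "\<sigma> \<in> \<Omega>" and q: "quad \<sigma> a b c d" shows "{c, d} \<notin> \<sigma>"
proof
  interpret triangulated vs \<sigma> by (rule Omega_trg[OF s])
  assume "{c, d} \<in> \<sigma>"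
  have qq: "a \<noteq> b" "c \<noteq> d" "c + d = a + b" "{a, b} \<in> \<sigma>" "{a, c} \<in> \<sigma>" "{a, d} \<in> \<sigma>" using q by (auto simp: quad_def)
  have "mid {c, d} \<in> seg {a, b}" using mid_parallelogram[OF qq(2,1,3)] mid_in_seg[OF qq(1)] by simp
  then have "{c, d} = {a, b}" using edges_disjoint[OF \<open>{c, d} \<in> \<sigma>\<close> qq(4) mid_in_seg[OF qq(2)]] by blast
  moreover have "a \<noteq> c" "a \<noteq> d" using edge_ends qq by blast+
  ultimately show False by (auto simp: doubleton_eq_iff)
qed

text \<open>The definition of \<open>flip\<close> chooses an ordered pair of apexes by
  \<open>SOME\<close>. There are only two apexes, one on each side, so every choice gives the same
  new edge.\<close>

lemma quad_flip:
  assumes s: "\<sigma> \<in> \<Omega>" and q: "quad \<sigma> a b c d"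
  shows "edge_at \<sigma> (mid {a, b}) = {a, b}" "flip vs \<sigma> (mid {a, b}) = insert {c, d} (\<sigma> - {{a, b}})"
    "{a, b} \<notin> \<xi> \<Longrightarrow> flippable vs \<xi> \<sigma> (mid {a, b})"
proof -
  interpret triangulated vs \<sigma> by (rule Omega_trg[OF s])
  have u: "\<bar>iori a b c\<bar> = 1" and cd: "c + d = a + b" and ne: "a \<noteq> b" "c \<noteq> d"
    and e: "{a, b} \<in> \<sigma>" "{a, c} \<in> \<sigma>" "{b, c} \<in> \<sigma>" "{a, d} \<in> \<sigma>" "{b, d} \<in> \<sigma>"
    using q by (auto simp: quad_def)
  have u': "\<bar>iori a b d\<bar> = 1" using u iori_opposite[OF cd] by simp
  show ea: "edge_at \<sigma> (mid {a, b}) = {a, b}" by (rule edge_at_eq[OF e(1)])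
  have ap: "apex vs \<sigma> {a, b} c" "apex vs \<sigma> {a, b} d"
    using apexI[OF ne(1) e(2,3) u] apexI[OF ne(1) e(4,5) u'] by auto
  have only: "r = c \<or> r = d" if r: "apex vs \<sigma> {a, b} r" for r
  proof -
    have "\<bar>iori a b r\<bar> = 1" by (rule apexD(3)[OF r e(1)])
    then have "iori a b r = iori a b c \<or> iori a b r = iori a b d"
      using u iori_opposite[OF cd] by linarith
    then show ?thesis using apex_unique[OF e(1) r ap(1)] apex_unique[OF e(1) r ap(2)] by blast
  qed
  define P where "P = (\<lambda>r. fst r \<noteq> snd r \<and> apex vs \<sigma> {a, b} (fst r) \<and> apex vs \<sigma> {a, b} (snd r))"
  have "P (c, d)" unfolding P_def using ap ne by simp
  then have "P (Eps P)" by (rule someI)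
  then have ps: "fst (Eps P) \<noteq> snd (Eps P)" "apex vs \<sigma> {a, b} (fst (Eps P))" "apex vs \<sigma> {a, b} (snd (Eps P))"
    unfolding P_def by blast+
  have "{fst (Eps P), snd (Eps P)} = {c, d}"
    using only[OF ps(2)] only[OF ps(3)] ps(1) by (elim disjE) (simp_all add: insert_commute)
  then show "flip vs \<sigma> (mid {a, b}) = insert {c, d} (\<sigma> - {{a, b}})"
    unfolding flip_def ea Let_def P_def by simp
  show "flippable vs \<xi> \<sigma> (mid {a, b})" if "{a, b} \<notin> \<xi>"
    unfolding flippable_def ea using that ap ne parallelogram_strictly_convex[OF cd u ne] by blast
qed

text \<open>By \<open>apex_unique\<close> the two apexes lie on opposite sides, and strict convexity
  then leaves only a parallelogram.\<close>

lemma flippable_quad: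
  assumes s: "\<sigma> \<in> \<Omega>" and x: "x \<in> \<Lambda>" and f: "flippable vs \<xi> \<sigma> x"
  obtains a b c d where "quad \<sigma> a b c d" "x = mid {a, b}" "{a, b} \<notin> \<xi>"
proof -
  interpret triangulated vs \<sigma> by (rule Omega_trg[OF s])
  note e = edge_at[OF x]
  obtain a b where ab: "a \<noteq> b" "edge_at \<sigma> x = {a, b}" "a \<in> Lam0 vs" "b \<in> Lam0 vs" by (rule edgeE[OF e(1)])
  obtain c d where cd: "c \<noteq> d" "apex vs \<sigma> {a, b} c" "apex vs \<sigma> {a, b} d"
    "strictly_convex_quad ({a, b} \<union> {c, d})" "{a, b} \<notin> \<xi>"
    using f unfolding flippable_def ab(2) by blast
  have eab: "{a, b} \<in> \<sigma>" using e ab by simp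
  note c = apexD[OF cd(2) eab] and d = apexD[OF cd(3) eab]
  have "iori a b c \<noteq> iori a b d" using apex_unique[OF eab cd(2,3)] cd(1) by blast
  then have opp: "iori a b c + iori a b d = 0" using c(3) d(3) by linarith
  have nc: "c \<noteq> a" "c \<noteq> b" "d \<noteq> a" "d \<noteq> b" using c d edge_ends by blast+
  have "c + d = a + b" by (rule strictly_convex_parallelogram[OF cd(4) opp c(3) ab(1) cd(1) nc])
  then have "quad \<sigma> a b c d" unfolding quad_def using ab cd c d eab by blast
  moreover have "x = mid {a, b}" using e ab by simp
  ultimately show ?thesis using that cd(5) by blast
qed

lemma quad_flipped:
  assumes s: "\<sigma> \<in> \<Omega>" and q: "quad \<sigma> a b c d"
  shows "quad (insert {c, d} (\<sigma> - {{a, b}})) c d a b"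
proof -
  interpret triangulated vs \<sigma> by (rule Omega_trg[OF s])
  have u: "\<bar>iori a b c\<bar> = 1" and cd: "c + d = a + b" and ne: "a \<noteq> b" "c \<noteq> d"
    and e: "{a, b} \<in> \<sigma>" "{a, c} \<in> \<sigma>" "{b, c} \<in> \<sigma>" "{a, d} \<in> \<sigma>" "{b, d} \<in> \<sigma>"
    using q by (auto simp: quad_def)
  have nc: "c \<noteq> a" "c \<noteq> b" "d \<noteq> a" "d \<noteq> b" using e edge_ends by blast+
  have "\<bar>iori c d a\<bar> = 1" using iori_diag[OF cd] iori_opposite[OF cd] u by simp
  moreover have "{a, c} \<noteq> {a, b}" "{b, c} \<noteq> {a, b}" "{a, d} \<noteq> {a, b}" "{b, d} \<noteq> {a, b}"
    using nc by (simp_all add: doubleton_eq_iff)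
  moreover have "{c, a} = {a, c}" "{c, b} = {b, c}" "{d, a} = {a, d}" "{d, b} = {b, d}" by blast+
  ultimately show ?thesis unfolding quad_def using ne cd e by simp
qed

lemma flip_props:
  assumes s: "\<sigma> \<in> \<Omega>" and q: "quad \<sigma> a b c d" and n: "{a, b} \<notin> \<xi>"
  defines "x \<equiv> mid {a, b}" and "\<tau> \<equiv> flip vs \<sigma> (mid {a, b})"
  shows "\<tau> \<in> \<Omega>" "quad \<tau> c d a b" "edge_at \<sigma> x = {a, b}" "edge_at \<tau> x = {c, d}" "{c, d} \<notin> \<xi>"
    "flippable vs \<xi> \<tau> x" "flip vs \<tau> x = \<sigma>" "x \<in> \<Lambda>"
    "\<And>y. y \<in> \<Lambda> \<Longrightarrow> y \<noteq> x \<Longrightarrow> edge_at \<tau> y = edge_at \<sigma> y"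
proof -
  interpret triangulated vs \<sigma> by (rule Omega_trg[OF s])
  have t: "\<tau> = insert {c, d} (\<sigma> - {{a, b}})" unfolding \<tau>_def by (rule quad_flip(2)[OF s q])
  show tO: "\<tau> \<in> \<Omega>" unfolding t by (rule quad_Omega[OF s q n])
  show tq: "quad \<tau> c d a b" unfolding t by (rule quad_flipped[OF s q])
  have m: "mid {c, d} = x" unfolding x_def using q mid_parallelogram[of c d a b] by (auto simp: quad_def)
  show "edge_at \<sigma> x = {a, b}" unfolding x_def by (rule quad_flip(1)[OF s q])
  show et: "edge_at \<tau> x = {c, d}" using quad_flip(1)[OF tO tq] unfolding m .
  have cn: "{c, d} \<notin> \<sigma>" by (rule diagonal_notin[OF s q])
  then show nx: "{c, d} \<notin> \<xi>" using s unfolding Omega_def by blast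
  show "flippable vs \<xi> \<tau> x" using quad_flip(3)[OF tO tq nx] unfolding m .
  have ab: "{a, b} \<in> \<sigma>" using q by (auto simp: quad_def)
  have "flip vs \<tau> x = insert {a, b} (\<tau> - {{c, d}})" using quad_flip(2)[OF tO tq] unfolding m .
  also have "\<dots> = \<sigma>" unfolding t using ab cn by blast
  finally show "flip vs \<tau> x = \<sigma>" .
  show "x \<in> \<Lambda>" unfolding x_def by (rule edge_at_eq(2)[OF ab])
  fix y assume y: "y \<in> \<Lambda>" "y \<noteq> x"
  have "edge_at \<sigma> y \<noteq> {a, b}" using edge_at(2)[OF y(1)] y(2) x_def by auto
  then have "edge_at \<sigma> y \<in> \<tau>" unfolding t using edge_at(1)[OF y(1)] by blast
  then show "edge_at \<tau> y = edge_at \<sigma> y"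
    using triangulated.edge_at_eq(1)[OF Omega_trg[OF tO]] edge_at(2)[OF y(1)] by metis
qed

end

section \<open>Parents and the height function\<close>

lemma int_l1: "int (l1 p q) = \<bar>fst p - fst q\<bar> + \<bar>snd p - snd q\<bar>"
  by (simp add: l1_def)

text \<open>Two short diagonals of parallelograms over the same edge differ by an even multiple of that edge.\<close>

lemma short_diagonal_unique_aux:
  assumes cd: "c + d = a + b" and cd': "c' + d' = a + b" and u: "\<bar>iori a b c\<bar> = 1"
    and l: "l1 c d \<le> l1 a b" "l1 c' d' < l1 a b" and i: "iori a b c = iori a b c'"
  shows "c = c'"
proof -
  obtain k where k: "fst c' = fst c + k * (fst b - fst a)" "snd c' = snd c + k * (snd b - snd a)"
    by (rule same_side_shift[OF i u])
  have d: "d = a + b - c" "d' = a + b - c'" using cd cd' by (simp_all add: algebra_simps)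
  have 1: "2 * k * (fst b - fst a) = (fst c' - fst d') - (fst c - fst d)"
     "2 * k * (snd b - snd a) = (snd c' - snd d') - (snd c - snd d)"
    unfolding d using k by (simp_all add: algebra_simps)
  have "2 * \<bar>k\<bar> * (\<bar>fst b - fst a\<bar> + \<bar>snd b - snd a\<bar>) = \<bar>2 * k * (fst b - fst a)\<bar> + \<bar>2 * k * (snd b - snd a)\<bar>"
    by (simp add: abs_mult distrib_left del: right_diff_distrib')
  also have "\<dots> \<le> int (l1 c' d') + int (l1 c d)" unfolding 1 int_l1 by linarith
  also have "\<dots> < 2 * int (l1 a b)" using l by linarith
  also have "\<dots> = 2 * (\<bar>fst b - fst a\<bar> + \<bar>snd b - snd a\<bar>)" unfolding int_l1 by (simp add: abs_minus_commute)
  finally have lt: "2 * \<bar>k\<bar> * (\<bar>fst b - fst a\<bar> + \<bar>snd b - snd a\<bar>) < 2 * (\<bar>fst b - fst a\<bar> + \<bar>snd b - snd a\<bar>)" .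
  have "k = 0"
  proof (rule ccontr)
    assume "k \<noteq> 0"
    then have "2 * (\<bar>fst b - fst a\<bar> + \<bar>snd b - snd a\<bar>) \<le> 2 * \<bar>k\<bar> * (\<bar>fst b - fst a\<bar> + \<bar>snd b - snd a\<bar>)"
      by (intro mult_right_mono) auto
    then show False using lt by linarith
  qed
  then show ?thesis using k by (simp add: prod_eq_iff)
qed

text \<open>The second diagonal may be labelled on either side of \<open>{a, b}\<close>, hence the
  two cases. One weak and one strict inequality let the result also cover a flip that keeps the
  length.\<close>

lemma short_diagonal_unique:
  assumes cd: "c + d = a + b" and cd': "c' + d' = a + b" and u: "\<bar>iori a b c\<bar> = 1" "\<bar>iori a b c'\<bar> = 1"
    and l: "l1 c d \<le> l1 a b" "l1 c' d' < l1 a b"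
  shows "{c, d} = {c', d'}"
proof (cases "iori a b c = iori a b c'")
  case True
  then have "c = c'" using short_diagonal_unique_aux[OF cd cd' u(1) l] by blast
  moreover have "d = d'" using calculation cd cd' by (metis add_left_cancel)
  ultimately show ?thesis by simp
next
  case False
  have "iori a b d' = - iori a b c'" by (rule iori_opposite[OF cd'])
  then have i: "iori a b c = iori a b d'" using False u by linarith
  have cd'': "d' + c' = a + b" using cd' by (simp add: add.commute)
  have l': "l1 d' c' < l1 a b" using l(2) by (simp add: l1_commute)
  have "c = d'" using short_diagonal_unique_aux[OF cd cd'' u(1) l(1) l' i] .
  moreover have "d = c'" using calculation cd cd'' by (metis add_left_cancel)
  ultimately show ?thesis by auto
qed

section \<open>The generator, and the effect of a flip on the height function\<close>

definition wt :: "real \<Rightarrow> edge \<Rightarrow> edge \<Rightarrow> real" where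
  "wt \<alpha> g e = (if seg e \<inter> seg g \<noteq> {} then \<alpha> powr (real (len e) - real (len g)) else 0)"

lemma wt_nonneg: "wt \<alpha> g e \<ge> 0" by (simp add: wt_def)

definition rate :: "real \<Rightarrow> lpt list \<Rightarrow> edge set \<Rightarrow> real \<times> real \<Rightarrow> real" where
  "rate lam vs \<sigma> x = lam ^ len (edge_at (flip vs \<sigma> x) x) /
     (lam ^ len (edge_at (flip vs \<sigma> x) x) + lam ^ len (edge_at \<sigma> x))"

lemma rate_bounds: assumes "lam > 0" shows "0 < rate lam vs \<sigma> x" "rate lam vs \<sigma> x < 1"
  using assms zero_less_power[OF assms, of "len (edge_at (flip vs \<sigma> x) x)"] zero_less_power[OF assms, of "len (edge_at \<sigma> x)"]
  by (auto simp: rate_def add_pos_pos)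

definition flips :: "lpt list \<Rightarrow> edge set \<Rightarrow> edge set \<Rightarrow> (real \<times> real) set" where
  "flips vs \<xi> \<sigma> = {x \<in> Lam vs. flippable vs \<xi> \<sigma> x}"

text \<open>The generator of the dynamics, without the factor \<open>1 / |\<Lambda>|\<close>.\<close>

definition gen :: "real \<Rightarrow> lpt list \<Rightarrow> edge set \<Rightarrow> (edge set \<Rightarrow> real) \<Rightarrow> edge set \<Rightarrow> real" where
  "gen lam vs \<xi> f \<sigma> = (\<Sum>x\<in>flips vs \<xi> \<sigma>. rate lam vs \<sigma> x * (f (flip vs \<sigma> x) - f \<sigma>))"

text \<open>The share of one midpoint in the height function, depending only on the current edge
  there. A flip thus changes a single summand.\<close>

definition height_term :: "lpt list \<Rightarrow> edge set \<Rightarrow> real \<Rightarrow> edge \<Rightarrow> real \<times> real \<Rightarrow> edge \<Rightarrow> real" where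
  "height_term vs \<xi> \<alpha> g x f =
     (\<Sum>e\<in>{e \<in> Ex vs \<xi> x. seg e \<inter> seg g \<noteq> {} \<and> preceq vs \<xi> e f}. \<alpha> powr (real (len e) - real (len g)))"

lemma Psi_height_term: "Psi vs \<xi> \<alpha> g \<sigma> = (\<Sum>x\<in>Lam vs. height_term vs \<xi> \<alpha> g x (edge_at \<sigma> x))"
  unfolding Psi_def Exsg_def height_term_def ..

context glauber
begin

lemma finite_Lam: "finite \<Lambda>"
proof (cases "\<Omega> = {}")
  case False
  then show ?thesis using triangulated.finite_Lam Omega_trg by blast
next
  case True
  have "\<Lambda> \<subseteq> mid ` Pow (Lam0 vs)" unfolding Lam_def triangulation_def by (auto elim!: admissibleE)
  then show ?thesis by (rule finite_subset) (simp add: finite_Lam0)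
qed

lemma finite_Omega: "finite \<Omega>"
proof -
  have "\<Omega> \<subseteq> Pow (Pow (Lam0 vs))"
    unfolding Omega_def triangulation_def by (auto elim!: admissibleE)
  then show ?thesis by (rule finite_subset) (simp add: finite_Lam0)
qed

lemma finite_Ex: "finite (Ex vs \<xi> x)"
proof -
  have "Ex vs \<xi> x = (\<lambda>\<sigma>. edge_at \<sigma> x) ` \<Omega>" unfolding Ex_def by auto
  then show ?thesis using finite_Omega by simp
qed

lemma in_Ex: "\<sigma> \<in> \<Omega> \<Longrightarrow> edge_at \<sigma> x \<in> Ex vs \<xi> x"
  unfolding Ex_def by blast

text \<open>Sides of the polygon belong to the boundary condition. This provides the probability at
  least 1 / N of standing still in each step.\<close>

lemma side_not_flippable:
  assumes s: "\<sigma> \<in> \<Omega>" shows "\<exists>x\<in>\<Lambda>. \<not> flippable vs \<xi> \<sigma> x"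
proof -
  have "0 < length vs" using poly unfolding lattice_polygon_def by linarith
  then have e: "side vs 0 \<in> \<xi>" using bc unfolding boundary_condition_def by blast
  then have es: "side vs 0 \<in> \<sigma>" using s unfolding Omega_def by blast
  have "edge_at \<sigma> (mid (side vs 0)) = side vs 0" "mid (side vs 0) \<in> \<Lambda>"
    using triangulated.edge_at_eq[OF Omega_trg[OF s] es] by auto
  then show ?thesis using e unfolding flippable_def by metis
qed

lemma parent_flip:
  assumes s: "\<sigma> \<in> \<Omega>" and q: "quad \<sigma> a b c d" and n: "{a, b} \<notin> \<xi>" and l: "len {c, d} < len {a, b}"
  shows "parent vs \<xi> {c, d} {a, b}"
proof -
  note p = flip_props[OF s q n]
  have E: "{a, b} \<in> Ex vs \<xi> (mid {a, b})" "{c, d} \<in> Ex vs \<xi> (mid {a, b})"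
    using in_Ex[OF s, of "mid {a, b}"] in_Ex[OF p(1), of "mid {a, b}"] p(3,4) by auto
  then have "{a, b} \<notin> ground vs \<xi> (mid {a, b})" unfolding ground_def using l by force
  moreover have "flippable vs \<xi> \<sigma> (mid {a, b})" by (rule quad_flip(3)[OF s q n])
  ultimately show ?thesis unfolding parent_def using E l s p(3,4,8) by blast
qed

text \<open>A parent may be witnessed in a different triangulation;
  \<open>short_diagonal_unique\<close> compares the two parallelograms over the same edge.\<close>

lemma parent_unique:
  assumes q: "quad \<sigma> a b c d" and l: "len {c, d} \<le> len {a, b}" and p: "parent vs \<xi> e {a, b}"
  shows "e = {c, d}"
proof -
  obtain x \<tau> where x: "x \<in> \<Lambda>" "\<tau> \<in> \<Omega>" "edge_at \<tau> x = {a, b}" "flippable vs \<xi> \<tau> x" "edge_at (flip vs \<tau> x) x = e"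
    and le: "len e < len {a, b}" using p unfolding parent_def by blast
  obtain a' b' c' d' where q': "quad \<tau> a' b' c' d'" "x = mid {a', b'}" "{a', b'} \<notin> \<xi>"
    by (rule flippable_quad[OF x(2,1,4)])
  note fp = flip_props[OF x(2) q'(1,3)]
  have ab: "{a', b'} = {a, b}" using fp(3) x(3) q'(2) by simp
  have e: "e = {c', d'}" using fp(4) x(5) q'(2) by simp
  have "\<exists>c' d'. quad \<tau> a b c' d' \<and> e = {c', d'}"
  proof (cases "a' = a")
    case True
    then have "b' = b" using ab by (auto simp: doubleton_eq_iff)
    then show ?thesis using True q' e by blast
  next
    case False
    then have "a' = b" "b' = a" using ab by (auto simp: doubleton_eq_iff)
    then show ?thesis using quad_sym(1)[OF q'(1)] e by blast
  qed
  then obtain c'' d'' where q'': "quad \<tau> a b c'' d''" and e'': "e = {c'', d''}" by blast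
  have "{c, d} = {c'', d''}"
    by (rule short_diagonal_unique[of c d a b c'' d''])
       (use q q'' l le e'' in \<open>auto simp: quad_def len_pair\<close>)
  then show ?thesis using e'' by simp
qed

lemma prec_len: "prec vs \<xi> e f \<Longrightarrow> len e < len f"
proof -
  assume "prec vs \<xi> e f"
  then have "(parent vs \<xi>)\<^sup>+\<^sup>+ e f" by (simp add: prec_def)
  then show ?thesis
  proof (induction rule: tranclp_induct)
    case (base y) then show ?case unfolding parent_def by blast
  next
    case (step y z)
    have "len y < len z" using step(2) unfolding parent_def by blast
    then show ?case using step(3) by simp
  qed
qed

lemma prec_cases: "prec vs \<xi> e f \<Longrightarrow> \<exists>p. preceq vs \<xi> e p \<and> parent vs \<xi> p f"
  unfolding prec_def preceq_def by (erule tranclp.cases) auto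

lemma preceq_down:
  assumes s: "\<sigma> \<in> \<Omega>" and q: "quad \<sigma> a b c d" and n: "{a, b} \<notin> \<xi>" and l: "len {c, d} < len {a, b}"
  shows "preceq vs \<xi> e {a, b} \<longleftrightarrow> e = {a, b} \<or> preceq vs \<xi> e {c, d}"
proof
  assume "preceq vs \<xi> e {a, b}"
  then consider "e = {a, b}" | "prec vs \<xi> e {a, b}" unfolding preceq_def by blast
  then show "e = {a, b} \<or> preceq vs \<xi> e {c, d}"
  proof cases
    case 2
    obtain p where p: "preceq vs \<xi> e p" "parent vs \<xi> p {a, b}" using prec_cases[OF 2] by blast
    have "p = {c, d}" by (rule parent_unique[OF q less_imp_le[OF l] p(2)])
    then show ?thesis using p by simp
  qed simp
next
  have "parent vs \<xi> {c, d} {a, b}" by (rule parent_flip[OF s q n l])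
  then have "prec vs \<xi> e {a, b}" if "preceq vs \<xi> e {c, d}"
    using that unfolding preceq_def prec_def by (metis tranclp.r_into_trancl tranclp.trancl_into_trancl)
  moreover assume "e = {a, b} \<or> preceq vs \<xi> e {c, d}"
  ultimately show "preceq vs \<xi> e {a, b}" unfolding preceq_def by blast
qed

text \<open>An edge with an equally long flip has no parent: the parent would have to be that flip,
  yet be strictly shorter.\<close>

lemma preceq_level:
  assumes q: "quad \<sigma> a b c d" and l: "len {c, d} = len {a, b}"
  shows "preceq vs \<xi> e {a, b} \<longleftrightarrow> e = {a, b}"
proof -
  have "\<not> prec vs \<xi> e {a, b}"
  proof
    assume p: "prec vs \<xi> e {a, b}"
    obtain p where p: "parent vs \<xi> p {a, b}" using prec_cases[OF p] by blast
    have "p = {c, d}" by (rule parent_unique[OF q eq_imp_le[OF l] p])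
    then show False using p l unfolding parent_def by auto
  qed
  then show ?thesis unfolding preceq_def by blast
qed

abbreviation "ht \<equiv> height_term vs \<xi>"

lemma ht_nonneg: "ht \<alpha> g x f \<ge> 0"
  unfolding height_term_def by (intro sum_nonneg) simp

lemma wt_le_ht: assumes "e \<in> Ex vs \<xi> x" "preceq vs \<xi> e f" shows "wt \<alpha> g e \<le> ht \<alpha> g x f"
proof (cases "seg e \<inter> seg g = {}")
  case True then show ?thesis using ht_nonneg by (simp add: wt_def)
next
  case False
  then have "e \<in> {e \<in> Ex vs \<xi> x. seg e \<inter> seg g \<noteq> {} \<and> preceq vs \<xi> e f}" using assms by blast
  moreover have "finite {e \<in> Ex vs \<xi> x. seg e \<inter> seg g \<noteq> {} \<and> preceq vs \<xi> e f}" using finite_Ex[of x] by simp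
  ultimately have "\<alpha> powr (real (len e) - real (len g)) \<le> ht \<alpha> g x f"
    unfolding height_term_def
    using member_le_sum[of e "{e \<in> Ex vs \<xi> x. seg e \<inter> seg g \<noteq> {} \<and> preceq vs \<xi> e f}" "\<lambda>e. \<alpha> powr (real (len e) - real (len g))"]
    by simp
  then show ?thesis using False by (simp add: wt_def)
qed

text \<open>The edges below \<open>{a, b}\<close> are those below its parent together with
  \<open>{a, b}\<close> itself, so passing to the parent removes exactly one term.\<close>

lemma ht_down:
  assumes s: "\<sigma> \<in> \<Omega>" and q: "quad \<sigma> a b c d" and n: "{a, b} \<notin> \<xi>" and l: "len {c, d} < len {a, b}"
  shows "ht \<alpha> g (mid {a, b}) {a, b} = ht \<alpha> g (mid {a, b}) {c, d} + wt \<alpha> g {a, b}"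
proof -
  let ?x = "mid {a, b}"
  define S where "S = {e \<in> Ex vs \<xi> ?x. seg e \<inter> seg g \<noteq> {} \<and> preceq vs \<xi> e {c, d}}"
  have fin: "finite S" unfolding S_def using finite_Ex[of ?x] by simp
  have E: "{a, b} \<in> Ex vs \<xi> ?x" using in_Ex[OF s, of ?x] flip_props(3)[OF s q n] by simp
  have nS: "{a, b} \<notin> S"
  proof
    assume "{a, b} \<in> S"
    then have "len {a, b} \<le> len {c, d}" unfolding S_def preceq_def using prec_len by force
    then show False using l by simp
  qed
  have T: "{e \<in> Ex vs \<xi> ?x. seg e \<inter> seg g \<noteq> {} \<and> preceq vs \<xi> e {a, b}} = (if seg {a, b} \<inter> seg g \<noteq> {} then insert {a, b} S else S)"
    unfolding preceq_down[OF s q n l] S_def using E by auto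
  show ?thesis
    unfolding height_term_def T wt_def S_def[symmetric] using fin nS by simp
qed

lemma ht_level:
  assumes s: "\<sigma> \<in> \<Omega>" and q: "quad \<sigma> a b c d" and n: "{a, b} \<notin> \<xi>" and l: "len {c, d} = len {a, b}"
  shows "ht \<alpha> g (mid {a, b}) {a, b} = wt \<alpha> g {a, b}"
proof -
  let ?x = "mid {a, b}"
  have E: "{a, b} \<in> Ex vs \<xi> ?x" using in_Ex[OF s, of ?x] flip_props(3)[OF s q n] by simp
  have T: "{e \<in> Ex vs \<xi> ?x. seg e \<inter> seg g \<noteq> {} \<and> preceq vs \<xi> e {a, b}} = (if seg {a, b} \<inter> seg g \<noteq> {} then {{a, b}} else {})"
    unfolding preceq_level[OF q l] using E by auto
  show ?thesis unfolding height_term_def T wt_def by simp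
qed

abbreviation "\<Psi> \<equiv> Psi vs \<xi>"

lemma Psi_flip_diff:
  assumes s: "\<sigma> \<in> \<Omega>" and q: "quad \<sigma> a b c d" and n: "{a, b} \<notin> \<xi>"
  shows "\<Psi> \<alpha> g (flip vs \<sigma> (mid {a, b})) - \<Psi> \<alpha> g \<sigma> = ht \<alpha> g (mid {a, b}) {c, d} - ht \<alpha> g (mid {a, b}) {a, b}"
proof -
  let ?x = "mid {a, b}" and ?\<tau> = "flip vs \<sigma> (mid {a, b})"
  note p = flip_props[OF s q n]
  have 1: "\<Psi> \<alpha> g \<rho> = ht \<alpha> g ?x (edge_at \<rho> ?x) + (\<Sum>y\<in>\<Lambda> - {?x}. ht \<alpha> g y (edge_at \<rho> y))" for \<rho>
    unfolding Psi_height_term using finite_Lam p(8) by (intro sum.remove)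
  have 2: "(\<Sum>y\<in>\<Lambda> - {?x}. ht \<alpha> g y (edge_at ?\<tau> y)) = (\<Sum>y\<in>\<Lambda> - {?x}. ht \<alpha> g y (edge_at \<sigma> y))"
    using p(9) by (intro sum.cong) auto
  show ?thesis using 1[of ?\<tau>] 1[of \<sigma>] 2 p(3,4) by simp
qed

lemma Psi_flip:
  fixes \<alpha> :: real and g :: edge
  assumes s: "\<sigma> \<in> \<Omega>" and q: "quad \<sigma> a b c d" and n: "{a, b} \<notin> \<xi>"
  defines "D \<equiv> \<Psi> \<alpha> g (flip vs \<sigma> (mid {a, b})) - \<Psi> \<alpha> g \<sigma>"
  shows "len {c, d} < len {a, b} \<Longrightarrow> D = - wt \<alpha> g {a, b}"
    "len {c, d} = len {a, b} \<Longrightarrow> D = wt \<alpha> g {c, d} - wt \<alpha> g {a, b}"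
    "len {c, d} > len {a, b} \<Longrightarrow> D = wt \<alpha> g {c, d}"
proof -
  note p = flip_props[OF s q n]
  have m: "mid {c, d} = mid {a, b}" using q mid_parallelogram[of c d a b] by (auto simp: quad_def)
  note d = Psi_flip_diff[OF s q n, of \<alpha> g, folded D_def]
  show "len {c, d} < len {a, b} \<Longrightarrow> D = - wt \<alpha> g {a, b}"
    using ht_down[OF s q n] d by simp
  show "len {c, d} = len {a, b} \<Longrightarrow> D = wt \<alpha> g {c, d} - wt \<alpha> g {a, b}"
    using ht_level[OF s q n] ht_level[OF p(1,2,5), unfolded m] d by simp
  show "len {c, d} > len {a, b} \<Longrightarrow> D = wt \<alpha> g {c, d}"
    using ht_down[OF p(1,2,5), unfolded m] d by simp
qed

lemma Psi_flip_le:
  assumes s: "\<sigma> \<in> \<Omega>" and q: "quad \<sigma> a b c d" and n: "{a, b} \<notin> \<xi>"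
  shows "\<Psi> \<alpha> g (flip vs \<sigma> (mid {a, b})) - \<Psi> \<alpha> g \<sigma> \<le> (if len {a, b} \<le> len {c, d} then wt \<alpha> g {c, d} else 0)"
    "- wt \<alpha> g {a, b} \<le> \<Psi> \<alpha> g (flip vs \<sigma> (mid {a, b})) - \<Psi> \<alpha> g \<sigma>"
  using Psi_flip[OF s q n, of \<alpha> g] wt_nonneg[of \<alpha> g "{a, b}"] wt_nonneg[of \<alpha> g "{c, d}"]
  by (cases "len {c, d}" "len {a, b}" rule: linorder_cases; simp)+

lemma Psi_nonneg: "\<Psi> \<alpha> g \<sigma> \<ge> 0"
  unfolding Psi_height_term by (intro sum_nonneg ht_nonneg)

lemma sum_wt_le_Psi:
  assumes "\<sigma> \<in> \<Omega>" shows "(\<Sum>x\<in>\<Lambda>. wt \<alpha> g (edge_at \<sigma> x)) \<le> \<Psi> \<alpha> g \<sigma>"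
  unfolding Psi_height_term by (intro sum_mono wt_le_ht in_Ex[OF assms]) (simp add: preceq_def)

lemma card_Lam_pos: "\<sigma> \<in> \<Omega> \<Longrightarrow> card \<Lambda> > 0"
  using side_not_flippable[of \<sigma>] finite_Lam by (auto simp: card_gt_0_iff)

text \<open>Each chosen midpoint contributes \<open>f \<sigma>\<close> plus the rate times the
  increment, and averaging over the midpoints gives the factor 1 / N in front of the
  generator.\<close>

lemma step_expectation:
  assumes s: "\<sigma> \<in> \<Omega>" and lam: "lam > 0"
  shows "measure_pmf.expectation (step lam vs \<xi> \<sigma>) f = f \<sigma> + gen lam vs \<xi> f \<sigma> / card \<Lambda>" (is "?E = _")
proof -
  have N: "card \<Lambda> > 0" by (rule card_Lam_pos[OF s])
  then have ne: "\<Lambda> \<noteq> {}" by auto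
  define h where "h x = (if flippable vs \<xi> \<sigma> x then rate lam vs \<sigma> x * (f (flip vs \<sigma> x) - f \<sigma>) else 0)" for x
  have inner: "measure_pmf.expectation (if flippable vs \<xi> \<sigma> x then
       map_pmf (\<lambda>b. if b then flip vs \<sigma> x else \<sigma>)
         (bernoulli_pmf (rate lam vs \<sigma> x))
     else return_pmf \<sigma>) f = f \<sigma> + h x" for x
    using rate_bounds[OF lam, of vs \<sigma> x] by (simp add: h_def algebra_simps)
  have "?E = (\<Sum>x\<in>\<Lambda>. measure_pmf.expectation (if flippable vs \<xi> \<sigma> x then
       map_pmf (\<lambda>b. if b then flip vs \<sigma> x else \<sigma>)
         (bernoulli_pmf (rate lam vs \<sigma> x))
     else return_pmf \<sigma>) f /\<^sub>R real (card \<Lambda>))"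
    unfolding step_def rate_def[symmetric]
    by (rule pmf_expectation_bind_pmf_of_set[OF ne finite_Lam]) auto
  also have "\<dots> = (\<Sum>x\<in>\<Lambda>. f \<sigma> + h x) / card \<Lambda>"
    unfolding inner real_scaleR_def sum_distrib_left[symmetric] by (simp only: divide_inverse mult.commute)
  also have "\<dots> = f \<sigma> + (\<Sum>x\<in>\<Lambda>. h x) / card \<Lambda>"
    using N by (simp add: sum.distrib add_divide_distrib)
  also have "(\<Sum>x\<in>\<Lambda>. h x) = gen lam vs \<xi> f \<sigma>"
    unfolding gen_def flips_def h_def using finite_Lam by (simp add: sum.If_cases Int_def)
  finally show ?thesis .
qed

end

section \<open>Lengths in a unimodular parallelogram\<close>

text \<open>If the coordinate differences had opposite signs, one product in the determinant would
  exceed the other by more than 1, unless the matrix is the identity or a permutation. That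
  exception is the unit square.\<close>

lemma unimodular_l1_aux:
  fixes A B C E :: int
  assumes nn: "0 \<le> A" "0 \<le> B" "0 \<le> C" "0 \<le> E" and d: "\<bar>A * E - C * B\<bar> = 1"
  shows "\<bar>A - B\<bar> + \<bar>C - E\<bar> = \<bar>(A + C) - (B + E)\<bar> \<or> (A + C = 1 \<and> B + E = 1)"
proof -
  have key: "X = 1 \<and> W = 1 \<and> Y = 0 \<and> Z = 0" if "Y < X" "Z < W" "0 \<le> Y" "0 \<le> Z" "X * W - Z * Y \<le> 1" for X Y Z W :: int
  proof -
    have "(Y + 1) * (Z + 1) \<le> X * W" using that by (intro mult_mono) auto
    then have "Y * Z + Y + Z + 1 \<le> X * W" by (simp add: algebra_simps)
    then have yz: "Y = 0" "Z = 0" using that by (auto simp: mult.commute)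
    then have *: "X * W \<le> 1" "X \<ge> 1" "W \<ge> 1" using that by auto
    have "X * 1 \<le> X * W" "1 * W \<le> X * W" using * by (intro mult_mono; simp)+
    then have "X \<le> 1" "W \<le> 1" using *(1) unfolding mult_1_left mult_1_right by linarith+
    then show ?thesis using yz * by simp
  qed
  consider "B \<le> A \<and> E \<le> C \<or> A \<le> B \<and> C \<le> E" | "B < A" "C < E" | "A < B" "E < C" by linarith
  then show ?thesis
  proof cases
    case 1 then show ?thesis by linarith
  next
    case 2
    have "A = 1 \<and> E = 1 \<and> B = 0 \<and> C = 0" by (rule key) (use 2 nn d in auto)
    then show ?thesis by simp
  next
    case 3
    have "C = 1 \<and> B = 1 \<and> E = 0 \<and> A = 0" by (rule key) (use 3 nn d in \<open>auto simp: mult.commute\<close>)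
    then show ?thesis by simp
  qed
qed

text \<open>\<open>x1 y2\<close> and \<open>y1 x2\<close> are consecutive integers, so \<open>(x1 x2) (y1 y2) \<ge> 0\<close> and the two
  coordinate products have the same sign.\<close>

lemma unimodular_l1:
  fixes x1 x2 y1 y2 :: int
  assumes d: "\<bar>x1 * y2 - y1 * x2\<bar> = 1" and l: "\<bar>x1 - x2\<bar> + \<bar>y1 - y2\<bar> \<le> \<bar>x1 + x2\<bar> + \<bar>y1 + y2\<bar>"
  shows "\<bar>x1 + x2\<bar> + \<bar>y1 + y2\<bar> = (\<bar>x1\<bar> + \<bar>y1\<bar>) + (\<bar>x2\<bar> + \<bar>y2\<bar>)"
    "\<bar>x1 - x2\<bar> + \<bar>y1 - y2\<bar> = \<bar>(\<bar>x1\<bar> + \<bar>y1\<bar>) - (\<bar>x2\<bar> + \<bar>y2\<bar>)\<bar> \<or> (\<bar>x1\<bar> + \<bar>y1\<bar> = 1 \<and> \<bar>x2\<bar> + \<bar>y2\<bar> = 1)"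
proof -
  have consec: "0 \<le> P * Q" if "\<bar>P - Q\<bar> = 1" for P Q :: int
  proof -
    have "(0 \<le> P \<and> 0 \<le> Q) \<or> (P \<le> 0 \<and> Q \<le> 0)" using that by linarith
    then show ?thesis by (auto simp: mult_nonneg_nonneg mult_nonpos_nonpos)
  qed
  have PQ: "0 \<le> (x1 * y2) * (y1 * x2)" by (rule consec[OF d])
  then have prod: "0 \<le> (x1 * x2) * (y1 * y2)" by (simp add: algebra_simps)
  have abs_prod: "\<bar>s + t\<bar> = \<bar>s\<bar> + \<bar>t\<bar> \<and> \<bar>s - t\<bar> = \<bar>\<bar>s\<bar> - \<bar>t\<bar>\<bar>" if "0 \<le> s * t" for s t :: int
    using that by (auto simp: zero_le_mult_iff)
  have abs_prod': "\<bar>s - t\<bar> = \<bar>s\<bar> + \<bar>t\<bar>" if "s * t \<le> 0" for s t :: int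
    using that by (auto simp: mult_le_0_iff)
  \<comment> \<open>If a coordinate product were negative, both would be nonpositive, and
    \<open>l\<close> would force equality in the triangle inequalities; both products would then
    vanish.\<close>
  have same: "0 \<le> x1 * x2 \<and> 0 \<le> y1 * y2"
  proof (rule ccontr)
    assume n: "\<not> ?thesis"
    have nonpos: "x1 * x2 \<le> 0 \<and> y1 * y2 \<le> 0" using prod n by (auto simp: zero_le_mult_iff)
    then have "\<bar>x1 - x2\<bar> = \<bar>x1\<bar> + \<bar>x2\<bar>" "\<bar>y1 - y2\<bar> = \<bar>y1\<bar> + \<bar>y2\<bar>" using abs_prod' by auto
    then have "\<bar>x1 + x2\<bar> = \<bar>x1\<bar> + \<bar>x2\<bar>" "\<bar>y1 + y2\<bar> = \<bar>y1\<bar> + \<bar>y2\<bar>" using l by linarith+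
    then have "x1 * x2 = 0" "y1 * y2 = 0" using nonpos by (auto simp: mult_le_0_iff)
    then have "0 \<le> x1 * x2 \<and> 0 \<le> y1 * y2" by (simp only: order_refl)
    with n show False by contradiction
  qed
  note a1 = abs_prod[OF conjunct1[OF same]] and a2 = abs_prod[OF conjunct2[OF same]]
  show "\<bar>x1 + x2\<bar> + \<bar>y1 + y2\<bar> = (\<bar>x1\<bar> + \<bar>y1\<bar>) + (\<bar>x2\<bar> + \<bar>y2\<bar>)" using a1 a2 by linarith
  have "\<bar>x1 * y2 - y1 * x2\<bar> = \<bar>\<bar>x1 * y2\<bar> - \<bar>y1 * x2\<bar>\<bar>" using abs_prod[OF PQ] by blast
  then have "\<bar>\<bar>x1\<bar> * \<bar>y2\<bar> - \<bar>y1\<bar> * \<bar>x2\<bar>\<bar> = 1" using d by (simp add: abs_mult)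
  from unimodular_l1_aux[OF abs_ge_zero abs_ge_zero abs_ge_zero abs_ge_zero this]
  show "\<bar>x1 - x2\<bar> + \<bar>y1 - y2\<bar> = \<bar>(\<bar>x1\<bar> + \<bar>y1\<bar>) - (\<bar>x2\<bar> + \<bar>y2\<bar>)\<bar> \<or> (\<bar>x1\<bar> + \<bar>y1\<bar> = 1 \<and> \<bar>x2\<bar> + \<bar>y2\<bar> = 1)"
    using a1 a2 by auto
qed

text \<open>The longer diagonal is the sum of the lengths of two adjacent sides, the shorter one
  their difference. The exception is the unit square, both of whose diagonals have length 2.\<close>

lemma parallelogram_lengths:
  assumes cd: "c + d = a + b" and u: "\<bar>iori a b c\<bar> = 1" and l: "l1 a b \<le> l1 c d"
  shows "l1 c d = l1 a c + l1 b c" "l1 a b + l1 b c = l1 a c \<or> l1 a b + l1 a c = l1 b c \<or> (l1 a c = 1 \<and> l1 b c = 1)"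
proof -
  have d: "d = a + b - c" using cd by (simp add: algebra_simps)
  let ?x1 = "fst a - fst c" and ?y1 = "snd a - snd c" and ?x2 = "fst b - fst c" and ?y2 = "snd b - snd c"
  have "\<bar>?x1 * ?y2 - ?y1 * ?x2\<bar> = \<bar>iori a b c\<bar>" by (simp add: iori_def algebra_simps)
  then have D: "\<bar>?x1 * ?y2 - ?y1 * ?x2\<bar> = 1" using u by simp
  have ab: "int (l1 a b) = \<bar>?x1 - ?x2\<bar> + \<bar>?y1 - ?y2\<bar>" by (simp add: int_l1)
  have cdl: "int (l1 c d) = \<bar>?x1 + ?x2\<bar> + \<bar>?y1 + ?y2\<bar>" unfolding int_l1 d by simp
  have L: "\<bar>?x1 - ?x2\<bar> + \<bar>?y1 - ?y2\<bar> \<le> \<bar>?x1 + ?x2\<bar> + \<bar>?y1 + ?y2\<bar>" using l ab cdl by linarith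
  have ac: "int (l1 a c) = \<bar>?x1\<bar> + \<bar>?y1\<bar>" "int (l1 b c) = \<bar>?x2\<bar> + \<bar>?y2\<bar>" by (simp_all add: int_l1)
  note r = unimodular_l1[OF D L, folded ab cdl ac]
  show "l1 c d = l1 a c + l1 b c" using r(1) by linarith
  show "l1 a b + l1 b c = l1 a c \<or> l1 a b + l1 a c = l1 b c \<or> (l1 a c = 1 \<and> l1 b c = 1)" using r(2) by linarith
qed

section \<open>Crossings of the reference edge\<close>

text \<open>Along the segment the functional is monotone, so in one of the two directions from
  \<open>y\<close> it does not drop below its positive value at \<open>y\<close>.\<close>

lemma affn_not_both_zero:
  assumes D: "affn D" and y: "y \<in> open_segment r1 r2" and pos: "D y > 0"
    and y1: "y1 \<in> open_segment y r1 \<or> y1 = r1" and y2: "y2 \<in> open_segment y r2 \<or> y2 = r2"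
  shows "\<not> (D y1 = 0 \<and> D y2 = 0)"
proof -
  have yc: "y \<in> closed_segment r1 r2" "y \<in> closed_segment r2 r1"
    using y segment_open_subset_closed by (auto simp: closed_segment_commute)
  have c: "y1 \<in> closed_segment r1 y" "y2 \<in> closed_segment r2 y"
    using y1 y2 segment_open_subset_closed[of y r1] segment_open_subset_closed[of y r2]
    by (auto simp: closed_segment_commute)
  show ?thesis
  proof (cases "D r1 \<le> D r2")
    case True
    then have "D y \<le> D r2" using affn_segment_le(1)[OF D True yc(2)] by simp
    then have "D y \<le> D y2" using affn_segment_le(2)[OF D _ c(2)] by simp
    then show ?thesis using pos by simp
  next
    case False
    then have "D r2 \<le> D r1" by simp
    then have "D y \<le> D r1" using affn_segment_le(1)[OF D _ yc(1)] by simp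
    then have "D y \<le> D y1" using affn_segment_le(2)[OF D _ c(1)] by simp
    then show ?thesis using pos by simp
  qed
qed

context triangulated
begin

text \<open>The reference edge is followed from \<open>y\<close> in both directions to its exits. No
  coordinate can vanish at both exits, which excludes the vertex \<open>c\<close> and two exits of
  the same kind.\<close>

lemma triangle_crossing:
  assumes s: "{a, b} \<in> \<sigma>" "{a, c} \<in> \<sigma>" "{b, c} \<in> \<sigma>" and u: "\<bar>iori a b c\<bar> = 1"
    and g: "g = {r1, r2}" "r1 \<noteq> r2" "\<And>p. rp p \<notin> seg g"
    and y: "y \<in> seg g" "y \<in> tri (rp a) (rp b) (rp c)" and no: "seg {a, b} \<inter> seg g = {}"
  shows "(seg {a, c} \<inter> seg g \<noteq> {} \<and> seg {b, c} \<inter> seg g \<noteq> {}) \<or> (a \<in> g \<and> seg {b, c} \<inter> seg g \<noteq> {})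
    \<or> (b \<in> g \<and> seg {a, c} \<inter> seg g \<noteq> {})"
proof -
  let ?A = "bar (rp a) (rp b) (rp c)" and ?B = "bar (rp b) (rp c) (rp a)" and ?C = "bar (rp c) (rp a) (rp b)"
  have o: "ori (rp a) (rp b) (rp c) \<noteq> 0" using u by (auto simp: ori_rp)
  have o2: "ori (rp b) (rp c) (rp a) \<noteq> 0" "ori (rp c) (rp a) (rp b) \<noteq> 0" using o ori_cyc by metis+
  note vb = quad_vertex_bars[OF u]
  have ne: "a \<noteq> b" "a \<noteq> c" "b \<noteq> c" using s edge_ends by auto
  have yo: "y \<in> open_segment (rp r1) (rp r2)" using y(1) seg_pair[OF g(2)] g(1) by blast
  then have yc: "y \<in> closed_segment (rp r1) (rp r2)" using segment_open_subset_closed by blast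
  have pos: "?A y > 0" "?B y > 0" "?C y > 0" using y(2) by (auto simp: tri_def)
  \<comment> \<open>Each way of leaving is recorded together with a coordinate that vanishes there;
    the last alternative is the exit through \<open>c\<close>.\<close>
  have loc: "\<exists>y'. (y' \<in> open_segment y (rp r) \<or> y' = rp r) \<and>
     ((?A y' = 0 \<and> seg {b, c} \<inter> seg g \<noteq> {}) \<or> (?B y' = 0 \<and> seg {a, c} \<inter> seg g \<noteq> {}) \<or>
      (?B y' = 0 \<and> ?C y' = 0 \<and> a \<in> g) \<or> (?A y' = 0 \<and> ?C y' = 0 \<and> b \<in> g) \<or> (?A y' = 0 \<and> ?B y' = 0))"
    if r: "r \<in> g" for r
  proof -
    have sub: "open_segment y (rp r) \<subseteq> seg g"
      unfolding g(1) seg_pair[OF g(2)] subset_open_segment using yc r g(1) by auto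
    obtain y' where y': "y' \<in> open_segment y (rp r) \<or> y' = rp r"
      "y' \<in> open_segment (rp a) (rp b) \<or> y' \<in> open_segment (rp b) (rp c) \<or> y' \<in> open_segment (rp a) (rp c) \<or> y' \<in> {rp a, rp b, rp c}"
      by (rule exit_tri[OF y(2) lattice_notin_unimodular_tri[OF u]])
    have hit: "seg f \<inter> seg g \<noteq> {}" if f: "f \<in> \<sigma>" "y' \<in> seg f" for f
      using y'(1) sub f edge_lattice_free[OF f(1)] by blast
    have rv: "v \<in> g" if v: "y' = rp v" for v
    proof -
      have "y' \<notin> open_segment y (rp r)" using sub g(3) v by blast
      then have "rp v = rp r" using y'(1) v by simp
      then show ?thesis using r rp_inj by auto
    qed
    consider "y' \<in> open_segment (rp a) (rp b)" | "y' \<in> open_segment (rp b) (rp c)" | "y' \<in> open_segment (rp a) (rp c)"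
      | "y' = rp a" | "y' = rp b" | "y' = rp c" using y'(2) by blast
    then show ?thesis
    proof cases
      case 1
      then have "y' \<in> seg {a, b}" using seg_pair[OF ne(1)] by blast
      then show ?thesis using hit[OF s(1)] no by blast
    next
      case 2
      then have "y' \<in> seg {b, c}" using seg_pair[OF ne(3)] by blast
      moreover have "?A y' = 0" using bar_side[OF o2(1)] 2 segment_open_subset_closed by blast
      ultimately show ?thesis using hit[OF s(3)] y'(1) by blast
    next
      case 3
      then have "y' \<in> seg {a, c}" using seg_pair[OF ne(2)] by blast
      moreover have "y' \<in> closed_segment (rp c) (rp a)"
        using 3 segment_open_subset_closed[of "rp c" "rp a"] by (auto simp: open_segment_commute)
      then have "?B y' = 0" by (rule bar_side[OF o2(2)])
      ultimately show ?thesis using hit[OF s(2)] y'(1) by blast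
    next
      case 4
      then have "?B y' = 0 \<and> ?C y' = 0 \<and> a \<in> g" using rv vb by simp
      then show ?thesis using y'(1) by blast
    next
      case 5
      then have "?A y' = 0 \<and> ?C y' = 0 \<and> b \<in> g" using rv vb by simp
      then show ?thesis using y'(1) by blast
    next
      case 6
      then have "?A y' = 0 \<and> ?B y' = 0" using vb by simp
      then show ?thesis using y'(1) by blast
    qed
  qed
  have r12: "r1 \<in> g" "r2 \<in> g" using g by auto
  obtain y1 where y1: "y1 \<in> open_segment y (rp r1) \<or> y1 = rp r1" and
     l1: "((?A y1 = 0 \<and> seg {b, c} \<inter> seg g \<noteq> {}) \<or> (?B y1 = 0 \<and> seg {a, c} \<inter> seg g \<noteq> {}) \<or>
      (?B y1 = 0 \<and> ?C y1 = 0 \<and> a \<in> g) \<or> (?A y1 = 0 \<and> ?C y1 = 0 \<and> b \<in> g) \<or> (?A y1 = 0 \<and> ?B y1 = 0))"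
    using loc[OF r12(1)] by blast
  obtain y2 where y2: "y2 \<in> open_segment y (rp r2) \<or> y2 = rp r2" and
     l2: "((?A y2 = 0 \<and> seg {b, c} \<inter> seg g \<noteq> {}) \<or> (?B y2 = 0 \<and> seg {a, c} \<inter> seg g \<noteq> {}) \<or>
      (?B y2 = 0 \<and> ?C y2 = 0 \<and> a \<in> g) \<or> (?A y2 = 0 \<and> ?C y2 = 0 \<and> b \<in> g) \<or> (?A y2 = 0 \<and> ?B y2 = 0))"
    using loc[OF r12(2)] by blast
  have "\<not> (?A y1 = 0 \<and> ?A y2 = 0)" "\<not> (?B y1 = 0 \<and> ?B y2 = 0)" "\<not> (?C y1 = 0 \<and> ?C y2 = 0)"
    using affn_not_both_zero[OF affn_bar yo pos(1) y1 y2] affn_not_both_zero[OF affn_bar yo pos(2) y1 y2]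
      affn_not_both_zero[OF affn_bar yo pos(3) y1 y2] by auto
  then show ?thesis using l1 l2 by argo
qed

end

text \<open>An edge leaving the triangle at \<open>a\<close> has integral coordinates at least 1 in the basis \<open>b - a\<close>, \<open>c - a\<close>.\<close>

lemma corner_edge_length:
  assumes u: "\<bar>iori a b c\<bar> = 1" and ar: "a \<noteq> r" and y: "y \<in> seg {a, r}" "y \<in> tri (rp a) (rp b) (rp c)"
    and l: "l1 b c \<le> l1 a c"
  shows "l1 a c \<le> l1 a r"
proof -
  let ?A = "bar (rp a) (rp b) (rp c)" and ?B = "bar (rp b) (rp c) (rp a)" and ?C = "bar (rp c) (rp a) (rp b)"
  have o: "ori (rp a) (rp b) (rp c) \<noteq> 0" using u by (auto simp: ori_rp)
  note vb = quad_vertex_bars[OF u]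
  have yo: "y \<in> open_segment (rp a) (rp r)" using y(1) seg_pair[OF ar] by blast
  have pos: "?B (rp r) > 0" "?C (rp r) > 0"
  proof -
    obtain t where t: "0 < t" "t < 1" "y = (1 - t) *\<^sub>R rp a + t *\<^sub>R rp r"
      using yo unfolding in_segment by blast
    have "?B y = t * ?B (rp r)" "?C y = t * ?C (rp r)" unfolding t(3) affn_convex_comb[OF affn_bar] vb by simp_all
    moreover have "?B y > 0" "?C y > 0" using y(2) by (auto simp: tri_def)
    ultimately show "?B (rp r) > 0" "?C (rp r) > 0" using t by (simp_all add: zero_less_mult_iff)
  qed
  obtain i j where ij: "?C (rp r) = of_int i" "?B (rp r) = of_int j"
    using bar_int(2,3)[OF u, of r] by (auto elim!: Ints_cases)
  have ij1: "i \<ge> 1" "j \<ge> 1" using pos ij by auto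
  have A: "?A (rp r) = 1 - of_int i - of_int j" using bar_sum[OF o, of "rp r"] ij by simp
  have "rp r = ?A (rp r) *\<^sub>R rp a + ?B (rp r) *\<^sub>R rp b + ?C (rp r) *\<^sub>R rp c" by (rule bar_decomp[OF o])
  then have "rp r = (1 - of_int i - of_int j) *\<^sub>R rp a + of_int j *\<^sub>R rp b + of_int i *\<^sub>R rp c" unfolding A ij .
  then have "real_of_int (fst r) = of_int ((1 - i - j) * fst a + j * fst b + i * fst c)"
    "real_of_int (snd r) = of_int ((1 - i - j) * snd a + j * snd b + i * snd c)"
    by (simp_all add: rp_def)
  then have r: "fst r = (1 - i - j) * fst a + j * fst b + i * fst c" "snd r = (1 - i - j) * snd a + j * snd b + i * snd c"
    by (simp_all only: of_int_eq_iff)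
  have tri: "(i + j) * \<bar>p - q\<bar> - j * \<bar>m - q\<bar> \<le> \<bar>p - ((1 - i - j) * p + j * m + i * q)\<bar>" for p q m :: int
  proof -
    have "p - ((1 - i - j) * p + j * m + i * q) = (i + j) * (p - q) - j * (m - q)" by (simp add: algebra_simps)
    moreover have "\<bar>(i + j) * (p - q)\<bar> = (i + j) * \<bar>p - q\<bar>" "\<bar>j * (m - q)\<bar> = j * \<bar>m - q\<bar>" using ij1 by (simp_all add: abs_mult)
    ultimately show ?thesis by linarith
  qed
  \<comment> \<open>Coordinatewise, a - r = (i + j) (a - c) - j (b - c); the reverse triangle
    inequality gives the bound, and the side from \<open>b\<close> to \<open>c\<close> is no longer
    than that from \<open>a\<close> to \<open>c\<close>.\<close>
  have "(i + j) * int (l1 a c) - j * int (l1 b c) \<le> int (l1 a r)"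
    unfolding int_l1 r using tri[of "fst a" "fst c" "fst b"] tri[of "snd a" "snd c" "snd b"] by (simp add: distrib_left)
  moreover have "j * int (l1 b c) \<le> j * int (l1 a c)" using l ij1 by (intro mult_left_mono) auto
  moreover have "1 * int (l1 a c) \<le> i * int (l1 a c)" using ij1 by (intro mult_right_mono) auto
  ultimately show ?thesis by (simp add: distrib_right)
qed

section \<open>Rates of upward flips and counts for charging them\<close>

lemma rate_weight_bound:
  fixes lam \<alpha> :: real
  assumes lam: "0 < lam" and al: "1 < \<alpha>" "lam \<le> \<alpha> powr (- 2)" and nm: "m \<le> n"
  shows "lam ^ n / (lam ^ n + lam ^ m) \<le> \<alpha> powr (- 2 * (real n - real m))"
proof -
  have pos: "0 < lam ^ n" "0 < lam ^ m" using lam by simp_all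
  have "lam ^ n / (lam ^ n + lam ^ m) \<le> lam ^ n / lam ^ m" using pos by (intro divide_left_mono) auto
  also have "\<dots> = lam ^ (n - m)" using lam nm by (simp add: power_diff)
  also have "\<dots> \<le> (\<alpha> powr (- 2)) ^ (n - m)" using lam al by (intro power_mono) auto
  also have "\<dots> = \<alpha> powr (- 2 * real (n - m))" using al by (simp add: powr_power mult.commute)
  finally show ?thesis using nm by (simp add: of_nat_diff)
qed

text \<open>Rate and weight together have exponent twice the old length minus the new length. Apart
  from the unit square this is the longer side minus three times the shorter one; for the unit
  square it is 2 instead of -2, which the factor \<alpha> to the power 4 repairs.\<close>

lemma flip_weight_bound:
  fixes lam \<alpha> \<gamma> :: real
  assumes lam: "0 < lam" and al: "1 < \<alpha>" "lam \<le> \<alpha> powr (- 2)"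
    and cd: "c + d = a + b" and u: "\<bar>iori a b c\<bar> = 1" and l: "l1 a b \<le> l1 c d" and s: "l1 b c \<le> l1 a c"
  shows "lam ^ l1 c d / (lam ^ l1 c d + lam ^ l1 a b) * \<alpha> powr (real (l1 c d) - \<gamma>) \<le>
    \<alpha> powr 4 * \<alpha> powr (- 3 * real (l1 b c)) * \<alpha> powr (real (l1 a c) - \<gamma>)"
proof -
  note pl = parallelogram_lengths[OF cd u l]
  have n: "real (l1 c d) = real (l1 a c) + real (l1 b c)" using pl(1) by simp
  have p: "lam ^ l1 c d / (lam ^ l1 c d + lam ^ l1 a b) \<le> \<alpha> powr (- 2 * (real (l1 c d) - real (l1 a b)))"
    by (rule rate_weight_bound[OF lam al l])
  have rhs: "\<alpha> powr 4 * \<alpha> powr (- 3 * real (l1 b c)) * \<alpha> powr (real (l1 a c) - \<gamma>)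
     = \<alpha> powr (4 - 3 * real (l1 b c) + real (l1 a c) - \<gamma>)" by (simp add: powr_add[symmetric] add_diff_eq)
  have "lam ^ l1 c d / (lam ^ l1 c d + lam ^ l1 a b) * \<alpha> powr (real (l1 c d) - \<gamma>)
      \<le> \<alpha> powr (- 2 * (real (l1 c d) - real (l1 a b))) * \<alpha> powr (real (l1 c d) - \<gamma>)"
    by (rule mult_right_mono[OF p]) simp
  also have "\<dots> = \<alpha> powr (2 * real (l1 a b) - real (l1 c d) - \<gamma>)"
    unfolding powr_add[symmetric] by (rule arg_cong[where f="\<lambda>x. \<alpha> powr x"]) (simp add: algebra_simps)
  also have "\<dots> \<le> \<alpha> powr (4 - 3 * real (l1 b c) + real (l1 a c) - \<gamma>)"
  proof (rule powr_mono)
    have "real (l1 a b) + real (l1 b c) = real (l1 a c) \<or> (real (l1 a c) = real (l1 b c) \<and> real (l1 a b) = 0) \<or> (real (l1 a c) = 1 \<and> real (l1 b c) = 1)"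
      using pl(2) s by (elim disjE) auto
    moreover have "real (l1 a b) \<le> real (l1 c d)" using l by simp
    ultimately show "2 * real (l1 a b) - real (l1 c d) - \<gamma> \<le> 4 - 3 * real (l1 b c) + real (l1 a c) - \<gamma>"
      using n by (elim disjE) linarith+
  qed (use al in simp)
  finally show ?thesis using rhs by simp
qed

text \<open>The edge at \<open>x\<close> is one of the other two sides of a triangle standing on
  \<open>s\<close>. These are the edges whose flips may be charged to \<open>s\<close>.\<close>

definition near :: "lpt list \<Rightarrow> edge set \<Rightarrow> edge \<Rightarrow> real \<times> real \<Rightarrow> bool" where
  "near vs \<sigma> s x \<longleftrightarrow> (\<exists>r\<in>s. \<exists>t. apex vs \<sigma> s t \<and> edge_at \<sigma> x = {r, t})"

lemma (in triangulated) apex_count: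
  assumes s: "s \<in> \<sigma>" shows "finite {t. apex vs \<sigma> s t}" "card {t. apex vs \<sigma> s t} \<le> 2"
proof -
  obtain p q where pq: "p \<noteq> q" "s = {p, q}" "p \<in> Lam0 vs" "q \<in> Lam0 vs" by (rule edgeE[OF s])
  have e: "{p, q} \<in> \<sigma>" using s pq by simp
  have inj: "inj_on (iori p q) {t. apex vs \<sigma> s t}"
    unfolding pq(2) by (rule inj_onI) (use apex_unique[OF e] in blast)
  have sub: "iori p q ` {t. apex vs \<sigma> s t} \<subseteq> {1, -1}"
  proof
    fix i assume "i \<in> iori p q ` {t. apex vs \<sigma> s t}"
    then obtain t where t: "apex vs \<sigma> {p, q} t" "i = iori p q t" unfolding pq(2) by blast
    then have "\<bar>i\<bar> = 1" using apexD(3)[OF t(1) e] by simp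
    then show "i \<in> {1, -1}" by (auto simp: abs_if split: if_splits)
  qed
  show "finite {t. apex vs \<sigma> s t}" by (rule inj_on_finite[OF inj sub]) simp
  have "card {t. apex vs \<sigma> s t} \<le> card {1, -1 :: int}" by (rule card_inj_on_le[OF inj sub]) simp
  then show "card {t. apex vs \<sigma> s t} \<le> 2" by simp
qed

lemma (in triangulated) near_count:
  assumes s: "s \<in> \<sigma>" shows "card {x \<in> Lam vs. near vs \<sigma> s x} \<le> 4"
proof -
  let ?A = "{t. apex vs \<sigma> s t}"
  obtain p q where pq: "p \<noteq> q" "s = {p, q}" "p \<in> Lam0 vs" "q \<in> Lam0 vs" by (rule edgeE[OF s])
  have fin: "finite (s \<times> ?A)" using apex_count[OF s] pq by simp
  have "{x \<in> Lam vs. near vs \<sigma> s x} \<subseteq> (\<lambda>(r, t). mid {r, t}) ` (s \<times> ?A)"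
  proof
    fix x assume x: "x \<in> {x \<in> Lam vs. near vs \<sigma> s x}"
    then obtain r t where rt: "r \<in> s" "apex vs \<sigma> s t" "edge_at \<sigma> x = {r, t}" unfolding near_def by blast
    have "x = mid {r, t}" using edge_at(2)[of x] x rt(3) by simp
    then show "x \<in> (\<lambda>(r, t). mid {r, t}) ` (s \<times> ?A)" using rt by force
  qed
  then have "card {x \<in> Lam vs. near vs \<sigma> s x} \<le> card ((\<lambda>(r, t). mid {r, t}) ` (s \<times> ?A))"
    using fin by (intro card_mono) auto
  also have "\<dots> \<le> card (s \<times> ?A)" by (rule card_image_le[OF fin])
  also have "\<dots> = card s * card ?A" by (rule card_cartesian_product)
  also have "\<dots> \<le> 2 * 2" using apex_count(2)[OF s] pq by (intro mult_mono) auto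
  finally show ?thesis by simp
qed

lemma (in triangulated) first_crossing_unique:
  assumes s: "s \<in> \<sigma>" "apex vs \<sigma> s t" "seg s \<inter> seg g \<noteq> {}"
    and s': "s' \<in> \<sigma>" "apex vs \<sigma> s' t" "seg s' \<inter> seg g \<noteq> {}"
    and g: "g = {t, r}" "t \<noteq> r"
  shows "s = s'"
proof -
  obtain y where y: "y \<in> seg s" "y \<in> seg g" using s(3) by blast
  obtain y' where y': "y' \<in> seg s'" "y' \<in> seg g" using s'(3) by blast
  have inner: "v \<notin> seg f" if e: "e \<in> \<sigma>" "apex vs \<sigma> e t" "z \<in> seg e" "v \<in> open_segment (rp t) z" and f: "f \<in> \<sigma>" for e f v z
  proof -
    obtain p q where pq: "p \<noteq> q" "e = {p, q}" "p \<in> Lam0 vs" "q \<in> Lam0 vs" by (rule edgeE[OF e(1)])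
    have epq: "{p, q} \<in> \<sigma>" and apq: "apex vs \<sigma> {p, q} t" using e pq by auto
    note d = apexD[OF apq epq]
    have o: "ori (rp t) (rp p) (rp q) \<noteq> 0"
      using d(3) ori_cyc[of "rp p" "rp q" "rp t"] by (auto simp: ori_rp)
    have "z \<in> open_segment (rp p) (rp q)" using e(3) seg_pair[OF pq(1)] pq(2) by blast
    then have "v \<in> tri (rp t) (rp p) (rp q)" by (rule open_segment_vertex_tri[OF o _ e(4)])
    then have "v \<in> tri (rp p) (rp q) (rp t)" by (simp add: tri_comm)
    then show ?thesis using triangle_free[OF epq d(1,2,3) f] by blast
  qed
  obtain m where m: "0 < m" "m < 1" "y = (1 - m) *\<^sub>R rp t + m *\<^sub>R rp r"
    using y(2) unfolding g(1) seg_pair[OF g(2)] in_segment by blast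
  obtain m' where m': "0 < m'" "m' < 1" "y' = (1 - m') *\<^sub>R rp t + m' *\<^sub>R rp r"
    using y'(2) unfolding g(1) seg_pair[OF g(2)] in_segment by blast
  have tr: "rp t \<noteq> rp r" using g(2) rp_inj by blast
  have between: "(1 - k) *\<^sub>R rp t + k *\<^sub>R rp r \<in> open_segment (rp t) ((1 - l) *\<^sub>R rp t + l *\<^sub>R rp r)"
    if "0 < k" "k < l" for k l
  proof -
    have "(1 - k/l) *\<^sub>R rp t + (k/l) *\<^sub>R ((1 - l) *\<^sub>R rp t + l *\<^sub>R rp r) = (1 - k) *\<^sub>R rp t + k *\<^sub>R rp r"
      using that by (simp add: prod_eq_iff field_simps)
    moreover have "rp t \<noteq> (1 - l) *\<^sub>R rp t + l *\<^sub>R rp r"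
    proof
      assume "rp t = (1 - l) *\<^sub>R rp t + l *\<^sub>R rp r"
      then have "l *\<^sub>R rp t = l *\<^sub>R rp r" by (simp add: algebra_simps)
      then show False using tr that by simp
    qed
    ultimately show ?thesis using that unfolding in_segment by (intro conjI exI[of _ "k/l"]) auto
  qed
  consider "m = m'" | "m < m'" | "m' < m" by linarith
  then show ?thesis
  proof cases
    case 1
    then have "y = y'" using m m' by simp
    then show ?thesis using edges_disjoint[OF s(1) s'(1) y(1)] y'(1) by simp
  next
    case 2
    have "y \<in> open_segment (rp t) y'" unfolding m(3) m'(3) by (rule between[OF m(1) 2])
    then have False using inner[OF s'(1,2) y'(1) _ s(1)] y(1) by blast
    then show ?thesis ..
  next
    case 3
    have "y' \<in> open_segment (rp t) y" unfolding m(3) m'(3) by (rule between[OF m'(1) 3])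
    then have False using inner[OF s(1,2) y(1) _ s'(1)] y'(1) by blast
    then show ?thesis ..
  qed
qed

section \<open>Tail bounds from a drift condition\<close>

text \<open>The bound \<open>E \<Psi>(\<sigma>\<^sup>t) \<le> q\<^sup>t \<Psi>(\<sigma>) + O(1)\<close> loses an additive constant, which the maximum in the
  conclusion does not allow. The loss is absorbed by a gain at the last \<open>\<approx> s0 N\<close> steps: the tail
  probability is smaller than \<open>\<Psi> / L\<close> by a factor \<open>1 - \<theta>\<close> unless the state lies in \<open>A\<close> and \<open>\<Psi>\<close> is
  concentrated (\<open>\<Psi> < (1 + \<delta>) L\<close>), and there the drift is stronger than \<open>\<epsilon>\<close>.\<close>

lemma drift_tail_bound:
  fixes \<Omega> :: "'s set" and E :: "('s \<Rightarrow> real) \<Rightarrow> 's \<Rightarrow> real" and u :: "nat \<Rightarrow> 's \<Rightarrow> real"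
  assumes N: "N \<ge> 1" and eps: "0 < \<epsilon>" "\<epsilon> < 1" and nn: "0 \<le> D" "0 \<le> C" "0 \<le> C'"
    and dl: "0 < \<delta>" "0 < \<Delta>"
    and s0: "0 < s0" "s0 * (4 * (C + 2)) \<le> 1" "s0 * (4 * (1 + \<delta>)) \<le> \<delta>"
    and kap: "0 < \<kappa>" "\<kappa> \<le> 1/2" "\<kappa> * (2 * (1 + \<delta>)) \<le> \<delta>" "\<kappa> \<le> \<Delta> / 2"
    and c: "c * \<kappa> \<ge> D + C' + C * D"
    and stay: "\<And>f h \<sigma>. \<sigma> \<in> \<Omega> \<Longrightarrow> (\<And>\<tau>. \<tau> \<in> \<Omega> \<Longrightarrow> f \<tau> \<le> h \<tau>) \<Longrightarrow> E f \<sigma> \<le> E h \<sigma> - (h \<sigma> - f \<sigma>) / N"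
    and lin: "\<And>a f b \<sigma>. \<sigma> \<in> \<Omega> \<Longrightarrow> E (\<lambda>\<tau>. a * f \<tau> + b) \<sigma> = a * E f \<sigma> + b"
    and add: "\<And>f h \<sigma>. \<sigma> \<in> \<Omega> \<Longrightarrow> E (\<lambda>\<tau>. f \<tau> + h \<tau>) \<sigma> = E f \<sigma> + E h \<sigma>"
    and Psi0: "\<And>\<sigma>. \<sigma> \<in> \<Omega> \<Longrightarrow> 0 \<le> \<Psi> \<sigma>" and L: "0 \<le> L"
    and u0: "\<And>\<sigma>. \<sigma> \<in> \<Omega> \<Longrightarrow> u 0 \<sigma> = (if A \<sigma> then L else 0)"
    and uS: "\<And>t \<sigma>. \<sigma> \<in> \<Omega> \<Longrightarrow> u (Suc t) \<sigma> = E (u t) \<sigma>"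
    and H0: "\<And>\<sigma>. \<sigma> \<in> \<Omega> \<Longrightarrow> A \<sigma> \<Longrightarrow> L \<le> \<Psi> \<sigma>"
    and H1: "\<And>\<sigma>. \<sigma> \<in> \<Omega> \<Longrightarrow> E \<Psi> \<sigma> \<le> (1 - \<epsilon> / N) * \<Psi> \<sigma> + D / N"
    and H2: "\<And>\<sigma>. \<sigma> \<in> \<Omega> \<Longrightarrow> \<not> A \<sigma> \<Longrightarrow> E (\<lambda>\<tau>. if A \<tau> then L else 0) \<sigma> \<le> (C * \<Psi> \<sigma> + C') / N"
    and H3: "\<And>\<sigma>. \<sigma> \<in> \<Omega> \<Longrightarrow> A \<sigma> \<Longrightarrow> \<Psi> \<sigma> < (1 + \<delta>) * L \<Longrightarrow> E \<Psi> \<sigma> \<le> (1 - (\<epsilon> + \<Delta>) / N) * \<Psi> \<sigma>"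
    and sg: "\<sigma> \<in> \<Omega>"
  shows "u t \<sigma> \<le> max (\<Psi> \<sigma> * (1 - \<epsilon> / N) ^ t) (c + D / (\<epsilon> * (\<kappa> * s0)))"
proof -
  define q where "q = 1 - \<epsilon> / N"
  have eN: "\<epsilon> / N \<le> \<epsilon>" "0 < \<epsilon> / N" using N eps by (auto simp: field_simps)
  have q: "0 < q" "q < 1" using eN eps by (auto simp: q_def)
  have qp: "0 \<le> q ^ t" "q ^ t \<le> 1" for t using q by (auto intro: power_le_one)
  have mono: "E f \<sigma> \<le> E h \<sigma>" if "\<sigma> \<in> \<Omega>" "\<And>\<tau>. \<tau> \<in> \<Omega> \<Longrightarrow> f \<tau> \<le> h \<tau>" for f h \<sigma>
  proof -
    have "0 \<le> (h \<sigma> - f \<sigma>) / N" using that(2)[OF that(1)] N by simp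
    then show ?thesis using stay[where f=f and h=h, OF that] by linarith
  qed
  have const: "E (\<lambda>\<tau>. b) \<sigma> = b" if "\<sigma> \<in> \<Omega>" for b \<sigma>
    using lin[OF that, of 0 "\<lambda>_. 0" b] by simp
  have c0: "c \<ge> 0"
  proof -
    have "0 \<le> C * D" using nn by simp
    then have "0 \<le> c * \<kappa>" using c nn by linarith
    then show ?thesis using kap(1) zero_le_mult_iff[of c \<kappa>] by linarith
  qed
  have s1: "s0 \<le> 1/8"
  proof -
    have "s0 * 8 \<le> s0 * (4 * (C + 2))" using s0(1) nn by (intro mult_left_mono) auto
    then show ?thesis using s0(2) by simp
  qed
  have uL: "u t \<sigma> \<le> L" if "\<sigma> \<in> \<Omega>" for t \<sigma>
    using that
  proof (induction t arbitrary: \<sigma>)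
    case 0 then show ?case using u0 L by simp
  next
    case (Suc t)
    have "E (u t) \<sigma> \<le> E (\<lambda>\<tau>. L) \<sigma>" by (rule mono) (use Suc in auto)
    then show ?case using uS const Suc.prems by simp
  qed
  define C'' where "C'' = C' + C * D"
  have C'': "0 \<le> C''" using nn by (simp add: C''_def)
  \<comment> \<open>Outside \<open>A\<close> the event has to be created, at a rate bounded by
    \<open>H2\<close> in each of at most N steps. The extra C D in the constant pays for the growth
    of the height function by at most D / N per step.\<close>
  have Q: "u t \<sigma> \<le> real t / N * (C * \<Psi> \<sigma> + C'')" if "real t \<le> N" "\<sigma> \<in> \<Omega>" "\<not> A \<sigma>" for t \<sigma>
    using that
  proof (induction t arbitrary: \<sigma>)
    case 0 then show ?case using u0 by simp
  next
    case (Suc t)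
    have tN: "real t \<le> N" using Suc.prems by simp
    let ?I = "\<lambda>\<tau>. if A \<tau> then L else 0"
    let ?k = "real t / N"
    have k: "0 \<le> ?k" "?k \<le> 1" using tN N by auto
    have CP: "0 \<le> C * \<Psi> \<tau> + C''" if "\<tau> \<in> \<Omega>" for \<tau> using Psi0[OF that] nn C'' by simp
    have ineq: "u t \<tau> \<le> ?I \<tau> + (?k * C * \<Psi> \<tau> + ?k * C'')" if "\<tau> \<in> \<Omega>" for \<tau>
    proof -
      have e: "?k * C * \<Psi> \<tau> + ?k * C'' = ?k * (C * \<Psi> \<tau> + C'')" by (simp add: algebra_simps)
      show ?thesis
      proof (cases "A \<tau>")
        case True
        then show ?thesis unfolding e using uL[OF that, of t] mult_nonneg_nonneg[OF k(1) CP[OF that]] by simp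
      next
        case False
        then show ?thesis unfolding e using Suc.IH[OF tN that False] by simp
      qed
    qed
    have "u (Suc t) \<sigma> = E (u t) \<sigma>" using uS Suc.prems by simp
    also have "\<dots> \<le> E (\<lambda>\<tau>. ?I \<tau> + (?k * C * \<Psi> \<tau> + ?k * C'')) \<sigma>" by (rule mono[OF Suc.prems(2) ineq])
    also have "\<dots> = E ?I \<sigma> + (?k * C * E \<Psi> \<sigma> + ?k * C'')"
      using add[OF Suc.prems(2), of ?I "\<lambda>\<tau>. ?k * C * \<Psi> \<tau> + ?k * C''"] lin[OF Suc.prems(2), of "?k * C" \<Psi> "?k * C''"] by simp
    also have "\<dots> \<le> (C * \<Psi> \<sigma> + C') / N + (?k * C * (\<Psi> \<sigma> + D / N) + ?k * C'')"
    proof -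
      have "q * \<Psi> \<sigma> \<le> \<Psi> \<sigma>" using q Psi0[OF Suc.prems(2)] by (simp add: mult_left_le_one_le)
      then have "E \<Psi> \<sigma> \<le> \<Psi> \<sigma> + D / N" using H1[OF Suc.prems(2)] unfolding q_def by linarith
      then have "?k * C * E \<Psi> \<sigma> \<le> ?k * C * (\<Psi> \<sigma> + D / N)"
        by (rule mult_left_mono[OF _ mult_nonneg_nonneg[OF k(1) nn(2)]])
      then show ?thesis using H2[OF Suc.prems(2,3)] by linarith
    qed
    also have "\<dots> = real (Suc t) / N * (C * \<Psi> \<sigma> + C'') - (C * D - ?k * (C * D)) / N"
      by (simp add: C''_def algebra_simps add_divide_distrib diff_divide_distrib)
    also have "\<dots> \<le> real (Suc t) / N * (C * \<Psi> \<sigma> + C'')"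
    proof -
      have "?k * (C * D) \<le> 1 * (C * D)" using k nn by (intro mult_right_mono) auto
      then have "0 \<le> (C * D - ?k * (C * D)) / N" using N by simp
      then show ?thesis by linarith
    qed
    finally show ?case .
  qed
  \<comment> \<open>The coefficient of the constant rises by \<kappa> / N per step. Keeping the
    invariant then requires regaining about \<kappa> \<open>\<Psi>\<close> / N each time.\<close>
  define th where "th t = \<kappa> * real t / N" for t :: nat
  define B where "B t \<sigma> = (1 - th t) * q ^ t * \<Psi> \<sigma> + c * th t" for t \<sigma>
  have EB: "E (B t) \<sigma> = (1 - th t) * q ^ t * E \<Psi> \<sigma> + c * th t" if "\<sigma> \<in> \<Omega>" for t \<sigma>
    unfolding B_def using lin[OF that, of "(1 - th t) * q ^ t" \<Psi> "c * th t"] by simp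
  have P: "u t \<sigma> \<le> B t \<sigma>" if "t = 0 \<or> real (t - 1) \<le> s0 * N" "\<sigma> \<in> \<Omega>" for t \<sigma>
    using that
  proof (induction t arbitrary: \<sigma>)
    case 0 then show ?case using u0 H0 Psi0 by (simp add: B_def th_def)
  next
    case (Suc t)
    have sO: "\<sigma> \<in> \<Omega>" by (rule Suc.prems(2))
    have ts: "real t \<le> s0 * N" using Suc.prems by simp
    have IH: "u t \<tau> \<le> B t \<tau>" if "\<tau> \<in> \<Omega>" for \<tau> by (rule Suc.IH) (use ts that in auto)
    have tN: "real t / N \<le> s0" "0 \<le> real t / N" using ts N by (auto simp: field_simps)
    have the: "th t = \<kappa> * (real t / N)" by (simp add: th_def)
    have "\<kappa> * (real t / N) \<le> 1 * s0" using tN kap by (intro mult_mono) auto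
    moreover have "0 \<le> \<kappa> * (real t / N)" using tN(2) kap(1) by (intro mult_nonneg_nonneg) auto
    ultimately have th: "0 \<le> th t" "th t \<le> s0" unfolding the by simp_all
    have "1 + real t * (- (\<epsilon> / N)) \<le> (1 + - (\<epsilon> / N)) ^ t" using eN eps by (intro Bernoulli_inequality) linarith
    moreover have "real t * (\<epsilon> / N) \<le> s0"
    proof -
      have "real t * (\<epsilon> / N) = real t / N * \<epsilon>" by simp
      also have "\<dots> \<le> s0 * 1" using tN eps s0 by (intro mult_mono) auto
      finally show ?thesis by simp
    qed
    ultimately have qt: "1 - s0 \<le> q ^ t" unfolding q_def by simp
    \<comment> \<open>Up to time about \<open>s0\<close> N the main coefficient has lost at most 2
      \<open>s0\<close>, so \<open>B\<close> remains comparable to the height function.\<close>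
    have coef: "1 - 2 * s0 \<le> (1 - th t) * q ^ t"
    proof -
      have "(1 - s0) * (1 - s0) \<le> (1 - th t) * q ^ t" using th qt s1 by (intro mult_mono) auto
      moreover have "(1 - s0) * (1 - s0) = 1 - 2 * s0 + s0 * s0" by (simp add: algebra_simps)
      ultimately show ?thesis using zero_le_square[of s0] by linarith
    qed
    have P0: "0 \<le> \<Psi> \<sigma>" by (rule Psi0[OF sO])
    have Bge: "(1 - 2 * s0) * \<Psi> \<sigma> \<le> B t \<sigma>"
      using mult_right_mono[OF coef P0] mult_nonneg_nonneg[OF c0 th(1)] unfolding B_def by linarith
    have step: "u (Suc t) \<sigma> \<le> E (B t) \<sigma> - (B t \<sigma> - u t \<sigma>) / N"
      using uS[OF sO] stay[where f="u t" and h="B t", OF sO IH] by simp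
    have thS: "th (Suc t) = th t + \<kappa> / N" unfolding th_def by (simp add: algebra_simps add_divide_distrib)
    have target: "B (Suc t) \<sigma> = (1 - th t) * q ^ t * (q * \<Psi> \<sigma>) + c * th t + (c * \<kappa> - \<kappa> * q ^ Suc t * \<Psi> \<sigma>) / N"
      unfolding B_def thS by (simp add: algebra_simps add_divide_distrib diff_divide_distrib)
    have co1: "0 \<le> (1 - th t) * q ^ t" "(1 - th t) * q ^ t \<le> 1"
      using th s1 qp[of t] by (auto intro!: mult_le_one)
    have kq: "\<kappa> * q ^ Suc t * \<Psi> \<sigma> \<le> \<kappa> * \<Psi> \<sigma>"
      using kap qp[of "Suc t"] P0 by (intro mult_right_mono) (auto simp del: power_Suc intro: mult_left_le)
    \<comment> \<open>The hypothesis \<open>stay\<close> passes on a fraction 1 / N of the current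
      gap \<open>B t \<sigma> - u t \<sigma>\<close>. It has to cover the drift loss D and the
      increase of the coefficient, of which c \<kappa> is already paid for.\<close>
    have easy: "u (Suc t) \<sigma> \<le> B (Suc t) \<sigma>" if gap: "D + \<kappa> * \<Psi> \<sigma> \<le> B t \<sigma> - u t \<sigma> + c * \<kappa>"
    proof -
      have "E \<Psi> \<sigma> \<le> q * \<Psi> \<sigma> + D / N" using H1[OF sO] by (simp add: q_def)
      then have "(1 - th t) * q ^ t * E \<Psi> \<sigma> \<le> (1 - th t) * q ^ t * (q * \<Psi> \<sigma> + D / N)"
        using co1(1) by (rule mult_left_mono)
      also have "\<dots> = (1 - th t) * q ^ t * (q * \<Psi> \<sigma>) + (1 - th t) * q ^ t * (D / N)" by (rule distrib_left)
      also have "(1 - th t) * q ^ t * (D / N) \<le> 1 * (D / N)" using co1(2) nn N by (intro mult_right_mono) auto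
      finally have 1: "E (B t) \<sigma> \<le> (1 - th t) * q ^ t * (q * \<Psi> \<sigma>) + D / N + c * th t" unfolding EB[OF sO] by linarith
      have "D - (B t \<sigma> - u t \<sigma>) \<le> c * \<kappa> - \<kappa> * q ^ Suc t * \<Psi> \<sigma>" using gap kq by linarith
      then have "(D - (B t \<sigma> - u t \<sigma>)) / N \<le> (c * \<kappa> - \<kappa> * q ^ Suc t * \<Psi> \<sigma>) / N" using N by (intro divide_right_mono) auto
      then have "D / N - (B t \<sigma> - u t \<sigma>) / N \<le> (c * \<kappa> - \<kappa> * q ^ Suc t * \<Psi> \<sigma>) / N" by (simp add: diff_divide_distrib)
      then show ?thesis unfolding target using step 1 by linarith
    qed
    have cD: "D + C'' \<le> c * \<kappa>" using c by (simp add: C''_def)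
    \<comment> \<open>The gap is large outside \<open>A\<close> because \<open>u\<close> is small
      there, and for a spread height function because \<open>u\<close> is at most L. In the
      concentrated case no gap is available and the stronger drift must pay.\<close>
    consider (out) "\<not> A \<sigma>" | (spread) "A \<sigma>" "(1 + \<delta>) * L \<le> \<Psi> \<sigma>" | (conc) "A \<sigma>" "\<Psi> \<sigma> < (1 + \<delta>) * L" by linarith
    then show ?case
    proof cases
      case out
      have "s0 * N \<le> 1 * N" using s1 N by (intro mult_right_mono) auto
      then have "real t \<le> N" using ts by simp
      then have "u t \<sigma> \<le> real t / N * (C * \<Psi> \<sigma> + C'')" by (rule Q[OF _ sO out])
      also have "\<dots> \<le> s0 * (C * \<Psi> \<sigma> + C'')" using tN nn C'' P0 by (intro mult_right_mono) auto
      finally have ut: "u t \<sigma> \<le> s0 * (C * \<Psi> \<sigma> + C'')" .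
      have "s0 * C'' \<le> 1 * C''" using s1 C'' by (intro mult_right_mono) auto
      moreover have "s0 * (4 * (C + 2)) * \<Psi> \<sigma> \<le> 1 * \<Psi> \<sigma>" using s0(2) P0 by (rule mult_right_mono)
      moreover have "\<kappa> * \<Psi> \<sigma> \<le> 1/2 * \<Psi> \<sigma>" using kap P0 by (intro mult_right_mono) auto
      ultimately have "D + \<kappa> * \<Psi> \<sigma> \<le> B t \<sigma> - u t \<sigma> + c * \<kappa>" using ut Bge cD P0 by (simp add: algebra_simps)
      then show ?thesis by (rule easy)
    next
      case spread
      have d1: "1 + \<delta> > 0" using dl by simp
      have uu: "(1 + \<delta>) * u t \<sigma> \<le> \<Psi> \<sigma>" using mult_left_mono[OF uL[OF sO, of t], of "1 + \<delta>"] spread(2) d1 by linarith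
      have "(1 + \<delta>) * (\<kappa> * \<Psi> \<sigma> + u t \<sigma>) \<le> (1 + \<delta>) * ((1 - 2 * s0) * \<Psi> \<sigma>)"
      proof -
        have "\<kappa> * (2 * (1 + \<delta>)) * \<Psi> \<sigma> \<le> \<delta> * \<Psi> \<sigma>" "s0 * (4 * (1 + \<delta>)) * \<Psi> \<sigma> \<le> \<delta> * \<Psi> \<sigma>"
          using kap(3) s0(3) P0 by (auto intro: mult_right_mono)
        then show ?thesis using uu by (simp add: algebra_simps)
      qed
      then have "\<kappa> * \<Psi> \<sigma> + u t \<sigma> \<le> (1 - 2 * s0) * \<Psi> \<sigma>" using d1 by (rule mult_left_le_imp_le)
      then have "D + \<kappa> * \<Psi> \<sigma> \<le> B t \<sigma> - u t \<sigma> + c * \<kappa>" using Bge cD C'' by linarith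
      then show ?thesis by (rule easy)
    next
      case conc
      have "E \<Psi> \<sigma> \<le> q * \<Psi> \<sigma> - \<Delta> / N * \<Psi> \<sigma>" using H3[OF sO conc] by (simp add: q_def algebra_simps add_divide_distrib)
      then have "(1 - th t) * q ^ t * E \<Psi> \<sigma> \<le> (1 - th t) * q ^ t * (q * \<Psi> \<sigma> - \<Delta> / N * \<Psi> \<sigma>)"
        using co1(1) by (rule mult_left_mono)
      then have 1: "E (B t) \<sigma> \<le> (1 - th t) * q ^ t * (q * \<Psi> \<sigma>) - (1 - th t) * \<Delta> * q ^ t * \<Psi> \<sigma> / N + c * th t"
        unfolding EB[OF sO] by (simp add: algebra_simps diff_divide_distrib)
      have "\<kappa> \<le> (1 - th t) * \<Delta>"
      proof -
        have "1/2 * \<Delta> \<le> (1 - th t) * \<Delta>" using th s1 dl by (intro mult_right_mono) auto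
        then show ?thesis using kap(4) by simp
      qed
      then have "\<kappa> * (q * (q ^ t * \<Psi> \<sigma>)) \<le> (1 - th t) * \<Delta> * (q ^ t * \<Psi> \<sigma>)"
      proof -
        assume k: "\<kappa> \<le> (1 - th t) * \<Delta>"
        have nq: "0 \<le> q ^ t * \<Psi> \<sigma>" using qp P0 by simp
        have "\<kappa> * (q * (q ^ t * \<Psi> \<sigma>)) \<le> \<kappa> * (1 * (q ^ t * \<Psi> \<sigma>))"
          using kap q nq by (intro mult_left_mono mult_right_mono) auto
        also have "\<dots> \<le> (1 - th t) * \<Delta> * (q ^ t * \<Psi> \<sigma>)" using mult_right_mono[OF k nq] by simp
        finally show ?thesis .
      qed
      then have "- ((1 - th t) * \<Delta> * q ^ t * \<Psi> \<sigma>) \<le> c * \<kappa> - \<kappa> * q ^ Suc t * \<Psi> \<sigma>"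
        using mult_nonneg_nonneg[OF c0, of \<kappa>] kap by (simp add: mult.assoc)
      then have "- ((1 - th t) * \<Delta> * q ^ t * \<Psi> \<sigma>) / N \<le> (c * \<kappa> - \<kappa> * q ^ Suc t * \<Psi> \<sigma>) / N"
        using N by (intro divide_right_mono) auto
      moreover have "0 \<le> (B t \<sigma> - u t \<sigma>) / N" using IH[OF sO] N by simp
      ultimately show ?thesis unfolding target using step 1 by simp
    qed
  qed
  \<comment> \<open>The first integer time beyond \<open>s0\<close> N. Its predecessor still
    satisfies the bound needed for the induction above, and the coefficient is then at least
    \<kappa> \<open>s0\<close>.\<close>
  define T where "T = nat \<lfloor>s0 * N\<rfloor> + 1"
  have sN: "0 \<le> s0 * N" using s0 N by simp
  have T: "real (T - 1) \<le> s0 * N" "s0 * N \<le> real T"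
  proof -
    have n: "real (nat \<lfloor>s0 * N\<rfloor>) = of_int \<lfloor>s0 * N\<rfloor>" using sN by simp
    have f: "of_int \<lfloor>s0 * N\<rfloor> \<le> s0 * N" "s0 * N \<le> of_int \<lfloor>s0 * N\<rfloor> + 1" by linarith+
    have T1: "real (T - 1) = of_int \<lfloor>s0 * N\<rfloor>" "real T = of_int \<lfloor>s0 * N\<rfloor> + 1" unfolding T_def using n by simp_all
    show "real (T - 1) \<le> s0 * N" "s0 * N \<le> real T" unfolding T1 using f by simp_all
  qed
  have thT: "\<kappa> * s0 \<le> th T" "th T \<le> 1"
  proof -
    have "s0 \<le> real T / N" using T N by (simp add: field_simps)
    then have "\<kappa> * s0 \<le> \<kappa> * (real T / N)" using kap(1) by (intro mult_left_mono) auto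
    then show "\<kappa> * s0 \<le> th T" by (simp add: th_def)
    have "real T \<le> s0 * N + 1" using T(1) unfolding T_def by simp
    also have "\<dots> \<le> 1 * N + N" using s1 N by (intro add_mono mult_right_mono) auto
    finally have "real T / N \<le> 2" using N by (simp add: field_simps)
    then have "\<kappa> * (real T / N) \<le> 1/2 * 2" using kap N by (intro mult_mono) auto
    then show "th T \<le> 1" unfolding th_def by simp
  qed
  have thpos: "0 < th T" using thT(1) mult_pos_pos[OF kap(1) s0(1)] by linarith
  \<comment> \<open>From here on the coefficient is frozen and nothing is gained; the losses D / N
    form a geometric series with total below D / \<epsilon>.\<close>
  have late: "u (T + n) \<sigma> \<le> (1 - th T) * q ^ (T + n) * \<Psi> \<sigma> + c * th T + D / \<epsilon> * (1 - q ^ n)" if "\<sigma> \<in> \<Omega>" for n \<sigma>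
    using that
  proof (induction n arbitrary: \<sigma>)
    case 0
    then show ?case using P[of T \<sigma>] T by (simp add: B_def)
  next
    case (Suc n)
    note sO = Suc.prems
    let ?a = "(1 - th T) * q ^ (T + n)" and ?b = "c * th T + D / \<epsilon> * (1 - q ^ n)"
    have "u (T + Suc n) \<sigma> = E (u (T + n)) \<sigma>" using uS[OF sO] by simp
    also have "\<dots> \<le> E (\<lambda>\<tau>. ?a * \<Psi> \<tau> + ?b) \<sigma>" by (rule mono[OF sO]) (use Suc.IH in \<open>auto simp: add.assoc\<close>)
    also have "\<dots> = ?a * E \<Psi> \<sigma> + ?b" by (rule lin[OF sO])
    also have "?a * E \<Psi> \<sigma> \<le> ?a * (q * \<Psi> \<sigma> + D / N)"
      using H1[OF sO] thT qp by (intro mult_left_mono) (auto simp: q_def)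
    also have "?a * (q * \<Psi> \<sigma> + D / N) = (1 - th T) * q ^ (T + Suc n) * \<Psi> \<sigma> + ?a * (D / N)"
      by (simp add: algebra_simps)
    also have "?a * (D / N) \<le> q ^ n * (D / N)"
    proof -
      have "(1 - th T) * (q ^ T * q ^ n) \<le> 1 * (1 * q ^ n)"
        using thT thpos qp by (intro mult_mono mult_right_mono) auto
      then show ?thesis using nn N by (intro mult_right_mono) (auto simp: power_add)
    qed
    also have "q ^ n * (D / N) = D / \<epsilon> * (q ^ n - q ^ Suc n)"
      using eps by (simp add: q_def algebra_simps)
    finally show ?case by (simp add: algebra_simps)
  qed
  show ?thesis
  proof (cases "t \<le> T")
    case True
    have th1: "0 \<le> th t" "th t \<le> 1"
    proof -
      show "0 \<le> th t" using kap N by (simp add: th_def)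
      have "th t \<le> th T" unfolding th_def using True kap N by (intro divide_right_mono mult_left_mono) auto
      then show "th t \<le> 1" using thT by simp
    qed
    have "t = 0 \<or> real (t - 1) \<le> s0 * N" using True T(1) by (cases t) auto
    then have "u t \<sigma> \<le> (1 - th t) * (q ^ t * \<Psi> \<sigma>) + th t * c" using P[OF _ sg] by (simp add: B_def algebra_simps)
    also have "\<dots> \<le> (1 - th t) * max (\<Psi> \<sigma> * q ^ t) c + th t * max (\<Psi> \<sigma> * q ^ t) c"
      using th1 by (intro add_mono mult_left_mono) (auto simp: mult.commute)
    also have "\<dots> = max (\<Psi> \<sigma> * q ^ t) c" by (simp add: algebra_simps)
    also have "\<dots> \<le> max (\<Psi> \<sigma> * q ^ t) (c + D / (\<epsilon> * (\<kappa> * s0)))"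
      using nn eps kap s0 by (intro max.mono) auto
    finally show ?thesis by (simp add: q_def)
  next
    case False
    define n where "n = t - T"
    have t: "t = T + n" using False by (simp add: n_def)
    let ?c = "c + D / (\<epsilon> * (\<kappa> * s0))"
    have "D / \<epsilon> * (1 - q ^ n) \<le> D / \<epsilon> * 1" using nn eps qp[of n] by (intro mult_left_mono) auto
    also have "D / \<epsilon> * 1 \<le> th T * (D / (\<epsilon> * (\<kappa> * s0)))"
    proof -
      have "D / \<epsilon> * 1 = (\<kappa> * s0) * (D / (\<epsilon> * (\<kappa> * s0)))" using kap s0 eps by simp
      also have "\<dots> \<le> th T * (D / (\<epsilon> * (\<kappa> * s0)))" using thT nn eps kap s0 by (intro mult_right_mono) auto
      finally show ?thesis .
    qed
    finally have "u t \<sigma> \<le> (1 - th T) * (q ^ t * \<Psi> \<sigma>) + th T * ?c"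
      using late[OF sg, of n] unfolding t by (simp add: algebra_simps)
    also have "\<dots> \<le> (1 - th T) * max (\<Psi> \<sigma> * q ^ t) ?c + th T * max (\<Psi> \<sigma> * q ^ t) ?c"
      using thT thpos by (intro add_mono mult_left_mono) (auto simp: mult.commute)
    also have "\<dots> = max (\<Psi> \<sigma> * q ^ t) ?c" by (simp add: algebra_simps)
    finally show ?thesis by (simp add: q_def)
  qed
qed

section \<open>The drift of the height function\<close>

text \<open>The upper bound on \<alpha> is used only as
  \<open>lam \<le> \<alpha> powr (- 2)\<close>: lengthening an edge by n costs at least \<alpha> to
  the power -2 n in rate and gains \<alpha> to the power n in weight.\<close>

locale weighted = glauber +
  fixes lam \<alpha> :: real and g :: edge
  assumes lam: "0 < lam" and al: "1 < \<alpha>" "lam \<le> \<alpha> powr (- 2)" and gG: "g \<in> G vs \<xi>"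
begin

abbreviation w :: "edge \<Rightarrow> real" where "w \<equiv> wt \<alpha> g"
abbreviation old :: "edge set \<Rightarrow> real \<times> real \<Rightarrow> edge" where "old \<sigma> x \<equiv> edge_at \<sigma> x"
abbreviation new :: "edge set \<Rightarrow> real \<times> real \<Rightarrow> edge" where "new \<sigma> x \<equiv> edge_at (flip vs \<sigma> x) x"
abbreviation fl :: "edge set \<Rightarrow> (real \<times> real) set" where "fl \<sigma> \<equiv> flips vs \<xi> \<sigma>"
abbreviation rt :: "edge set \<Rightarrow> real \<times> real \<Rightarrow> real" where "rt \<equiv> rate lam vs"

lemma g_props:
  obtains r1 r2 where "g = {r1, r2}" "r1 \<noteq> r2" "\<And>p. rp p \<notin> seg g" "mid g \<in> \<Lambda>" "\<Omega> \<noteq> {}"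
proof -
  obtain x where x: "x \<in> \<Lambda>" "g \<in> ground vs \<xi> x" using gG unfolding G_def by blast
  then obtain \<sigma> where s: "\<sigma> \<in> \<Omega>" "g = edge_at \<sigma> x" unfolding ground_def Ex_def by blast
  interpret triangulated vs \<sigma> by (rule Omega_trg[OF s(1)])
  have gs: "g \<in> \<sigma>" "mid g = x" using edge_at[OF x(1)] s(2) by auto
  obtain r1 r2 where r: "r1 \<noteq> r2" "g = {r1, r2}" "r1 \<in> Lam0 vs" "r2 \<in> Lam0 vs" by (rule edgeE[OF gs(1)])
  show ?thesis by (rule that[OF r(2,1) edge_lattice_free[OF gs(1)]]) (use gs x s in auto)
qed

lemma len_g_pos: "1 \<le> len g"
proof -
  obtain r1 r2 where g: "g = {r1, r2}" "r1 \<noteq> r2" by (rule g_props, rule that)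
  have "l1 r1 r2 \<noteq> 0"
  proof
    assume "l1 r1 r2 = 0"
    then have "fst r1 = fst r2" "snd r1 = snd r2" using int_l1[of r1 r2] by linarith+
    then show False using g(2) by (simp add: prod_eq_iff)
  qed
  then show ?thesis unfolding g(1) len_pair by simp
qed

lemma flE:
  assumes "\<sigma> \<in> \<Omega>" "x \<in> fl \<sigma>"
  obtains a b c d where "quad \<sigma> a b c d" "x = mid {a, b}" "{a, b} \<notin> \<xi>" "old \<sigma> x = {a, b}" "new \<sigma> x = {c, d}"
proof -
  have x: "x \<in> \<Lambda>" "flippable vs \<xi> \<sigma> x" using assms(2) by (auto simp: flips_def)
  obtain a b c d where q: "quad \<sigma> a b c d" "x = mid {a, b}" "{a, b} \<notin> \<xi>" by (rule flippable_quad[OF assms(1) x])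
  show ?thesis using that[OF q] flip_props(3,4)[OF assms(1) q(1,3)] q(2) by blast
qed

lemma finite_fl: "finite (fl \<sigma>)"
  using finite_Lam by (simp add: flips_def)

lemma rate_le_one: "rt \<sigma> x \<le> 1" "0 \<le> rt \<sigma> x"
  using rate_bounds[OF lam, of vs \<sigma> x] by auto

text \<open>The diagonal \<open>{c, d}\<close> meets \<open>g\<close> and \<open>{a, b}\<close> does not: then \<open>g\<close> either crosses the longer
  side of the parallelogram or starts at a corner and is at least as long as that side.\<close>

lemma new_diagonal_crossing:
  assumes s: "\<sigma> \<in> \<Omega>" and q: "quad \<sigma> a b c d"
    and cr: "seg {c, d} \<inter> seg g \<noteq> {}" and no: "seg {a, b} \<inter> seg g = {}"
  obtains a' b' c' d' where "quad \<sigma> a' b' c' d'" "{a', b'} = {a, b}" "{c', d'} = {c, d}" "l1 b' c' \<le> l1 a' c'"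
    "seg {a', c'} \<inter> seg g \<noteq> {} \<or> (a' \<in> g \<and> seg {b', c'} \<inter> seg g \<noteq> {} \<and> l1 a' c' \<le> len g)"
proof -
  interpret triangulated vs \<sigma> by (rule Omega_trg[OF s])
  obtain r1 r2 where g: "g = {r1, r2}" "r1 \<noteq> r2" "\<And>p. rp p \<notin> seg g" by (rule g_props, rule that)
  define concl where "concl = (\<exists>a' b' c' d'. quad \<sigma> a' b' c' d' \<and> {a', b'} = {a, b} \<and> {c', d'} = {c, d} \<and> l1 b' c' \<le> l1 a' c' \<and>
    (seg {a', c'} \<inter> seg g \<noteq> {} \<or> (a' \<in> g \<and> seg {b', c'} \<inter> seg g \<noteq> {} \<and> l1 a' c' \<le> len g)))"
  \<comment> \<open>The longer of the two sides is named \<open>{a', c'}\<close>. If it is not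
    crossed, \<open>g\<close> starts at \<open>a'\<close> and enters the triangle, and
    \<open>corner_edge_length\<close> bounds that side by the length of \<open>g\<close>.\<close>
  have label: concl if q': "quad \<sigma> a' b' c' d'" "{a', b'} = {a, b}" "{c', d'} = {c, d}" "l1 b' c' \<le> l1 a' c'"
    and y: "y \<in> seg g" "y \<in> tri (rp a') (rp b') (rp c')"
    and x: "seg {a', c'} \<inter> seg g \<noteq> {} \<or> (a' \<in> g \<and> seg {b', c'} \<inter> seg g \<noteq> {})" for a' b' c' d' y
  proof (cases "seg {a', c'} \<inter> seg g \<noteq> {}")
    case True
    then show ?thesis unfolding concl_def using q' by blast
  next
    case False
    then have a': "a' \<in> g" "seg {b', c'} \<inter> seg g \<noteq> {}" using x by auto
    obtain r where r: "g = {a', r}" "a' \<noteq> r" using a'(1) g(1,2) by (metis insert_commute insert_iff singletonD)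
    have u: "\<bar>iori a' b' c'\<bar> = 1" using q'(1) by (simp add: quad_def)
    have "l1 a' c' \<le> l1 a' r"
      by (rule corner_edge_length[OF u r(2) _ y(2) q'(4)]) (use y(1) r(1) in simp)
    then have "l1 a' c' \<le> len g" unfolding r(1) len_pair .
    then show ?thesis unfolding concl_def using q' a' by blast
  qed
  have side: concl if q': "quad \<sigma> a b c' d'" "{c', d'} = {c, d}" and y: "y \<in> seg g" "y \<in> tri (rp a) (rp b) (rp c')" for c' d' y
  proof -
    have u: "\<bar>iori a b c'\<bar> = 1" and e: "{a, b} \<in> \<sigma>" "{a, c'} \<in> \<sigma>" "{b, c'} \<in> \<sigma>" using q'(1) by (auto simp: quad_def)
    have t: "(seg {a, c'} \<inter> seg g \<noteq> {} \<and> seg {b, c'} \<inter> seg g \<noteq> {}) \<or> (a \<in> g \<and> seg {b, c'} \<inter> seg g \<noteq> {})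
      \<or> (b \<in> g \<and> seg {a, c'} \<inter> seg g \<noteq> {})"
      by (rule triangle_crossing[OF e u g y no])
    show ?thesis
    proof (cases "l1 b c' \<le> l1 a c'")
      case True
      show ?thesis by (rule label[OF q'(1) refl q'(2) True y]) (use t in blast)
    next
      case False
      then have le: "l1 a c' \<le> l1 b c'" by simp
      have y': "y \<in> tri (rp b) (rp a) (rp c')" using y(2) by (simp add: tri_comm)
      have ba: "{b, a} = {a, b}" by blast
      show ?thesis by (rule label[OF quad_sym(1)[OF q'(1)] ba q'(2) le y(1) y']) (use t in blast)
    qed
  qed
  have qq: "c + d = a + b" "\<bar>iori a b c\<bar> = 1" "a \<noteq> b" "c \<noteq> d" using q by (auto simp: quad_def)
  obtain y where y: "y \<in> seg {c, d}" "y \<in> seg g" using cr by blast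
  have "y \<in> tri (rp a) (rp b) (rp c) \<or> y = mid {a, b} \<or> y \<in> tri (rp a) (rp b) (rp d)"
    using diagonal_cases[OF qq(1,2,3)] y(1) seg_pair[OF qq(4)] by blast
  moreover have "y \<noteq> mid {a, b}" using no y(2) mid_in_seg[OF qq(3)] by blast
  ultimately have concl
    using side[OF q refl y(2)] side[OF quad_sym(2)[OF q] _ y(2)] insert_commute[of d c "{}"] by blast
  then show ?thesis unfolding concl_def using that by blast
qed

text \<open>If \<open>g\<close> crosses the longer side, that side is charged, with decay in the
  shorter one. Otherwise \<open>g\<close> starts at a corner and the longer side is no longer than
  \<open>g\<close>, so the charge is bounded by a constant and is assigned to the opposite
  side.\<close>

lemma up_flip_charge:
  assumes s: "\<sigma> \<in> \<Omega>" and x: "x \<in> fl \<sigma>" and l: "len (old \<sigma> x) \<le> len (new \<sigma> x)"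
    and cr: "seg (new \<sigma> x) \<inter> seg g \<noteq> {}" and no: "seg (old \<sigma> x) \<inter> seg g = {}"
  shows "\<exists>s\<in>\<sigma>. near vs \<sigma> s x \<and> seg s \<inter> seg g \<noteq> {} \<and>
    ((\<exists>r\<in>s. \<exists>t. apex vs \<sigma> s t \<and> rt \<sigma> x * w (new \<sigma> x) \<le> \<alpha> powr 4 * \<alpha> powr (- 3 * real (l1 r t)) * w s) \<or>
     ((\<exists>t\<in>g. apex vs \<sigma> s t) \<and> rt \<sigma> x * w (new \<sigma> x) \<le> \<alpha> powr 4))"
proof -
  obtain a0 b0 c0 d0 where q0: "quad \<sigma> a0 b0 c0 d0" "x = mid {a0, b0}" "{a0, b0} \<notin> \<xi>" "old \<sigma> x = {a0, b0}" "new \<sigma> x = {c0, d0}"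
    by (rule flE[OF s x])
  obtain a b c d where q: "quad \<sigma> a b c d" "{a, b} = {a0, b0}" "{c, d} = {c0, d0}" "l1 b c \<le> l1 a c"
    and alt: "seg {a, c} \<inter> seg g \<noteq> {} \<or> (a \<in> g \<and> seg {b, c} \<inter> seg g \<noteq> {} \<and> l1 a c \<le> len g)"
    by (rule new_diagonal_crossing[OF s q0(1)]) (use cr no q0 in auto)
  have o: "old \<sigma> x = {a, b}" and n: "new \<sigma> x = {c, d}" using q0 q by auto
  interpret triangulated vs \<sigma> by (rule Omega_trg[OF s])
  have u: "\<bar>iori a b c\<bar> = 1" and cd: "c + d = a + b" and e: "{a, b} \<in> \<sigma>" "{a, c} \<in> \<sigma>" "{b, c} \<in> \<sigma>"
    using q(1) by (auto simp: quad_def)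
  have ne: "a \<noteq> b" "a \<noteq> c" "b \<noteq> c" using e edge_ends by auto
  have e': "{b, a} \<in> \<sigma>" "{c, a} \<in> \<sigma>" "{c, b} \<in> \<sigma>" using e by (simp_all add: insert_commute)
  have u': "\<bar>iori a c b\<bar> = 1" "\<bar>iori b c a\<bar> = 1" using u by (auto simp: iori_def algebra_simps)
  have lab: "l1 a b \<le> l1 c d" using l unfolding o n len_pair .
  have B: "rt \<sigma> x * w (new \<sigma> x) \<le> \<alpha> powr 4 * \<alpha> powr (- 3 * real (l1 b c)) * \<alpha> powr (real (l1 a c) - real (len g))"
    using flip_weight_bound[OF lam al cd u lab q(4), of "real (len g)"] cr unfolding rate_def o n wt_def len_pair by simp
  show ?thesis
  proof (cases "seg {a, c} \<inter> seg g \<noteq> {}")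
    case True
    have ap: "apex vs \<sigma> {a, c} b" by (rule apexI[OF ne(2) e(1) e'(3) u'(1)])
    have nr: "near vs \<sigma> {a, c} x" unfolding near_def o using ap by blast
    have "rt \<sigma> x * w (new \<sigma> x) \<le> \<alpha> powr 4 * \<alpha> powr (- 3 * real (l1 c b)) * w {a, c}"
      using B True by (simp add: wt_def len_pair l1_commute)
    then have "\<exists>r\<in>{a, c}. \<exists>t. apex vs \<sigma> {a, c} t \<and> rt \<sigma> x * w (new \<sigma> x) \<le> \<alpha> powr 4 * \<alpha> powr (- 3 * real (l1 r t)) * w {a, c}"
      using ap by blast
    then show ?thesis using e(2) nr True by blast
  next
    case False
    then have a: "a \<in> g" "seg {b, c} \<inter> seg g \<noteq> {}" "l1 a c \<le> len g" using alt by auto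
    have ap: "apex vs \<sigma> {b, c} a" by (rule apexI[OF ne(3) e'(1,2) u'(2)])
    have "old \<sigma> x = {b, a}" using o by (simp add: insert_commute)
    then have nr: "near vs \<sigma> {b, c} x" unfolding near_def using ap by blast
    have "\<alpha> powr (- 3 * real (l1 b c)) \<le> \<alpha> powr 0" "\<alpha> powr (real (l1 a c) - real (len g)) \<le> \<alpha> powr 0"
      using al(1) a(3) by (intro powr_mono; simp)+
    then have le1: "\<alpha> powr (- 3 * real (l1 b c)) \<le> 1" "\<alpha> powr (real (l1 a c) - real (len g)) \<le> 1" using al(1) by simp_all
    have "\<alpha> powr 4 * \<alpha> powr (- 3 * real (l1 b c)) * \<alpha> powr (real (l1 a c) - real (len g)) \<le> \<alpha> powr 4 * 1 * 1"
      using le1 by (intro mult_mono) auto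
    then have "rt \<sigma> x * w (new \<sigma> x) \<le> \<alpha> powr 4" using B by linarith
    then show ?thesis using e(3) nr a ap by blast
  qed
qed

text \<open>The new edge replaces one already counted, and the loss in the rate outweighs the gain
  in weight.\<close>

lemma up_flip_same:
  assumes s: "\<sigma> \<in> \<Omega>" and x: "x \<in> fl \<sigma>" and l: "len (old \<sigma> x) \<le> len (new \<sigma> x)" and no: "seg (old \<sigma> x) \<inter> seg g \<noteq> {}"
  shows "rt \<sigma> x * w (new \<sigma> x) \<le> w (old \<sigma> x)"
proof (cases "seg (new \<sigma> x) \<inter> seg g = {}")
  case True
  then have "w (new \<sigma> x) = 0" by (simp add: wt_def)
  then show ?thesis using wt_nonneg by simp
next
  case False
  have "rt \<sigma> x * w (new \<sigma> x) \<le> \<alpha> powr (- 2 * (real (len (new \<sigma> x)) - real (len (old \<sigma> x)))) * w (new \<sigma> x)"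
    unfolding rate_def by (rule mult_right_mono[OF rate_weight_bound[OF lam al l] wt_nonneg])
  also have "\<dots> = \<alpha> powr (- 2 * (real (len (new \<sigma> x)) - real (len (old \<sigma> x))) + (real (len (new \<sigma> x)) - real (len g)))"
    using False by (simp only: wt_def if_True powr_add not_False_eq_True)
  also have "\<dots> \<le> \<alpha> powr (real (len (old \<sigma> x)) - real (len g))"
    using al(1) l by (intro powr_mono) auto
  also have "\<dots> = w (old \<sigma> x)" using no by (simp add: wt_def)
  finally show ?thesis .
qed

definition corner :: "edge set \<Rightarrow> (real \<times> real) set" where
  "corner \<sigma> = {x \<in> \<Lambda>. \<exists>s\<in>\<sigma>. near vs \<sigma> s x \<and> seg s \<inter> seg g \<noteq> {} \<and> (\<exists>t\<in>g. apex vs \<sigma> s t)}"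

text \<open>For each of the two ends of \<open>g\<close> only one edge can be the crossed opposite
  side, and at most 4 midpoints are near that edge.\<close>

lemma corner_count: assumes s: "\<sigma> \<in> \<Omega>" shows "card (corner \<sigma>) \<le> 8"
proof -
  interpret triangulated vs \<sigma> by (rule Omega_trg[OF s])
  obtain r1 r2 where g: "g = {r1, r2}" "r1 \<noteq> r2" by (rule g_props, rule that)
  define X where "X t = {x \<in> \<Lambda>. \<exists>s\<in>\<sigma>. near vs \<sigma> s x \<and> seg s \<inter> seg g \<noteq> {} \<and> apex vs \<sigma> s t}" for t
  have X: "card (X t) \<le> 4" if t: "t \<in> g" for t
  proof (cases "\<exists>s\<in>\<sigma>. seg s \<inter> seg g \<noteq> {} \<and> apex vs \<sigma> s t")
    case False
    then have "X t = {}" unfolding X_def by blast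
    then show ?thesis by simp
  next
    case True
    then obtain e where e: "e \<in> \<sigma>" "seg e \<inter> seg g \<noteq> {}" "apex vs \<sigma> e t" by blast
    obtain r where r: "g = {t, r}" "t \<noteq> r" using t g by (metis insert_commute insert_iff singletonD)
    have "X t \<subseteq> {x \<in> \<Lambda>. near vs \<sigma> e x}"
      unfolding X_def using first_crossing_unique[OF e(1,3,2) _ _ _ r] by blast
    then have "card (X t) \<le> card {x \<in> \<Lambda>. near vs \<sigma> e x}" using finite_Lam by (intro card_mono) auto
    then show ?thesis using near_count[OF e(1)] by simp
  qed
  have gg: "(\<exists>t\<in>g. apex vs \<sigma> s t) \<longleftrightarrow> apex vs \<sigma> s r1 \<or> apex vs \<sigma> s r2" for s
    unfolding g(1) by simp
  have "corner \<sigma> = X r1 \<union> X r2" unfolding corner_def X_def gg by blast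
  then have "card (corner \<sigma>) \<le> card (X r1) + card (X r2)" using card_Un_le by metis
  then show ?thesis using X[of r1] X[of r2] g(1) by simp
qed

lemma sum_edges:
  fixes f :: "edge \<Rightarrow> real"
  assumes s: "\<sigma> \<in> \<Omega>" shows "(\<Sum>e\<in>\<sigma>. f e) = (\<Sum>x\<in>\<Lambda>. f (old \<sigma> x))"
proof -
  interpret triangulated vs \<sigma> by (rule Omega_trg[OF s])
  show ?thesis
    by (rule sum.reindex_bij_witness[of _ "old \<sigma>" mid]) (use edge_at edge_at_eq in auto)
qed

text \<open>Double counting of the charges: at most 4 per edge, and at most 8 bounded ones at the
  ends of \<open>g\<close>. The weights \<beta> are left free so that a dominating edge can later be
  discounted.\<close>

lemma up_sum:
  assumes s: "\<sigma> \<in> \<Omega>" and X: "X \<subseteq> fl \<sigma>" "\<And>x. x \<in> X \<Longrightarrow> len (old \<sigma> x) \<le> len (new \<sigma> x)"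
    and beta: "\<And>e. e \<in> \<sigma> \<Longrightarrow> 0 \<le> \<beta> e" "\<And>e r t. e \<in> \<sigma> \<Longrightarrow> r \<in> e \<Longrightarrow> apex vs \<sigma> e t \<Longrightarrow> \<alpha> powr (- 3 * real (l1 r t)) \<le> \<beta> e"
  shows "(\<Sum>x\<in>X. rt \<sigma> x * w (new \<sigma> x)) \<le> (\<Sum>x\<in>X. w (old \<sigma> x)) + 4 * \<alpha> powr 4 * (\<Sum>e\<in>\<sigma>. \<beta> e * w e) + 8 * \<alpha> powr 4"
proof -
  interpret triangulated vs \<sigma> by (rule Omega_trg[OF s])
  define h where "h e x = (if near vs \<sigma> e x then \<alpha> powr 4 * (\<beta> e * w e) else 0)" for e x
  define k where "k x = (if x \<in> corner \<sigma> then \<alpha> powr 4 else 0)" for x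
  have h0: "0 \<le> h e x" if "e \<in> \<sigma>" for e x unfolding h_def using beta(1)[OF that] wt_nonneg by simp
  have k0: "0 \<le> k x" for x unfolding k_def by simp
  have XL: "X \<subseteq> \<Lambda>" using X(1) by (auto simp: flips_def)
  have fX: "finite X" using XL finite_Lam finite_subset by blast
  have pt: "rt \<sigma> x * w (new \<sigma> x) \<le> w (old \<sigma> x) + (\<Sum>e\<in>\<sigma>. h e x) + k x" if x: "x \<in> X" for x
  proof -
    have xf: "x \<in> fl \<sigma>" using x X(1) by blast
    have S0: "0 \<le> (\<Sum>e\<in>\<sigma>. h e x)" by (intro sum_nonneg h0)
    consider "seg (new \<sigma> x) \<inter> seg g = {}" | "seg (old \<sigma> x) \<inter> seg g \<noteq> {}" |
      "seg (new \<sigma> x) \<inter> seg g \<noteq> {}" "seg (old \<sigma> x) \<inter> seg g = {}" by blast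
    then show ?thesis
    proof cases
      case 1
      then have "w (new \<sigma> x) = 0" by (simp add: wt_def)
      then show ?thesis using S0 k0[of x] wt_nonneg[of \<alpha> g "old \<sigma> x"] by simp
    next
      case 2
      then show ?thesis using up_flip_same[OF s xf X(2)[OF x]] S0 k0[of x] by linarith
    next
      case 3
      from up_flip_charge[OF s xf X(2)[OF x] 3]
      obtain e where e: "e \<in> \<sigma>" "near vs \<sigma> e x" "seg e \<inter> seg g \<noteq> {}"
        "(\<exists>r\<in>e. \<exists>t. apex vs \<sigma> e t \<and> rt \<sigma> x * w (new \<sigma> x) \<le> \<alpha> powr 4 * \<alpha> powr (- 3 * real (l1 r t)) * w e) \<or>
         ((\<exists>t\<in>g. apex vs \<sigma> e t) \<and> rt \<sigma> x * w (new \<sigma> x) \<le> \<alpha> powr 4)" by blast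
      from e(4) show ?thesis
      proof
        assume "\<exists>r\<in>e. \<exists>t. apex vs \<sigma> e t \<and> rt \<sigma> x * w (new \<sigma> x) \<le> \<alpha> powr 4 * \<alpha> powr (- 3 * real (l1 r t)) * w e"
        then obtain r t where r: "r \<in> e" "apex vs \<sigma> e t" "rt \<sigma> x * w (new \<sigma> x) \<le> \<alpha> powr 4 * \<alpha> powr (- 3 * real (l1 r t)) * w e" by blast
        have "\<alpha> powr (- 3 * real (l1 r t)) * w e \<le> \<beta> e * w e" by (rule mult_right_mono[OF beta(2)[OF e(1) r(1,2)] wt_nonneg])
        then have "\<alpha> powr 4 * (\<alpha> powr (- 3 * real (l1 r t)) * w e) \<le> h e x"
          unfolding h_def using e(2) by (simp add: mult_left_mono)
        also have "h e x \<le> (\<Sum>e\<in>\<sigma>. h e x)" by (rule member_le_sum[OF e(1) h0 finite_edges]) auto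
        finally show ?thesis using r(3) k0[of x] wt_nonneg[of \<alpha> g "old \<sigma> x"] by (simp add: mult.assoc)
      next
        assume a: "(\<exists>t\<in>g. apex vs \<sigma> e t) \<and> rt \<sigma> x * w (new \<sigma> x) \<le> \<alpha> powr 4"
        then have "x \<in> corner \<sigma>" unfolding corner_def using e x XL by blast
        then show ?thesis using a S0 wt_nonneg[of \<alpha> g "old \<sigma> x"] by (simp add: k_def)
      qed
    qed
  qed
  \<comment> \<open>Exchanging the sums turns the charges of the flips into the number of flips near
    each edge.\<close>
  have "(\<Sum>x\<in>X. \<Sum>e\<in>\<sigma>. h e x) \<le> (\<Sum>x\<in>\<Lambda>. \<Sum>e\<in>\<sigma>. h e x)"
    by (rule sum_mono2[OF finite_Lam XL]) (intro sum_nonneg h0)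
  also have "\<dots> = (\<Sum>e\<in>\<sigma>. \<Sum>x\<in>\<Lambda>. h e x)" by (rule sum.swap)
  also have "\<dots> \<le> (\<Sum>e\<in>\<sigma>. 4 * \<alpha> powr 4 * (\<beta> e * w e))"
  proof (rule sum_mono)
    fix e assume e: "e \<in> \<sigma>"
    have p: "0 \<le> \<alpha> powr 4 * (\<beta> e * w e)" using beta(1)[OF e] wt_nonneg by simp
    have "(\<Sum>x\<in>\<Lambda>. h e x) = real (card {x \<in> \<Lambda>. near vs \<sigma> e x}) * (\<alpha> powr 4 * (\<beta> e * w e))"
      unfolding h_def using finite_Lam by (simp add: sum.If_cases Int_def)
    also have "\<dots> \<le> 4 * (\<alpha> powr 4 * (\<beta> e * w e))" using near_count[OF e] p by (intro mult_right_mono) auto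
    finally show "(\<Sum>x\<in>\<Lambda>. h e x) \<le> 4 * \<alpha> powr 4 * (\<beta> e * w e)" by simp
  qed
  also have "\<dots> = 4 * \<alpha> powr 4 * (\<Sum>e\<in>\<sigma>. \<beta> e * w e)" by (simp only: sum_distrib_left)
  finally have 1: "(\<Sum>x\<in>X. \<Sum>e\<in>\<sigma>. h e x) \<le> 4 * \<alpha> powr 4 * (\<Sum>e\<in>\<sigma>. \<beta> e * w e)" .
  have "(\<Sum>x\<in>X. k x) \<le> (\<Sum>x\<in>\<Lambda>. k x)" by (rule sum_mono2[OF finite_Lam XL k0])
  also have "\<dots> = real (card (corner \<sigma>)) * \<alpha> powr 4"
  proof -
    have "\<Lambda> \<inter> corner \<sigma> = corner \<sigma>" by (auto simp: corner_def)
    then show ?thesis unfolding k_def using finite_Lam by (simp add: sum.If_cases)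
  qed
  also have "\<dots> \<le> 8 * \<alpha> powr 4" using corner_count[OF s] by (intro mult_right_mono) auto
  finally have 2: "(\<Sum>x\<in>X. k x) \<le> 8 * \<alpha> powr 4" .
  have "(\<Sum>x\<in>X. rt \<sigma> x * w (new \<sigma> x)) \<le> (\<Sum>x\<in>X. w (old \<sigma> x) + (\<Sum>e\<in>\<sigma>. h e x) + k x)" by (rule sum_mono[OF pt])
  also have "\<dots> = (\<Sum>x\<in>X. w (old \<sigma> x)) + (\<Sum>x\<in>X. \<Sum>e\<in>\<sigma>. h e x) + (\<Sum>x\<in>X. k x)" by (simp add: sum.distrib)
  finally show ?thesis using 1 2 by linarith
qed

end

section \<open>The one-step operator, global drift bounds and the tail recursion\<close>

lemma prob_bind_pmf:
  "measure_pmf.prob (bind_pmf M f) X = measure_pmf.expectation M (\<lambda>x. measure_pmf.prob (f x) X)"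
proof -
  have "ennreal (measure_pmf.prob (bind_pmf M f) X) = (\<integral>\<^sup>+x. ennreal (measure_pmf.prob (f x) X) \<partial>M)"
    by (simp add: measure_pmf.emeasure_eq_measure[symmetric])
  also have "\<dots> = ennreal (measure_pmf.expectation M (\<lambda>x. measure_pmf.prob (f x) X))"
    by (rule nn_integral_eq_integral) (auto intro!: measure_pmf.integrable_const_bound[where B=1])
  finally show ?thesis by simp
qed

text \<open>The chain appends steps at the end, whereas the recursion for tail probabilities as
  functions of the initial state needs the first step in front.\<close>

lemma chain_Suc_step: "chain lam vs \<xi> \<sigma> (Suc t) = step lam vs \<xi> \<sigma> \<bind> (\<lambda>\<tau>. chain lam vs \<xi> \<tau> t)"
proof (induction t)
  case 0
  show ?case by (simp add: bind_return_pmf bind_return_pmf')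
next
  case (Suc t)
  have "chain lam vs \<xi> \<sigma> (Suc (Suc t)) = chain lam vs \<xi> \<sigma> (Suc t) \<bind> step lam vs \<xi>" by simp
  also have "\<dots> = step lam vs \<xi> \<sigma> \<bind> (\<lambda>\<tau>. chain lam vs \<xi> \<tau> (Suc t))"
    unfolding Suc.IH by (simp add: bind_assoc_pmf)
  finally show ?case .
qed

context weighted
begin

abbreviation H :: "edge set \<Rightarrow> real" where "H \<equiv> Psi vs \<xi> \<alpha> g"
abbreviation gn :: "(edge set \<Rightarrow> real) \<Rightarrow> edge set \<Rightarrow> real" where "gn \<equiv> gen lam vs \<xi>"
abbreviation \<N> :: real where "\<N> \<equiv> real (card \<Lambda>)"
abbreviation EE :: "(edge set \<Rightarrow> real) \<Rightarrow> edge set \<Rightarrow> real" where "EE f \<sigma> \<equiv> f \<sigma> + gn f \<sigma> / \<N>"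

lemma flip_Omega: "\<sigma> \<in> \<Omega> \<Longrightarrow> x \<in> fl \<sigma> \<Longrightarrow> flip vs \<sigma> x \<in> \<Omega>"
proof -
  assume s: "\<sigma> \<in> \<Omega>" and x: "x \<in> fl \<sigma>"
  obtain a b c d where q: "quad \<sigma> a b c d" "x = mid {a, b}" "{a, b} \<notin> \<xi>" by (rule flE[OF s x])
  show ?thesis unfolding q(2) by (rule flip_props(1)[OF s q(1,3)])
qed

lemma card_fl: assumes s: "\<sigma> \<in> \<Omega>" shows "real (card (fl \<sigma>)) \<le> \<N> - 1"
proof -
  obtain x where x: "x \<in> \<Lambda>" "\<not> flippable vs \<xi> \<sigma> x" using side_not_flippable[OF s] by blast
  have "fl \<sigma> \<subseteq> \<Lambda> - {x}" using x by (auto simp: flips_def)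
  then have "card (fl \<sigma>) \<le> card (\<Lambda> - {x})" using finite_Lam by (intro card_mono) auto
  also have "\<dots> = card \<Lambda> - 1" using x finite_Lam by simp
  finally have "card (fl \<sigma>) \<le> card \<Lambda> - 1" .
  moreover have "card \<Lambda> \<ge> 1" using card_Lam_pos[OF s] by simp
  ultimately have "card (fl \<sigma>) + 1 \<le> card \<Lambda>" by linarith
  then have "real (card (fl \<sigma>) + 1) \<le> \<N>" by (simp only: of_nat_le_iff)
  then show ?thesis by simp
qed

lemma gen_add: "gn (\<lambda>\<tau>. f \<tau> + h \<tau>) \<sigma> = gn f \<sigma> + gn h \<sigma>"
  unfolding gen_def by (simp add: algebra_simps sum.distrib sum_subtractf)

lemma gen_lin: "gn (\<lambda>\<tau>. a * f \<tau> + b) \<sigma> = a * gn f \<sigma>"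
  unfolding gen_def sum_distrib_left by (rule sum.cong) (simp_all add: algebra_simps)

text \<open>At most N - 1 midpoints can flip, so the state survives with probability at least 1 / N
  and keeps that share of the gap.\<close>

lemma step_stay:
  assumes s: "\<sigma> \<in> \<Omega>" and le: "\<And>\<tau>. \<tau> \<in> \<Omega> \<Longrightarrow> f \<tau> \<le> h \<tau>"
  shows "EE f \<sigma> \<le> EE h \<sigma> - (h \<sigma> - f \<sigma>) / \<N>"
proof -
  define D where "D \<tau> = h \<tau> + (-1) * f \<tau>" for \<tau>
  have D0: "0 \<le> D \<tau>" if "\<tau> \<in> \<Omega>" for \<tau> using le[OF that] by (simp add: D_def)
  have N: "\<N> > 0" using card_Lam_pos[OF s] by simp
  have "gn D \<sigma> = gn h \<sigma> + (-1) * gn f \<sigma>"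
    unfolding D_def gen_add using gen_lin[of "-1" f 0 \<sigma>] by simp
  moreover have "- (\<N> - 1) * D \<sigma> \<le> gn D \<sigma>"
  proof -
    have "(\<Sum>x\<in>fl \<sigma>. - D \<sigma>) \<le> gn D \<sigma>" unfolding gen_def
    proof (rule sum_mono)
      fix x assume x: "x \<in> fl \<sigma>"
      have "rt \<sigma> x * D \<sigma> \<le> 1 * D \<sigma>" using rate_le_one(1) D0[OF s] by (rule mult_right_mono)
      moreover have "0 \<le> rt \<sigma> x * D (flip vs \<sigma> x)" using rate_le_one(2) D0[OF flip_Omega[OF s x]] by simp
      ultimately show "- D \<sigma> \<le> rt \<sigma> x * (D (flip vs \<sigma> x) - D \<sigma>)" by (simp add: right_diff_distrib)
    qed
    moreover have "real (card (fl \<sigma>)) * D \<sigma> \<le> (\<N> - 1) * D \<sigma>" using card_fl[OF s] D0[OF s] by (rule mult_right_mono)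
    ultimately show ?thesis by (simp add: algebra_simps)
  qed
  ultimately have "- (\<N> - 1) * D \<sigma> / \<N> \<le> (gn h \<sigma> - gn f \<sigma>) / \<N>" using N by (intro divide_right_mono) auto
  moreover have "- (\<N> - 1) * D \<sigma> / \<N> = - D \<sigma> + D \<sigma> / \<N>" using N by (simp add: field_simps)
  ultimately have "- D \<sigma> + D \<sigma> / \<N> \<le> gn h \<sigma> / \<N> - gn f \<sigma> / \<N>" by (simp only: diff_divide_distrib)
  then show ?thesis by (simp add: D_def)
qed

lemma H_flip:
  assumes s: "\<sigma> \<in> \<Omega>" and x: "x \<in> fl \<sigma>"
  shows "H (flip vs \<sigma> x) - H \<sigma> \<le> (if len (old \<sigma> x) \<le> len (new \<sigma> x) then w (new \<sigma> x) else 0)"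
    "- w (old \<sigma> x) \<le> H (flip vs \<sigma> x) - H \<sigma>"
    "len (new \<sigma> x) < len (old \<sigma> x) \<Longrightarrow> H (flip vs \<sigma> x) - H \<sigma> = - w (old \<sigma> x)"
    "len (old \<sigma> x) < len (new \<sigma> x) \<Longrightarrow> H (flip vs \<sigma> x) - H \<sigma> = w (new \<sigma> x)"
proof -
  obtain a b c d where q: "quad \<sigma> a b c d" "x = mid {a, b}" "{a, b} \<notin> \<xi>" "old \<sigma> x = {a, b}" "new \<sigma> x = {c, d}"
    by (rule flE[OF s x])
  show "H (flip vs \<sigma> x) - H \<sigma> \<le> (if len (old \<sigma> x) \<le> len (new \<sigma> x) then w (new \<sigma> x) else 0)"
    "- w (old \<sigma> x) \<le> H (flip vs \<sigma> x) - H \<sigma>"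
    unfolding q(4,5) unfolding q(2) by (rule Psi_flip_le[OF s q(1,3)])+
  show "len (new \<sigma> x) < len (old \<sigma> x) \<Longrightarrow> H (flip vs \<sigma> x) - H \<sigma> = - w (old \<sigma> x)"
    "len (old \<sigma> x) < len (new \<sigma> x) \<Longrightarrow> H (flip vs \<sigma> x) - H \<sigma> = w (new \<sigma> x)"
    unfolding q(4,5) unfolding q(2) by (rule Psi_flip(1,3)[OF s q(1,3)]; assumption)+
qed

lemma sum_old_le: "\<sigma> \<in> \<Omega> \<Longrightarrow> X \<subseteq> \<Lambda> \<Longrightarrow> (\<Sum>x\<in>X. w (old \<sigma> x)) \<le> H \<sigma>"
  using sum_mono2[OF finite_Lam, of X "\<lambda>x. w (old \<sigma> x)"] wt_nonneg sum_wt_le_Psi[of \<sigma> \<alpha> g] by force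

text \<open>Flips preserving the length count as upward: they too may bring in a new edge of
  positive weight.\<close>

definition ups :: "edge set \<Rightarrow> (real \<times> real) set" where
  "ups \<sigma> = {x \<in> fl \<sigma>. len (old \<sigma> x) \<le> len (new \<sigma> x)}"

lemma ups_sum_le: assumes s: "\<sigma> \<in> \<Omega>"
  shows "(\<Sum>x\<in>ups \<sigma>. rt \<sigma> x * w (new \<sigma> x)) \<le> (1 + 4 * \<alpha> powr 4) * H \<sigma> + 8 * \<alpha> powr 4"
proof -
  have "(\<Sum>x\<in>ups \<sigma>. rt \<sigma> x * w (new \<sigma> x)) \<le> (\<Sum>x\<in>ups \<sigma>. w (old \<sigma> x)) + 4 * \<alpha> powr 4 * (\<Sum>e\<in>\<sigma>. 1 * w e) + 8 * \<alpha> powr 4"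
  proof (rule up_sum[OF s])
    fix e r t
    have "\<alpha> powr (- 3 * real (l1 r t)) \<le> \<alpha> powr 0" using al(1) by (intro powr_mono) auto
    then show "\<alpha> powr (- 3 * real (l1 r t)) \<le> 1" using al(1) by simp
  qed (auto simp: ups_def)
  moreover have "(\<Sum>x\<in>ups \<sigma>. w (old \<sigma> x)) \<le> H \<sigma>" by (rule sum_old_le[OF s]) (auto simp: ups_def flips_def)
  moreover have "(\<Sum>e\<in>\<sigma>. 1 * w e) \<le> H \<sigma>" using sum_edges[OF s, of w] sum_wt_le_Psi[OF s, of \<alpha> g] by simp
  then have "4 * \<alpha> powr 4 * (\<Sum>e\<in>\<sigma>. 1 * w e) \<le> 4 * \<alpha> powr 4 * H \<sigma>" by (intro mult_left_mono) auto
  ultimately show ?thesis by (simp add: distrib_right)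
qed

lemma gen_H_le: assumes s: "\<sigma> \<in> \<Omega>"
  shows "gn H \<sigma> \<le> (1 + 4 * \<alpha> powr 4) * H \<sigma> + 8 * \<alpha> powr 4"
proof -
  have "gn H \<sigma> \<le> (\<Sum>x\<in>fl \<sigma>. if len (old \<sigma> x) \<le> len (new \<sigma> x) then rt \<sigma> x * w (new \<sigma> x) else 0)"
    unfolding gen_def
  proof (rule sum_mono)
    fix x assume x: "x \<in> fl \<sigma>"
    show "rt \<sigma> x * (H (flip vs \<sigma> x) - H \<sigma>) \<le> (if len (old \<sigma> x) \<le> len (new \<sigma> x) then rt \<sigma> x * w (new \<sigma> x) else 0)"
      using mult_left_mono[OF H_flip(1)[OF s x] rate_le_one(2)[of \<sigma> x]] by (auto split: if_splits)
  qed
  also have "\<dots> = (\<Sum>x\<in>ups \<sigma>. rt \<sigma> x * w (new \<sigma> x))"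
    unfolding ups_def using finite_fl by (simp add: sum.If_cases Int_def)
  finally show ?thesis using ups_sum_le[OF s] by linarith
qed

text \<open>The rate of decrease is at most the sum of the weights of flippable edges, each
  multiplied by a flip rate below 1. For \<epsilon> at least 1 all these weights would have to
  vanish, and then nothing decreases.\<close>

lemma drift_rate_lt_one:
  assumes s: "\<sigma> \<in> \<Omega>" and pos: "0 < H \<sigma>" "0 < \<epsilon>" and d: "gn H \<sigma> \<le> - \<epsilon> * H \<sigma>"
  shows "\<epsilon> < 1"
proof (rule ccontr)
  assume "\<not> \<epsilon> < 1"
  have "- gn H \<sigma> = (\<Sum>x\<in>fl \<sigma>. rt \<sigma> x * (- (H (flip vs \<sigma> x) - H \<sigma>)))" unfolding gen_def sum_negf[symmetric] by (rule sum.cong) (simp_all add: algebra_simps)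
  also have "\<dots> \<le> (\<Sum>x\<in>fl \<sigma>. rt \<sigma> x * w (old \<sigma> x))"
  proof (rule sum_mono)
    fix x assume x: "x \<in> fl \<sigma>"
    show "rt \<sigma> x * (- (H (flip vs \<sigma> x) - H \<sigma>)) \<le> rt \<sigma> x * w (old \<sigma> x)"
      using H_flip(2)[OF s x] rate_le_one(2) by (intro mult_left_mono) auto
  qed
  finally have 1: "\<epsilon> * H \<sigma> \<le> (\<Sum>x\<in>fl \<sigma>. rt \<sigma> x * w (old \<sigma> x))" using d by simp
  have "(\<Sum>x\<in>fl \<sigma>. w (old \<sigma> x)) \<le> H \<sigma>" by (rule sum_old_le[OF s]) (auto simp: flips_def)
  moreover have "1 * H \<sigma> \<le> \<epsilon> * H \<sigma>" using \<open>\<not> \<epsilon> < 1\<close> pos by (intro mult_right_mono) auto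
  ultimately have "(\<Sum>x\<in>fl \<sigma>. w (old \<sigma> x)) - (\<Sum>x\<in>fl \<sigma>. rt \<sigma> x * w (old \<sigma> x)) \<le> 0" using 1 by linarith
  then have "(\<Sum>x\<in>fl \<sigma>. (1 - rt \<sigma> x) * w (old \<sigma> x)) \<le> 0" by (simp add: sum_subtractf left_diff_distrib)
  moreover have nn: "0 \<le> (1 - rt \<sigma> x) * w (old \<sigma> x)" for x using rate_le_one wt_nonneg by simp
  moreover have "0 \<le> (\<Sum>x\<in>fl \<sigma>. (1 - rt \<sigma> x) * w (old \<sigma> x))" by (intro sum_nonneg nn)
  ultimately have "(\<Sum>x\<in>fl \<sigma>. (1 - rt \<sigma> x) * w (old \<sigma> x)) = 0" by linarith
  moreover have "(\<Sum>x\<in>fl \<sigma>. (1 - rt \<sigma> x) * w (old \<sigma> x)) = 0 \<longleftrightarrow> (\<forall>x\<in>fl \<sigma>. (1 - rt \<sigma> x) * w (old \<sigma> x) = 0)"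
    by (rule sum_nonneg_eq_0_iff) (use finite_fl nn in auto)
  ultimately have z: "\<forall>x\<in>fl \<sigma>. (1 - rt \<sigma> x) * w (old \<sigma> x) = 0" by blast
  have "\<forall>x\<in>fl \<sigma>. w (old \<sigma> x) = 0"
  proof
    fix x assume "x \<in> fl \<sigma>"
    moreover have "1 - rt \<sigma> x \<noteq> 0" using rate_bounds(2)[OF lam, of vs \<sigma> x] by linarith
    ultimately show "w (old \<sigma> x) = 0" using z by (simp only: mult_eq_0_iff) blast
  qed
  then have "\<epsilon> * H \<sigma> \<le> 0" using 1 by simp
  then show False using mult_pos_pos[OF pos(2,1)] by linarith
qed

definition long :: "real \<Rightarrow> edge set \<Rightarrow> bool" where
  "long l \<tau> \<longleftrightarrow> (\<exists>y\<in>\<Lambda>. seg (old \<tau> y) \<inter> seg g \<noteq> {} \<and> real (len (old \<tau> y)) \<ge> real (len g) + l)"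

lemma long_w: "seg e \<inter> seg g \<noteq> {} \<Longrightarrow> real (len e) \<ge> real (len g) + l \<Longrightarrow> \<alpha> powr l \<le> w e"
  unfolding wt_def using al(1) by (auto intro!: powr_mono)

lemma w_le_H: assumes s: "\<sigma> \<in> \<Omega>" and x: "x \<in> \<Lambda>" shows "w (old \<sigma> x) \<le> H \<sigma>"
  using sum_old_le[OF s, of "{x}"] x by simp

lemma long_H: assumes "\<sigma> \<in> \<Omega>" "long l \<sigma>" shows "\<alpha> powr l \<le> H \<sigma>"
proof -
  obtain y where y: "y \<in> \<Lambda>" "seg (old \<sigma> y) \<inter> seg g \<noteq> {}" "real (len (old \<sigma> y)) \<ge> real (len g) + l"
    using assms(2) unfolding long_def by blast
  show ?thesis using long_w[OF y(2,3)] w_le_H[OF assms(1) y(1)] by linarith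
qed

text \<open>Only the flipped edge can become long. After an upward flip it is covered by the charged
  sum. After a downward flip it lies below the old edge, so its weight was already part of the
  height function; this accounts for the additional 1 in the coefficient 2 + 4 \<alpha>^4.\<close>

lemma long_creation:
  assumes s: "\<sigma> \<in> \<Omega>" and n: "\<not> long l \<sigma>"
  shows "EE (\<lambda>\<tau>. if long l \<tau> then \<alpha> powr l else 0) \<sigma> \<le> ((2 + 4 * \<alpha> powr 4) * H \<sigma> + 8 * \<alpha> powr 4) / \<N>"
proof -
  have pt: "rt \<sigma> x * ((if long l (flip vs \<sigma> x) then \<alpha> powr l else 0) - 0) \<le>
     (if x \<in> ups \<sigma> then rt \<sigma> x * w (new \<sigma> x) else 0) + height_term vs \<xi> \<alpha> g x (old \<sigma> x)" if x: "x \<in> fl \<sigma>" for x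
  proof (cases "long l (flip vs \<sigma> x)")
    case False
    then show ?thesis using ht_nonneg[of \<alpha> g x "old \<sigma> x"] rate_le_one(2)[of \<sigma> x] wt_nonneg[of \<alpha> g "new \<sigma> x"] by simp
  next
    case True
    obtain a b c d where q: "quad \<sigma> a b c d" "x = mid {a, b}" "{a, b} \<notin> \<xi>" "old \<sigma> x = {a, b}" "new \<sigma> x = {c, d}"
      by (rule flE[OF s x])
    note fp = flip_props[OF s q(1,3), folded q(2)]
    obtain y where y: "y \<in> \<Lambda>" "seg (edge_at (flip vs \<sigma> x) y) \<inter> seg g \<noteq> {}" "real (len (edge_at (flip vs \<sigma> x) y)) \<ge> real (len g) + l"
      using True unfolding long_def by blast
    have "y = x"
    proof (rule ccontr)
      assume "y \<noteq> x"
      then have "edge_at (flip vs \<sigma> x) y = old \<sigma> y" using fp(9) y(1) by blast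
      then show False using n y unfolding long_def by auto
    qed
    then have Lw: "\<alpha> powr l \<le> w (new \<sigma> x)" using long_w y by blast
    have hn: "0 \<le> height_term vs \<xi> \<alpha> g x (old \<sigma> x)" by (rule ht_nonneg)
    show ?thesis
    proof (cases "x \<in> ups \<sigma>")
      case up: True
      have "rt \<sigma> x * \<alpha> powr l \<le> rt \<sigma> x * w (new \<sigma> x)" using Lw rate_le_one(2) by (rule mult_left_mono)
      then show ?thesis using True up hn by simp
    next
      case False
      then have lt: "len {c, d} < len {a, b}" using x q unfolding ups_def by auto
      have "{c, d} \<in> Ex vs \<xi> x" using in_Ex[OF fp(1), of x] q(5) by simp
      moreover have "preceq vs \<xi> {c, d} {a, b}" unfolding preceq_down[OF s q(1,3) lt] by (simp add: preceq_def)
      ultimately have "w {c, d} \<le> height_term vs \<xi> \<alpha> g x {a, b}" by (rule wt_le_ht)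
      then have "\<alpha> powr l \<le> height_term vs \<xi> \<alpha> g x (old \<sigma> x)" using Lw q by simp
      moreover have "rt \<sigma> x * \<alpha> powr l \<le> 1 * \<alpha> powr l" using rate_le_one by (intro mult_right_mono) auto
      ultimately show ?thesis using True False by simp
    qed
  qed
  have "gn (\<lambda>\<tau>. if long l \<tau> then \<alpha> powr l else 0) \<sigma> \<le>
    (\<Sum>x\<in>fl \<sigma>. (if x \<in> ups \<sigma> then rt \<sigma> x * w (new \<sigma> x) else 0) + height_term vs \<xi> \<alpha> g x (old \<sigma> x))"
    unfolding gen_def using n pt by (intro sum_mono) simp
  also have "\<dots> = (\<Sum>x\<in>ups \<sigma>. rt \<sigma> x * w (new \<sigma> x)) + (\<Sum>x\<in>fl \<sigma>. height_term vs \<xi> \<alpha> g x (old \<sigma> x))"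
  proof -
    have "fl \<sigma> \<inter> ups \<sigma> = ups \<sigma>" by (auto simp: ups_def)
    then show ?thesis using finite_fl by (simp add: sum.distrib sum.If_cases)
  qed
  also have "(\<Sum>x\<in>fl \<sigma>. height_term vs \<xi> \<alpha> g x (old \<sigma> x)) \<le> H \<sigma>"
    unfolding Psi_height_term by (rule sum_mono2[OF finite_Lam]) (auto simp: flips_def ht_nonneg)
  finally have "gn (\<lambda>\<tau>. if long l \<tau> then \<alpha> powr l else 0) \<sigma> \<le> (2 + 4 * \<alpha> powr 4) * H \<sigma> + 8 * \<alpha> powr 4"
    using ups_sum_le[OF s] by (simp add: algebra_simps)
  then have "gn (\<lambda>\<tau>. if long l \<tau> then \<alpha> powr l else 0) \<sigma> / \<N> \<le> ((2 + 4 * \<alpha> powr 4) * H \<sigma> + 8 * \<alpha> powr 4) / \<N>"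
    by (rule divide_right_mono) simp
  then show ?thesis using n by simp
qed

text \<open>Scaling by the threshold lets the probability be compared directly with the height
  function, as Markov's inequality does.\<close>

definition tail :: "real \<Rightarrow> nat \<Rightarrow> edge set \<Rightarrow> real" where
  "tail l t \<sigma> = \<alpha> powr l * measure_pmf.prob (chain lam vs \<xi> \<sigma> t) {\<tau>. long l \<tau>}"

lemma tail_0: "tail l 0 \<sigma> = (if long l \<sigma> then \<alpha> powr l else 0)"
  by (simp add: tail_def indicator_def)

lemma tail_Suc: assumes s: "\<sigma> \<in> \<Omega>" shows "tail l (Suc t) \<sigma> = EE (tail l t) \<sigma>"
proof -
  let ?f = "\<lambda>\<tau>. measure_pmf.prob (chain lam vs \<xi> \<tau> t) {\<tau>. long l \<tau>}"
  have "tail l (Suc t) \<sigma> = \<alpha> powr l * EE ?f \<sigma>"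
    unfolding tail_def chain_Suc_step prob_bind_pmf step_expectation[OF s lam] ..
  moreover have "gn (tail l t) \<sigma> = \<alpha> powr l * gn ?f \<sigma>"
    using gen_lin[of "\<alpha> powr l" ?f 0 \<sigma>] unfolding tail_def by simp
  ultimately show ?thesis by (simp add: tail_def distrib_left)
qed

section \<open>Reversibility and the stationary measure\<close>

lemma weight_rate_symmetric:
  assumes s: "\<sigma> \<in> \<Omega>" and x: "x \<in> fl \<sigma>"
  shows "flip vs \<sigma> x \<in> \<Omega>" "x \<in> fl (flip vs \<sigma> x)" "flip vs (flip vs \<sigma> x) x = \<sigma>"
    "weight lam vs (flip vs \<sigma> x) * rt (flip vs \<sigma> x) x = weight lam vs \<sigma> * rt \<sigma> x"
proof -
  obtain a b c d where q: "quad \<sigma> a b c d" "x = mid {a, b}" "{a, b} \<notin> \<xi>" "old \<sigma> x = {a, b}" "new \<sigma> x = {c, d}"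
    by (rule flE[OF s x])
  note fp = flip_props[OF s q(1,3), folded q(2)]
  show "flip vs \<sigma> x \<in> \<Omega>" "x \<in> fl (flip vs \<sigma> x)" and ff: "flip vs (flip vs \<sigma> x) x = \<sigma>"
    using fp(1,6,7,8) by (auto simp: flips_def)
  define S where "S = (\<Sum>y\<in>\<Lambda> - {x}. len (old \<sigma> y))"
  have "(\<Sum>y\<in>\<Lambda>. len (old \<sigma> y)) = len (old \<sigma> x) + S"
    unfolding S_def using finite_Lam fp(8) by (rule sum.remove)
  moreover have "(\<Sum>y\<in>\<Lambda>. len (edge_at (flip vs \<sigma> x) y)) = len (new \<sigma> x) + (\<Sum>y\<in>\<Lambda> - {x}. len (edge_at (flip vs \<sigma> x) y))"
    using finite_Lam fp(8) by (rule sum.remove)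
  moreover have "(\<Sum>y\<in>\<Lambda> - {x}. len (edge_at (flip vs \<sigma> x) y)) = S" unfolding S_def using fp(9) by (intro sum.cong) auto
  ultimately show "weight lam vs (flip vs \<sigma> x) * rt (flip vs \<sigma> x) x = weight lam vs \<sigma> * rt \<sigma> x"
    unfolding weight_def rate_def ff by (simp add: power_add add.commute)
qed

text \<open>Flipping is an involution on pairs of a triangulation and a flippable midpoint. It
  preserves weight times rate by detailed balance and exchanges the two halves of the sum.\<close>

lemma stationary: "(\<Sum>\<sigma>\<in>\<Omega>. weight lam vs \<sigma> * gn f \<sigma>) = 0"
proof -
  define S where "S = (SIGMA \<sigma>:\<Omega>. fl \<sigma>)"
  define a where "a p = weight lam vs (fst p) * rt (fst p) (snd p)" for p
  define T where "T p = (flip vs (fst p) (snd p), snd p)" for p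
  have T: "T p \<in> S" "T (T p) = p" "a (T p) = a p" if "p \<in> S" for p
  proof -
    have "fst p \<in> \<Omega>" "snd p \<in> fl (fst p)" using that by (auto simp: S_def)
    note r = weight_rate_symmetric[OF this]
    show "T p \<in> S" "T (T p) = p" "a (T p) = a p" using r by (auto simp: S_def T_def a_def)
  qed
  have "(\<Sum>\<sigma>\<in>\<Omega>. weight lam vs \<sigma> * gn f \<sigma>) = (\<Sum>\<sigma>\<in>\<Omega>. \<Sum>x\<in>fl \<sigma>. a (\<sigma>, x) * (f (fst (T (\<sigma>, x))) - f \<sigma>))"
    unfolding gen_def sum_distrib_left a_def T_def by (simp add: mult.assoc)
  also have "\<dots> = (\<Sum>(\<sigma>, x)\<in>S. a (\<sigma>, x) * (f (fst (T (\<sigma>, x))) - f \<sigma>))"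
    unfolding S_def by (rule sum.Sigma) (auto simp: finite_Omega finite_fl)
  also have "\<dots> = (\<Sum>p\<in>S. a p * (f (fst (T p)) - f (fst p)))"
    by (rule sum.cong) auto
  also have "\<dots> = (\<Sum>p\<in>S. a p * f (fst (T p))) - (\<Sum>p\<in>S. a p * f (fst p))"
    by (simp add: right_diff_distrib sum_subtractf)
  also have "(\<Sum>p\<in>S. a p * f (fst (T p))) = (\<Sum>p\<in>S. a p * f (fst p))"
    by (rule sum.reindex_bij_witness[of _ T T]) (auto simp: T)
  finally show ?thesis by simp
qed

text \<open>The generator has mean 0, so the drift bounds the stationary mean of the height function
  by D / \<epsilon>. The edge at the midpoint of \<open>g\<close> meets \<open>g\<close> there, so
  if it is long enough the state is \<open>long\<close>, and Markov's inequality applies.\<close>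

lemma stationary_bound:
  assumes b: "\<And>\<sigma>. \<sigma> \<in> \<Omega> \<Longrightarrow> gn H \<sigma> \<le> - \<epsilon> * H \<sigma> + D" and e: "\<epsilon> > 0"
  shows "\<alpha> powr l * pi_prob lam vs \<xi> (\<lambda>\<sigma>. real (len (edge_at \<sigma> (mid g))) \<ge> real (len g) + l) \<le> D / \<epsilon>"
proof -
  obtain r1 r2 where g: "g = {r1, r2}" "r1 \<noteq> r2" "mid g \<in> \<Lambda>" "\<Omega> \<noteq> {}" by (rule g_props, rule that)
  define W where "W = weight lam vs"
  define Z where "Z = (\<Sum>\<tau>\<in>\<Omega>. W \<tau>)"
  have W: "0 < W \<sigma>" for \<sigma> unfolding W_def weight_def using lam by simp
  have Z: "0 < Z" unfolding Z_def using g(4) finite_Omega W by (intro sum_pos) auto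
  have "0 \<le> (\<Sum>\<sigma>\<in>\<Omega>. W \<sigma> * (- \<epsilon> * H \<sigma> + D))"
  proof -
    have "0 = (\<Sum>\<sigma>\<in>\<Omega>. W \<sigma> * gn H \<sigma>)" unfolding W_def by (simp add: stationary)
    also have "\<dots> \<le> (\<Sum>\<sigma>\<in>\<Omega>. W \<sigma> * (- \<epsilon> * H \<sigma> + D))"
      using b less_imp_le[OF W] by (intro sum_mono mult_left_mono) auto
    finally show ?thesis .
  qed
  also have "\<dots> = D * Z - \<epsilon> * (\<Sum>\<sigma>\<in>\<Omega>. W \<sigma> * H \<sigma>)"
    unfolding Z_def sum_distrib_left sum_subtractf[symmetric] by (rule sum.cong) (auto simp: algebra_simps)
  finally have EH: "\<epsilon> * (\<Sum>\<sigma>\<in>\<Omega>. W \<sigma> * H \<sigma>) \<le> D * Z" by simp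
  let ?P = "\<lambda>\<sigma>. real (len (edge_at \<sigma> (mid g))) \<ge> real (len g) + l"
  have lw: "\<alpha> powr l \<le> H \<sigma>" if s: "\<sigma> \<in> \<Omega>" "?P \<sigma>" for \<sigma>
  proof -
    interpret triangulated vs \<sigma> by (rule Omega_trg[OF s(1)])
    note e = edge_at[OF g(3)]
    obtain p q where pq: "p \<noteq> q" "old \<sigma> (mid g) = {p, q}" "p \<in> Lam0 vs" "q \<in> Lam0 vs" by (rule edgeE[OF e(1)])
    have "mid g \<in> seg (old \<sigma> (mid g))" using mid_in_seg[OF pq(1)] e(2) pq(2) by simp
    moreover have "mid g \<in> seg g" using mid_in_seg[OF g(2)] g(1) by simp
    ultimately have "long l \<sigma>" unfolding long_def using g(3) s(2) by blast
    then show ?thesis by (rule long_H[OF s(1)])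
  qed
  have "\<alpha> powr l * pi_prob lam vs \<xi> ?P = (\<Sum>\<sigma>\<in>{\<sigma> \<in> \<Omega>. ?P \<sigma>}. \<alpha> powr l * (W \<sigma> / Z))"
    unfolding pi_prob_def sum_distrib_left pi_def Z_def W_def by (rule sum.cong) auto
  also have "\<dots> \<le> (\<Sum>\<sigma>\<in>{\<sigma> \<in> \<Omega>. ?P \<sigma>}. H \<sigma> * (W \<sigma> / Z))"
    using lw less_imp_le[OF W] Z by (intro sum_mono mult_right_mono) auto
  also have "\<dots> \<le> (\<Sum>\<sigma>\<in>\<Omega>. H \<sigma> * (W \<sigma> / Z))"
    using finite_Omega Psi_nonneg less_imp_le[OF W] Z by (intro sum_mono2) auto
  also have "\<dots> = (\<Sum>\<sigma>\<in>\<Omega>. W \<sigma> * H \<sigma>) / Z" unfolding sum_divide_distrib by (simp add: mult.commute)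
  also have "\<dots> \<le> D / \<epsilon>" using EH Z e by (simp add: field_simps)
  finally show ?thesis .
qed

end

section \<open>States in which one long edge carries almost the whole height\<close>

lemma parallelogram_sides: assumes "c + d = a + b" shows "l1 a d = l1 b c" "l1 b d = l1 a c"
proof -
  have "d = a + b - c" using assms by (simp add: algebra_simps)
  then show "l1 a d = l1 b c" "l1 b d = l1 a c" by (simp_all add: l1_def abs_minus_commute)
qed

lemma l1_pos: "a \<noteq> b \<Longrightarrow> 1 \<le> l1 a b"
proof (rule ccontr)
  assume "a \<noteq> b" "\<not> 1 \<le> l1 a b"
  then have "int (l1 a b) = 0" by simp
  then have "fst a = fst b" "snd a = snd b" unfolding int_l1 by linarith+
  then show False using \<open>a \<noteq> b\<close> by (simp add: prod_eq_iff)
qed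

context weighted
begin

lemma sum_old_rest:
  assumes s: "\<sigma> \<in> \<Omega>" and y: "y \<in> \<Lambda>" and X: "X \<subseteq> \<Lambda> - {y}"
  shows "(\<Sum>x\<in>X. w (old \<sigma> x)) \<le> H \<sigma> - w (old \<sigma> y)"
proof -
  have "finite X" using X finite_Lam finite_subset by blast
  then have "(\<Sum>x\<in>insert y X. w (old \<sigma> x)) = w (old \<sigma> y) + (\<Sum>x\<in>X. w (old \<sigma> x))"
    using X by (intro sum.insert) auto
  moreover have "(\<Sum>x\<in>insert y X. w (old \<sigma> x)) \<le> H \<sigma>" by (rule sum_old_le[OF s]) (use X y in auto)
  ultimately show ?thesis by simp
qed

lemma quad_apex:
  assumes s: "\<sigma> \<in> \<Omega>" and q: "quad \<sigma> a b c d" and t: "apex vs \<sigma> {a, b} t" shows "t = c \<or> t = d"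
proof -
  interpret triangulated vs \<sigma> by (rule Omega_trg[OF s])
  have u: "\<bar>iori a b c\<bar> = 1" and cd: "c + d = a + b" and ne: "a \<noteq> b" "c \<noteq> d"
    and e: "{a, b} \<in> \<sigma>" "{a, c} \<in> \<sigma>" "{b, c} \<in> \<sigma>" "{a, d} \<in> \<sigma>" "{b, d} \<in> \<sigma>"
    using q by (auto simp: quad_def)
  have u': "\<bar>iori a b d\<bar> = 1" using u iori_opposite[OF cd] by simp
  have ap: "apex vs \<sigma> {a, b} c" "apex vs \<sigma> {a, b} d"
    using apexI[OF ne(1) e(2,3) u] apexI[OF ne(1) e(4,5) u'] by auto
  have "\<bar>iori a b t\<bar> = 1" by (rule apexD(3)[OF t e(1)])
  then have "iori a b t = iori a b c \<or> iori a b t = iori a b d"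
    using u iori_opposite[OF cd] by linarith
  then show ?thesis using apex_unique[OF e(1) t ap(1)] apex_unique[OF e(1) t ap(2)] by blast
qed

text \<open>When a single edge dominates the height function, the drift condition forces that edge to be
  flippable; the edges around it are then so much shorter that it flips at rate almost 1, which
  exceeds \<open>\<epsilon>\<close>.\<close>

lemma concentrated_drift:
  assumes s: "\<sigma> \<in> \<Omega>" and lg: "long l \<sigma>" and conc: "H \<sigma> < (1 + \<delta>) * \<alpha> powr l"
    and dl: "0 < \<delta>" "\<delta> \<le> \<epsilon> / 2" "\<delta> * (3 + 16 * \<alpha> powr 4) \<le> (1 - \<epsilon>) / 2" and eps: "\<epsilon> < 1"
    and L: "1 / \<delta> \<le> \<alpha> powr l" "\<alpha> < \<alpha> powr l"
    and drift: "gn H \<sigma> \<le> - \<epsilon> * H \<sigma>"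
  shows "gn H \<sigma> \<le> - ((1 + \<epsilon>) / 2) * H \<sigma>"
proof -
  interpret triangulated vs \<sigma> by (rule Omega_trg[OF s])
  obtain y where y: "y \<in> \<Lambda>" "seg (old \<sigma> y) \<inter> seg g \<noteq> {}" "real (len (old \<sigma> y)) \<ge> real (len g) + l"
    using lg unfolding long_def by blast
  define W where "W = w (old \<sigma> y)"
  have LW: "\<alpha> powr l \<le> W" unfolding W_def by (rule long_w[OF y(2,3)])
  have W0: "0 < W" using LW L(2) al(1) by linarith
  have WH: "W \<le> H \<sigma>" unfolding W_def by (rule w_le_H[OF s y(1)])
  have "(1 + \<delta>) * \<alpha> powr l \<le> (1 + \<delta>) * W" using LW dl by (intro mult_left_mono) auto
  then have HW: "H \<sigma> - W < \<delta> * W" using conc by (simp add: distrib_right)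
  have dW: "1 \<le> \<delta> * W"
  proof -
    have "1 / \<delta> \<le> W" using L(1) LW by linarith
    then show ?thesis using dl(1) by (simp add: field_simps)
  qed
  have Wpow: "W = \<alpha> powr (real (len (old \<sigma> y)) - real (len g))" unfolding W_def wt_def using y(2) by simp
  \<comment> \<open>Rules out the unit square, the only parallelogram in which the two diagonals are
    equally long. An edge of length 2 has weight at most \<alpha>, since \<open>g\<close> has length
    at least 1.\<close>
  have len2: "len (old \<sigma> y) \<noteq> 2"
  proof
    assume "len (old \<sigma> y) = 2"
    then have "W \<le> \<alpha> powr 1" unfolding Wpow using len_g_pos al(1) by (intro powr_mono) auto
    then show False using LW L(2) al(1) by simp
  qed
  \<comment> \<open>If the dominating edge could not flip downwards, all decrease would come from
    the other edges. Their total weight is below \<delta> W, less than the decrease of at least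
    \<epsilon> times the height required by the drift.\<close>
  have down: "y \<in> fl \<sigma> \<and> len (new \<sigma> y) < len (old \<sigma> y)"
  proof (rule ccontr)
    assume n: "\<not> ?thesis"
    have yt: "H \<sigma> - H (flip vs \<sigma> y) \<le> 0" if yf: "y \<in> fl \<sigma>"
    proof -
      obtain a b c d where q: "quad \<sigma> a b c d" "y = mid {a, b}" "{a, b} \<notin> \<xi>" "old \<sigma> y = {a, b}" "new \<sigma> y = {c, d}"
        by (rule flE[OF s yf])
      have qq: "c + d = a + b" "\<bar>iori a b c\<bar> = 1" "{a, c} \<in> \<sigma>" "{b, c} \<in> \<sigma>" using q(1) by (auto simp: quad_def)
      have le: "l1 a b \<le> l1 c d" using n yf q(4,5) by (simp add: len_pair)
      have "l1 a b \<noteq> l1 c d"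
      proof
        assume eq: "l1 a b = l1 c d"
        have "1 \<le> l1 a c" "1 \<le> l1 b c" using l1_pos edge_ends qq by blast+
        then have "l1 a b = 2" using parallelogram_lengths[OF qq(1,2) le] eq by (elim disjE) auto
        then show False using len2 q(4) len_pair by simp
      qed
      then have "len (old \<sigma> y) < len (new \<sigma> y)" using le q(4,5) by (simp add: len_pair)
      then show ?thesis using H_flip(4)[OF s yf] wt_nonneg[of \<alpha> g "new \<sigma> y"] by simp
    qed
    have "- gn H \<sigma> = (\<Sum>x\<in>fl \<sigma>. rt \<sigma> x * (H \<sigma> - H (flip vs \<sigma> x)))"
      unfolding gen_def sum_negf[symmetric] by (rule sum.cong) (simp_all add: algebra_simps)
    also have "\<dots> \<le> (\<Sum>x\<in>fl \<sigma>. if x = y then 0 else w (old \<sigma> x))"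
    proof (rule sum_mono)
      fix x assume x: "x \<in> fl \<sigma>"
      show "rt \<sigma> x * (H \<sigma> - H (flip vs \<sigma> x)) \<le> (if x = y then 0 else w (old \<sigma> x))"
      proof (cases "x = y")
        case True
        then show ?thesis using yt x rate_le_one(2)[of \<sigma> x] by (simp add: mult_nonneg_nonpos)
      next
        case False
        have "rt \<sigma> x * (H \<sigma> - H (flip vs \<sigma> x)) \<le> rt \<sigma> x * w (old \<sigma> x)"
          using H_flip(2)[OF s x] rate_le_one(2)[of \<sigma> x] by (intro mult_left_mono) auto
        also have "\<dots> \<le> 1 * w (old \<sigma> x)" using rate_le_one(1) wt_nonneg by (rule mult_right_mono)
        finally show ?thesis using False by simp
      qed
    qed
    also have "\<dots> = (\<Sum>x\<in>fl \<sigma> - {y}. w (old \<sigma> x))"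
      using finite_fl by (simp add: sum.If_cases Diff_eq)
    also have "\<dots> \<le> H \<sigma> - W" unfolding W_def by (rule sum_old_rest[OF s y(1)]) (auto simp: flips_def)
    finally have "\<epsilon> * H \<sigma> < \<delta> * W" using drift HW by linarith
    also have "\<delta> * W \<le> \<epsilon> / 2 * H \<sigma>" using dl WH W0 by (intro mult_mono) auto
    finally have "\<epsilon> * H \<sigma> < \<epsilon> / 2 * H \<sigma>" .
    moreover have "\<epsilon> / 2 * H \<sigma> \<le> \<epsilon> * H \<sigma>" using dl WH W0 by (intro mult_right_mono) auto
    ultimately show False by linarith
  qed
  then have yf: "y \<in> fl \<sigma>" and lt: "len (new \<sigma> y) < len (old \<sigma> y)" by auto
  obtain a b c d where q: "quad \<sigma> a b c d" "y = mid {a, b}" "{a, b} \<notin> \<xi>" "old \<sigma> y = {a, b}" "new \<sigma> y = {c, d}"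
    by (rule flE[OF s yf])
  note fp = flip_props[OF s q(1,3), folded q(2)]
  have qq: "c + d = a + b" "\<bar>iori a b c\<bar> = 1" "a \<noteq> b" "c \<noteq> d" using q(1) by (auto simp: quad_def)
  have qq': "a + b = c + d" "\<bar>iori c d a\<bar> = 1" using qq iori_diag[OF qq(1)] iori_opposite[OF qq(1)] by auto
  have ltl: "l1 c d < l1 a b" using lt q(4,5) by (simp add: len_pair)
  have ab2: "l1 a b \<noteq> 2" using len2 q(4) by (simp add: len_pair)
  define m where "m = min (l1 a c) (l1 b c)"
  \<comment> \<open>The long diagonal is the sum and the short one the difference of the side
    lengths, so they differ by twice the shorter side.\<close>
  have m: "l1 c d + 2 * m = l1 a b"
  proof -
    have "l1 c a = l1 a c" "l1 d a = l1 b c" using l1_commute[of c a] l1_commute[of d a] parallelogram_sides(1)[OF qq(1)] by auto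
    then show ?thesis using parallelogram_lengths[OF qq' less_imp_le[OF ltl]] ab2 unfolding m_def by auto
  qed
  have pm: "\<alpha> powr x \<le> \<alpha> powr x'" if "x \<le> x'" for x x' using that al(1) by (intro powr_mono) auto
  have Wab: "W = \<alpha> powr (real (l1 a b) - real (len g))" using Wpow q(4) by (simp add: len_pair)
  \<comment> \<open>Domination forces the shorter side to be long: otherwise some other crossing
    edge, current or below the dominating one, would have weight comparable to W.\<close>
  have small: "\<alpha> powr (- 3 * real m) \<le> \<delta>"
  proof (cases "seg {c, d} \<inter> seg g = {}")
    case False
    have ex: "{c, d} \<in> Ex vs \<xi> y" using in_Ex[OF fp(1), of y] q(5) by simp
    have "w {c, d} \<le> height_term vs \<xi> \<alpha> g y {c, d}" by (rule wt_le_ht[OF ex]) (simp add: preceq_def)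
    moreover have "height_term vs \<xi> \<alpha> g y {a, b} = height_term vs \<xi> \<alpha> g y {c, d} + w {a, b}"
      unfolding q(2) by (rule ht_down[OF s q(1,3)]) (use ltl in \<open>simp add: len_pair\<close>)
    moreover have "height_term vs \<xi> \<alpha> g y (old \<sigma> y) \<le> H \<sigma>"
      unfolding Psi_height_term using y(1) finite_Lam ht_nonneg by (intro member_le_sum) auto
    ultimately have "w {c, d} < \<delta> * W" using HW q(4) unfolding W_def by simp
    moreover have "w {c, d} = \<alpha> powr (- 2 * real m) * W"
    proof -
      have e: "real (l1 c d) - real (len g) = - 2 * real m + (real (l1 a b) - real (len g))" using m by linarith
      then show ?thesis unfolding Wab powr_add[symmetric] wt_def len_pair e using False by simp
    qed
    ultimately have "\<alpha> powr (- 2 * real m) < \<delta>" using W0 by (simp add: mult_less_cancel_right)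
    moreover have "\<alpha> powr (- 3 * real m) \<le> \<alpha> powr (- 2 * real m)" by (rule pm) simp
    ultimately show ?thesis by linarith
  next
    case True
    have cr: "seg {a, b} \<inter> seg g \<noteq> {}" using y(2) q(4) by simp
    \<comment> \<open>Here the crossing lemma is applied in the flipped triangulation, where the
      dominating edge is the new diagonal. A crossed longer side is also an edge of \<sigma>, with
      weight W times \<alpha> to the power -m. In the corner case W is at most \<alpha> to the power
      m.\<close>
    obtain a' b' c' d' where q': "quad (flip vs \<sigma> y) a' b' c' d'" "{a', b'} = {c, d}" "{c', d'} = {a, b}" "l1 b' c' \<le> l1 a' c'"
      and alt: "seg {a', c'} \<inter> seg g \<noteq> {} \<or> (a' \<in> g \<and> seg {b', c'} \<inter> seg g \<noteq> {} \<and> l1 a' c' \<le> len g)"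
      by (rule new_diagonal_crossing[OF fp(1,2) cr True])
    have r: "c' + d' = a' + b'" "\<bar>iori a' b' c'\<bar> = 1" "{a', c'} \<in> flip vs \<sigma> y" "{b', c'} \<in> flip vs \<sigma> y"
      using q'(1) by (auto simp: quad_def)
    have lab: "l1 a' b' = l1 c d" "l1 c' d' = l1 a b"
      using arg_cong[OF q'(2), of len] arg_cong[OF q'(3), of len] by (simp_all add: len_pair)
    have le: "l1 a' b' \<le> l1 c' d'" using lab ltl by simp
    have bm: "l1 b' c' = m" "l1 a' c' + m = l1 a b"
      using parallelogram_lengths[OF r(1,2) le] lab m q'(4) ab2 by auto
    have bc: "b' \<noteq> c'" using triangulated.edge_ends[OF Omega_trg[OF fp(1)] r(4)] by blast
    have "{a', c'} \<noteq> {c, d}" using bc unfolding q'(2)[symmetric] by (auto simp: doubleton_eq_iff)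
    then have ac: "{a', c'} \<in> \<sigma>" "{a', c'} \<noteq> {a, b}"
      using r(3) quad_flip(2)[OF s q(1)] unfolding q(2)[symmetric] by auto
    have "\<alpha> powr (- real m) \<le> \<delta>"
    proof (cases "seg {a', c'} \<inter> seg g \<noteq> {}")
      case True
      define x where "x = mid {a', c'}"
      have x: "old \<sigma> x = {a', c'}" "x \<in> \<Lambda>" unfolding x_def using edge_at_eq[OF ac(1)] by auto
      have "x \<noteq> y" using x(1) ac(2) q(4) by auto
      then have "(\<Sum>x\<in>{x}. w (old \<sigma> x)) \<le> H \<sigma> - W" unfolding W_def by (intro sum_old_rest[OF s y(1)]) (use x in auto)
      then have "w {a', c'} < \<delta> * W" using HW x(1) by simp
      moreover have "w {a', c'} = \<alpha> powr (- real m) * W"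
      proof -
        have e: "real (l1 a' c') - real (len g) = - real m + (real (l1 a b) - real (len g))" using bm(2) by linarith
        then show ?thesis unfolding Wab powr_add[symmetric] wt_def len_pair e using True by simp
      qed
      ultimately show ?thesis using W0 by (simp add: mult_less_cancel_right)
    next
      case False
      then have "l1 a' c' \<le> len g" using alt by blast
      then have "W \<le> \<alpha> powr (real m)" unfolding Wab using bm(2) by (intro pm) linarith
      then have "1 \<le> \<delta> * \<alpha> powr (real m)" using dW mult_left_mono[of W "\<alpha> powr real m" \<delta>] dl(1) by linarith
      then have "\<alpha> powr (- real m) * 1 \<le> \<alpha> powr (- real m) * (\<delta> * \<alpha> powr (real m))" by (intro mult_left_mono) auto
      also have "\<dots> = \<delta> * (\<alpha> powr (- real m) * \<alpha> powr real m)" by simp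
      also have "\<dots> = \<delta>" unfolding powr_add[symmetric] using al(1) by simp
      finally show ?thesis by simp
    qed
    moreover have "\<alpha> powr (- 3 * real m) \<le> \<alpha> powr (- real m)" by (rule pm) simp
    ultimately show ?thesis by linarith
  qed
  \<comment> \<open>The complementary probability is at most \<alpha> to the power -4 m, which
    \<open>small\<close> bounds by \<delta>.\<close>
  have rate: "1 - \<delta> \<le> rt \<sigma> y"
  proof -
    have p: "0 < lam ^ l1 c d" "0 < lam ^ l1 a b" using lam by simp_all
    have r: "rt \<sigma> y = lam ^ l1 c d / (lam ^ l1 c d + lam ^ l1 a b)" unfolding rate_def q(4,5) len_pair ..
    have "lam ^ l1 a b / (lam ^ l1 a b + lam ^ l1 c d) \<le> \<alpha> powr (- 2 * (real (l1 a b) - real (l1 c d)))"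
      by (rule rate_weight_bound[OF lam al less_imp_le[OF ltl]])
    also have "\<dots> \<le> \<alpha> powr (- 3 * real m)"
    proof (rule pm)
      have "real (l1 a b) - real (l1 c d) = 2 * real m" using m by linarith
      then show "- 2 * (real (l1 a b) - real (l1 c d)) \<le> - 3 * real m" by simp
    qed
    finally have "lam ^ l1 a b / (lam ^ l1 a b + lam ^ l1 c d) \<le> \<delta>" using small by linarith
    moreover have "lam ^ l1 a b / (lam ^ l1 a b + lam ^ l1 c d) + rt \<sigma> y = 1"
      unfolding r add.commute[of "lam ^ l1 c d"] add_divide_distrib[symmetric] using p by simp
    ultimately show ?thesis by linarith
  qed
  have yu: "y \<notin> ups \<sigma>" using lt by (simp add: ups_def)
  have K: "0 \<le> \<alpha> powr 4" by simp
  have upper: "gn H \<sigma> \<le> - (rt \<sigma> y * W) + (\<Sum>x\<in>ups \<sigma>. rt \<sigma> x * w (new \<sigma> x))"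
  proof -
    have "gn H \<sigma> \<le> (\<Sum>x\<in>fl \<sigma>. (if x = y then - (rt \<sigma> y * W) else 0) + (if x \<in> ups \<sigma> then rt \<sigma> x * w (new \<sigma> x) else 0))"
      unfolding gen_def
    proof (rule sum_mono)
      fix x assume x: "x \<in> fl \<sigma>"
      show "rt \<sigma> x * (H (flip vs \<sigma> x) - H \<sigma>) \<le> (if x = y then - (rt \<sigma> y * W) else 0) + (if x \<in> ups \<sigma> then rt \<sigma> x * w (new \<sigma> x) else 0)"
      proof (cases "x = y")
        case True
        then show ?thesis using H_flip(3)[OF s yf lt] yu unfolding W_def by simp
      next
        case False
        then show ?thesis using mult_left_mono[OF H_flip(1)[OF s x] rate_le_one(2)[of \<sigma> x]] x
          unfolding ups_def by (auto split: if_splits)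
      qed
    qed
    also have "\<dots> = - (rt \<sigma> y * W) + (\<Sum>x\<in>ups \<sigma>. rt \<sigma> x * w (new \<sigma> x))"
    proof -
      have "fl \<sigma> \<inter> ups \<sigma> = ups \<sigma>" by (auto simp: ups_def)
      then show ?thesis using finite_fl yf by (simp add: sum.distrib sum.If_cases)
    qed
    finally show ?thesis .
  qed
  \<comment> \<open>The dominating edge is discounted by \<delta>: every flip charged to it involves
    a side of length at least m.\<close>
  define \<beta> where "\<beta> e = (if e = {a, b} then \<delta> else 1)" for e :: edge
  have us: "(\<Sum>x\<in>ups \<sigma>. rt \<sigma> x * w (new \<sigma> x)) \<le> (\<Sum>x\<in>ups \<sigma>. w (old \<sigma> x)) + 4 * \<alpha> powr 4 * (\<Sum>e\<in>\<sigma>. \<beta> e * w e) + 8 * \<alpha> powr 4"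
  proof (rule up_sum[OF s])
    fix e r t assume e: "e \<in> \<sigma>" "r \<in> e" "apex vs \<sigma> e t"
    show "\<alpha> powr (- 3 * real (l1 r t)) \<le> \<beta> e"
    proof (cases "e = {a, b}")
      case True
      have t: "t = c \<or> t = d" using quad_apex[OF s q(1)] e(3) True by simp
      have r: "r = a \<or> r = b" using e(2) True by simp
      have "m \<le> l1 r t" using t r parallelogram_sides[OF qq(1)] unfolding m_def by auto
      then have "\<alpha> powr (- 3 * real (l1 r t)) \<le> \<alpha> powr (- 3 * real m)" by (intro pm) simp
      then show ?thesis using small True by (simp add: \<beta>_def)
    next
      case False
      have "\<alpha> powr (- 3 * real (l1 r t)) \<le> \<alpha> powr 0" by (rule pm) simp
      then show ?thesis using False al(1) by (simp add: \<beta>_def)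
    qed
  qed (use dl in \<open>auto simp: ups_def \<beta>_def\<close>)
  have o1: "(\<Sum>x\<in>ups \<sigma>. w (old \<sigma> x)) \<le> H \<sigma> - W"
    unfolding W_def by (rule sum_old_rest[OF s y(1)]) (use yu in \<open>auto simp: ups_def flips_def\<close>)
  have o2: "(\<Sum>e\<in>\<sigma>. \<beta> e * w e) \<le> 2 * (\<delta> * W)"
  proof -
    have "(\<Sum>e\<in>\<sigma>. \<beta> e * w e) = (\<Sum>x\<in>\<Lambda>. \<beta> (old \<sigma> x) * w (old \<sigma> x))" by (rule sum_edges[OF s])
    also have "\<dots> = \<beta> (old \<sigma> y) * w (old \<sigma> y) + (\<Sum>x\<in>\<Lambda> - {y}. \<beta> (old \<sigma> x) * w (old \<sigma> x))"
      by (rule sum.remove[OF finite_Lam y(1)])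
    also have "\<beta> (old \<sigma> y) * w (old \<sigma> y) = \<delta> * W" unfolding W_def q(4) \<beta>_def by simp
    also have "(\<Sum>x\<in>\<Lambda> - {y}. \<beta> (old \<sigma> x) * w (old \<sigma> x)) = (\<Sum>x\<in>\<Lambda> - {y}. w (old \<sigma> x))"
    proof (rule sum.cong[OF refl])
      fix x assume x: "x \<in> \<Lambda> - {y}"
      have "old \<sigma> x \<noteq> {a, b}" using edge_at(2)[of x] x q(2) by auto
      then show "\<beta> (old \<sigma> x) * w (old \<sigma> x) = w (old \<sigma> x)" by (simp add: \<beta>_def)
    qed
    also have "\<dots> \<le> H \<sigma> - W" unfolding W_def by (rule sum_old_rest[OF s y(1)]) auto
    finally show ?thesis using HW by linarith
  qed
  have "4 * \<alpha> powr 4 * (\<Sum>e\<in>\<sigma>. \<beta> e * w e) \<le> 4 * \<alpha> powr 4 * (2 * (\<delta> * W))" using o2 by (intro mult_left_mono) auto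
  moreover have "8 * \<alpha> powr 4 * 1 \<le> 8 * \<alpha> powr 4 * (\<delta> * W)" using dW by (intro mult_left_mono) auto
  moreover have "(1 - \<delta>) * W \<le> rt \<sigma> y * W" using rate W0 by (intro mult_right_mono) auto
  \<comment> \<open>The losses in units of \<delta> W are 1 for the rate, 1 for the other edges, 8
    \<alpha>^4 for the charges and 8 \<alpha>^4 for the ends of \<open>g\<close>. One more is spent
    below on replacing W by the height, which gives the 3 + 16 \<alpha>^4 in the hypothesis.\<close>
  ultimately have "gn H \<sigma> \<le> - ((1 - \<delta>) * W) + \<delta> * W + 4 * \<alpha> powr 4 * (2 * (\<delta> * W)) + 8 * \<alpha> powr 4 * (\<delta> * W)"
    using upper us o1 HW by linarith
  also have "\<dots> = - ((1 - \<delta> * (2 + 16 * \<alpha> powr 4)) * W)" by (simp add: algebra_simps)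
  finally have G: "gn H \<sigma> \<le> - ((1 - \<delta> * (2 + 16 * \<alpha> powr 4)) * W)" .
  have e0: "0 \<le> (1 + \<epsilon>) / 2" "(1 + \<epsilon>) / 2 \<le> 1" using dl eps by auto
  have "(1 + \<epsilon>) / 2 * H \<sigma> \<le> (1 + \<epsilon>) / 2 * (W + \<delta> * W)" using HW e0 by (intro mult_left_mono) auto
  also have "\<dots> \<le> (1 + \<epsilon>) / 2 * W + 1 * (\<delta> * W)"
    unfolding distrib_left using e0 dl W0 by (intro add_left_mono mult_right_mono) auto
  also have "\<dots> = ((1 + \<epsilon>) / 2 + \<delta>) * W" by (simp add: distrib_right)
  also have "\<dots> \<le> (1 - \<delta> * (2 + 16 * \<alpha> powr 4)) * W"
    using dl(3) W0 by (intro mult_right_mono) (auto simp: field_simps)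
  finally show ?thesis using G by simp
qed

section \<open>Assembly of the constants and the final bounds\<close>

lemma prob_long_le:
  assumes "tail l t \<sigma> \<le> M"
  shows "measure_pmf.prob (chain lam vs \<xi> \<sigma> t)
      {\<tau>. \<exists>y\<in>\<Lambda>. seg (edge_at \<tau> y) \<inter> seg g \<noteq> {} \<and> real (len (edge_at \<tau> y)) \<ge> real (len g) + l}
    \<le> M * \<alpha> powr (- l)"
proof -
  have "\<alpha> powr (- l) * tail l t \<sigma> \<le> \<alpha> powr (- l) * M" using assms by (intro mult_left_mono) auto
  moreover have "\<alpha> powr (- l) * (\<alpha> powr l * p) = p" for p
    unfolding mult.assoc[symmetric] powr_add[symmetric] using al(1) by simp
  ultimately show ?thesis unfolding tail_def long_def by (simp add: mult.commute)
qed

lemma tail_le: "tail l t \<sigma> \<le> \<alpha> powr l"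
  unfolding tail_def using mult_left_mono[OF measure_pmf.prob_le_1, of "\<alpha> powr l"] by simp

lemma tail_zero:
  assumes n: "\<And>\<tau>. \<tau> \<in> \<Omega> \<Longrightarrow> \<not> long l \<tau>" and s: "\<sigma> \<in> \<Omega>"
  shows "tail l t \<sigma> = 0"
  using s
proof (induction t arbitrary: \<sigma>)
  case 0 then show ?case using n by (simp add: tail_0)
next
  case (Suc t)
  have "gn (tail l t) \<sigma> = 0"
    unfolding gen_def using Suc.IH flip_Omega[OF Suc.prems] Suc.prems by (intro sum.neutral) auto
  then show ?case using tail_Suc[OF Suc.prems] Suc.IH[OF Suc.prems] by simp
qed

lemma gen_drift:
  assumes s: "\<sigma> \<in> \<Omega>" and d: "measure_pmf.expectation (step lam vs \<xi> \<sigma>) H \<le> (1 - \<epsilon> / \<N>) * H \<sigma>"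
  shows "gn H \<sigma> \<le> - \<epsilon> * H \<sigma>"
proof -
  have N: "\<N> > 0" using card_Lam_pos[OF s] by simp
  have "gn H \<sigma> / \<N> \<le> (- \<epsilon> * H \<sigma>) / \<N>"
    using d unfolding step_expectation[OF s lam] by (simp add: algebra_simps)
  then show ?thesis using N by (simp only: divide_le_cancel)
qed

text \<open>Small thresholds are trivial since a probability is at most 1. For large ones the terms
  in \<open>c'\<close> ensure that every long state satisfies the drift condition and the size
  conditions of \<open>concentrated_drift\<close>.\<close>

lemma tail_bound:
  assumes eps: "0 < \<epsilon>" "\<epsilon> < 1" and psi: "0 < \<psi>0"
    and drift: "\<And>\<sigma>. \<sigma> \<in> \<Omega> \<Longrightarrow> \<psi>0 \<le> H \<sigma> \<Longrightarrow> gn H \<sigma> \<le> - \<epsilon> * H \<sigma>"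
    and D: "D = (\<epsilon> + (1 + 4 * \<alpha> powr 4)) * \<psi>0 + 8 * \<alpha> powr 4"
    and C: "C = 2 + 4 * \<alpha> powr 4"
    and dl: "0 < \<delta>" "\<delta> \<le> \<epsilon> / 2" "\<delta> * (3 + 16 * \<alpha> powr 4) \<le> (1 - \<epsilon>) / 2"
    and s0: "0 < s0" "s0 * (4 * (C + 2)) \<le> 1" "s0 * (4 * (1 + \<delta>)) \<le> \<delta>"
    and kap: "0 < \<kappa>" "\<kappa> \<le> 1/2" "\<kappa> * (2 * (1 + \<delta>)) \<le> \<delta>" "\<kappa> \<le> (1 - \<epsilon>) / 2 / 2"
    and c: "c * \<kappa> \<ge> D + 8 * \<alpha> powr 4 + C * D"
    and c': "c + D / (\<epsilon> * (\<kappa> * s0)) \<le> c'" "\<psi>0 \<le> c'" "1 / \<delta> \<le> c'" "\<alpha> \<le> c'"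
    and s: "\<sigma> \<in> \<Omega>"
  shows "tail l t \<sigma> \<le> max (H \<sigma> * (1 - \<epsilon> / \<N>) ^ t) c'"
proof (cases "\<alpha> powr l \<le> c'")
  case True
  then show ?thesis using tail_le[of l t \<sigma>] by linarith
next
  case False
  have K: "0 \<le> \<alpha> powr 4" by simp
  have N: "1 \<le> \<N>" using card_Lam_pos[OF s] by simp
  have nn: "0 \<le> D" "0 \<le> C" "0 \<le> 8 * \<alpha> powr 4" unfolding D C using eps psi K by auto
  have "tail l t \<sigma> \<le> max (H \<sigma> * (1 - \<epsilon> / \<N>) ^ t) (c + D / (\<epsilon> * (\<kappa> * s0)))"
  proof (rule drift_tail_bound[where E = EE and A = "long l" and L = "\<alpha> powr l" and u = "tail l" and \<Omega> = \<Omega> and \<Delta> = "(1 - \<epsilon>) / 2",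
        OF N eps nn dl(1) _ s0 kap c])
    show "0 < (1 - \<epsilon>) / 2" using eps by simp
    show "EE f \<tau> \<le> EE h \<tau> - (h \<tau> - f \<tau>) / \<N>" if "\<tau> \<in> \<Omega>" "\<And>\<tau>. \<tau> \<in> \<Omega> \<Longrightarrow> f \<tau> \<le> h \<tau>" for f h \<tau>
      by (rule step_stay[OF that])
    show "EE (\<lambda>\<tau>. a * f \<tau> + b) \<tau> = a * EE f \<tau> + b" for a f b \<tau>
      unfolding gen_lin by (simp add: algebra_simps)
    show "EE (\<lambda>\<tau>. f \<tau> + h \<tau>) \<tau> = EE f \<tau> + EE h \<tau>" for f h \<tau>
      unfolding gen_add by (simp add: add_divide_distrib)
    show "0 \<le> H \<tau>" for \<tau> by (rule Psi_nonneg)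
    show "0 \<le> \<alpha> powr l" by simp
    show "tail l 0 \<tau> = (if long l \<tau> then \<alpha> powr l else 0)" for \<tau> by (rule tail_0)
    show "tail l (Suc t) \<tau> = EE (tail l t) \<tau>" if "\<tau> \<in> \<Omega>" for t \<tau> by (rule tail_Suc[OF that])
    show "\<alpha> powr l \<le> H \<tau>" if "\<tau> \<in> \<Omega>" "long l \<tau>" for \<tau> by (rule long_H[OF that])
    show "EE H \<tau> \<le> (1 - \<epsilon> / \<N>) * H \<tau> + D / \<N>" if t: "\<tau> \<in> \<Omega>" for \<tau>
    proof -
      have "gn H \<tau> \<le> - \<epsilon> * H \<tau> + D"
      proof (cases "\<psi>0 \<le> H \<tau>")
        case True
        then show ?thesis using drift[OF t] nn(1) by linarith
      next
        case False
        have "(\<epsilon> + (1 + 4 * \<alpha> powr 4)) * H \<tau> \<le> (\<epsilon> + (1 + 4 * \<alpha> powr 4)) * \<psi>0"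
          using False eps K by (intro mult_left_mono) auto
        then show ?thesis using gen_H_le[OF t] unfolding D by (simp add: distrib_right)
      qed
      then have "gn H \<tau> / \<N> \<le> (- \<epsilon> * H \<tau> + D) / \<N>" by (rule divide_right_mono) simp
      then show ?thesis by (simp add: add_divide_distrib diff_divide_distrib left_diff_distrib)
    qed
    show "EE (\<lambda>\<tau>. if long l \<tau> then \<alpha> powr l else 0) \<tau> \<le> (C * H \<tau> + 8 * \<alpha> powr 4) / \<N>"
      if "\<tau> \<in> \<Omega>" "\<not> long l \<tau>" for \<tau> unfolding C by (rule long_creation[OF that])
    show "EE H \<tau> \<le> (1 - (\<epsilon> + (1 - \<epsilon>) / 2) / \<N>) * H \<tau>"
      if t: "\<tau> \<in> \<Omega>" "long l \<tau>" "H \<tau> < (1 + \<delta>) * \<alpha> powr l" for \<tau>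
    proof -
      have "\<psi>0 \<le> H \<tau>" using long_H[OF t(1,2)] False c'(2) by linarith
      note d = drift[OF t(1) this]
      have "gn H \<tau> \<le> - ((1 + \<epsilon>) / 2) * H \<tau>"
        by (rule concentrated_drift[OF t dl eps(2) _ _ d]) (use False c' in linarith)+
      then have "gn H \<tau> / \<N> \<le> (- ((1 + \<epsilon>) / 2) * H \<tau>) / \<N>" by (rule divide_right_mono) simp
      moreover have e: "\<epsilon> + (1 - \<epsilon>) / 2 = (1 + \<epsilon>) / 2" by (simp add: field_simps)
      ultimately show ?thesis unfolding e by (simp add: left_diff_distrib)
    qed
    show "\<sigma> \<in> \<Omega>" by (rule s)
  qed
  also have "\<dots> \<le> max (H \<sigma> * (1 - \<epsilon> / \<N>) ^ t) c'" using c'(1) by (intro max.mono) auto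
  finally show ?thesis .
qed

end

lemma weighted_intro:
  assumes "0 < lam" "1 < \<alpha>" "\<alpha> < lam powr (- 1 / 2)" "lattice_polygon vs" "boundary_condition vs \<xi>" "g \<in> G vs \<xi>"
  shows "weighted vs \<xi> lam \<alpha> g"
proof
  have "(lam powr (- 1 / 2)) powr (- 2) \<le> \<alpha> powr (- 2)"
    using assms by (intro powr_mono2') auto
  then show "lam \<le> \<alpha> powr (- 2)" using assms by (simp add: powr_powr)
qed (use assms in auto)

theorem mainTheorem16:
  fixes lam \<alpha> \<psi>0 \<epsilon> :: real
  assumes "0 < lam" and "lam < 1"
    and "lyapunov_constants lam \<alpha> \<psi>0 \<epsilon>"
  shows "\<exists>c>0.
    (\<forall>vs \<xi> g \<sigma> (t::nat) (l::real).
       lattice_polygon vs \<longrightarrow> boundary_condition vs \<xi> \<longrightarrow> g \<in> G vs \<xi> \<longrightarrow>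
       \<sigma> \<in> Omega vs \<xi> \<longrightarrow> t \<ge> 1 \<longrightarrow> l \<ge> 0 \<longrightarrow>
       measure_pmf.prob (chain lam vs \<xi> \<sigma> t)
         {\<tau>. \<exists>y\<in>Lam vs. seg (edge_at \<tau> y) \<inter> seg g \<noteq> {} \<and>
               real (len (edge_at \<tau> y)) \<ge> real (len g) + l}
       \<le> max (Psi vs \<xi> \<alpha> g \<sigma> * (1 - \<epsilon> / real (card (Lam vs))) ^ t) c * \<alpha> powr (- l)) \<and>
    (\<forall>vs \<xi> g (l::real).
       lattice_polygon vs \<longrightarrow> boundary_condition vs \<xi> \<longrightarrow> g \<in> G vs \<xi> \<longrightarrow> l \<ge> 0 \<longrightarrow>
       pi_prob lam vs \<xi> (\<lambda>\<sigma>. real (len (edge_at \<sigma> (mid g))) \<ge> real (len g) + l)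
       \<le> c * \<alpha> powr (- l))"
proof -
  have al: "1 < \<alpha>" "\<alpha> < lam powr (- 1 / 2)" and psi: "1 < \<psi>0" and eps: "0 < \<epsilon>"
    and lyap: "\<And>vs \<xi> \<sigma> g. lattice_polygon vs \<Longrightarrow> boundary_condition vs \<xi> \<Longrightarrow> \<sigma> \<in> Omega vs \<xi> \<Longrightarrow> g \<in> G vs \<xi> \<Longrightarrow>
        Psi vs \<xi> \<alpha> g \<sigma> \<ge> \<psi>0 \<Longrightarrow> measure_pmf.expectation (step lam vs \<xi> \<sigma>) (Psi vs \<xi> \<alpha> g)
          \<le> (1 - \<epsilon> / real (card (Lam vs))) * Psi vs \<xi> \<alpha> g \<sigma>"
    using assms(3) unfolding lyapunov_constants_def by auto
  have wtd: "weighted vs \<xi> lam \<alpha> g" if "lattice_polygon vs" "boundary_condition vs \<xi>" "g \<in> G vs \<xi>" for vs \<xi> g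
    by (rule weighted_intro[OF assms(1) al that])
  have drift: "gen lam vs \<xi> (Psi vs \<xi> \<alpha> g) \<sigma> \<le> - \<epsilon> * Psi vs \<xi> \<alpha> g \<sigma>"
    if h: "lattice_polygon vs" "boundary_condition vs \<xi>" "g \<in> G vs \<xi>" "\<sigma> \<in> Omega vs \<xi>" "\<psi>0 \<le> Psi vs \<xi> \<alpha> g \<sigma>" for vs \<xi> g \<sigma>
    by (rule weighted.gen_drift[OF wtd[OF h(1-3)] h(4) lyap[OF h(1,2,4,3,5)]])
  define D where "D = (\<epsilon> + (1 + 4 * \<alpha> powr 4)) * \<psi>0 + 8 * \<alpha> powr 4"
  have K: "0 \<le> \<alpha> powr 4" by simp
  have D0: "0 \<le> D" unfolding D_def using eps psi K by simp
  have gD: "gen lam vs \<xi> (Psi vs \<xi> \<alpha> g) \<sigma> \<le> - \<epsilon> * Psi vs \<xi> \<alpha> g \<sigma> + D"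
    if h: "lattice_polygon vs" "boundary_condition vs \<xi>" "g \<in> G vs \<xi>" "\<sigma> \<in> Omega vs \<xi>" for vs \<xi> g \<sigma>
  proof (cases "\<psi>0 \<le> Psi vs \<xi> \<alpha> g \<sigma>")
    case True
    then show ?thesis using drift[OF h] D0 by linarith
  next
    case False
    have "(\<epsilon> + (1 + 4 * \<alpha> powr 4)) * Psi vs \<xi> \<alpha> g \<sigma> \<le> (\<epsilon> + (1 + 4 * \<alpha> powr 4)) * \<psi>0"
      using False eps K by (intro mult_left_mono) auto
    then show ?thesis using weighted.gen_H_le[OF wtd[OF h(1-3)] h(4)] unfolding D_def by (simp add: distrib_right)
  qed
  have stat: "pi_prob lam vs \<xi> (\<lambda>\<sigma>. real (len (edge_at \<sigma> (mid g))) \<ge> real (len g) + l) \<le> c * \<alpha> powr (- l)"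
    if h: "lattice_polygon vs" "boundary_condition vs \<xi>" "g \<in> G vs \<xi>" and c: "D / \<epsilon> \<le> c" for vs \<xi> g l c
  proof -
    let ?p = "pi_prob lam vs \<xi> (\<lambda>\<sigma>. real (len (edge_at \<sigma> (mid g))) \<ge> real (len g) + l)"
    have "\<alpha> powr l * ?p \<le> D / \<epsilon>" by (rule weighted.stationary_bound[OF wtd[OF h] gD[OF h] eps])
    then have "\<alpha> powr (- l) * (\<alpha> powr l * ?p) \<le> \<alpha> powr (- l) * c" using c by (intro mult_left_mono) auto
    moreover have "\<alpha> powr (- l) * (\<alpha> powr l * ?p) = ?p"
      unfolding mult.assoc[symmetric] powr_add[symmetric] using al(1) by simp
    ultimately show ?thesis by (simp add: mult.commute)
  qed
  \<comment> \<open>The drift hypothesis restricts \<epsilon> only if some state reaches \<psi>0; in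
    that case \<epsilon> < 1 follows. If no state does, \<epsilon> may be arbitrarily large, but
    then no edge is long at thresholds above \<psi>0.\<close>
  show ?thesis
  proof (cases "\<exists>vs \<xi> g \<sigma>. lattice_polygon vs \<and> boundary_condition vs \<xi> \<and> g \<in> G vs \<xi> \<and> \<sigma> \<in> Omega vs \<xi> \<and> \<psi>0 \<le> Psi vs \<xi> \<alpha> g \<sigma>")
    case True
    then obtain vs0 \<xi>0 g0 \<sigma>0 where h0: "lattice_polygon vs0" "boundary_condition vs0 \<xi>0" "g0 \<in> G vs0 \<xi>0" "\<sigma>0 \<in> Omega vs0 \<xi>0"
      "\<psi>0 \<le> Psi vs0 \<xi>0 \<alpha> g0 \<sigma>0" by blast
    have eps1: "\<epsilon> < 1"
      by (rule weighted.drift_rate_lt_one[OF wtd[OF h0(1-3)] h0(4) _ eps drift[OF h0]]) (use h0(5) psi in linarith)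
    define C where "C = 2 + 4 * \<alpha> powr 4"
    \<comment> \<open>Each minimum collects the conditions of the earlier estimates: \<delta> serves
      the concentrated states, \<open>s0\<close> the length of the gaining phase, \<kappa> the gain
      per step.\<close>
    define \<delta> where "\<delta> = min (\<epsilon> / 2) ((1 - \<epsilon>) / 2 / (3 + 16 * \<alpha> powr 4))"
    define s0 where "s0 = min (1 / (4 * (C + 2))) (\<delta> / (4 * (1 + \<delta>)))"
    define \<kappa> where "\<kappa> = min (1/2) (min (\<delta> / (2 * (1 + \<delta>))) ((1 - \<epsilon>) / 2 / 2))"
    define c where "c = (D + 8 * \<alpha> powr 4 + C * D) / \<kappa>"
    define c' where "c' = c + D / (\<epsilon> * (\<kappa> * s0)) + \<psi>0 + 1 / \<delta> + \<alpha> + D / \<epsilon>"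
    have le_div: "x * y \<le> z" if "x \<le> z / y" "0 < y" for x y z :: real using that by (simp add: pos_le_divide_eq)
    have C0: "0 \<le> C" unfolding C_def using K by simp
    have p: "0 < 3 + 16 * \<alpha> powr 4" "0 < 4 * (C + 2)" proof -
      show "0 < 3 + 16 * \<alpha> powr 4" using K by linarith
      show "0 < 4 * (C + 2)" using C0 by simp
    qed
    have "0 < (1 - \<epsilon>) / 2 / (3 + 16 * \<alpha> powr 4)" using eps1 p(1) by simp
    then have d0: "0 < \<delta>" unfolding \<delta>_def using eps by simp
    have d: "\<delta> \<le> \<epsilon> / 2" "\<delta> * (3 + 16 * \<alpha> powr 4) \<le> (1 - \<epsilon>) / 2"
    proof -
      show "\<delta> \<le> \<epsilon> / 2" unfolding \<delta>_def by (rule min.cobounded1)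
      show "\<delta> * (3 + 16 * \<alpha> powr 4) \<le> (1 - \<epsilon>) / 2"
        by (rule le_div[OF _ p(1)], unfold \<delta>_def, rule min.cobounded2)
    qed
    have dp: "0 < 4 * (1 + \<delta>)" "0 < 2 * (1 + \<delta>)" using d0 by auto
    have s: "0 < s0" "s0 * (4 * (C + 2)) \<le> 1" "s0 * (4 * (1 + \<delta>)) \<le> \<delta>"
    proof -
      show "0 < s0" unfolding s0_def using divide_pos_pos[OF zero_less_one p(2)] divide_pos_pos[OF d0 dp(1)] by (simp only: min_less_iff_conj simp_thms)
      show "s0 * (4 * (C + 2)) \<le> 1" by (rule le_div[OF _ p(2)], unfold s0_def, rule min.cobounded1)
      show "s0 * (4 * (1 + \<delta>)) \<le> \<delta>" by (rule le_div[OF _ dp(1)], unfold s0_def, rule min.cobounded2)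
    qed
    have k: "0 < \<kappa>" "\<kappa> \<le> 1/2" "\<kappa> * (2 * (1 + \<delta>)) \<le> \<delta>" "\<kappa> \<le> (1 - \<epsilon>) / 2 / 2"
    proof -
      have "0 < (1 - \<epsilon>) / 2 / 2" using eps1 by simp
      then show "0 < \<kappa>" unfolding \<kappa>_def using divide_pos_pos[OF d0 dp(2)] by (simp only: min_less_iff_conj simp_thms half_gt_zero_iff zero_less_one)
      show "\<kappa> \<le> 1/2" unfolding \<kappa>_def by (rule min.cobounded1)
      show "\<kappa> * (2 * (1 + \<delta>)) \<le> \<delta>"
        by (rule le_div[OF _ dp(2)], unfold \<kappa>_def, rule min.coboundedI2, rule min.cobounded1)
      show "\<kappa> \<le> (1 - \<epsilon>) / 2 / 2" unfolding \<kappa>_def by (intro min.coboundedI2 order_refl)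
    qed
    have ck: "D + 8 * \<alpha> powr 4 + C * D \<le> c * \<kappa>" unfolding c_def using k(1) by simp
    have c0: "0 \<le> c" unfolding c_def using D0 C0 K k(1) by simp
    have pos: "0 \<le> D / (\<epsilon> * (\<kappa> * s0))" "0 \<le> 1 / \<delta>" "0 \<le> D / \<epsilon>" using D0 eps k(1) s(1) d0 by simp_all
    have c': "c + D / (\<epsilon> * (\<kappa> * s0)) \<le> c'" "\<psi>0 \<le> c'" "1 / \<delta> \<le> c'" "\<alpha> \<le> c'" "D / \<epsilon> \<le> c'" "0 < c'"
      unfolding c'_def using pos c0 psi al(1) by linarith+
    have psi0: "0 < \<psi>0" using psi by simp
    show ?thesis
    proof (intro exI[of _ c'] conjI allI impI)
      show "0 < c'" by (rule c'(6))
    next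
      fix vs \<xi> g \<sigma> and t :: nat and l :: real
      assume h: "lattice_polygon vs" "boundary_condition vs \<xi>" "g \<in> G vs \<xi>" "\<sigma> \<in> Omega vs \<xi>"
      show "measure_pmf.prob (chain lam vs \<xi> \<sigma> t)
         {\<tau>. \<exists>y\<in>Lam vs. seg (edge_at \<tau> y) \<inter> seg g \<noteq> {} \<and> real (len (edge_at \<tau> y)) \<ge> real (len g) + l}
       \<le> max (Psi vs \<xi> \<alpha> g \<sigma> * (1 - \<epsilon> / real (card (Lam vs))) ^ t) c' * \<alpha> powr (- l)"
        by (rule weighted.prob_long_le[OF wtd[OF h(1-3)]
            weighted.tail_bound[OF wtd[OF h(1-3)] eps eps1 psi0 drift[OF h(1-3)] D_def C_def d0 d s k ck c'(1-4) h(4)]])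
    next
      fix vs \<xi> g and l :: real
      assume h: "lattice_polygon vs" "boundary_condition vs \<xi>" "g \<in> G vs \<xi>"
      show "pi_prob lam vs \<xi> (\<lambda>\<sigma>. real (len (edge_at \<sigma> (mid g))) \<ge> real (len g) + l) \<le> c' * \<alpha> powr (- l)"
        by (rule stat[OF h c'(5)])
    qed
  next
    case False
    \<comment> \<open>The first summand settles the chain, since beyond it no state is long; the
      second is the stationary bound.\<close>
    define c where "c = \<psi>0 + D / \<epsilon>"
    have c: "0 < c" "D / \<epsilon> \<le> c" "\<psi>0 \<le> c" unfolding c_def using psi D0 eps by (auto intro: add_pos_nonneg)
    show ?thesis
    proof (intro exI[of _ c] conjI allI impI)
      show "0 < c" by (rule c(1))
    next
      fix vs \<xi> g \<sigma> and t :: nat and l :: real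
      assume h: "lattice_polygon vs" "boundary_condition vs \<xi>" "g \<in> G vs \<xi>" "\<sigma> \<in> Omega vs \<xi>"
      interpret weighted vs \<xi> lam \<alpha> g by (rule wtd[OF h(1-3)])
      have "tail l t \<sigma> \<le> c"
      proof (cases "\<alpha> powr l \<le> c")
        case True
        then show ?thesis using tail_le[of l t \<sigma>] by linarith
      next
        case large: False
        have "\<not> long l \<tau>" if t: "\<tau> \<in> \<Omega>" for \<tau>
        proof
          assume "long l \<tau>"
          have "\<psi>0 \<le> H \<tau>" using long_H[OF t \<open>long l \<tau>\<close>] large c(3) by linarith
          then show False using False h t by blast
        qed
        then show ?thesis using tail_zero[OF _ h(4), of l t] c(1) by simp
      qed
      then have "tail l t \<sigma> \<le> max (Psi vs \<xi> \<alpha> g \<sigma> * (1 - \<epsilon> / real (card (Lam vs))) ^ t) c" by simp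
      then show "measure_pmf.prob (chain lam vs \<xi> \<sigma> t)
         {\<tau>. \<exists>y\<in>Lam vs. seg (edge_at \<tau> y) \<inter> seg g \<noteq> {} \<and> real (len (edge_at \<tau> y)) \<ge> real (len g) + l}
       \<le> max (Psi vs \<xi> \<alpha> g \<sigma> * (1 - \<epsilon> / real (card (Lam vs))) ^ t) c * \<alpha> powr (- l)"
        by (rule prob_long_le)
    next
      fix vs \<xi> g and l :: real
      assume h: "lattice_polygon vs" "boundary_condition vs \<xi>" "g \<in> G vs \<xi>"
      show "pi_prob lam vs \<xi> (\<lambda>\<sigma>. real (len (edge_at \<sigma> (mid g))) \<ge> real (len g) + l) \<le> c * \<alpha> powr (- l)"
        by (rule stat[OF h c(2)])
    qed
  qed
qed

end
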